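(* Let $p\equiv 1\pmod 4$ be a prime, write $p=2n+1$, and let $g\in\mathbb{Z}$ be a primitive root modulo $p$. Let $\sigma_{0,2}$ be the permutation relating the sequence $A_0:\ \overline{1^2},\overline{2^2},\ldots,\overline{((p-1)/2)^2}$ to the sequence $A_2:\ \overline{g^2},\overline{g^4},\ldots,\overline{g^{p-1}}$. Then $$\operatorname{sgn}(\sigma_{0,2})=\overline{\tfrac12\, n^{n/2}\,u_p\, g^{(p-1)(3n^2-n-2)/8}}\cdot(-1)^{(h(p)+1)/2}.$$ In particular, when $p\equiv 5\pmod 8$, $\operatorname{sgn}(\sigma_{0,2})$ is independent of the choice of $g$ and $$\operatorname{sgn}(\sigma_{0,2})=\overline{\tfrac12\, n^{n/2}\,u_p}\cdot(-1)^{(2h(p)+n)/4}.$$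
   Context: For an odd prime $p$ and a $p$-adic integer $a$ (for instance a rational number with denominator prime to $p$), $\overline{a}$ denotes the unique integer $x$ with $-p/2<x<p/2$ and $x-a$ divisible by $p$. The sequences $A_0$ and $A_2$ list the same $(p-1)/2$ distinct integers in two orders. $\sigma_{0,2}$ is the permutation $\pi$ of $\{1,\dots,(p-1)/2\}$ such that the $i$-th term of $A_0$ is the $\pi(i)$-th term of $A_2$; $\operatorname{sgn}$ denotes the sign of a permutation (so replacing $\pi$ by its inverse makes no difference). For a prime $p\equiv1\pmod4$: $\varepsilon_p=(u_p+v_p\sqrt p)/2>1$ (with $u_p,v_p$ integers) is the fundamental unit of $\mathbb{Q}(\sqrt p)$, and $h(p)$ is the class number of $\mathbb{Q}(\sqrt p)$. *)

theory Defs
  imports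
    "HOL-Computational_Algebra.Polynomial"
    "HOL-Number_Theory.Number_Theory"
    "HOL-Algebra.Ideal"
    "HOL-Combinatorics.Permutations"
begin

text \<open>Rationals with denominator prime to p; these are the only p-adic integers needed.\<close>

definition p_integral :: "nat \<Rightarrow> rat \<Rightarrow> bool" where
  "p_integral p a \<longleftrightarrow> coprime (snd (quotient_of a)) (int p)"

text \<open>For a p-integral rational a, divisibility by p is meant in the p-integral rationals.\<close>

definition abs_least_residue :: "nat \<Rightarrow> rat \<Rightarrow> int" where
  "abs_least_residue p a =
     (THE x::int. - (of_nat p / 2 :: rat) < of_int x \<and> of_int x < (of_nat p / 2 :: rat) \<and>
        (\<exists>b. p_integral p b \<and> of_int x - a = of_nat p * b))"

text \<open>Both sequences are indexed from 1 to (p - 1) / 2.\<close>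

definition seq_A0 :: "nat \<Rightarrow> nat \<Rightarrow> int" where
  "seq_A0 p i = abs_least_residue p (of_nat i ^ 2)"

definition seq_A2 :: "nat \<Rightarrow> int \<Rightarrow> nat \<Rightarrow> int" where
  "seq_A2 p g i = abs_least_residue p (of_int g ^ (2 * i))"

definition relating_perm :: "nat \<Rightarrow> (nat \<Rightarrow> 'a) \<Rightarrow> (nat \<Rightarrow> 'a) \<Rightarrow> nat \<Rightarrow> nat" where
  "relating_perm m A B = (THE \<pi>. \<pi> permutes {1..m} \<and> (\<forall>i\<in>{1..m}. A i = B (\<pi> i)))"

definition sigma02 :: "nat \<Rightarrow> int \<Rightarrow> nat \<Rightarrow> nat" where
  "sigma02 p g = relating_perm ((p - 1) div 2) (seq_A0 p) (seq_A2 p g)"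

definition quad_field :: "nat \<Rightarrow> real set" where
  "quad_field d = {a + b * sqrt (real d) | a b. a \<in> \<rat> \<and> b \<in> \<rat>}"

definition quad_ring_of_ints :: "nat \<Rightarrow> real ring" where
  "quad_ring_of_ints d =
     \<lparr>carrier = {x \<in> quad_field d. algebraic_int x},
      monoid.mult = (*), one = 1, zero = 0, add = (+)\<rparr>"

text \<open>The unit group is infinite cyclic modulo sign; the requirement of being greater than 1
  singles out one of the generators.\<close>

definition fundamental_unit :: "nat \<Rightarrow> real" where
  "fundamental_unit d =
     (THE e. e > 1 \<and> e \<in> Units (quad_ring_of_ints d) \<and>
        (\<forall>x \<in> Units (quad_ring_of_ints d). \<exists>k::int. x = e powi k \<or> x = - (e powi k)))"

text \<open>Since the square root of a prime p is irrational, the integers u and v with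
  fundamental unit (u + v sqrt p) / 2 are unique.\<close>

definition fund_u :: "nat \<Rightarrow> int" where
  "fund_u p =
     (THE u. \<exists>v::int. fundamental_unit p = (of_int u + of_int v * sqrt (real p)) / 2)"

text \<open>Every fractional ideal is a multiple of an integral one, so the classes below are the
  elements of the ideal class group. The class number is finite, hence card does not collapse to 0.\<close>

definition nonzero_ideals :: "nat \<Rightarrow> real set set" where
  "nonzero_ideals d = {I. ideal I (quad_ring_of_ints d) \<and> I \<noteq> {0}}"

definition ideal_class_rel :: "nat \<Rightarrow> (real set \<times> real set) set" where
  "ideal_class_rel d =
     {(I, J). I \<in> nonzero_ideals d \<and> J \<in> nonzero_ideals d \<and>
        (\<exists>\<alpha> \<in> carrier (quad_ring_of_ints d) - {0}. \<exists>\<beta> \<in> carrier (quad_ring_of_ints d) - {0}.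
           (\<lambda>x. \<alpha> * x) ` I = (\<lambda>x. \<beta> * x) ` J)}"

definition class_number :: "nat \<Rightarrow> nat" where
  "class_number d = card (nonzero_ideals d // ideal_class_rel d)"

end

theory Submission
  imports Defs "HOL-Analysis.Analysis" "HOL-Computational_Algebra.Nth_Powers"
begin

text \<open>Both sequences of residues have a Vandermonde product modulo \<open>p\<close>, and the sign of the permutation is
  the quotient of the two. For the squares the product is the inverse of \<open>n!\<close>, for the powers of \<open>g\<close>
  it is \<open>n ^ (n div 2)\<close> times a power of \<open>g\<close>, so everything reduces to Chowla's congruence
  \<open>2 n! = (-1) ^ ((h + 1) div 2) * u\<close> modulo \<open>p\<close>.

  For the latter, counting the ideals of bounded norm once through the character and once class by class
  gives \<open>2 h ln eps = sqrt p * L(1, chi)\<close>, and the sign of the quadratic Gauss sum identifies the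
  right-hand side as \<open>2 ln eta\<close>, where \<open>eta\<close> is the product of the \<open>sin (pi b / p)\<close> over the nonresidues
  \<open>b \<le> n\<close> divided by the product of the \<open>sin (pi a / p)\<close> over the residues \<open>a \<le> n\<close>. The relation
  \<open>eps ^ h = eta\<close> between \<open>p\<close>-th roots of unity is reduced modulo the prime above \<open>p\<close> by setting the root
  of unity to 1. It becomes \<open>(u / 2) ^ h = - n!\<close>; since \<open>(n!)\<^sup>2 = - 1\<close> and
  \<open>(u / 2)\<^sup>2 = 1\<close> or \<open>(u / 2)\<^sup>2 = - 1\<close> modulo \<open>p\<close>, the class number is odd and the power collapses.\<close>

subsection \<open>The sign of a permutation as a quotient of Vandermonde products\<close>

text \<open>The sign of the Gauss sum decides the sign in Chowla's congruence: with
  \<open>- sqrt p\<close> in place of \<open>sqrt p\<close>, \<open>eta\<close> would become its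
  inverse, and modulo \<open>p\<close> the quotient \<open>B / A = - n!\<close> of the signed
  products of nonresidues and residues up to \<open>n\<close> would become
  \<open>A / B = n!\<close>. Gauss's alternating sums of Gaussian binomials supply this sign. To
  reduce modulo the prime above \<open>p\<close> without its ring of integers, the relation is
  written as an integer polynomial in \<open>zeta\<close>: \<open>sqrt p\<close> is replaced by the
  Gauss sum, which vanishes at 1, and the half-angle root \<open>cis (pi / p)\<close> in the sines
  has the inverse \<open>- zeta ^ n\<close>. Finiteness of the class number is a by-product of the
  counting. After division by \<open>k\<close>, an ideal \<open>k (a Z + (t + om) Z)\<close> is
  primitive, and its class is counted by lattice points in a region of area
  \<open>2 a ln eps / (a sqrt p)\<close>. This does not depend on \<open>a\<close>, so all classes
  have the same positive density, while the total density \<open>L(1, chi)\<close> is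
  finite.\<close>

definition sgn_pair :: "nat \<Rightarrow> nat \<Rightarrow> int" where
  "sgn_pair i j = (if i < j then 1 else - 1)"

text \<open>A permutation of \<open>S\<close> also permutes the two-element subsets of
  \<open>S\<close>. Increasing pairs stand for these subsets; \<open>so\<close> sorts the image of a
  pair, which a symmetric \<open>G\<close> does not notice, and the same map for the inverse
  permutation undoes it.\<close>

lemma prod_pairs_permute:
  fixes G :: "nat \<Rightarrow> nat \<Rightarrow> 'a::comm_monoid_mult"
  assumes "\<pi> permutes S" and sym: "\<And>i j. G i j = G j i"
  shows "(\<Prod>(i,j)\<in>{(i,j). i \<in> S \<and> j \<in> S \<and> i < j}. G (\<pi> i) (\<pi> j)) =
         (\<Prod>(i,j)\<in>{(i,j). i \<in> S \<and> j \<in> S \<and> i < j}. G i j)"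
proof -
  define so where "so = (\<lambda>f (i::nat, j::nat). (min (f i) (f j :: nat), max (f i) (f j)))"
  have 1: "Hilbert_Choice.inv \<pi> permutes S" using assms(1) by (rule permutes_inv)
  have e: "\<pi> (Hilbert_Choice.inv \<pi> i) = i" "Hilbert_Choice.inv \<pi> (\<pi> i) = i" for i
    using assms(1) by (simp_all add: permutes_inverses)
  have ne: "f i \<noteq> f j" if "f permutes S" "i \<noteq> j" for f i j
    using that by (meson inj_eq permutes_inj)
  have m: "so f x \<in> {(i,j). i \<in> S \<and> j \<in> S \<and> i < j}"
    if f: "f permutes S" and xP: "x \<in> {(i,j). i \<in> S \<and> j \<in> S \<and> i < j}" for f x
  proof -
    obtain i j where x: "x = (i,j)" "i \<in> S" "j \<in> S" "i < j" using xP by auto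
    have "f i \<in> S" "f j \<in> S" using x f by (simp_all add: permutes_in_image)
    moreover have "f i \<noteq> f j" using ne[OF f] x by auto
    ultimately show ?thesis by (auto simp: so_def x min_def max_def)
  qed
  show ?thesis
    apply (rule prod.reindex_bij_witness[where j = "so \<pi>" and i = "so (Hilbert_Choice.inv \<pi>)"])
    subgoal for a by (auto simp: so_def e min_def max_def)
    subgoal for a using m[OF assms(1), of a] .
    subgoal for a by (auto simp: so_def e min_def max_def)
    subgoal for a using m[OF 1, of a] .
    subgoal for a by (cases a) (auto simp: so_def min_def max_def sym)
    done
qed

definition vdm :: "nat set \<Rightarrow> (nat \<Rightarrow> 'a::comm_ring_1) \<Rightarrow> 'a" where
  "vdm S f = (\<Prod>(i,j)\<in>{(i,j). i \<in> S \<and> j \<in> S \<and> i < j}. f j - f i)"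

text \<open>Each difference is a symmetric function \<open>G\<close> of the pair times its
  orientation. The symmetric part is invariant under \<open>\<pi>\<close>, so only the orientations
  survive; since nothing is divided, the values of \<open>f\<close> may coincide in the
  ring.\<close>

lemma vdm_permute_sgn_pair:
  fixes f :: "nat \<Rightarrow> 'a::comm_ring_1"
  assumes "\<pi> permutes S"
  shows "vdm S (f \<circ> \<pi>) = vdm S f *
    of_int (\<Prod>(i,j)\<in>{(i,j). i \<in> S \<and> j \<in> S \<and> i < j}. sgn_pair (\<pi> i) (\<pi> j))"
proof -
  let ?P = "{(i,j). i \<in> S \<and> j \<in> S \<and> i < j}"
  define G where "G = (\<lambda>i j. if i = j then 0 else (f j - f i) * of_int (sgn_pair i j))"
  have sym: "G i j = G j i" for i j
    unfolding G_def sgn_pair_def by (cases i j rule: linorder_cases) auto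
  have ne: "\<pi> i \<noteq> \<pi> j" if "i < j" for i j
    using that assms by (metis inj_eq nat_neq_iff permutes_inj)
  have "vdm S (f \<circ> \<pi>) = (\<Prod>(i,j)\<in>?P. G (\<pi> i) (\<pi> j) * of_int (sgn_pair (\<pi> i) (\<pi> j)))"
    unfolding vdm_def by (rule prod.cong) (auto simp: G_def sgn_pair_def ne)
  also have "\<dots> = (\<Prod>(i,j)\<in>?P. G (\<pi> i) (\<pi> j)) * (\<Prod>(i,j)\<in>?P. of_int (sgn_pair (\<pi> i) (\<pi> j)))"
    by (simp add: case_prod_unfold prod.distrib)
  also have "(\<Prod>(i,j)\<in>?P. G (\<pi> i) (\<pi> j)) = (\<Prod>(i,j)\<in>?P. G i j)"
    by (rule prod_pairs_permute[OF assms sym])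
  also have "\<dots> = vdm S f"
    unfolding vdm_def by (rule prod.cong) (auto simp: G_def sgn_pair_def)
  finally show ?thesis by (simp only: case_prod_unfold of_int_prod)
qed

text \<open>The inversions of the transposition of \<open>a < b\<close> are \<open>(a, b)\<close>
  and, for every \<open>k\<close> strictly between, \<open>(a, k)\<close> and \<open>(k, b)\<close>:
  an odd number.\<close>

lemma prod_sgn_pair_transpose:
  assumes "a \<in> {1..m}" "b \<in> {1..m}" "a < b"
  shows "(\<Prod>(i,j)\<in>{(i,j). i \<in> {1..m} \<and> j \<in> {1..m} \<and> i < j}.
           sgn_pair (Transposition.transpose a b i) (Transposition.transpose a b j)) = - 1"
proof -
  let ?P = "{(i,j). i \<in> {1..m} \<and> j \<in> {1..m} \<and> i < j}"
  define I where "I = insert (a,b) ((\<lambda>k. (a,k)) ` {a<..<b} \<union> (\<lambda>k. (k,b)) ` {a<..<b})"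
  have "?P \<subseteq> {1..m} \<times> {1..m}" by auto
  then have fin: "finite ?P" by (rule finite_subset) auto
  have sub: "I \<subseteq> ?P" unfolding I_def using assms by auto
  have "(\<Prod>x\<in>?P. case x of (i,j) \<Rightarrow> sgn_pair (Transposition.transpose a b i) (Transposition.transpose a b j)) =
      (\<Prod>x\<in>I. case x of (i,j) \<Rightarrow> sgn_pair (Transposition.transpose a b i) (Transposition.transpose a b j))"
    by (rule prod.mono_neutral_right[OF fin sub])
      (use assms in \<open>auto simp: I_def sgn_pair_def Transposition.transpose_def image_iff split: if_splits\<close>)
  also have "\<dots> = (\<Prod>x\<in>I. - 1)"
    by (rule prod.cong) (use assms in \<open>auto simp: I_def sgn_pair_def Transposition.transpose_def\<close>)
  also have "\<dots> = (- 1) ^ card I" by simp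
  also have "card I = Suc (card ((\<lambda>k. (a,k)) ` {a<..<b} \<union> (\<lambda>k. (k,b)) ` {a<..<b}))"
    unfolding I_def by (rule card_insert_disjoint) auto
  also have "card ((\<lambda>k. (a,k)) ` {a<..<b} \<union> (\<lambda>k. (k,b)) ` {a<..<b}) =
      card ((\<lambda>k. (a,k)) ` {a<..<b}) + card ((\<lambda>k. (k,b)) ` {a<..<b})"
    by (rule card_Un_disjoint) auto
  also have "card ((\<lambda>k. (a,k)) ` {a<..<b}) = card {a<..<b}"
    by (rule card_image) (auto simp: inj_on_def)
  also have "card ((\<lambda>k. (k,b)) ` {a<..<b}) = card {a<..<b}"
    by (rule card_image) (auto simp: inj_on_def)
  finally show ?thesis by (simp add: power_add[symmetric] mult_2[symmetric])
qed

text \<open>Induction over a factorisation into transpositions, each of which flips the sign by the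
  parity of its inversions. In the step the transposition acts on
  \<open>f \<circ> p\<close>.\<close>

lemma vdm_permute:
  fixes f :: "nat \<Rightarrow> 'a::comm_ring_1"
  assumes "\<pi> permutes {1..m}"
  shows "vdm {1..m} (f \<circ> \<pi>) = of_int (sign \<pi>) * vdm {1..m} f"
proof -
  have "\<forall>f :: nat \<Rightarrow> 'a. vdm {1..m} (f \<circ> \<pi>) = of_int (sign \<pi>) * vdm {1..m} f"
  proof (rule permutes_rev_induct[OF finite_atLeastAtMost assms], goal_cases)
    case 1
    then show ?case by simp
  next
    case (2 a b p)
    have tr: "vdm {1..m} (f \<circ> Transposition.transpose a b) = - vdm {1..m} f" for f :: "nat \<Rightarrow> 'a"
    proof -
      have "Transposition.transpose a b permutes {1..m}" by (rule permutes_swap_id) (use 2 in auto)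
      from vdm_permute_sgn_pair[OF this, of f] show ?thesis
        using prod_sgn_pair_transpose[of a m b] prod_sgn_pair_transpose[of b m a] 2(1-3)
        by (cases a b rule: linorder_cases) (simp_all add: Transposition.transpose_commute del: of_int_prod)
    qed
    have "permutation p" using 2(5) permutation_permutes by blast
    then have s: "sign (p \<circ> Transposition.transpose a b) = - sign p"
      using 2(3) by (simp add: sign_compose permutation_swap_id sign_swap_id)
    show ?case
    proof
      fix f :: "nat \<Rightarrow> 'a"
      have "vdm {1..m} (f \<circ> (p \<circ> Transposition.transpose a b)) = vdm {1..m} ((f \<circ> p) \<circ> Transposition.transpose a b)"
        by (simp add: comp_assoc)
      also have "\<dots> = - vdm {1..m} (f \<circ> p)" by (rule tr)
      also have "\<dots> = of_int (sign (p \<circ> Transposition.transpose a b)) * vdm {1..m} f"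
        using 2(4) s by (simp add: o_def)
      finally show "vdm {1..m} (f \<circ> (p \<circ> Transposition.transpose a b)) =
          of_int (sign (p \<circ> Transposition.transpose a b)) * vdm {1..m} f" .
    qed
  qed
  then show ?thesis by blast
qed

lemma vdm_nested: "vdm {1..m} f = (\<Prod>j=1..m. \<Prod>i=1..<j. f j - f i)"
proof -
  have "(\<Prod>j=1..m. \<Prod>i=1..<j. f j - f i) = (\<Prod>(j,i)\<in>(SIGMA j:{1..m}. {1..<j}). f j - f i)"
    by (subst prod.Sigma) auto
  also have "\<dots> = vdm {1..m} f"
    unfolding vdm_def
    by (rule prod.reindex_bij_witness[where i = "\<lambda>(i,j). (j,i)" and j = "\<lambda>(i,j). (j,i)"]) auto
  finally show ?thesis by simp
qed

text \<open>Grouped by the difference \<open>d\<close> of the indices: for a geometric sequence the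
  factor is \<open>w ^ i * (w ^ d - 1)\<close>, so \<open>w ^ d - 1\<close> occurs exactly
  \<open>m - d\<close> times.\<close>

lemma vdm_nested':
  "vdm {1..m} f = (\<Prod>d=1..<m. \<Prod>i=1..m-d. f (i + d) - f i)"
proof -
  have "(\<Prod>d=1..<m. \<Prod>i=1..m-d. f (i + d) - f i) = (\<Prod>(d,i)\<in>(SIGMA d:{1..<m}. {1..m-d}). f (i+d) - f i)"
    by (subst prod.Sigma) auto
  also have "\<dots> = vdm {1..m} f"
    unfolding vdm_def
    by (rule prod.reindex_bij_witness[where i = "\<lambda>(i,j). (j-i,i)" and j = "\<lambda>(d,i). (i,i+d)"]) auto
  finally show ?thesis by simp
qed

section \<open>Vandermonde products of squares and of powers modulo p\<close>

lemma cong_vdm: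
  fixes f h :: "nat \<Rightarrow> int"
  assumes "\<And>i. i \<in> S \<Longrightarrow> [f i = h i] (mod q)"
  shows "[vdm S f = vdm S h] (mod q)"
  unfolding vdm_def by (rule cong_prod) (auto intro!: cong_diff assms)

text \<open>Wilson's theorem is the case \<open>k = 0\<close>. Passing to \<open>k + 1\<close> moves
  the factor \<open>p - 1 - k\<close>, congruent to \<open>- (k + 1)\<close>, from the second
  factorial to the first, which costs one sign.\<close>

lemma wilson_complement:
  assumes "prime p" "k < p"
  shows "[fact k * fact (p - 1 - k) = (- 1) ^ Suc k] (mod int p)"
  using assms(2)
proof (induction k)
  case 0
  show ?case using wilson_theorem[OF assms(1)] by simp
next
  case (Suc k)
  then have IH: "[fact k * fact (p - 1 - k) = (- 1) ^ Suc k] (mod int p)" by simp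
  have e: "p - 1 - k = Suc (p - 1 - Suc k)" using Suc.prems by simp
  have "fact k * fact (p - 1 - k) = (int p - int (Suc k)) * (fact k * fact (p - 1 - Suc k))"
    unfolding e fact_Suc using Suc.prems by (simp add: of_nat_diff algebra_simps)
  moreover have "[(int p - int (Suc k)) * (fact k * fact (p - 1 - Suc k)) =
      (0 - int (Suc k)) * (fact k * fact (p - 1 - Suc k))] (mod int p)"
    by (intro cong_mult cong_diff cong_refl) (simp add: Cong.cong_def)
  moreover have "(0 - int (Suc k)) * (fact k * fact (p - 1 - Suc k)) = - (fact (Suc k) * fact (p - 1 - Suc k))"
    by (simp add: algebra_simps)
  ultimately have "[- (fact (Suc k) * fact (p - 1 - Suc k)) = fact k * fact (p - 1 - k)] (mod int p)"
    by (metis cong_sym)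
  then have "[- (fact (Suc k) * fact (p - 1 - Suc k)) = (- 1) ^ Suc k] (mod int p)"
    using IH cong_trans by blast
  then have "[- (- (fact (Suc k) * fact (p - 1 - Suc k))) = - ((- 1) ^ Suc k)] (mod int p)"
    by (rule cong_minus_minus_iff[THEN iffD2])
  then show ?case by simp
qed

text \<open>For fixed \<open>j\<close> the factors \<open>j - i\<close>, \<open>j\<close> and
  \<open>j + i\<close> with \<open>i < j\<close> together run through
  \<open>1, ..., 2 j - 1\<close>. The factorial on the left supplies the middle factors
  \<open>j\<close>.\<close>

lemma vdm_squares_exact:
  "vdm {1..m} (\<lambda>i. (of_nat i)\<^sup>2) * fact m = (\<Prod>j=1..m. fact (2 * j - 1) :: 'a::{comm_ring_1,semiring_char_0})"
proof -
  have *: "(\<Prod>i=1..<j. (of_nat j)\<^sup>2 - (of_nat i)\<^sup>2) * of_nat j = (fact (2 * j - 1) :: 'a)" if "j \<ge> 1" for j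
  proof -
    have a: "(\<Prod>i=1..<j. of_nat j - of_nat i :: 'a) = (\<Prod>i=1..<j. of_nat i)"
      by (rule prod.reindex_bij_witness[where i = "\<lambda>i. j - i" and j = "\<lambda>i. j - i"]) (auto simp: of_nat_diff)
    have b: "(\<Prod>i=1..<j. of_nat j + of_nat i :: 'a) = (\<Prod>i=j+1..<2*j. of_nat i)"
      by (rule prod.reindex_bij_witness[where i = "\<lambda>i. i - j" and j = "\<lambda>i. i + j"]) (auto simp: add.commute)
    have "fact (2 * j - 1) = (\<Prod>i=1..<2*j. of_nat i :: 'a)"
      unfolding fact_prod of_nat_prod using that by (intro prod.cong) auto
    also have "{1..<2*j} = {1..<j} \<union> insert j {j+1..<2*j}" using that by auto
    also have "(\<Prod>i\<in>\<dots>. of_nat i :: 'a) = (\<Prod>i=1..<j. of_nat i) * (of_nat j * (\<Prod>i=j+1..<2*j. of_nat i))"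
      by (subst prod.union_disjoint) auto
    also have "\<dots> = (\<Prod>i=1..<j. of_nat j - of_nat i) * (of_nat j * (\<Prod>i=1..<j. of_nat j + of_nat i))"
      by (simp only: a b)
    also have "\<dots> = (\<Prod>i=1..<j. (of_nat j)\<^sup>2 - (of_nat i)\<^sup>2) * of_nat j"
    proof -
      have "(of_nat j)\<^sup>2 - (of_nat i)\<^sup>2 = (of_nat j - of_nat i) * (of_nat j + of_nat i :: 'a)" for i
        by (simp add: power2_eq_square algebra_simps)
      then show ?thesis by (simp only: prod.distrib mult_ac)
    qed
    finally show ?thesis by simp
  qed
  have "fact m = (\<Prod>j=1..m. of_nat j :: 'a)" by (simp add: fact_prod)
  then have "vdm {1..m} (\<lambda>i. (of_nat i)\<^sup>2) * fact m = (\<Prod>j=1..m. (\<Prod>i=1..<j. (of_nat j)\<^sup>2 - (of_nat i)\<^sup>2) * (of_nat j :: 'a))"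
    by (simp only: vdm_nested prod.distrib)
  also have "\<dots> = (\<Prod>j=1..m. fact (2 * j - 1))"
    by (rule prod.cong[OF refl], rule *) auto
  finally show ?thesis .
qed

text \<open>The factorials at \<open>j\<close> and at \<open>n + 1 - j\<close> have arguments adding
  up to \<open>2 n = p - 1\<close>, so by the complement form of Wilson's theorem each pair
  contributes \<open>(- 1) ^ (2 j) = 1\<close>. As \<open>n\<close> is even, all \<open>j\<close>
  fall into such pairs.\<close>

lemma vdm_squares_mod:
  assumes "prime p" "p = 2 * n + 1" "n = 2 * m"
  shows "[vdm {1..n} (\<lambda>i. (int i)\<^sup>2) * fact n = 1] (mod int p)"
proof -
  have "{1..n} = {1..m} \<union> {m+1..n}" using assms by auto
  then have "(\<Prod>j=1..n. fact (2 * j - 1) :: int) = (\<Prod>j=1..m. fact (2 * j - 1)) * (\<Prod>j=m+1..n. fact (2 * j - 1))"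
    by (simp add: prod.union_disjoint)
  also have "(\<Prod>j=m+1..n. fact (2 * j - 1) :: int) = (\<Prod>j=1..m. fact (2 * (n + 1 - j) - 1))"
    by (rule prod.reindex_bij_witness[where i = "\<lambda>i. n + 1 - i" and j = "\<lambda>i. n + 1 - i"]) (use assms in auto)
  finally have e: "(\<Prod>j=1..n. fact (2 * j - 1) :: int) = (\<Prod>j=1..m. fact (2 * j - 1) * fact (2 * (n + 1 - j) - 1))"
    by (simp add: prod.distrib)
  have "[(\<Prod>j=1..m. fact (2 * j - 1) * fact (2 * (n + 1 - j) - 1)) = (\<Prod>j=1..m. 1 :: int)] (mod int p)"
  proof (rule cong_prod)
    fix j assume j: "j \<in> {1..m}"
    have "p - 1 - (2 * j - 1) = 2 * (n + 1 - j) - 1" using j assms by auto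
    moreover have "Suc (2 * j - 1) = 2 * j" using j by auto
    ultimately show "[fact (2 * j - 1) * fact (2 * (n + 1 - j) - 1) = (1::int)] (mod int p)"
      using wilson_complement[OF assms(1), of "2 * j - 1"] j assms by simp
  qed
  then show ?thesis using vdm_squares_exact[of n, where ?'a = int] e by simp
qed

lemma sign_cong_mult:
  assumes "[of_int (sign \<pi>) * x = y] (mod q)"
  shows "[x = sign \<pi> * (y :: int)] (mod q)"
proof -
  have "[sign \<pi> * (sign \<pi> * x) = sign \<pi> * y] (mod q)"
    using assms by (intro cong_mult cong_refl) simp
  then show ?thesis by (simp add: mult.assoc[symmetric] sign_idempotent)
qed

lemma fact_half_square:
  assumes "prime p" "p = 2 * n + 1" "n = 2 * m"
  shows "[(fact n)\<^sup>2 = - 1] (mod int p)"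
  using wilson_complement[OF assms(1), of n] assms by (simp add: power2_eq_square)

text \<open>The powers \<open>w ^ d\<close> with \<open>0 < d < n\<close> are the squares
  \<open>i ^ 2\<close> with \<open>1 < i \<le> n\<close>, because the index 1 corresponds to
  \<open>w ^ n\<close>. This turns the product into that of
  \<open>i ^ 2 - 1 = (i - 1) (i + 1)\<close>, which telescopes to factorials.\<close>

lemma prod_one_minus_powers:
  fixes w :: int
  assumes p: "prime p" "p = 2 * n + 1" "n = 2 * m"
    and \<pi>: "\<pi> permutes {1..n}"
    and rel: "\<And>i. i \<in> {1..n} \<Longrightarrow> [(int i)\<^sup>2 = w ^ \<pi> i] (mod int p)"
    and inj: "\<And>i. i \<in> {1..<n} \<Longrightarrow> \<not> [w ^ i = 1] (mod int p)"
  shows "[(\<Prod>d=1..<n. w ^ d - 1) = - int n] (mod int p)"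
proof -
  have n: "n \<ge> 2" using p prime_gt_1_nat[OF p(1)] by (cases m) auto
  have "\<pi> 1 = n"
  proof (rule ccontr)
    assume "\<pi> 1 \<noteq> n"
    moreover have "\<pi> 1 \<in> {1..n}" using \<pi> n by (subst permutes_in_image) auto
    ultimately have "\<pi> 1 \<in> {1..<n}" by auto
    with inj rel[of 1] n show False by (auto simp: cong_sym_eq)
  qed
  have "bij_betw \<pi> {1..n} {1..n}" using \<pi> by (rule permutes_imp_bij)
  then have bij: "bij_betw \<pi> ({1..n} - {1}) ({1..n} - {\<pi> 1})"
  proof -
    have "\<pi> ` ({1..n} - {1}) = {1..n} - {\<pi> 1}"
      using permutes_image[OF \<pi>] permutes_inj[OF \<pi>] by (simp add: image_set_diff)
    then show ?thesis using inj_on_subset[OF permutes_inj[OF \<pi>] subset_UNIV] by (simp add: bij_betw_def)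
  qed
  have sets: "{1..n} - {1} = {2..n}" "{1..n} - {\<pi> 1} = {1..<n}"
    using n \<open>\<pi> 1 = n\<close> by auto
  have "(\<Prod>d=1..<n. w ^ d - 1) = (\<Prod>i=2..n. w ^ \<pi> i - 1)"
    using prod.reindex_bij_betw[OF bij[unfolded sets], of "\<lambda>d. w ^ d - 1"] by simp
  also have "[\<dots> = (\<Prod>i=2..n. (int i)\<^sup>2 - 1)] (mod int p)"
    by (intro cong_prod cong_diff cong_refl cong_sym[OF rel]) auto
  finally have c1: "[(\<Prod>d=1..<n. w ^ d - 1) = (\<Prod>i=2..n. (int i)\<^sup>2 - 1)] (mod int p)" .
  \<comment> \<open>The product equals \<open>(k - 1)! (k + 1)! / 2\<close>; the factor
    \<open>2 k\<close> turns it into \<open>k! (k + 1)!\<close>.\<close>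
  have "2 * int k * (\<Prod>i=2..k. (int i)\<^sup>2 - 1) = (int k + 1) * (fact k)\<^sup>2" if "k \<ge> 1" for k
    using that
  proof (induction k rule: dec_induct)
    case (step k)
    have "{2..Suc k} = insert (Suc k) {2..k}" using step by auto
    then have "int k * (2 * int (Suc k) * (\<Prod>i=2..Suc k. (int i)\<^sup>2 - 1)) =
        int (Suc k) * ((int (Suc k))\<^sup>2 - 1) * (2 * int k * (\<Prod>i=2..k. (int i)\<^sup>2 - 1))"
      by simp
    also have "\<dots> = int (Suc k) * ((int (Suc k))\<^sup>2 - 1) * ((int k + 1) * (fact k)\<^sup>2)"
      by (simp only: step.IH)
    also have "\<dots> = int k * ((int (Suc k) + 1) * (fact (Suc k))\<^sup>2)"
      by (simp add: power2_eq_square algebra_simps)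
    finally show ?case using step(1) by simp
  qed simp
  from this[of n] have e: "2 * int n * (\<Prod>i=2..n. (int i)\<^sup>2 - 1) = (int n + 1) * (fact n)\<^sup>2"
    using n by simp
  have "[2 * int n * (\<Prod>d=1..<n. w ^ d - 1) = (int n + 1) * (- 1)] (mod int p)"
    using cong_trans[OF cong_mult[OF cong_refl c1, of "2 * int n"]] e
      cong_mult[OF cong_refl fact_half_square[OF p], of "int n + 1"] by simp
  \<comment> \<open>Uses \<open>2 n = - 1\<close> modulo \<open>p\<close>.\<close>
  moreover have "[(int n + 1) * (- 1) = 2 * int n * (- int n)] (mod int p)"
  proof -
    have "2 * int n * (- int n) - (int n + 1) * (- 1) = int p * (1 - int n)"
      using p(2) by (simp add: algebra_simps power2_eq_square)
    then show ?thesis by (metis cong_iff_dvd_diff cong_sym dvd_triv_left)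
  qed
  ultimately have "[2 * int n * (\<Prod>d=1..<n. w ^ d - 1) = 2 * int n * (- int n)] (mod int p)"
    by (rule cong_trans)
  moreover have "coprime (2 * int n) (int p)"
    using p(2) by (metis coprime_add_one_right int_ops(2,7) of_nat_add of_nat_numeral coprime_commute)
  ultimately show ?thesis by (metis cong_mult_lcancel)
qed

text \<open>With \<open>y d = w ^ d - 1\<close>, the relation \<open>w ^ m = - 1\<close> gives the
  reflection \<open>y (n - d) = w ^ (m - d) * y d\<close>. The exponents \<open>n - d\<close> and
  \<open>d\<close> of a reflected pair add up to \<open>n = 2 m\<close>, so each pair yields an
  \<open>m\<close>-th power of \<open>y d ^ 2\<close>, and the known product of all
  \<open>y d\<close> evaluates \<open>2 * Y\<close> up to a power of \<open>w\<close>. The rest is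
  bookkeeping of exponents of \<open>w\<close>.\<close>

lemma vdm_powers_mod:
  fixes w :: int
  assumes p: "prime p" "p = 2 * n + 1" "n = 2 * m"
    and P: "[(\<Prod>d=1..<n. w ^ d - 1) = - int n] (mod int p)"
    and wm: "[w ^ m = - 1] (mod int p)"
  shows "[vdm {1..n} (\<lambda>i. w ^ i) = int n ^ m * w ^ ((6 * m ^ 3 - m\<^sup>2 - m) div 2)] (mod int p)"
proof -
  have m: "m \<ge> 1" using p prime_gt_1_nat[OF p(1)] by (cases m) auto
  have wn: "[w ^ n = 1] (mod int p)"
    using cong_pow[OF wm, of 2] p(3) by (simp add: power_mult[symmetric] mult.commute)
  define y where "y = (\<lambda>d. w ^ d - 1)"
  have split: "{1..<n} = {1..<m} \<union> insert m {m+1..<n}" using m p(3) by auto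
  \<comment> \<open>Pairs \<open>d\<close> with \<open>n - d\<close>; the fixed point
    \<open>m\<close> stays alone.\<close>
  have halve: "(\<Prod>d=1..<n. f d) = f m * (\<Prod>d=1..<m. f d * f (n - d))" for f :: "nat \<Rightarrow> int"
  proof -
    have "(\<Prod>d=1..<n. f d) = (\<Prod>d=1..<m. f d) * (f m * (\<Prod>d=m+1..<n. f d))"
      unfolding split by (subst prod.union_disjoint) auto
    also have "(\<Prod>d=m+1..<n. f d) = (\<Prod>d=1..<m. f (n - d))"
      by (rule prod.reindex_bij_witness[where i = "\<lambda>d. n - d" and j = "\<lambda>d. n - d"]) (use p(3) in auto)
    finally show ?thesis by (simp add: prod.distrib mult_ac)
  qed
  have refl: "[y (n - d) = w ^ (m - d) * y d] (mod int p)" if "d \<in> {1..<m}" for d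
  proof -
    have "n - d = m + (m - d)" "m = (m - d) + d" using that p(3) by auto
    then have e: "w ^ (n - d) = w ^ m * w ^ (m - d)" "w ^ m = w ^ (m - d) * w ^ d"
      by (metis power_add)+
    have "[w ^ m * w ^ (m - d) - 1 = - 1 * w ^ (m - d) + w ^ m] (mod int p)"
      using cong_add[OF cong_mult[OF wm cong_refl[of "w ^ (m - d)"]] cong_sym[OF wm]] by simp
    moreover have "- 1 * w ^ (m - d) + w ^ m = w ^ (m - d) * y d"
      unfolding y_def using e(2) by (simp add: algebra_simps)
    ultimately show ?thesis unfolding y_def e(1) by simp
  qed
  have ym: "[y m = - 2] (mod int p)"
    using cong_diff[OF wm cong_refl[of 1]] by (simp add: y_def)
  define Y where "Y = (\<Prod>d=1..<m. (y d)\<^sup>2)"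
  define T where "T = (\<Sum>d=1..<m. m - d)"
  have cop: "coprime (2 :: int) (int p)" using p(2) by simp
  have Yeq: "[w ^ T * Y = int m] (mod int p)"
  proof -
    have "[(\<Prod>d=1..<n. y d) = - 2 * (\<Prod>d=1..<m. y d * (w ^ (m - d) * y d))] (mod int p)"
      unfolding halve[of y] by (intro cong_mult ym cong_prod refl cong_refl)
    moreover have "(\<Prod>d=1..<m. y d * (w ^ (m - d) * y d)) = w ^ T * Y"
      unfolding T_def Y_def power_sum prod.distrib[symmetric]
      by (simp add: power2_eq_square mult_ac)
    ultimately have "[- 2 * (w ^ T * Y) = - 2 * int m] (mod int p)"
      using P p(3) unfolding y_def by (metis (no_types, lifting) cong_sym cong_trans mult_minus_left of_nat_mult of_nat_numeral)
    moreover have "coprime (- 2 :: int) (int p)" using cop by simp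
    ultimately show ?thesis by (metis cong_mult_lcancel)
  qed
  define A where "A = (\<Sum>d=1..<n. \<Sum>i=1..n-d. i)"
  have "vdm {1..n} (\<lambda>i. w ^ i) = (\<Prod>d=1..<n. \<Prod>i=1..n-d. w ^ i * y d)"
    unfolding vdm_nested' y_def by (simp add: power_add algebra_simps)
  also have "\<dots> = (\<Prod>d=1..<n. w ^ (\<Sum>i=1..n-d. i) * y d ^ (n - d))"
    by (simp add: prod.distrib power_sum)
  also have "\<dots> = w ^ A * (\<Prod>d=1..<n. y d ^ (n - d))"
    by (simp add: prod.distrib power_sum A_def)
  also have "(\<Prod>d=1..<n. y d ^ (n - d)) = y m ^ m * (\<Prod>d=1..<m. y d ^ (n - d) * y (n - d) ^ d)"
    unfolding halve[of "\<lambda>d. y d ^ (n - d)"] using p(3) by (intro arg_cong2[where f = "(*)"] prod.cong) auto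
  finally have V: "vdm {1..n} (\<lambda>i. w ^ i) = w ^ A * (y m ^ m * (\<Prod>d=1..<m. y d ^ (n - d) * y (n - d) ^ d))" .
  define B where "B = (\<Sum>d=1..<m. (m - d) * d)"
  have "[(\<Prod>d=1..<m. y d ^ (n - d) * y (n - d) ^ d) =
      (\<Prod>d=1..<m. y d ^ (n - d) * (w ^ (m - d) * y d) ^ d)] (mod int p)"
    by (intro cong_prod cong_mult cong_pow refl cong_refl)
  also have "(\<Prod>d=1..<m. y d ^ (n - d) * (w ^ (m - d) * y d) ^ d) = (\<Prod>d=1..<m. w ^ ((m - d) * d) * (y d ^ 2) ^ m)"
  proof (rule prod.cong)
    fix d assume d: "d \<in> {1..<m}"
    then have "y d ^ (n - d) * y d ^ d = y d ^ n" using p(3) by (simp add: power_add[symmetric])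
    moreover have "y d ^ n = (y d ^ 2) ^ m" using p(3) by (simp add: power_mult)
    moreover have "y d ^ (n - d) * (w ^ (m - d) * y d) ^ d = (w ^ (m - d)) ^ d * (y d ^ (n - d) * y d ^ d)"
      by (simp add: power_mult_distrib)
    ultimately show "y d ^ (n - d) * (w ^ (m - d) * y d) ^ d = w ^ ((m - d) * d) * (y d ^ 2) ^ m"
      by (simp only: power_mult)
  qed simp
  also have "\<dots> = w ^ B * Y ^ m"
    by (simp add: prod.distrib power_sum B_def Y_def prod_power_distrib)
  finally have "[vdm {1..n} (\<lambda>i. w ^ i) = w ^ A * ((- 2) ^ m * (w ^ B * Y ^ m))] (mod int p)"
    unfolding V by (intro cong_mult cong_pow ym cong_refl)
  also have "w ^ A * ((- 2) ^ m * (w ^ B * Y ^ m)) = w ^ (A + B) * (- 1) ^ m * (2 ^ m * Y ^ m)"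
  proof -
    have "(- 2 :: int) ^ m = (- 1) ^ m * 2 ^ m" by (simp flip: power_mult_distrib)
    then show ?thesis by (simp add: power_add mult_ac)
  qed
  \<comment> \<open>The sign \<open>(- 1) ^ m\<close> is turned back into the power
    \<open>w ^ (m * m)\<close>, so that it merges with the exponent.\<close>
  also have "[\<dots> = w ^ (A + B) * (w ^ m) ^ m * (2 ^ m * Y ^ m)] (mod int p)"
    by (intro cong_mult cong_refl cong_pow cong_sym[OF wm])
  also have "w ^ (A + B) * (w ^ m) ^ m * (2 ^ m * Y ^ m) = w ^ (A + B + m * m) * (2 ^ m * Y ^ m)"
    by (simp add: power_add power_mult mult_ac)
  finally have main: "[vdm {1..n} (\<lambda>i. w ^ i) = w ^ (A + B + m * m) * (2 ^ m * Y ^ m)] (mod int p)" .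
  have T': "2 * T + m = m * m"
  proof -
    have "T = (\<Sum>d=1..<m. d)" unfolding T_def
      by (rule sum.reindex_bij_witness[where i = "\<lambda>d. m - d" and j = "\<lambda>d. m - d"]) auto
    moreover have "2 * (\<Sum>d=1..<k. d) + k = k * k" if "k \<ge> 1" for k :: nat
      using that by (induction k rule: dec_induct) auto
    ultimately show ?thesis using m by simp
  qed
  have B': "6 * B + m = m ^ 3"
  proof -
    have "6 * (\<Sum>d=1..<k. (int k - int d) * int d) + int k = int k ^ 3" if "k \<ge> 1" for k :: nat
    proof -
      have 1: "2 * (\<Sum>d=1..<k. int d) = int k * int k - int k"
        using that by (induction k rule: dec_induct) (auto simp: algebra_simps)
      have 2: "6 * (\<Sum>d=1..<k. int d * int d) = 2 * int k ^ 3 - 3 * int k ^ 2 + int k"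
        using that by (induction k rule: dec_induct) (auto simp: algebra_simps power2_eq_square power3_eq_cube)
      have "(\<Sum>d=1..<k. (int k - int d) * int d) = int k * (\<Sum>d=1..<k. int d) - (\<Sum>d=1..<k. int d * int d)"
        by (simp add: algebra_simps sum_subtractf sum_distrib_left)
      then have "6 * (\<Sum>d=1..<k. (int k - int d) * int d) = 3 * int k * (2 * (\<Sum>d=1..<k. int d)) - 6 * (\<Sum>d=1..<k. int d * int d)"
        by simp
      then show ?thesis unfolding 1 2 by (simp add: algebra_simps power2_eq_square power3_eq_cube)
    qed
    moreover have "int B = (\<Sum>d=1..<m. (int m - int d) * int d)"
      unfolding B_def by (simp add: of_nat_diff)
    ultimately have "int (6 * B + m) = int (m ^ 3)" using m by simp
    then show ?thesis using of_nat_eq_iff by blast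
  qed
  have A': "6 * A + n = n ^ 3"
  proof -
    have "A = (\<Sum>k=1..<n. \<Sum>i=1..k. i)" unfolding A_def
      by (rule sum.reindex_bij_witness[where i = "\<lambda>d. n - d" and j = "\<lambda>d. n - d"]) auto
    moreover have "6 * (\<Sum>k=1..<j. \<Sum>i=1..k. i) + j = j ^ 3" if "j \<ge> 1" for j :: nat
      using that
    proof (induction j rule: dec_induct)
      case (step j)
      have "2 * (\<Sum>i=1..k. i) = k * (k + 1)" for k :: nat by (induction k) auto
      from this[of j] have "6 * (\<Sum>i=1..j. i) = 3 * (j * (j + 1))" by linarith
      then show ?case using step by (auto simp: algebra_simps power3_eq_cube)
    qed simp
    ultimately show ?thesis using m p(3) by simp
  qed
  define G where "G = (6 * m ^ 3 - m\<^sup>2 - m) div 2"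
  have G': "2 * G + m\<^sup>2 + m = 6 * m ^ 3"
  proof -
    have "m\<^sup>2 + m \<le> 6 * m ^ 3"
    proof -
      have "m * m \<le> m * m * m" "m \<le> m * m * m" using m by auto
      then have "m * m + m \<le> 6 * (m * m * m)" by linarith
      then show ?thesis by (simp add: power2_eq_square power3_eq_cube)
    qed
    moreover have "even (6 * m ^ 3 - (m\<^sup>2 + m))"
      by (rule dvd_diff_nat) auto
    ultimately show ?thesis unfolding G_def by (auto simp: diff_diff_left)
  qed
  \<comment> \<open>The exponents agree up to a multiple of \<open>n\<close>, and
    \<open>w ^ n = 1\<close>. The multiple is put on the right so that the identity can be stated in
    natural numbers without subtraction.\<close>
  have exps: "T * m + G = A + B + m * m + n * (2 * T)"
  proof -
    \<comment> \<open>The closed forms of \<open>A\<close> and \<open>B\<close> have denominator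
      6.\<close>
    have "6 * (int A + int B + int m * int m + int n * (2 * int T)) = 6 * (int T * int m + int G)"
    proof -
      have a: "6 * int A = int n ^ 3 - int n" using A' by (metis add_diff_cancel_right' of_nat_add of_nat_mult of_nat_numeral of_nat_power)
      have b: "6 * int B = int m ^ 3 - int m" using B' by (metis add_diff_cancel_right' of_nat_add of_nat_mult of_nat_numeral of_nat_power)
      have t: "2 * int T = int m * int m - int m" using T' by (metis add_diff_cancel_right' of_nat_add of_nat_mult of_nat_numeral)
      have g: "2 * int G = 6 * int m ^ 3 - int m ^ 2 - int m"
        using arg_cong[OF G', of int] by (simp add: algebra_simps)
      have "6 * (int A + int B + int m * int m + int n * (2 * int T)) =
          6 * int A + 6 * int B + 6 * (int m * int m) + 12 * int m * (2 * int T)"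
        using p(3) by (simp add: algebra_simps)
      also have "\<dots> = 3 * int m * (2 * int T) + 3 * (2 * int G)"
        unfolding a b t g using p(3) by (simp add: algebra_simps power2_eq_square power3_eq_cube)
      finally show ?thesis by (simp add: algebra_simps)
    qed
    then have "int (T * m + G) = int (A + B + m * m + n * (2 * T))" by simp
    then show ?thesis using of_nat_eq_iff by blast
  qed
  have "[int n ^ m * w ^ G = (2 * (w ^ T * Y)) ^ m * w ^ G] (mod int p)"
    using p(3) by (intro cong_mult cong_pow cong_refl) (auto intro!: cong_mult cong_sym[OF Yeq])
  also have "(2 * (w ^ T * Y)) ^ m * w ^ G = w ^ (T * m + G) * (2 ^ m * Y ^ m)"
    by (simp add: power_mult_distrib power_add power_mult mult_ac)
  also have "w ^ (T * m + G) = w ^ (A + B + m * m) * (w ^ n) ^ (2 * T)"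
    unfolding exps by (simp add: power_add power_mult)
  also have "[w ^ (A + B + m * m) * (w ^ n) ^ (2 * T) * (2 ^ m * Y ^ m) =
      w ^ (A + B + m * m) * 1 ^ (2 * T) * (2 ^ m * Y ^ m)] (mod int p)"
    by (intro cong_mult cong_refl cong_pow wn)
  finally show ?thesis using main unfolding G_def[symmetric] by (simp add: Cong.cong_def)
qed

subsection \<open>Least absolute residues and the permutation of squares\<close>

text \<open>Any representation with a denominator prime to \<open>p\<close> will do, not only the
  reduced one; closure under subtraction is then immediate.\<close>

lemma p_integral_iff:
  "p_integral p a \<longleftrightarrow> (\<exists>c d. d \<noteq> 0 \<and> coprime d (int p) \<and> a = of_int c / of_int d)"
proof
  assume "p_integral p a"
  moreover obtain c d where cd: "quotient_of a = (c, d)" by force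
  ultimately show "\<exists>c d. d \<noteq> 0 \<and> coprime d (int p) \<and> a = of_int c / of_int d"
    using quotient_of_div[OF cd] quotient_of_denom_pos[OF cd]
    by (intro exI[of _ c] exI[of _ d]) (auto simp: p_integral_def)
next
  assume "\<exists>c d. d \<noteq> 0 \<and> coprime d (int p) \<and> a = of_int c / of_int d"
  then obtain c d where d: "d \<noteq> 0" "coprime d (int p)" "a = of_int c / of_int d" by blast
  obtain c' d' where cd: "quotient_of a = (c', d')" by force
  have "(of_int c :: rat) / of_int d = of_int c' / of_int d'" "d' > 0"
    using quotient_of_div[OF cd] quotient_of_denom_pos[OF cd] d(3) by auto
  then have "(of_int (c * d') :: rat) = of_int (c' * d)" using d(1) by (simp add: field_simps)
  then have "c * d' = c' * d" by (simp only: of_int_eq_iff)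
  then have "d' dvd c' * d" by (metis dvd_triv_right)
  moreover have "coprime d' c'" using quotient_of_coprime[OF cd] by (simp add: coprime_commute)
  ultimately have "d' dvd d" by (simp only: coprime_dvd_mult_right_iff)
  then show "p_integral p a"
    using coprime_divisors[OF _ dvd_refl d(2)] by (simp add: p_integral_def cd)
qed

lemma p_integral_diff:
  assumes "p_integral p a" "p_integral p b"
  shows "p_integral p (a - b)"
proof -
  obtain c d c' d' where *: "d \<noteq> 0" "coprime d (int p)" "a = of_int c / of_int d"
    "d' \<noteq> 0" "coprime d' (int p)" "b = of_int c' / of_int d'"
    using assms by (auto simp: p_integral_iff)
  show ?thesis unfolding p_integral_iff
    by (rule exI[of _ "c * d' - c' * d"], rule exI[of _ "d * d'"]) (use * in \<open>simp add: diff_frac_eq\<close>)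
qed

text \<open>Two candidates differ by \<open>p\<close> times a \<open>p\<close>-integral rational,
  hence by an integer multiple of \<open>p\<close>, and by less than \<open>p\<close> in absolute
  value.\<close>

lemma abs_least_residue_eqI:
  assumes "p > 0" "2 * \<bar>x\<bar> < int p" "p_integral p b" "of_int x - a = of_nat p * b"
  shows "abs_least_residue p a = x"
  unfolding abs_least_residue_def
proof (rule the_equality)
  have "\<bar>of_int x :: rat\<bar> < of_nat p / 2"
    using assms(2) of_int_less_iff[of "2 * \<bar>x\<bar>" "int p", where ?'a = rat] by simp
  then show "- (of_nat p / 2 :: rat) < of_int x \<and> of_int x < (of_nat p / 2 :: rat) \<and>
        (\<exists>b. p_integral p b \<and> of_int x - a = of_nat p * b)"
    using assms by auto
next
  fix y :: int
  assume y: "- (of_nat p / 2 :: rat) < of_int y \<and> of_int y < (of_nat p / 2 :: rat) \<and>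
        (\<exists>b. p_integral p b \<and> of_int y - a = of_nat p * b)"
  then obtain b' where b': "p_integral p b'" "of_int y - a = of_nat p * b'" by blast
  from p_integral_diff[OF b'(1) assms(3)] obtain c d where
    cd: "d \<noteq> 0" "coprime d (int p)" "b' - b = of_int c / of_int d"
    by (auto simp: p_integral_iff)
  have "of_int (y - x) = of_nat p * (b' - b)" using b'(2) assms(4) by (simp add: algebra_simps)
  then have "(of_int ((y - x) * d) :: rat) = of_int (int p * c)"
    using cd by (simp add: field_simps)
  then have "int p dvd (y - x) * d" by (simp only: of_int_eq_iff) simp
  then have "int p dvd y - x" using cd(2) by (simp add: coprime_dvd_mult_left_iff coprime_commute)
  moreover have "\<bar>y - x\<bar> < int p"
  proof -
    have "(of_int (2 * y) :: rat) < of_int (int p)" "(of_int (- int p) :: rat) < of_int (2 * y)"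
      using y by auto
    then show ?thesis using assms(2) unfolding of_int_less_iff by linarith
  qed
  ultimately show "y = x" using dvd_imp_le_int[of "y - x" "int p"] by fastforce
qed

text \<open>The halved argument of the theorem is handled by doubling the candidate: as 2 is a unit
  modulo an odd \<open>p\<close>, an ordinary integer congruence for \<open>2 * x\<close>
  suffices.\<close>

lemma abs_least_residue_half:
  assumes "odd p" "2 * \<bar>x\<bar> < int p" "[2 * x = y] (mod int p)"
  shows "abs_least_residue p (1 / 2 * of_int y) = x"
proof -
  obtain k where k: "2 * x - y = int p * k" using assms(3) by (auto simp: cong_iff_dvd_diff)
  have "p_integral p (of_int k / of_int 2)"
    unfolding p_integral_iff using assms(1)
    by (intro exI[of _ k] exI[of _ 2]) auto
  moreover have "of_int x - 1 / 2 * of_int y = of_nat p * (of_int k / of_int 2 :: rat)"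
  proof -
    have "(of_int (2 * x - y) :: rat) = of_int (int p * k)" using k by simp
    then show ?thesis by (simp add: field_simps)
  qed
  ultimately show ?thesis using assms by (intro abs_least_residue_eqI) (auto simp: odd_pos)
qed

lemma abs_least_residue_of_int:
  assumes "odd p"
  shows "[abs_least_residue p (of_int y) = y] (mod int p)"
    and "abs_least_residue p (of_int y) = abs_least_residue p (of_int z) \<longleftrightarrow> [y = z] (mod int p)"
proof -
  define h where "h = (int p - 1) div 2"
  have h: "int p = 2 * h + 1" using assms unfolding h_def by (auto elim!: oddE)
  \<comment> \<open>Shifting by \<open>h = (p - 1) / 2\<close> turns the symmetric interval into the
    range of \<open>mod\<close>, which gives an explicit formula serving both claims.\<close>
  have *: "abs_least_residue p (of_int y) = (y + h) mod int p - h" for y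
  proof -
    have "[(y + h) mod int p = y + h] (mod int p)" by (simp add: Cong.cong_def)
    from cong_diff[OF this cong_refl[of h]] obtain k where k: "(y + h) mod int p - h - y = int p * k"
      by (auto simp: cong_iff_dvd_diff)
    then have "(of_int ((y + h) mod int p - h - y) :: rat) = of_int (int p * k)" by simp
    then have "of_int ((y + h) mod int p - h) - of_int y = of_nat p * (of_int k / of_int 1 :: rat)" by simp
    moreover have "p_integral p (of_int k / of_int 1)" unfolding p_integral_iff
      by (intro exI[of _ k] exI[of _ 1]) auto
    moreover have "2 * \<bar>(y + h) mod int p - h\<bar> < int p"
    proof -
      have "(y + h) mod int p \<ge> 0" "(y + h) mod int p < int p"
        using odd_pos[OF assms] by auto
      moreover have "2 * \<bar>x - h\<bar> < int p" if "0 \<le> x" "x < int p" for x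
      proof -
        have "x \<le> 2 * h" using that h by linarith
        then show ?thesis using that h by (auto simp: abs_if)
      qed
      ultimately show ?thesis by blast
    qed
    ultimately show ?thesis using odd_pos[OF assms] by (intro abs_least_residue_eqI) auto
  qed
  show "[abs_least_residue p (of_int y) = y] (mod int p)"
    unfolding * by (simp add: Cong.cong_def mod_diff_left_eq)
  show "abs_least_residue p (of_int y) = abs_least_residue p (of_int z) \<longleftrightarrow> [y = z] (mod int p)"
    unfolding * by (simp add: Cong.cong_def[symmetric] cong_add_rcancel)
qed

section \<open>Powers of a primitive root and the permutation of squares\<close>

lemma primroot_exponent:
  fixes g :: int
  assumes p: "prime p" and g: "residue_primroot p (nat (g mod int p))" and a: "\<not> int p dvd a"
  obtains k where "k \<ge> 1" "[a = g ^ k] (mod int p)"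
proof -
  define \<gamma> where "\<gamma> = nat (g mod int p)"
  have pp: "p > 1" using p prime_gt_1_nat by blast
  then have \<gamma>: "int \<gamma> = g mod int p" unfolding \<gamma>_def by simp
  define b where "b = nat (a mod int p)"
  have b: "int b = a mod int p" unfolding b_def using pp by simp
  have "0 < b" "b < p"
    using a pp unfolding b_def by (auto simp: dvd_eq_mod_eq_0 zero_less_nat_eq nat_less_iff order_neq_le_trans)
  then have "b \<in> totatives p" using totatives_prime[OF p] by auto
  moreover have "(\<lambda>i. \<gamma> ^ i mod p) ` {..<totient p} = totatives p"
    using residue_primroot_is_generator[OF pp g[folded \<gamma>_def]] by (simp add: bij_betw_def)
  ultimately have "b \<in> (\<lambda>i. \<gamma> ^ i mod p) ` {..<totient p}" by simp
  then obtain i where i: "b = \<gamma> ^ i mod p" by auto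
  \<comment> \<open>Adding the period \<open>p - 1\<close> makes the exponent positive, as the later
    reduction to the indices \<open>1, ..., n\<close> requires.\<close>
  have "[\<gamma> ^ (p - 1) = 1] (mod p)"
    using g fermat_theorem[OF p] pp unfolding \<gamma>_def[symmetric] residue_primroot_def
    by (metis coprime_absorb_left coprime_commute nat_dvd_1_iff_1 not_less_iff_gr_or_eq)
  then have "[\<gamma> ^ i * \<gamma> ^ (p - 1) = \<gamma> ^ i * 1] (mod p)" by (rule cong_mult[OF cong_refl])
  then have "[\<gamma> ^ (i + (p - 1)) = b] (mod p)" using i by (simp add: Cong.cong_def power_add)
  then have "[int b = int \<gamma> ^ (i + (p - 1))] (mod int p)" by (metis cong_int_iff cong_sym of_nat_power)
  moreover have "[int \<gamma> ^ (i + (p - 1)) = g ^ (i + (p - 1))] (mod int p)"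
    by (rule cong_pow) (simp add: \<gamma>)
  moreover have "[a = int b] (mod int p)" by (simp add: b)
  ultimately have "[a = g ^ (i + (p - 1))] (mod int p)" by (meson cong_trans)
  then show ?thesis using pp by (intro that[of "i + (p - 1)"]) auto
qed

lemma primroot_pow_eq_1:
  fixes g :: int
  assumes p: "prime p" and g: "residue_primroot p (nat (g mod int p))"
  shows "[g ^ k = 1] (mod int p) \<longleftrightarrow> (p - 1) dvd k"
proof -
  define \<gamma> where "\<gamma> = nat (g mod int p)"
  have pp: "p > 1" using p prime_gt_1_nat by blast
  then have \<gamma>: "int \<gamma> = g mod int p" unfolding \<gamma>_def by simp
  have "[g ^ k = int \<gamma> ^ k] (mod int p)" by (rule cong_pow) (simp add: \<gamma>)
  then have "[g ^ k = 1] (mod int p) \<longleftrightarrow> [int (\<gamma> ^ k) = int 1] (mod int p)"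
    by (metis cong_sym cong_trans of_nat_1 of_nat_power)
  also have "\<dots> \<longleftrightarrow> [\<gamma> ^ k = 1] (mod p)" by (rule cong_int_iff)
  also have "\<dots> \<longleftrightarrow> ord p \<gamma> dvd k" by (rule ord_divides)
  also have "ord p \<gamma> = p - 1"
    using g p unfolding \<gamma>_def[symmetric] by (simp add: residue_primroot_def totient_prime)
  finally show ?thesis .
qed

lemma primroot_cop:
  fixes g :: int
  assumes p: "prime p" and g: "residue_primroot p (nat (g mod int p))"
  shows "coprime g (int p)"
proof -
  have "[g ^ (p - 1) = 1] (mod int p)" using primroot_pow_eq_1[OF assms] by simp
  then have "coprime (g ^ (p - 1)) (int p)" by (metis cong_imp_coprime cong_sym coprime_1_left)
  then show ?thesis using prime_gt_1_nat[OF p] by (simp add: coprime_power_left_iff)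
qed

lemma primroot_pow_inj:
  fixes g :: int
  assumes p: "prime p" "p = 2 * n + 1" and g: "residue_primroot p (nat (g mod int p))"
    and ij: "i \<in> {1..n}" "j \<in> {1..n}" "[g ^ (2 * i) = g ^ (2 * j)] (mod int p)"
  shows "i = j"
  using ij
proof (induction i j rule: linorder_wlog)
  case (le i j)
  have "g ^ (2 * j) = g ^ (2 * i) * g ^ (2 * (j - i))"
    unfolding power_add[symmetric] using le by (intro arg_cong[where f = "(^) g"]) auto
  then have "[g ^ (2 * i) * g ^ (2 * (j - i)) = g ^ (2 * i) * 1] (mod int p)"
    using le(4) by (simp add: cong_sym)
  moreover have "coprime (g ^ (2 * i)) (int p)" using primroot_cop[OF p(1) g] by simp
  ultimately have "[g ^ (2 * (j - i)) = 1] (mod int p)" by (metis cong_mult_lcancel)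
  then have "p - 1 dvd 2 * (j - i)" using primroot_pow_eq_1[OF p(1) g] by blast
  then have "n dvd j - i" using p(2) by simp
  then show ?case using le by (cases "j - i = 0") (auto dest: dvd_imp_le)
next
  case (sym i j)
  then show ?case by (metis cong_sym)
qed

text \<open>The definite description in \<open>relating_perm\<close> needs a unique witness: every
  \<open>i \<le> n\<close> is a power of \<open>g\<close>, its square is an even power whose
  exponent can be reduced modulo \<open>p - 1 = 2 n\<close>, and different indices give incongruent
  squares as well as incongruent even powers.\<close>

lemma sigma02_permutes:
  fixes g :: int
  assumes p: "prime p" "p = 2 * n + 1" and g: "residue_primroot p (nat (g mod int p))"
  shows "sigma02 p g permutes {1..n}"
    and "i \<in> {1..n} \<Longrightarrow> [(int i)\<^sup>2 = g ^ (2 * sigma02 p g i)] (mod int p)"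
proof -
  have odd: "odd p" using p by simp
  have n: "(p - 1) div 2 = n" using p by simp
  have n1: "n \<ge> 1" using p prime_gt_1_nat[OF p(1)] by (cases n) auto
  have rel: "seq_A0 p i = seq_A2 p g j \<longleftrightarrow> [(int i)\<^sup>2 = g ^ (2 * j)] (mod int p)" for i j
    using abs_least_residue_of_int(2)[OF odd, of "(int i)\<^sup>2" "g ^ (2 * j)"]
    by (simp add: seq_A0_def seq_A2_def)
  have ex: "\<exists>j\<in>{1..n}. [(int i)\<^sup>2 = g ^ (2 * j)] (mod int p)" if i: "i \<in> {1..n}" for i
  proof -
    have "\<not> int p dvd int i" using i p(2) by (auto dest: zdvd_imp_le)
    then obtain k where k: "k \<ge> 1" "[int i = g ^ k] (mod int p)"
      using primroot_exponent[OF p(1) g] by blast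
    \<comment> \<open>Reduction modulo \<open>n\<close> into the range \<open>1, ..., n\<close>
      instead of \<open>0, ..., n - 1\<close>, since the sequences are indexed from 1.\<close>
    define j where "j = (k - 1) mod n + 1"
    have kj: "k = j + n * ((k - 1) div n)" unfolding j_def using k(1)
      by (metis add.assoc add.commute le_add_diff_inverse2 mod_mult_div_eq)
    have "[g ^ (p - 1) = 1] (mod int p)" using primroot_pow_eq_1[OF p(1) g] by simp
    then have one: "[(g ^ (2 * n)) ^ ((k - 1) div n) = 1 ^ ((k - 1) div n)] (mod int p)"
      using p(2) by (intro cong_pow) simp
    have "[(int i)\<^sup>2 = (g ^ k) ^ 2] (mod int p)" by (rule cong_pow[OF k(2)])
    also have "(g ^ k) ^ 2 = g ^ (2 * j) * (g ^ (2 * n)) ^ ((k - 1) div n)"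
      by (subst kj) (simp add: power_add power_mult[symmetric] algebra_simps)
    also have "[\<dots> = g ^ (2 * j) * 1 ^ ((k - 1) div n)] (mod int p)"
      by (rule cong_mult[OF cong_refl one])
    finally have "[(int i)\<^sup>2 = g ^ (2 * j)] (mod int p)" by simp
    moreover have "j \<in> {1..n}" unfolding j_def using n1 by (simp add: Suc_le_eq)
    ultimately show ?thesis by blast
  qed
  define f where "f = (\<lambda>i. if i \<in> {1..n} then SOME j. j \<in> {1..n} \<and> [(int i)\<^sup>2 = g ^ (2 * j)] (mod int p) else i)"
  have f: "f i \<in> {1..n} \<and> [(int i)\<^sup>2 = g ^ (2 * f i)] (mod int p)" if "i \<in> {1..n}" for i
    unfolding f_def using that ex[OF that] by (auto intro: someI2_bex simp: Bex_def intro!: someI_ex)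
  have inj: "inj_on f {1..n}"
  proof (rule inj_onI)
    fix i j assume ij: "i \<in> {1..n}" "j \<in> {1..n}" "f i = f j"
    then have "[(int i)\<^sup>2 = (int j)\<^sup>2] (mod int p)" using f[of i] f[of j] by (metis cong_sym cong_trans)
    then have "int p dvd (int i - int j) * (int i + int j)"
      by (simp add: cong_iff_dvd_diff power2_eq_square algebra_simps)
    then have "int p dvd int i - int j \<or> int p dvd int i + int j"
      using p(1) by (simp add: prime_dvd_mult_iff)
    moreover have "\<not> int p dvd int i + int j" using ij p(2) by (auto dest: zdvd_imp_le)
    ultimately have "int p dvd int i - int j" by blast
    then show "i = j" using ij p(2) dvd_imp_le_int[of "int i - int j" "int p"] by fastforce
  qed
  have perm: "f permutes {1..n}"
  proof (rule bij_imp_permutes)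
    have "f ` {1..n} = {1..n}" by (rule endo_inj_surj[OF _ _ inj]) (use f in blast)+
    then show "bij_betw f {1..n} {1..n}" using inj by (simp add: bij_betw_def)
  next
    show "f x = x" if "x \<notin> {1..n}" for x using that by (simp only: f_def if_False)
  qed
  have the: "sigma02 p g = f"
    unfolding sigma02_def relating_perm_def n
  proof (rule the_equality)
    show "f permutes {1..n} \<and> (\<forall>i\<in>{1..n}. seq_A0 p i = seq_A2 p g (f i))"
      using perm f by (auto simp: rel)
    fix \<pi> assume \<pi>: "\<pi> permutes {1..n} \<and> (\<forall>i\<in>{1..n}. seq_A0 p i = seq_A2 p g (\<pi> i))"
    show "\<pi> = f"
    proof
      fix i show "\<pi> i = f i"
      proof (cases "i \<in> {1..n}")
        case True
        then have "[g ^ (2 * \<pi> i) = g ^ (2 * f i)] (mod int p)"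
          using \<pi> f[OF True] rel by (metis cong_sym cong_trans)
        moreover have "\<pi> i \<in> {1..n}" using \<pi> True by (metis permutes_in_image)
        ultimately show ?thesis using primroot_pow_inj[OF p g] f[OF True] by blast
      next
        case False
        then show ?thesis using \<pi> perm by (metis permutes_not_in)
      qed
    qed
  qed
  show "sigma02 p g permutes {1..n}" unfolding the by (rule perm)
  show "i \<in> {1..n} \<Longrightarrow> [(int i)\<^sup>2 = g ^ (2 * sigma02 p g i)] (mod int p)" unfolding the using f by blast
qed

lemma primroot_half:
  fixes g :: int
  assumes p: "prime p" "p = 2 * n + 1" and g: "residue_primroot p (nat (g mod int p))"
  shows "[g ^ n = - 1] (mod int p)"
proof -
  have n1: "n \<ge> 1" using p prime_gt_1_nat[OF p(1)] by (cases n) auto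
  have "[g ^ (p - 1) = 1] (mod int p)" using primroot_pow_eq_1[OF p(1) g] by simp
  then have "int p dvd (g ^ n - 1) * (g ^ n + 1)"
    using p(2) by (simp add: cong_iff_dvd_diff algebra_simps power_add[symmetric] mult_2[symmetric])
  then have "int p dvd g ^ n - 1 \<or> int p dvd g ^ n + 1" using p(1) by (simp add: prime_dvd_mult_iff)
  moreover have "\<not> [g ^ n = 1] (mod int p)"
    using primroot_pow_eq_1[OF p(1) g, of n] p(2) n1 by (auto dest: dvd_imp_le)
  ultimately show ?thesis by (simp add: cong_iff_dvd_diff)
qed

text \<open>With \<open>w = g ^ 2\<close> the second sequence is \<open>w, w ^ 2, ...\<close>, and
  the sign times its Vandermonde product is that of the squares. Multiplying by \<open>n!\<close>
  removes the product of the squares, whose inverse modulo \<open>p\<close> it is.\<close>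

lemma sign_sigma02_cong:
  fixes g :: int
  assumes p: "prime p" "p = 2 * n + 1" "n = 2 * m" and g: "residue_primroot p (nat (g mod int p))"
  shows "[sign (sigma02 p g) = int n ^ m * g ^ (6 * m ^ 3 - m\<^sup>2 - m) * fact n] (mod int p)"
proof -
  note perm = sigma02_permutes[OF p(1,2) g]
  let ?s = "sigma02 p g"
  define w where "w = g\<^sup>2"
  have rel: "[(int i)\<^sup>2 = w ^ ?s i] (mod int p)" if "i \<in> {1..n}" for i
    using perm(2)[OF that] unfolding w_def by (simp add: power_mult)
  have wm: "[w ^ m = - 1] (mod int p)"
    using primroot_half[OF p(1,2) g] p(3) by (simp add: w_def power_mult)
  have nt: "\<not> [w ^ i = 1] (mod int p)" if "i \<in> {1..<n}" for i
    unfolding w_def power_mult[symmetric] primroot_pow_eq_1[OF p(1) g]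
    using that p(2) by (auto dest: dvd_imp_le)
  have V: "[vdm {1..n} (\<lambda>i. w ^ i) = int n ^ m * w ^ ((6 * m ^ 3 - m\<^sup>2 - m) div 2)] (mod int p)"
    by (rule vdm_powers_mod[OF p prod_one_minus_powers[OF p perm(1) rel nt] wm])
  have "even (6 * m ^ 3 - (m\<^sup>2 + m))" by (rule dvd_diff_nat) auto
  then have "w ^ ((6 * m ^ 3 - m\<^sup>2 - m) div 2) = g ^ (6 * m ^ 3 - m\<^sup>2 - m)"
    unfolding w_def by (simp flip: power_mult add: diff_diff_left)
  note V = V[unfolded this]
  have "[of_int (sign ?s) * vdm {1..n} (\<lambda>i. w ^ i) = vdm {1..n} (\<lambda>i. (int i)\<^sup>2)] (mod int p)"
    unfolding vdm_permute[OF perm(1), symmetric] o_def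
    by (intro cong_vdm cong_sym[OF rel]) auto
  then have "[vdm {1..n} (\<lambda>i. w ^ i) = sign ?s * vdm {1..n} (\<lambda>i. (int i)\<^sup>2)] (mod int p)"
    by (rule sign_cong_mult)
  then have "[vdm {1..n} (\<lambda>i. w ^ i) * fact n = sign ?s * vdm {1..n} (\<lambda>i. (int i)\<^sup>2) * fact n] (mod int p)"
    by (rule cong_mult[OF _ cong_refl])
  also have "sign ?s * vdm {1..n} (\<lambda>i. (int i)\<^sup>2) * fact n = sign ?s * (vdm {1..n} (\<lambda>i. (int i)\<^sup>2) * fact n)"
    by simp
  also have "[\<dots> = sign ?s * 1] (mod int p)"
    by (intro cong_mult cong_refl vdm_squares_mod[OF p])
  finally show ?thesis using cong_mult[OF V cong_refl[of "fact n"]]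
    by (simp add: Cong.cong_def)
qed

subsection \<open>Gaussian binomials\<close>

text \<open>The Gaussian binomial coefficient, introduced by its Pascal rule rather than as a
  quotient, so that it makes sense for every \<open>q\<close> in a commutative ring, roots of unity
  included.\<close>

fun qbinomial :: "'a::comm_ring_1 \<Rightarrow> nat \<Rightarrow> nat \<Rightarrow> 'a" where
  "qbinomial q m 0 = 1"
| "qbinomial q 0 (Suc k) = 0"
| "qbinomial q (Suc m) (Suc k) = qbinomial q m k + q ^ Suc k * qbinomial q m (Suc k)"

lemma qbinomial_eq_0: "m < k \<Longrightarrow> qbinomial q m k = 0"
  by (induction q m k rule: qbinomial.induct) auto

text \<open>The mirror image of the defining Pascal rule. Eliminating one term between the two rules
  gives the absorption identity.\<close>

lemma qbinomial_Suc': "k \<le> m \<Longrightarrow> qbinomial q (Suc m) (Suc k) = q ^ (m - k) * qbinomial q m k + qbinomial q m (Suc k)"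
proof (induction m arbitrary: k)
  case 0
  then show ?case by simp
next
  case (Suc m)
  show ?case
  proof (cases k)
    case 0
    then show ?thesis using Suc.IH[of 0] by (cases m) (auto simp: algebra_simps)
  next
    case (Suc j)
    then have j: "j \<le> m" using Suc.prems by simp
    have IH1: "qbinomial q (Suc m) (Suc j) = q ^ (m - j) * qbinomial q m j + qbinomial q m (Suc j)"
      by (rule Suc.IH[OF j])
    show ?thesis
    proof (cases "j = m")
      case True
      then show ?thesis using Suc IH1 by (simp add: qbinomial_eq_0)
    next
      case False
      with j have jm: "Suc j \<le> m" by simp
      have IH2: "qbinomial q (Suc m) (Suc (Suc j)) = q ^ (m - Suc j) * qbinomial q m (Suc j) + qbinomial q m (Suc (Suc j))"
        by (rule Suc.IH[OF jm])
      have e: "q ^ Suc (Suc j) * q ^ (m - Suc j) = q ^ (m - j) * q ^ Suc j"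
        unfolding power_add[symmetric] using jm by (intro arg_cong[where f = "(^) q"]) auto
      have "qbinomial q (Suc (Suc m)) (Suc (Suc j)) =
          (q ^ (m - j) * qbinomial q m j + qbinomial q m (Suc j)) +
          (q ^ Suc (Suc j) * q ^ (m - Suc j)) * qbinomial q m (Suc j) + q ^ Suc (Suc j) * qbinomial q m (Suc (Suc j))"
        using qbinomial.simps(3)[of q "Suc m" "Suc j"] IH1 IH2 by (simp add: algebra_simps)
      also have "\<dots> = q ^ (m - j) * (qbinomial q m j + q ^ Suc j * qbinomial q m (Suc j)) +
          (qbinomial q m (Suc j) + q ^ Suc (Suc j) * qbinomial q m (Suc (Suc j)))"
        unfolding e by (simp add: algebra_simps)
      finally show ?thesis using Suc by simp
    qed
  qed
qed

lemma qbinomial_absorb: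
  "(1 - q ^ Suc k) * qbinomial q (Suc m) (Suc k) = (1 - q ^ Suc m) * qbinomial q m k"
proof (cases "k \<le> m")
  case True
  have e: "q ^ Suc k * q ^ (m - k) = q ^ Suc m"
    unfolding power_add[symmetric] using True by (intro arg_cong[where f = "(^) q"]) auto
  have "(1 - q ^ Suc k) * qbinomial q (Suc m) (Suc k) =
      (qbinomial q m k + q ^ Suc k * qbinomial q m (Suc k)) -
      q ^ Suc k * (q ^ (m - k) * qbinomial q m k + qbinomial q m (Suc k))"
    using qbinomial_Suc'[OF True, of q] qbinomial.simps(3)[of q m k] by (simp add: left_diff_distrib)
  also have "\<dots> = (1 - q ^ Suc k * q ^ (m - k)) * qbinomial q m k"
    by (simp add: algebra_simps)
  finally show ?thesis by (simp only: e)
qed (simp add: qbinomial_eq_0)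

text \<open>Splitting each coefficient by the Pascal rule and shifting one of the sums leaves the
  terms \<open>(1 - q ^ Suc k) * ?b (Suc k)\<close>, to which absorption applies. This is Gauss's
  recursion for his alternating sums; it advances the upper index by two.\<close>

lemma sum_qbinomial_Suc_Suc:
  "(\<Sum>k\<le>m+2. (- 1) ^ k * qbinomial q (m + 2) k) = (1 - q ^ Suc m) * (\<Sum>k\<le>m. (- 1) ^ k * qbinomial q m k)"
proof -
  let ?b = "qbinomial q (Suc m)"
  have "(\<Sum>k\<le>Suc (Suc m). (- 1) ^ k * qbinomial q (Suc (Suc m)) k) =
      1 + (\<Sum>k\<le>Suc m. - ((- 1) ^ k * (?b k + q ^ Suc k * ?b (Suc k))))"
    by (subst sum.atMost_Suc_shift) simp
  also have "\<dots> = 1 - (\<Sum>k\<le>Suc m. (- 1) ^ k * ?b k) - (\<Sum>k\<le>Suc m. (- 1) ^ k * (q ^ Suc k * ?b (Suc k)))"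
    by (simp only: sum_negf distrib_left sum.distrib) (simp only: diff_conv_add_uminus minus_add_distrib add.assoc)
  also have "(\<Sum>k\<le>Suc m. (- 1) ^ k * ?b k) = 1 - (\<Sum>k\<le>m. (- 1) ^ k * ?b (Suc k))"
    by (subst sum.atMost_Suc_shift) (simp add: sum_negf)
  also have "(\<Sum>k\<le>Suc m. (- 1) ^ k * (q ^ Suc k * ?b (Suc k))) = (\<Sum>k\<le>m. (- 1) ^ k * (q ^ Suc k * ?b (Suc k)))"
    by (simp add: qbinomial_eq_0)
  also have "1 - (1 - (\<Sum>k\<le>m. (- 1) ^ k * ?b (Suc k))) - (\<Sum>k\<le>m. (- 1) ^ k * (q ^ Suc k * ?b (Suc k))) =
      (\<Sum>k\<le>m. (- 1) ^ k * ((1 - q ^ Suc k) * ?b (Suc k)))"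
    by (simp add: sum_subtractf[symmetric] algebra_simps del: qbinomial.simps)
  also have "\<dots> = (\<Sum>k\<le>m. (- 1) ^ k * ((1 - q ^ Suc m) * qbinomial q m k))"
    by (simp only: qbinomial_absorb)
  also have "\<dots> = (1 - q ^ Suc m) * (\<Sum>k\<le>m. (- 1) ^ k * qbinomial q m k)"
    by (simp add: sum_distrib_left mult_ac)
  finally show ?thesis by simp
qed

lemma sum_qbinomial_even:
  "(\<Sum>k\<le>2*j. (- 1) ^ k * qbinomial q (2 * j) k) = (\<Prod>i<j. 1 - q ^ (2 * i + 1))"
proof (induction j)
  case (Suc j)
  have "2 * Suc j = 2 * j + 2" by simp
  then show ?case using sum_qbinomial_Suc_Suc[where m = "2 * j" and q = q] Suc
    by (simp only: prod.lessThan_Suc) (simp add: mult.commute del: qbinomial.simps)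
qed simp

text \<open>At a primitive \<open>p\<close>-th root of unity absorption makes
  \<open>qbinomial q p (Suc k)\<close> vanish for \<open>Suc k < p\<close>, so the Pascal rule
  becomes a first-order recursion in \<open>k\<close> for the upper index
  \<open>p - 1\<close>.\<close>

lemma qbinomial_root_of_unity:
  fixes q :: "'a::field"
  assumes "q ^ p = 1" "\<And>k. 0 < k \<Longrightarrow> k < p \<Longrightarrow> q ^ k \<noteq> 1" "k < p"
  shows "qbinomial q (p - 1) k = (- 1) ^ k * inverse q ^ (k * (k + 1) div 2)"
  using assms(3)
proof (induction k)
  case (Suc k)
  have q0: "q \<noteq> 0" using assms(1) Suc.prems by (metis gr_implies_not0 one_neq_zero power_0_left)
  have p: "p = Suc (p - 1)" using Suc.prems by simp
  have "(1 - q ^ Suc k) * qbinomial q p (Suc k) = (1 - q ^ p) * qbinomial q (p - 1) k"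
    by (subst (1 2) p) (rule qbinomial_absorb)
  then have "(1 - q ^ Suc k) * qbinomial q p (Suc k) = 0" using assms(1) by simp
  then have "qbinomial q p (Suc k) = 0" using assms(2)[of "Suc k"] Suc.prems
    by (auto simp del: power_Suc)
  then have "qbinomial q (p - 1) k + q ^ Suc k * qbinomial q (p - 1) (Suc k) = 0"
    by (subst (asm) p) simp
  then have "q ^ Suc k * qbinomial q (p - 1) (Suc k) = - ((- 1) ^ k * inverse q ^ (k * (k + 1) div 2))"
    using Suc by (simp add: eq_neg_iff_add_eq_0 add.commute)
  then have "qbinomial q (p - 1) (Suc k) = (- 1) ^ Suc k * (inverse q ^ (k * (k + 1) div 2) * inverse q ^ Suc k)"
    using q0 by (simp add: field_simps)
  also have "inverse q ^ (k * (k + 1) div 2) * inverse q ^ Suc k = inverse q ^ (Suc k * (Suc k + 1) div 2)"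
  proof -
    have "Suc k * (Suc k + 1) = k * (k + 1) + 2 * Suc k" by simp
    then have "Suc k * (Suc k + 1) div 2 = k * (k + 1) div 2 + Suc k" by simp
    then show ?thesis by (simp only: power_add)
  qed
  finally show ?case .
qed simp

subsection \<open>Integer polynomial functions at a root of unity\<close>

text \<open>Polynomials with integer coefficients as functions given by a list of monomials.
  Repeated exponents are allowed, so that sums, products and the substitution of a power of
  \<open>x\<close> are plain list operations.\<close>

definition int_poly_fun :: "(complex \<Rightarrow> complex) \<Rightarrow> bool" where
  "int_poly_fun F \<longleftrightarrow> (\<exists>l :: (int \<times> nat) list. \<forall>x. F x = (\<Sum>(c,e)\<leftarrow>l. of_int c * x ^ e))"

lemma int_poly_fun_const: "int_poly_fun (\<lambda>x. of_int c)"
  unfolding int_poly_fun_def by (rule exI[of _ "[(c, 0)]"]) simp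

lemma int_poly_fun_power: "int_poly_fun (\<lambda>x. x ^ e)"
  unfolding int_poly_fun_def by (rule exI[of _ "[(1, e)]"]) simp

lemma int_poly_fun_add:
  assumes "int_poly_fun F" "int_poly_fun G"
  shows "int_poly_fun (\<lambda>x. F x + G x)"
proof -
  obtain l l' where "\<forall>x. F x = (\<Sum>(c,e)\<leftarrow>l. of_int c * x ^ e)" "\<forall>x. G x = (\<Sum>(c,e)\<leftarrow>l'. of_int c * x ^ e)"
    using assms unfolding int_poly_fun_def by blast
  then show ?thesis unfolding int_poly_fun_def by (intro exI[of _ "l @ l'"]) simp
qed

lemma int_poly_fun_mult:
  assumes "int_poly_fun F" "int_poly_fun G"
  shows "int_poly_fun (\<lambda>x. F x * G x)"
proof -
  obtain l l' where l: "\<forall>x. F x = (\<Sum>(c,e)\<leftarrow>l. of_int c * x ^ e)" "\<forall>x. G x = (\<Sum>(c,e)\<leftarrow>l'. of_int c * x ^ e)"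
    using assms unfolding int_poly_fun_def by blast
  have 1: "(of_int c :: complex) * x ^ e * (\<Sum>(c,e)\<leftarrow>l'. of_int c * x ^ e) =
      (\<Sum>(c,e)\<leftarrow>map (\<lambda>(c',e'). (c * c', e + e')) l'. of_int c * x ^ e)" for c x e
    by (induction l') (auto simp: algebra_simps power_add)
  have "F x * G x = (\<Sum>(c,e)\<leftarrow>concat (map (\<lambda>(c,e). map (\<lambda>(c',e'). (c * c', e + e')) l') l). of_int c * x ^ e)" for x
    unfolding l(1)[rule_format] l(2)[rule_format]
  proof (induction l)
    case (Cons a l)
    then show ?case using 1[of "fst a" x "snd a"] by (auto simp: distrib_right case_prod_unfold)
  qed simp
  then show ?thesis unfolding int_poly_fun_def by blast
qed

lemma int_poly_fun_pow: "int_poly_fun F \<Longrightarrow> int_poly_fun (\<lambda>x. F x ^ k)"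
  by (induction k) (use int_poly_fun_const[of 1] in \<open>auto intro: int_poly_fun_mult\<close>)

lemma int_poly_fun_sum: "(\<And>i. i \<in> A \<Longrightarrow> int_poly_fun (F i)) \<Longrightarrow> int_poly_fun (\<lambda>x. \<Sum>i\<in>A. F i x)"
  by (induction A rule: infinite_finite_induct)
    (use int_poly_fun_const[of 0] in \<open>auto intro: int_poly_fun_add\<close>)

lemma int_poly_fun_prod: "(\<And>i. i \<in> A \<Longrightarrow> int_poly_fun (F i)) \<Longrightarrow> int_poly_fun (\<lambda>x. \<Prod>i\<in>A. F i x)"
  by (induction A rule: infinite_finite_induct)
    (use int_poly_fun_const[of 1] in \<open>auto intro: int_poly_fun_mult\<close>)

lemma int_poly_fun_subst_power:
  assumes "int_poly_fun F"
  shows "int_poly_fun (\<lambda>x. F (x ^ k))"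
proof -
  obtain l where l: "\<forall>x. F x = (\<Sum>(c,e)\<leftarrow>l. of_int c * x ^ e)"
    using assms unfolding int_poly_fun_def by blast
  have "(\<Sum>(c,e)\<leftarrow>l. of_int c * (x ^ k) ^ e) = (\<Sum>(c,e)\<leftarrow>map (\<lambda>(c,e). (c, k * e)) l. of_int c * x ^ e)" for x :: complex
    by (induction l) (auto simp: power_mult)
  then show ?thesis unfolding int_poly_fun_def using l by (intro exI[of _ "map (\<lambda>(c,e). (c, k * e)) l"]) simp
qed

definition zeta :: "nat \<Rightarrow> complex" where "zeta p = cis (2 * pi / real p)"

lemma zeta_pow: "zeta p ^ k = cis (2 * pi * real k / real p)"
  unfolding zeta_def Complex.DeMoivre by (simp add: field_simps)

lemma zeta_pow_self [simp]: "p > 0 \<Longrightarrow> zeta p ^ p = 1"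
  by (simp add: zeta_pow)

lemma zeta_pow_eq_1_iff: "p > 0 \<Longrightarrow> zeta p ^ k = 1 \<longleftrightarrow> p dvd k"
proof
  assume p: "p > 0" and "zeta p ^ k = 1"
  then have "cos (2 * pi * real k / real p) = 1" by (simp add: zeta_pow complex_eq_iff)
  then obtain j :: int where "2 * pi * real k / real p = of_int j * 2 * pi" using cos_one_2pi_int by blast
  then have "real k = of_int j * real p" using p by (simp add: field_simps)
  then have "real_of_int (int k) = real_of_int (j * int p)" by simp
  then have "int k = j * int p" by (simp only: of_int_eq_iff)
  then show "p dvd k" by (metis dvd_triv_right int_dvd_int_iff)
next
  assume "p > 0" "p dvd k"
  then show "zeta p ^ k = 1" by (auto simp: power_mult)
qed

lemma sum_zeta_pow:
  assumes "p > 0"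
  shows "(\<Sum>k<p. (zeta p ^ k) ^ e) = (if p dvd e then of_nat p else 0)"
proof (cases "p dvd e")
  case True
  have "(zeta p ^ k) ^ e = 1" for k
    using True assms by (simp add: power_mult[symmetric] zeta_pow_eq_1_iff)
  then show ?thesis using True by simp
next
  case False
  have "(\<Sum>k<p. (zeta p ^ k) ^ e) = (\<Sum>k<p. (zeta p ^ e) ^ k)"
    by (simp add: power_mult[symmetric] mult.commute)
  moreover have "(\<Sum>k<p. (zeta p ^ e) ^ k) = ((zeta p ^ e) ^ p - 1) / (zeta p ^ e - 1)"
    using False assms by (intro geometric_sum) (simp add: zeta_pow_eq_1_iff)
  moreover have "(zeta p ^ e) ^ p = 1" using assms by (simp add: power_mult[symmetric] zeta_pow_eq_1_iff)
  ultimately show ?thesis using False by simp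
qed

text \<open>Orthogonality: only monomials with exponent divisible by \<open>p\<close> survive the
  sum over all \<open>p\<close>-th roots of unity, each with the factor \<open>p\<close>.\<close>

lemma sum_over_roots_int_poly_fun:
  assumes "int_poly_fun F" "p > 0"
  shows "\<exists>N :: int. (\<Sum>k<p. F (zeta p ^ k)) = of_int (int p * N)"
proof -
  obtain l where l: "\<forall>x. F x = (\<Sum>(c,e)\<leftarrow>l. of_int c * x ^ e)"
    using assms unfolding int_poly_fun_def by blast
  have "(\<Sum>k<p. \<Sum>(c,e)\<leftarrow>l. of_int c * (zeta p ^ k) ^ e) =
      of_int (int p * (\<Sum>(c,e)\<leftarrow>l. if p dvd e then c else 0))"
  proof (induction l)
    case (Cons a l)
    have "(\<Sum>k<p. of_int (fst a) * (zeta p ^ k) ^ snd a) = of_int (int p * (if p dvd snd a then fst a else 0))"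
      by (simp add: sum_distrib_left[symmetric] sum_zeta_pow[OF assms(2)])
    then show ?case using Cons by (simp add: sum.distrib case_prod_unfold algebra_simps)
  qed simp
  then show ?thesis using l by auto
qed

text \<open>The product of the conjugates \<open>F (x ^ j)\<close> vanishes at all nontrivial roots of unity, so its
  value at 1 is the sum over all roots of unity, a multiple of p.\<close>

lemma int_poly_fun_root_imp_dvd:
  assumes "prime p" "int_poly_fun F" "F (zeta p) = 0" "F 1 = of_int N"
  shows "int p dvd N"
proof -
  have p: "p > 0" using assms(1) prime_gt_0_nat by blast
  define H where "H = (\<lambda>x. \<Prod>j=1..<p. F (x ^ j))"
  have H: "int_poly_fun H" unfolding H_def
    by (intro int_poly_fun_prod int_poly_fun_subst_power assms)
  have "H (zeta p ^ k) = 0" if "k \<in> {..<p} - {0}" for k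
  proof -
    have "coprime k p" using that assms(1)
      by (metis DiffD1 DiffD2 coprime_commute gr0I insertI1 lessThan_iff nat_dvd_not_less prime_imp_coprime)
    \<comment> \<open>\<open>j\<close> inverts \<open>k\<close> modulo \<open>p\<close>, so the
      factor of index \<open>j mod p\<close> takes \<open>zeta p ^ k\<close> back to
      \<open>zeta p\<close>, a zero of \<open>F\<close>.\<close>
    then obtain j where j: "[k * j = 1] (mod p)" using cong_solve_coprime_nat[of k p] by auto
    have "j mod p \<in> {1..<p}"
    proof -
      have "j mod p \<noteq> 0"
      proof
        assume "j mod p = 0"
        then have "k * j mod p = 0" by auto
        then show False using j assms(1) prime_gt_1_nat by (auto simp: Cong.cong_def)
      qed
      then show ?thesis using p by auto
    qed
    moreover have "(zeta p ^ k) ^ (j mod p) = zeta p"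
    proof -
      have "k * (j mod p) mod p = 1"
        using j prime_gt_1_nat[OF assms(1)] by (simp add: Cong.cong_def mod_mult_right_eq)
      then have "k * (j mod p) = 1 + p * (k * (j mod p) div p)" by (metis mod_mult_div_eq)
      then have "(zeta p ^ k) ^ (j mod p) = zeta p ^ (1 + p * (k * (j mod p) div p))"
        by (metis power_mult)
      also have "\<dots> = zeta p" using p by (simp add: power_mult)
      finally show ?thesis .
    qed
    ultimately show ?thesis unfolding H_def using assms(3)
      by (intro prod_zero) (auto intro!: bexI[of _ "j mod p"])
  qed
  then have "(\<Sum>k<p. H (zeta p ^ k)) = H (zeta p ^ 0)"
    using p by (subst sum.remove[of _ 0]) auto
  also have "\<dots> = of_int (N ^ (p - 1))" by (simp add: H_def assms(4))
  finally obtain M where "(of_int (N ^ (p - 1)) :: complex) = of_int (int p * M)"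
    using sum_over_roots_int_poly_fun[OF H p] by auto
  then have "int p dvd N ^ (p - 1)" by (simp only: of_int_eq_iff) simp
  then show ?thesis using assms(1) by (metis prime_dvd_power_int prime_nat_int_transfer)
qed

subsection \<open>The quadratic character and its Gauss sum\<close>

locale prime_1_mod_4 =
  fixes p n m :: nat
  assumes prime_p: "prime p" and p_eq: "p = 2 * n + 1" and n_eq: "n = 2 * m"
begin

definition chi :: "int \<Rightarrow> int" where "chi a = Legendre a (int p)"

lemma p_gt_2: "p > 2" and p_pos: "p > 0" and m_pos: "m > 0" and odd_p: "odd p"
proof -
  show "m > 0" using p_eq n_eq prime_gt_1_nat[OF prime_p] by (cases m) auto
  then show "p > 2" using p_eq n_eq by auto
  then show "p > 0" by simp
  show "odd p" using p_eq by simp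
qed

lemma prime_int_p: "prime (int p)" using prime_p by simp

lemma chi_values: "chi a \<in> {- 1, 0, 1}"
  by (auto simp: chi_def Legendre_def)

lemma chi_cong: "[chi a = a ^ n] (mod int p)"
proof -
  have "(p - 1) div 2 = n" using p_eq by simp
  then show ?thesis using euler_criterion[OF prime_p, of a] p_gt_2 by (simp add: chi_def)
qed

text \<open>The three possible values are pairwise incongruent because \<open>p > 2\<close>;
  identities for \<open>chi\<close> thus follow from Euler's criterion modulo
  \<open>p\<close>.\<close>

lemma chi_eqI:
  assumes "[chi a = x] (mod int p)" "x \<in> {- 1, 0, 1}"
  shows "chi a = x"
proof -
  have "int p dvd chi a - x" using assms(1) by (simp add: cong_iff_dvd_diff)
  moreover have "\<bar>chi a - x\<bar> < int p" using chi_values[of a] assms(2) p_gt_2 by auto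
  ultimately show ?thesis using dvd_imp_le_int[of "chi a - x" "int p"] by fastforce
qed

lemma chi_mod: "[a = b] (mod int p) \<Longrightarrow> chi a = chi b"
  by (rule chi_eqI) (use chi_values[of b] in \<open>auto intro: cong_trans[OF chi_cong] cong_trans[OF cong_pow] cong_sym[OF chi_cong]\<close>)

lemma chi_mult: "chi (a * b) = chi a * chi b"
proof (rule chi_eqI)
  have "[chi (a * b) = a ^ n * b ^ n] (mod int p)" using chi_cong[of "a * b"] by (simp add: power_mult_distrib)
  also have "[a ^ n * b ^ n = chi a * chi b] (mod int p)" by (intro cong_mult cong_sym[OF chi_cong])
  finally show "[chi (a * b) = chi a * chi b] (mod int p)" .
qed (use chi_values[of a] chi_values[of b] in auto)

lemma chi_eq_0_iff: "chi a = 0 \<longleftrightarrow> int p dvd a"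
  by (auto simp: chi_def Legendre_def cong_0_iff)

lemma chi_0 [simp]: "chi 0 = 0" by (simp add: chi_eq_0_iff)

lemma chi_1 [simp]: "chi 1 = 1"
  by (rule chi_eqI) (use chi_cong[of 1] in auto)

lemma chi_minus: "chi (- a) = chi a"
proof -
  have "chi (- 1) = 1" by (rule chi_eqI) (use chi_cong[of "- 1"] n_eq in auto)
  then show ?thesis using chi_mult[of "- 1" a] by simp
qed

lemma chi_square: "\<not> int p dvd a \<Longrightarrow> chi a * chi a = 1"
  using chi_values[of a] chi_eq_0_iff[of a] by auto

lemma chi_eq_1_iff: "\<not> int p dvd a \<Longrightarrow> chi a = 1 \<longleftrightarrow> (\<exists>y. [y\<^sup>2 = a] (mod int p))"
  by (auto simp: chi_def Legendre_def cong_0_iff QuadRes_def)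

lemma card_square_roots:
  assumes "a \<in> {0..<int p}"
  shows "int (card {k \<in> {0..<int p}. k\<^sup>2 mod int p = a}) = 1 + chi a"
proof -
  have iff: "k\<^sup>2 mod int p = a \<longleftrightarrow> [k\<^sup>2 = a] (mod int p)" for k
    using assms by (simp add: Cong.cong_def)
  have "a = 0" if "chi a = 0"
    using that chi_eq_0_iff[of a] assms zdvd_imp_le[of "int p" a] by fastforce
  then consider "a = 0" | "a \<noteq> 0" "chi a = - 1" | "a \<noteq> 0" "chi a = 1"
    using chi_values[of a] by auto
  then show ?thesis
  proof cases
    case 1
    have "{k \<in> {0..<int p}. k\<^sup>2 mod int p = a} = {0}"
    proof safe
      fix k assume k: "k \<in> {0..<int p}" "a = k\<^sup>2 mod int p"
      then have "int p dvd k\<^sup>2" using 1 by (simp add: dvd_eq_mod_eq_0)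
      then have "int p dvd k" using prime_int_p by (metis prime_dvd_power_int)
      then show "k = 0" using k(1) by (auto dest: zdvd_imp_le)
    qed (use 1 p_pos in auto)
    then show ?thesis using 1 by simp
  next
    case 2
    then have "\<not> int p dvd a" using chi_eq_0_iff[of a] by simp
    then have "{k \<in> {0..<int p}. k\<^sup>2 mod int p = a} = {}"
      using chi_eq_1_iff[of a] 2 by (auto simp: iff)
    then have "card {k \<in> {0..<int p}. k\<^sup>2 mod int p = a} = 0" by (simp only: card.empty)
    then show ?thesis using 2 by simp
  next
    case 3
    then have na: "\<not> int p dvd a" using chi_eq_0_iff[of a] by simp
    then obtain y0 where y0: "[y0\<^sup>2 = a] (mod int p)" using chi_eq_1_iff[of a] 3 by auto
    define y where "y = y0 mod int p"
    have y: "[y\<^sup>2 = a] (mod int p)" "y \<in> {0..<int p}"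
      using y0 p_pos unfolding y_def by (auto simp: Cong.cong_def power_mod)
    have y0: "y \<noteq> 0" using y(1) na by (auto simp: Cong.cong_def dvd_eq_mod_eq_0)
    have "{k \<in> {0..<int p}. k\<^sup>2 mod int p = a} = {y, int p - y}"
    proof (intro equalityI subsetI)
      fix k assume "k \<in> {k \<in> {0..<int p}. k\<^sup>2 mod int p = a}"
      then have k: "k \<in> {0..<int p}" "[k\<^sup>2 = a] (mod int p)" by (auto simp: iff)
      then have "[k\<^sup>2 = y\<^sup>2] (mod int p)" using y(1) by (metis cong_sym cong_trans)
      then have "int p dvd (k - y) * (k + y)" by (simp add: cong_iff_dvd_diff power2_eq_square algebra_simps)
      then consider "int p dvd k - y" | "int p dvd k + y" using prime_int_p by (auto simp: prime_dvd_mult_iff)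
      then show "k \<in> {y, int p - y}"
      proof cases
        case 1
        then have "k = y" using k(1) y(2) dvd_imp_le_int[of "k - y" "int p"] by fastforce
        then show ?thesis by simp
      next
        case 2
        then have "int p dvd (k + y) - int p" by simp
        then have "k + y = int p" using k(1) y(2) y0 dvd_imp_le_int[of "k + y - int p" "int p"] by fastforce
        then show ?thesis by simp
      qed
    next
      fix k assume "k \<in> {y, int p - y}"
      moreover have "[(int p - y)\<^sup>2 = y\<^sup>2] (mod int p)"
        by (auto simp: cong_iff_dvd_diff power2_eq_square algebra_simps)
      ultimately show "k \<in> {k \<in> {0..<int p}. k\<^sup>2 mod int p = a}"
        using y y0 by (auto simp: iff intro: cong_trans)
    qed
    moreover have "y \<noteq> int p - y" using odd_p by (metis add_diff_cancel_right' diff_add_cancel even_add even_of_nat_iff)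
    ultimately show ?thesis using 3 by simp
  qed
qed

lemma sum_squares_mod:
  fixes f :: "int \<Rightarrow> 'a::comm_ring_1"
  shows "(\<Sum>k=0..<int p. f (k\<^sup>2 mod int p)) = (\<Sum>a=0..<int p. (1 + of_int (chi a)) * f a)"
proof -
  have "(\<Sum>k=0..<int p. f (k\<^sup>2 mod int p)) =
      (\<Sum>a=0..<int p. \<Sum>k\<in>{k \<in> {0..<int p}. k\<^sup>2 mod int p = a}. f (k\<^sup>2 mod int p))"
    by (rule sum.group[symmetric]) (use p_pos in auto)
  also have "\<dots> = (\<Sum>a=0..<int p. (1 + of_int (chi a)) * f a)"
  proof (rule sum.cong[OF refl])
    fix a assume a: "a \<in> {0..<int p}"
    have "(\<Sum>k\<in>{k \<in> {0..<int p}. k\<^sup>2 mod int p = a}. f (k\<^sup>2 mod int p)) =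
        (\<Sum>k\<in>{k \<in> {0..<int p}. k\<^sup>2 mod int p = a}. f a)" by (rule sum.cong) auto
    also have "\<dots> = of_int (int (card {k \<in> {0..<int p}. k\<^sup>2 mod int p = a})) * f a" by simp
    finally show "(\<Sum>k\<in>{k \<in> {0..<int p}. k\<^sup>2 mod int p = a}. f (k\<^sup>2 mod int p)) = (1 + of_int (chi a)) * f a"
      unfolding card_square_roots[OF a] by simp
  qed
  finally show ?thesis .
qed

lemma sum_chi: "(\<Sum>a=0..<int p. chi a) = 0"
  using sum_squares_mod[of "\<lambda>_. 1 :: int"] by (simp add: sum.distrib)

lemma sum_residues_affine:
  fixes f :: "int \<Rightarrow> 'a::comm_monoid_add"
  assumes per: "\<And>x y. [x = y] (mod int p) \<Longrightarrow> f x = f y" and u: "\<not> int p dvd u"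
  shows "(\<Sum>k=0..<int p. f (u * k + s)) = (\<Sum>k=0..<int p. f k)"
proof -
  define h where "h = (\<lambda>k. (u * k + s) mod int p)"
  have "inj_on h {0..<int p}"
  proof (rule inj_onI)
    fix x y assume xy: "x \<in> {0..<int p}" "y \<in> {0..<int p}" "h x = h y"
    then have "[u * x = u * y] (mod int p)"
      unfolding h_def Cong.cong_def[symmetric] by (simp add: cong_add_rcancel)
    moreover have "coprime u (int p)"
      using prime_imp_coprime[OF prime_int_p u] by (simp add: coprime_commute)
    ultimately have "[x = y] (mod int p)" by (metis cong_mult_lcancel)
    then show "x = y" using xy by (simp add: Cong.cong_def)
  qed
  moreover have "h ` {0..<int p} \<subseteq> {0..<int p}" using p_pos by (auto simp: h_def)
  ultimately have "bij_betw h {0..<int p} {0..<int p}"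
    by (simp add: bij_betw_def endo_inj_surj)
  then have "(\<Sum>k=0..<int p. f k) = (\<Sum>k=0..<int p. f (h k))"
    by (rule sum.reindex_bij_betw[symmetric])
  also have "\<dots> = (\<Sum>k=0..<int p. f (u * k + s))"
    by (intro sum.cong per) (auto simp: h_def Cong.cong_def)
  finally show ?thesis by simp
qed

section \<open>The additive character and the Gauss sum\<close>

definition e :: "int \<Rightarrow> complex" where "e x = cis (2 * pi * of_int x / real p)"

lemma e_add: "e (x + y) = e x * e y"
  by (simp add: e_def cis_mult add_divide_distrib distrib_left)

lemma e_0 [simp]: "e 0 = 1" by (simp add: e_def)

lemma e_nat: "e (int k) = zeta p ^ k"
  by (simp add: e_def zeta_pow)

lemma e_p_mult: "e (int p * k) = 1"
proof -
  have "2 * pi * of_int (int p * k) / real p = 2 * pi * of_int k" using p_pos by simp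
  then show ?thesis unfolding e_def by (simp only: cis_multiple_2pi Ints_of_int)
qed

lemma e_cong: "[x = y] (mod int p) \<Longrightarrow> e x = e y"
proof -
  assume "[x = y] (mod int p)"
  then obtain k where "x - y = int p * k" by (auto simp: cong_iff_dvd_diff)
  then have "x = y + int p * k" by simp
  then show ?thesis by (simp add: e_add e_p_mult)
qed

lemma e_mult_pow: "e (int k * x) = e x ^ k"
  by (induction k) (auto simp: e_add algebra_simps)

lemma e_eq_1_iff: "e x = 1 \<longleftrightarrow> int p dvd x"
proof -
  have x: "[x = int (nat (x mod int p))] (mod int p)" using p_pos by simp
  then have "e x = zeta p ^ nat (x mod int p)" using e_nat e_cong by metis
  then have "e x = 1 \<longleftrightarrow> p dvd nat (x mod int p)" using zeta_pow_eq_1_iff[OF p_pos] by simp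
  also have "\<dots> \<longleftrightarrow> int p dvd int (nat (x mod int p))" by (simp only: int_dvd_int_iff)
  also have "\<dots> \<longleftrightarrow> int p dvd x" using cong_dvd_iff[OF x] by (metis cong_0_iff cong_sym cong_trans x)
  finally show ?thesis .
qed

lemma norm_e [simp]: "norm (e x) = 1" by (simp add: e_def)

lemma cnj_e: "cnj (e x) = e (- x)" by (simp add: e_def cis_cnj)

lemma sum_e: "(\<Sum>k=0..<int p. e (u * k)) = (if int p dvd u then of_nat p else 0)"
proof (cases "int p dvd u")
  case True
  then have "e (u * k) = 1" for k by (auto simp: e_eq_1_iff)
  then show ?thesis using True by simp
next
  case False
  have "(\<Sum>k=0..<int p. e (u * (1 * k + 1))) = (\<Sum>k=0..<int p. e (u * k))"
    by (rule sum_residues_affine[where f = "\<lambda>k. e (u * k)"])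
      (use p_gt_2 in \<open>auto intro!: e_cong cong_mult dest: zdvd_imp_le\<close>)
  moreover have "(\<Sum>k=0..<int p. e (u * (1 * k + 1))) = e u * (\<Sum>k=0..<int p. e (u * k))"
    by (simp add: distrib_left e_add sum_distrib_left mult.commute)
  ultimately have "(e u - 1) * (\<Sum>k=0..<int p. e (u * k)) = 0"
    by (simp add: left_diff_distrib)
  then show ?thesis using False e_eq_1_iff[of u] by simp
qed

text \<open>Gauss's form, a sum over squares, is the one that his product formula evaluates; the
  form weighted by \<open>chi\<close> follows from the count \<open>1 + chi a\<close> of square
  roots.\<close>

definition gauss_sum :: complex where "gauss_sum = (\<Sum>k=0..<int p. e (k\<^sup>2))"

lemma gauss_sum_chi: "gauss_sum = (\<Sum>a=0..<int p. of_int (chi a) * e a)"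
proof -
  have "gauss_sum = (\<Sum>k=0..<int p. e (k\<^sup>2 mod int p))"
    unfolding gauss_sum_def by (intro sum.cong e_cong) (auto simp: Cong.cong_def)
  also have "\<dots> = (\<Sum>a=0..<int p. e (1 * a)) + (\<Sum>a=0..<int p. of_int (chi a) * e a)"
    unfolding sum_squares_mod by (simp add: distrib_right sum.distrib)
  also have "(\<Sum>a=0..<int p. e (1 * a)) = 0"
    unfolding sum_e using p_gt_2 by (auto dest: zdvd_imp_le)
  finally show ?thesis by simp
qed

lemma gauss_sum_twist: "(\<Sum>a=0..<int p. of_int (chi a) * e (k * a)) = of_int (chi k) * gauss_sum"
proof (cases "int p dvd k")
  case True
  then have "e (k * a) = 1" for a by (auto simp: e_eq_1_iff)
  then have "(\<Sum>a=0..<int p. of_int (chi a) * e (k * a)) = of_int (\<Sum>a=0..<int p. chi a)" by simp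
  then show ?thesis using True chi_eq_0_iff[of k] sum_chi by simp
next
  case False
  have "gauss_sum = (\<Sum>a=0..<int p. of_int (chi (k * a + 0)) * e (k * a + 0))"
    unfolding gauss_sum_chi
    by (rule sum_residues_affine[symmetric, OF _ False]) (metis chi_mod e_cong)
  also have "\<dots> = of_int (chi k) * (\<Sum>a=0..<int p. of_int (chi a) * e (k * a))"
    by (simp add: chi_mult sum_distrib_left mult.assoc)
  finally have "of_int (chi k) * gauss_sum = of_int (chi k * chi k) * (\<Sum>a=0..<int p. of_int (chi a) * e (k * a))"
    by simp
  then show ?thesis using chi_square[OF False] by simp
qed

text \<open>Substituting \<open>j = d + k\<close> makes the exponent \<open>j ^ 2 - k ^ 2\<close>
  linear in \<open>k\<close>, so that summing over \<open>k\<close> first kills all terms with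
  \<open>d \<noteq> 0\<close>.\<close>

lemma norm_gauss_sum: "(norm gauss_sum)\<^sup>2 = real p"
proof -
  have nd: "\<not> int p dvd 1" using p_gt_2 by (auto dest: zdvd_imp_le)
  have inner: "(\<Sum>j=0..<int p. e (j\<^sup>2 - k\<^sup>2)) = (\<Sum>d=0..<int p. e (d\<^sup>2) * e ((2 * d) * k))" for k
  proof -
    have "(\<Sum>j=0..<int p. e (j\<^sup>2 - k\<^sup>2)) = (\<Sum>d=0..<int p. e ((1 * d + k)\<^sup>2 - k\<^sup>2))"
      by (rule sum_residues_affine[symmetric, OF _ nd]) (auto intro!: e_cong cong_diff cong_pow)
    also have "\<dots> = (\<Sum>d=0..<int p. e (d\<^sup>2) * e ((2 * d) * k))"
      by (simp add: e_add[symmetric] power2_eq_square algebra_simps)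
    finally show ?thesis .
  qed
  have "complex_of_real ((norm gauss_sum)\<^sup>2) = gauss_sum * cnj gauss_sum"
    by (rule complex_norm_square)
  also have "\<dots> = (\<Sum>k=0..<int p. \<Sum>j=0..<int p. e (j\<^sup>2 - k\<^sup>2))"
    unfolding gauss_sum_def cnj_sum sum_product cnj_e
    by (subst sum.swap) (simp add: e_add[symmetric])
  also have "\<dots> = (\<Sum>d=0..<int p. e (d\<^sup>2) * (\<Sum>k=0..<int p. e ((2 * d) * k)))"
    unfolding inner by (subst sum.swap) (simp add: sum_distrib_left)
  also have "\<dots> = (\<Sum>d=0..<int p. if d = 0 then of_nat p else 0)"
  proof (rule sum.cong[OF refl])
    fix d assume d: "d \<in> {0..<int p}"
    have "int p dvd 2 * d \<longleftrightarrow> d = 0"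
    proof
      assume "int p dvd 2 * d"
      then have "int p dvd d" using prime_int_p p_gt_2 by (auto simp: prime_dvd_mult_iff dest: zdvd_imp_le)
      then show "d = 0" using d by (auto dest: zdvd_imp_le)
    qed simp
    then show "e (d\<^sup>2) * (\<Sum>k=0..<int p. e (2 * d * k)) = (if d = 0 then of_nat p else 0)"
      unfolding sum_e by auto
  qed
  also have "\<dots> = of_nat p" using p_pos by simp
  finally show ?thesis by (metis of_real_eq_iff of_real_of_nat_eq)
qed

text \<open>Completing the square turns the Gauss sum into the sum of
  \<open>e (k * (k + 1))\<close>, up to a phase. For \<open>q = e (- 2)\<close> these terms are
  exactly the alternating Gaussian binomials of upper index \<open>2 * n = p - 1\<close>, whose sum
  is a product of sines up to another phase.\<close>

lemma gauss_sum_prod: "gauss_sum = (2 * \<i>) ^ n * (\<Prod>i<n. of_real (sin (2 * pi * real (2 * i + 1) / real p)))"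
proof -
  define q where "q = e (- 2)"
  have iq: "inverse q = e 2"
    unfolding q_def using e_add[of 2 "- 2"] by (intro inverse_unique) (simp add: mult.commute)
  have qk: "q ^ k = e (- 2 * int k)" for k unfolding q_def e_mult_pow[symmetric] by (simp add: mult.commute)
  have "q ^ k \<noteq> 1" if "0 < k" "k < p" for k
  proof
    assume "q ^ k = 1"
    then have "int p dvd 2 * int k" unfolding qk e_eq_1_iff by simp
    then have "int p dvd int k" using prime_int_p p_gt_2 by (auto simp: prime_dvd_mult_iff dest: zdvd_imp_le)
    then show False using that by (auto dest: zdvd_imp_le)
  qed
  moreover have "q ^ p = 1" unfolding qk e_eq_1_iff by simp
  ultimately have qb: "qbinomial q (2 * n) k = (- 1) ^ k * inverse q ^ (k * (k + 1) div 2)" if "k < p" for k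
    using qbinomial_root_of_unity[of q p k] that p_eq by simp
  have "(\<Sum>k\<le>2*n. e (int k * (int k + 1))) = (\<Sum>k\<le>2*n. (- 1) ^ k * qbinomial q (2 * n) k)"
  proof (rule sum.cong[OF refl])
    fix k assume "k \<in> {..2*n}"
    then have "(- 1) ^ k * qbinomial q (2 * n) k = inverse q ^ (k * (k + 1) div 2)"
      using p_eq by (subst qb) (auto simp: power_mult_distrib[symmetric] mult.assoc[symmetric])
    also have "\<dots> = e (int (2 * (k * (k + 1) div 2)))" unfolding iq e_mult_pow[symmetric] of_nat_mult of_nat_numeral by (simp only: mult.commute)
    also have "2 * (k * (k + 1) div 2) = k * (k + 1)" by simp
    finally show "e (int k * (int k + 1)) = (- 1) ^ k * qbinomial q (2 * n) k" by (simp add: algebra_simps)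
  qed
  also have "\<dots> = (\<Prod>i<n. 1 - q ^ (2 * i + 1))" by (rule sum_qbinomial_even)
  also have "\<dots> = (\<Prod>i<n. e (- int (2 * i + 1)) * (2 * \<i> * of_real (sin (2 * pi * real (2 * i + 1) / real p))))"
  proof (rule prod.cong[OF refl])
    fix i :: nat
    let ?j = "2 * i + 1"
    have "1 - q ^ ?j = e (- int ?j) * (e (int ?j) - e (- int ?j))"
      unfolding qk right_diff_distrib e_add[symmetric] by simp
    also have "e (int ?j) - e (- int ?j) = 2 * \<i> * of_real (sin (2 * pi * real ?j / real p))"
      unfolding cnj_e[symmetric] by (simp add: e_def complex_eq_iff)
    finally show "1 - q ^ ?j = e (- int ?j) * (2 * \<i> * of_real (sin (2 * pi * real ?j / real p)))" .
  qed
  also have "\<dots> = (\<Prod>i<n. e (- int (2 * i + 1))) * ((2 * \<i>) ^ n * (\<Prod>i<n. of_real (sin (2 * pi * real (2 * i + 1) / real p))))"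
    by (simp add: prod.distrib)
  also have "(\<Prod>i<n. e (- int (2 * i + 1))) = e (- (int n)\<^sup>2)"
  proof -
    have "(\<Prod>i<k. e (- int (2 * i + 1))) = e (- (int k)\<^sup>2)" for k
      by (induction k) (auto simp: e_add[symmetric] power2_eq_square algebra_simps)
    then show ?thesis .
  qed
  finally have S: "(\<Sum>k\<le>2*n. e (int k * (int k + 1))) =
      e (- (int n)\<^sup>2) * ((2 * \<i>) ^ n * (\<Prod>i<n. of_real (sin (2 * pi * real (2 * i + 1) / real p))))" .
  have nd: "\<not> int p dvd 1" using p_gt_2 by (auto dest: zdvd_imp_le)
  \<comment> \<open>\<open>n + 1\<close> is the inverse of 2 modulo \<open>p\<close>, so this shift
    produces the linear term of \<open>k * (k + 1)\<close>.\<close>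
  have "gauss_sum = (\<Sum>k=0..<int p. e ((1 * k + (int n + 1))\<^sup>2))"
    unfolding gauss_sum_def
    by (rule sum_residues_affine[symmetric, OF _ nd]) (auto intro!: e_cong cong_pow)
  also have "\<dots> = (\<Sum>k=0..<int p. e ((int n + 1)\<^sup>2) * e (k * (k + 1)))"
  proof (rule sum.cong[OF refl])
    fix k
    have "(1 * k + (int n + 1))\<^sup>2 = ((int n + 1)\<^sup>2 + k * (k + 1)) + int p * k"
      using p_eq by (simp add: power2_eq_square algebra_simps)
    then show "e ((1 * k + (int n + 1))\<^sup>2) = e ((int n + 1)\<^sup>2) * e (k * (k + 1))"
      by (simp only: e_add e_p_mult) simp
  qed
  also have "\<dots> = e ((int n + 1)\<^sup>2) * (\<Sum>k=0..<int p. e (k * (k + 1)))"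
    by (simp add: sum_distrib_left)
  also have "(\<Sum>k=0..<int p. e (k * (k + 1))) = (\<Sum>k\<le>2*n. e (int k * (int k + 1)))"
    by (rule sum.reindex_bij_witness[where i = int and j = nat]) (use p_eq in auto)
  also have "e ((int n + 1)\<^sup>2) * \<dots> = e ((int n + 1)\<^sup>2 + - (int n)\<^sup>2) * ((2 * \<i>) ^ n * (\<Prod>i<n. of_real (sin (2 * pi * real (2 * i + 1) / real p))))"
    unfolding S e_add by (simp only: mult.assoc)
  \<comment> \<open>The phases from the shift and from the product cancel.\<close>
  also have "(int n + 1)\<^sup>2 + - (int n)\<^sup>2 = int p * 1" using p_eq by (simp add: power2_eq_square algebra_simps)
  finally show ?thesis by (simp only: e_p_mult) simp
qed

text \<open>Of the sines, those with \<open>i < m\<close> are positive and the \<open>m\<close>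
  others negative, and \<open>\<i> ^ n = (- 1) ^ m\<close>. The signs cancel, the Gauss sum is a
  positive real, and its absolute value is known.\<close>

lemma gauss_sum_eq: "gauss_sum = of_real (sqrt (real p))"
proof -
  define s where "s = (\<lambda>i. sin (2 * pi * real (2 * i + 1) / real p))"
  have "(2 * \<i>) ^ n = of_real (2 ^ n * (- 1) ^ m)"
  proof -
    have "(- 4 :: complex) ^ m = 4 ^ m * (- 1) ^ m" by (simp flip: power_mult_distrib)
    then show ?thesis using n_eq by (simp add: power_mult_distrib power_mult)
  qed
  then have G: "gauss_sum = of_real (2 ^ n * (- 1) ^ m * (\<Prod>i<n. s i))"
    using gauss_sum_prod by (simp add: s_def)
  have split: "{..<n} = {..<m} \<union> {m..<n}" using n_eq by auto
  have pos: "s i > 0" if "i < m" for i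
  proof -
    have "2 * i + 1 < n" using that n_eq by auto
    then have "2 * (2 * i + 1) < p" using p_eq by simp
    then have "real (2 * (2 * i + 1)) < real p" by (simp only: of_nat_less_iff)
    then have "2 * real (2 * i + 1) / real p < 1" using p_pos by (simp add: field_simps)
    then have "pi * (2 * real (2 * i + 1) / real p) < pi * 1" by (intro mult_strict_left_mono) auto
    then show ?thesis unfolding s_def using p_pos by (intro sin_gt_zero) (auto simp: mult_ac)
  qed
  have neg: "- s i > 0" if "i \<in> {m..<n}" for i
  proof -
    have "n + 1 \<le> 2 * i + 1" "2 * i + 1 < p" using that n_eq p_eq by auto
    then have "p < 2 * (2 * i + 1)" "2 * i + 1 < p" using p_eq by auto
    then have "real p < real (2 * (2 * i + 1))" "real (2 * i + 1) < real p" by (simp_all only: of_nat_less_iff)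
    then have "1 < 2 * real (2 * i + 1) / real p" "2 * real (2 * i + 1) / real p < 2"
      using p_pos by (simp_all add: field_simps)
    then have "pi * 1 < pi * (2 * real (2 * i + 1) / real p)" "pi * (2 * real (2 * i + 1) / real p) < pi * 2"
      by (simp_all only: mult_less_cancel_left_pos[OF pi_gt_zero])
    then have "s i < 0" unfolding s_def by (intro sin_lt_zero) (auto simp: mult_ac)
    then show ?thesis by simp
  qed
  have "(\<Prod>i<n. s i) = (\<Prod>i<m. s i) * (\<Prod>i=m..<n. s i)"
    unfolding split by (rule prod.union_disjoint) auto
  also have "(\<Prod>i=m..<n. s i) = (\<Prod>i=m..<n. (- 1) * (- s i))" by simp
  also have "\<dots> = (- 1) ^ m * (\<Prod>i=m..<n. - s i)"
    unfolding prod.distrib using n_eq by simp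
  finally have "(- 1) ^ m * (\<Prod>i<n. s i) = (\<Prod>i<m. s i) * (\<Prod>i=m..<n. - s i)"
    by (simp add: mult.left_commute[of "(- 1) ^ m"] power_mult_distrib[symmetric] flip: mult.assoc)
  moreover have "(\<Prod>i<m. s i) > 0" "(\<Prod>i=m..<n. - s i) > 0"
    using pos neg by (auto intro!: prod_pos)
  ultimately have "2 ^ n * (- 1) ^ m * (\<Prod>i<n. s i) > 0" by (simp add: mult.assoc)
  moreover have "(2 ^ n * (- 1) ^ m * (\<Prod>i<n. s i))\<^sup>2 = real p"
    using norm_gauss_sum unfolding G norm_of_real by simp
  ultimately have "2 ^ n * (- 1) ^ m * (\<Prod>i<n. s i) = sqrt (real p)"
    by (intro real_sqrt_unique[symmetric]) auto
  then show ?thesis using G by simp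
qed

end

subsection \<open>The L-series at 1\<close>

text \<open>Summation by parts: against decreasing nonnegative weights, a bound on the partial sums
  of \<open>x\<close> is all that matters. It serves both the tails of the L-series and the sums of
  \<open>chi d * (X div d)\<close>.\<close>

lemma abel_summation_bound:
  fixes x c :: "nat \<Rightarrow> real"
  assumes B: "\<And>j. \<bar>\<Sum>i=M..<j. x i\<bar> \<le> B"
    and c: "\<And>i. i \<ge> M \<Longrightarrow> c (Suc i) \<le> c i" "\<And>i. i \<ge> M \<Longrightarrow> c i \<ge> 0"
  shows "\<bar>\<Sum>i=M..<N. x i * c i\<bar> \<le> B * c M"
proof (cases "M \<le> N")
  case True
  define S where "S = (\<lambda>j. \<Sum>i=M..<j. x i)"
  have eq: "(\<Sum>i=M..<N. x i * c i) = S N * c N + (\<Sum>i=M..<N. S (Suc i) * (c i - c (Suc i)))"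
    using True by (induction N rule: dec_induct) (auto simp: S_def algebra_simps)
  have tel: "(\<Sum>i=M..<N. c i - c (Suc i)) = c M - c N"
    using True by (induction N rule: dec_induct) auto
  have "\<bar>S N * c N\<bar> \<le> B * c N"
    using B[of N] c(2)[OF True] by (simp add: S_def abs_mult mult_right_mono)
  moreover have "\<bar>\<Sum>i=M..<N. S (Suc i) * (c i - c (Suc i))\<bar> \<le> (\<Sum>i=M..<N. B * (c i - c (Suc i)))"
  proof (rule order_trans[OF sum_abs sum_mono])
    fix i assume "i \<in> {M..<N}"
    then have "c (Suc i) \<le> c i" using c(1) by simp
    then show "\<bar>S (Suc i) * (c i - c (Suc i))\<bar> \<le> B * (c i - c (Suc i))"
      using B[of "Suc i"] unfolding S_def abs_mult by (intro mult_mono) auto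
  qed
  ultimately have "\<bar>\<Sum>i=M..<N. x i * c i\<bar> \<le> B * c N + B * (c M - c N)"
    unfolding eq by (simp add: sum_distrib_left[symmetric] tel)
  then show ?thesis by (simp add: algebra_simps)
next
  case False
  then show ?thesis using B[of M] c(2)[of M] by simp
qed

lemma norm_one_minus_cis: "norm (1 - cis t) = 2 * \<bar>sin (t / 2)\<bar>"
  using dist_exp_i_1[of t] by (simp add: cis_conv_exp norm_minus_commute)

context prime_1_mod_4
begin

lemma sum_chi_period: "(\<Sum>i=a..<a+p. chi (int i)) = 0"
proof -
  have "(\<Sum>i=a..<a+p. chi (int i)) = (\<Sum>k=0..<int p. chi (1 * k + int a))"
    by (rule sum.reindex_bij_witness[where i = "\<lambda>k. nat k + a" and j = "\<lambda>i. int i - int a"]) auto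
  also have "\<dots> = (\<Sum>k=0..<int p. chi k)"
    by (rule sum_residues_affine) (use chi_mod p_gt_2 in \<open>auto dest: zdvd_imp_le\<close>)
  finally show ?thesis by (simp add: sum_chi)
qed

text \<open>Full periods sum to zero, and what remains has fewer than \<open>p\<close> terms of
  absolute value at most 1.\<close>

lemma sum_chi_bound: "\<bar>\<Sum>i=M..<N. real_of_int (chi (int i))\<bar> \<le> real p"
proof (induction N rule: less_induct)
  case (less N)
  show ?case
  proof (cases "M + p \<le> N")
    case True
    then have "{M..<N} = {M..<N-p} \<union> {N-p..<(N-p)+p}" by auto
    then have "(\<Sum>i=M..<N. real_of_int (chi (int i))) =
        (\<Sum>i=M..<N-p. real_of_int (chi (int i))) + real_of_int (\<Sum>i=N-p..<(N-p)+p. chi (int i))"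
      by (simp add: sum.union_disjoint ivl_disj_int)
    also have "(\<Sum>i=N-p..<(N-p)+p. chi (int i)) = 0" by (rule sum_chi_period)
    finally show ?thesis using less[of "N - p"] True p_pos by simp
  next
    case False
    have "\<bar>\<Sum>i=M..<N. real_of_int (chi (int i))\<bar> \<le> (\<Sum>i=M..<N. 1)"
    proof (rule order_trans[OF sum_abs sum_mono])
      show "\<bar>real_of_int (chi (int i))\<bar> \<le> 1" for i using chi_values[of "int i"] by auto
    qed
    then show ?thesis using False by simp
  qed
qed

text \<open>\<open>r\<close> is the damping factor of Abel's method. The term at
  \<open>i = 0\<close> vanishes as \<open>chi 0 = 0\<close>, so the series may start there.\<close>

definition L_term :: "real \<Rightarrow> nat \<Rightarrow> real" where
  "L_term r i = of_int (chi (int i)) * (r ^ i / real i)"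

definition L_fun :: "real \<Rightarrow> real" where "L_fun r = (\<Sum>i. L_term r i)"

text \<open>The bound does not depend on \<open>r\<close>: the convergence is uniform up to
  \<open>r = 1\<close>, which gives the continuity used in the limit below.\<close>

lemma L_term_bound:
  assumes "0 \<le> r" "r \<le> 1" "M \<ge> 1"
  shows "\<bar>\<Sum>i=M..<N. L_term r i\<bar> \<le> real p / real M"
proof -
  have "\<bar>\<Sum>i=M..<N. of_int (chi (int i)) * (r ^ i / real i)\<bar> \<le> real p * (r ^ M / real M)"
  proof (rule abel_summation_bound[OF sum_chi_bound])
    fix i assume i: "i \<ge> M"
    have "r * r ^ i \<le> 1 * r ^ i" using assms by (intro mult_right_mono) auto
    then show "r ^ Suc i / real (Suc i) \<le> r ^ i / real i"
      using i assms by (intro frac_le) auto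
    show "r ^ i / real i \<ge> 0" using assms by simp
  qed
  also have "\<dots> \<le> real p * (1 / real M)"
    using assms by (intro mult_left_mono divide_right_mono power_le_one) auto
  finally show ?thesis by (simp add: L_term_def)
qed

lemma summable_L_term:
  assumes "0 \<le> r" "r \<le> 1"
  shows "summable (L_term r)"
  unfolding summable_Cauchy
proof (intro allI impI)
  fix \<epsilon> :: real assume "\<epsilon> > 0"
  then obtain K :: nat where K: "real p / \<epsilon> < real K" using reals_Archimedean2 by blast
  have "norm (\<Sum>i=M..<N. L_term r i) < \<epsilon>" if "M \<ge> Suc K" for M N
  proof -
    have "norm (\<Sum>i=M..<N. L_term r i) \<le> real p / real M" using L_term_bound[OF assms, of M N] that by simp
    also have "\<dots> < \<epsilon>"
    proof -
      have "real p < \<epsilon> * real K" using K \<open>\<epsilon> > 0\<close> by (simp add: field_simps)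
      also have "\<dots> \<le> \<epsilon> * real M" using that \<open>\<epsilon> > 0\<close> by simp
      finally show ?thesis using that by (simp add: field_simps)
    qed
    finally show ?thesis .
  qed
  then show "\<exists>N. \<forall>m\<ge>N. \<forall>n. norm (sum (L_term r) {m..<n}) < \<epsilon>" by blast
qed

lemma L_tail:
  assumes "0 \<le> r" "r \<le> 1" "M \<ge> 1"
  shows "\<bar>L_fun r - (\<Sum>i<M. L_term r i)\<bar> \<le> real p / real M"
proof -
  have lim: "(\<lambda>N. \<Sum>i<N. L_term r i) \<longlonglongrightarrow> L_fun r"
    unfolding L_fun_def using summable_L_term[OF assms(1,2)] by (rule summable_LIMSEQ)
  have "eventually (\<lambda>N. \<bar>(\<Sum>i<N. L_term r i) - (\<Sum>i<M. L_term r i)\<bar> \<le> real p / real M) sequentially"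
  proof (rule eventually_sequentiallyI[of M])
    fix N assume "N \<ge> M"
    then have "{..<N} = {..<M} \<union> {M..<N}" by auto
    then have "(\<Sum>i<N. L_term r i) - (\<Sum>i<M. L_term r i) = (\<Sum>i=M..<N. L_term r i)"
      by (simp add: sum.union_disjoint ivl_disj_int)
    then show "\<bar>(\<Sum>i<N. L_term r i) - (\<Sum>i<M. L_term r i)\<bar> \<le> real p / real M"
      using L_term_bound[OF assms] by simp
  qed
  moreover have "(\<lambda>N. \<bar>(\<Sum>i<N. L_term r i) - (\<Sum>i<M. L_term r i)\<bar>) \<longlonglongrightarrow> \<bar>L_fun r - (\<Sum>i<M. L_term r i)\<bar>"
    by (intro tendsto_intros lim)
  ultimately show ?thesis by (intro tendsto_upperbound) auto
qed

lemma continuous_L_fun: "continuous_on {0..1} L_fun"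
proof (rule uniform_limit_theorem)
  show "uniform_limit {0..1} (\<lambda>N r. \<Sum>i<N. L_term r i) L_fun sequentially"
    unfolding uniform_limit_sequentially_iff
  proof (intro allI impI)
    fix \<epsilon> :: real assume "\<epsilon> > 0"
    then obtain K :: nat where K: "real p / \<epsilon> < real K" using reals_Archimedean2 by blast
    have "dist (\<Sum>i<M. L_term r i) (L_fun r) < \<epsilon>" if "M \<ge> Suc K" "r \<in> {0..1}" for M r
    proof -
      have "dist (\<Sum>i<M. L_term r i) (L_fun r) \<le> real p / real M"
        using L_tail[of r M] that by (simp add: dist_real_def abs_minus_commute)
      also have "\<dots> < \<epsilon>"
      proof -
        have "real p < \<epsilon> * real K" using K \<open>\<epsilon> > 0\<close> by (simp add: field_simps)
        also have "\<dots> \<le> \<epsilon> * real M" using that \<open>\<epsilon> > 0\<close> by simp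
        finally show ?thesis using that by (simp add: field_simps)
      qed
      finally show ?thesis .
    qed
    then show "\<exists>N. \<forall>n\<ge>N. \<forall>x\<in>{0..1}. dist (\<Sum>i<n. L_term x i) (L_fun x) < \<epsilon>" by blast
  qed
  show "\<forall>\<^sub>F N in sequentially. continuous_on {0..1} (\<lambda>r. \<Sum>i<N. L_term r i)"
    unfolding L_term_def divide_inverse by (intro always_eventually allI continuous_intros)
qed simp

text \<open>The twisted Gauss sum expresses \<open>sqrt p * chi i\<close> through the
  \<open>e (i * a)\<close>, which turns the series into logarithmic series at the points
  \<open>r * e a\<close>. For \<open>r < 1\<close> these lie inside the disc of convergence.\<close>

lemma L_fun_log:
  assumes "0 \<le> r" "r < 1"
  shows "sqrt (real p) * L_fun r = - (\<Sum>a=0..<int p. of_int (chi a) * ln (norm (1 - of_real r * e a)))"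
proof -
  have "(\<lambda>i. - ((of_real r * e a) ^ i) / of_nat i) sums ln (1 - of_real r * e a)" for a
    using Ln_series'[of "- (of_real r * e a)"] assms by (simp add: norm_mult)
  then have "(\<lambda>i. \<Sum>a=0..<int p. of_int (chi a) * (- ((of_real r * e a) ^ i) / of_nat i)) sums
      (\<Sum>a=0..<int p. of_int (chi a) * ln (1 - of_real r * e a))"
    by (intro sums_sum sums_mult)
  moreover have "(\<Sum>a=0..<int p. of_int (chi a) * (- ((of_real r * e a) ^ i) / of_nat i)) =
      of_real (- (sqrt (real p) * L_term r i))" for i
  proof -
    have "(\<Sum>a=0..<int p. of_int (chi a) * (- ((of_real r * e a) ^ i) / of_nat i)) =
        - (of_real (r ^ i / real i) * (\<Sum>a=0..<int p. of_int (chi a) * e (int i * a)))"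
      unfolding sum_distrib_left sum_negf[symmetric]
      by (rule sum.cong) (simp_all add: e_mult_pow power_mult_distrib)
    also have "\<dots> = of_real (- (sqrt (real p) * L_term r i))"
      unfolding gauss_sum_twist gauss_sum_eq by (simp add: L_term_def)
    finally show ?thesis .
  qed
  ultimately have "(\<lambda>i. complex_of_real (- (sqrt (real p) * L_term r i))) sums
      (\<Sum>a=0..<int p. of_int (chi a) * ln (1 - of_real r * e a))" by simp
  then have "(\<lambda>i. - (sqrt (real p) * L_term r i)) sums
      Re (\<Sum>a=0..<int p. of_int (chi a) * ln (1 - of_real r * e a))"
    using sums_Re by fastforce
  moreover have "(\<lambda>i. - (sqrt (real p) * L_term r i)) sums - (sqrt (real p) * L_fun r)"
    unfolding L_fun_def using summable_L_term[of r] assms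
    by (intro sums_minus sums_mult summable_sums) auto
  ultimately have "- (sqrt (real p) * L_fun r) = Re (\<Sum>a=0..<int p. of_int (chi a) * ln (1 - of_real r * e a))"
    by (metis sums_unique2)
  also have "\<dots> = (\<Sum>a=0..<int p. of_int (chi a) * ln (norm (1 - of_real r * e a)))"
  proof -
    have "1 - of_real r * e a \<noteq> 0" for a
    proof
      assume "1 - of_real r * e a = 0"
      then have "norm (of_real r * e a) = 1" by simp
      then show False using assms by (simp add: norm_mult)
    qed
    then show ?thesis by simp
  qed
  finally show ?thesis by simp
qed

text \<open>Limit of the damped identity as \<open>r\<close> tends to 1. The logarithm diverges only
  at \<open>a = 0\<close>, where \<open>chi\<close> vanishes.\<close>

lemma L_1_log:
  "sqrt (real p) * L_fun 1 = - (\<Sum>a=0..<int p. of_int (chi a) * ln (norm (1 - e a)))"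
proof -
  have nt: "at 1 within {0..<1::real} \<noteq> bot"
  proof -
    have "1 \<in> closure ({0..<1::real} - {1})" by (simp add: Diff_insert_absorb)
    then show ?thesis by (simp add: trivial_limit_within islimpt_in_closure)
  qed
  have "((\<lambda>r. L_fun r) \<longlongrightarrow> L_fun 1) (at 1 within {0..1})"
    using continuous_L_fun by (auto simp: continuous_on_def)
  then have "((\<lambda>r. L_fun r) \<longlongrightarrow> L_fun 1) (at 1 within {0..<1})"
    by (rule tendsto_within_subset) auto
  then have 1: "((\<lambda>r. sqrt (real p) * L_fun r) \<longlongrightarrow> sqrt (real p) * L_fun 1) (at 1 within {0..<1})"
    by (intro tendsto_intros)
  have "((\<lambda>r. of_int (chi a) * ln (norm (1 - of_real r * e a))) \<longlongrightarrow>
      of_int (chi a) * ln (norm (1 - of_real 1 * e a))) (at 1 within {0..<1})" for a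
  proof (cases "int p dvd a")
    case True
    then show ?thesis using chi_eq_0_iff[of a] by simp
  next
    case False
    then have "norm (1 - of_real 1 * e a) \<noteq> 0" using e_eq_1_iff[of a] by simp
    then show ?thesis by (intro tendsto_intros) auto
  qed
  then have "((\<lambda>r. - (\<Sum>a=0..<int p. of_int (chi a) * ln (norm (1 - of_real r * e a)))) \<longlongrightarrow>
      - (\<Sum>a=0..<int p. of_int (chi a) * ln (norm (1 - of_real 1 * e a)))) (at 1 within {0..<1})"
    by (intro tendsto_minus tendsto_sum)
  moreover have "\<forall>\<^sub>F r in at 1 within {0..<1}. sqrt (real p) * L_fun r =
      - (\<Sum>a=0..<int p. of_int (chi a) * ln (norm (1 - of_real r * e a)))"
    unfolding eventually_at_filter by (intro always_eventually) (auto intro!: L_fun_log)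
  ultimately have "((\<lambda>r. sqrt (real p) * L_fun r) \<longlongrightarrow>
      - (\<Sum>a=0..<int p. of_int (chi a) * ln (norm (1 - of_real 1 * e a)))) (at 1 within {0..<1})"
    by (simp only: tendsto_cong)
  from tendsto_unique[OF nt 1 this] show ?thesis by simp
qed

section \<open>The quotient eta and its reduction modulo p\<close>

definition half_res :: "nat set" where "half_res = {a \<in> {1..n}. chi (int a) = 1}"
definition half_nonres :: "nat set" where "half_nonres = {a \<in> {1..n}. chi (int a) = - 1}"

lemma n_less_p: "2 * n < p" "n < p"
  using p_eq by simp_all

lemma not_p_dvd: "a \<in> {1..n} \<Longrightarrow> \<not> int p dvd int a"
  using n_less_p by (auto dest: dvd_imp_le simp del: of_nat_dvd_iff simp: int_dvd_int_iff)

lemma half_sets: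
  "finite half_res" "finite half_nonres" "half_res \<inter> half_nonres = {}" "half_res \<union> half_nonres = {1..n}"
proof -
  have "chi (int a) \<noteq> 0" if "a \<in> {1..n}" for a
    unfolding chi_eq_0_iff using not_p_dvd[OF that] .
  then show "half_res \<union> half_nonres = {1..n}"
    using chi_values by (fastforce simp: half_res_def half_nonres_def)
qed (auto simp: half_res_def half_nonres_def)

lemma sum_half:
  fixes f :: "int \<Rightarrow> real"
  assumes "\<And>a. f (int p - a) = f a"
  shows "(\<Sum>a=0..<int p. of_int (chi a) * f a) = 2 * ((\<Sum>a\<in>half_res. f (int a)) - (\<Sum>a\<in>half_nonres. f (int a)))"
proof -
  let ?g = "\<lambda>a. of_int (chi a) * f a"
  have sym: "?g (int p - a) = ?g a" for a
  proof -
    have "chi (int p - a) = chi (- a)" by (rule chi_mod) (simp add: Cong.cong_def)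
    then show ?thesis by (simp add: chi_minus assms)
  qed
  have s1: "(\<Sum>a=1..int n. ?g a) = (\<Sum>a=1..n. ?g (int a))"
    by (rule sum.reindex_bij_witness[where i = int and j = nat]) auto
  have s2: "(\<Sum>a=int n+1..<int p. ?g a) = (\<Sum>a=1..int n. ?g a)"
    by (rule sum.reindex_bij_witness[where i = "\<lambda>a. int p - a" and j = "\<lambda>a. int p - a"])
      (use p_eq sym in auto)
  have "{0..<int p} = insert 0 ({1..int n} \<union> {int n+1..<int p})" using p_eq by auto
  then have "(\<Sum>a=0..<int p. ?g a) = (\<Sum>a\<in>{1..int n} \<union> {int n+1..<int p}. ?g a)" by simp
  also have "\<dots> = (\<Sum>a=1..int n. ?g a) + (\<Sum>a=int n+1..<int p. ?g a)"
    by (rule sum.union_disjoint) auto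
  also have "\<dots> = 2 * (\<Sum>a=1..n. ?g (int a))" by (simp only: s2 s1)
  also have "(\<Sum>a=1..n. ?g (int a)) = (\<Sum>a\<in>half_res. ?g (int a)) + (\<Sum>a\<in>half_nonres. ?g (int a))"
    unfolding half_sets(4)[symmetric] using half_sets by (intro sum.union_disjoint) auto
  also have "(\<Sum>a\<in>half_res. ?g (int a)) = (\<Sum>a\<in>half_res. f (int a))"
    by (rule sum.cong) (auto simp: half_res_def)
  also have "(\<Sum>a\<in>half_nonres. ?g (int a)) = (\<Sum>a\<in>half_nonres. - f (int a))"
    by (rule sum.cong) (auto simp: half_nonres_def)
  finally show ?thesis by (simp add: sum_negf)
qed

text \<open>\<open>sum_half\<close> for a constant function: the full character sum vanishes and
  \<open>chi\<close> is even, so residues and nonresidues are balanced below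
  \<open>p / 2\<close>.\<close>

lemma card_half: "card half_res = m" "card half_nonres = m"
proof -
  have "real_of_int (\<Sum>a=0..<int p. chi a) = 2 * (real (card half_res) - real (card half_nonres))"
    using sum_half[of "\<lambda>_. 1"] by simp
  then have "card half_res = card half_nonres" by (simp add: sum_chi)
  moreover have "card half_res + card half_nonres = n"
    using card_Un_disjoint[OF half_sets(1-3)] half_sets(4) by simp
  ultimately show "card half_res = m" "card half_nonres = m" using n_eq by auto
qed

text \<open>By the class number formula this is \<open>eps ^ h\<close>, with \<open>eps\<close> the fundamental unit and \<open>h\<close> the class number.\<close>

definition eta :: real where
  "eta = (\<Prod>b\<in>half_nonres. sin (pi * real b / real p)) / (\<Prod>a\<in>half_res. sin (pi * real a / real p))"

lemma sin_pos: "a \<in> {1..n} \<Longrightarrow> sin (pi * real a / real p) > 0"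
proof (rule sin_gt_zero)
  assume a: "a \<in> {1..n}"
  then show "0 < pi * real a / real p" using p_pos by simp
  have "real a < real p" using a p_eq by auto
  then have "pi * (real a / real p) < pi * 1" using p_pos by (intro mult_strict_left_mono) auto
  then show "pi * real a / real p < pi" by simp
qed

lemma eta_pos: "eta > 0"
  unfolding eta_def using half_sets(4) by (intro divide_pos_pos prod_pos sin_pos) auto

text \<open>\<open>norm (1 - e a)\<close> is twice a sine; the factors 2 cancel because both half
  systems have \<open>m\<close> elements. Nonresidues end up in the numerator because of the minus
  sign in front of the logarithms.\<close>

lemma L_1_eta: "sqrt (real p) * L_fun 1 = 2 * ln eta"
proof -
  have ln: "ln (norm (1 - e (int a))) = ln 2 + ln (sin (pi * real a / real p))" if "a \<in> {1..n}" for a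
  proof -
    have "norm (1 - e (int a)) = 2 * \<bar>sin (pi * real a / real p)\<bar>"
      unfolding e_def norm_one_minus_cis by simp
    then show ?thesis using sin_pos[OF that] by (simp add: ln_mult)
  qed
  have "norm (1 - e (int p - a)) = norm (1 - e a)" for a
  proof -
    have "e (int p - a) = cnj (e a)" unfolding cnj_e by (rule e_cong) (simp add: Cong.cong_def)
    then have "1 - e (int p - a) = cnj (1 - e a)" by simp
    then show ?thesis by (simp only: complex_mod_cnj)
  qed
  then have "(\<Sum>a=0..<int p. of_int (chi a) * ln (norm (1 - e a))) =
      2 * ((\<Sum>a\<in>half_res. ln (norm (1 - e (int a)))) - (\<Sum>a\<in>half_nonres. ln (norm (1 - e (int a)))))"
    by (intro sum_half) simp
  also have "(\<Sum>a\<in>half_res. ln (norm (1 - e (int a)))) = (\<Sum>a\<in>half_res. ln 2 + ln (sin (pi * real a / real p)))"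
    by (rule sum.cong[OF refl], rule ln) (auto simp: half_res_def)
  also have "(\<Sum>a\<in>half_nonres. ln (norm (1 - e (int a)))) = (\<Sum>a\<in>half_nonres. ln 2 + ln (sin (pi * real a / real p)))"
    by (rule sum.cong[OF refl], rule ln) (auto simp: half_nonres_def)
  also have "(\<Sum>a\<in>half_res. ln 2 + ln (sin (pi * real a / real p))) - (\<Sum>a\<in>half_nonres. ln 2 + ln (sin (pi * real a / real p))) =
      ln (\<Prod>a\<in>half_res. sin (pi * real a / real p)) - ln (\<Prod>a\<in>half_nonres. sin (pi * real a / real p))"
  proof -
    have "ln (\<Prod>a\<in>A. sin (pi * real a / real p)) = (\<Sum>a\<in>A. ln (sin (pi * real a / real p)))" if "A \<subseteq> {1..n}" for A
    proof (rule ln_prod)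
      show "finite A" using that finite_subset by blast
      show "sin (pi * real a / real p) \<noteq> 0" if "a \<in> A" for a
        using sin_pos[of a] \<open>A \<subseteq> {1..n}\<close> that by fastforce
    qed
    moreover have "half_res \<subseteq> {1..n}" "half_nonres \<subseteq> {1..n}" using half_sets(4) by auto
    ultimately show ?thesis by (simp add: sum.distrib card_half)
  qed
  also have "\<dots> = - ln eta"
  proof -
    have "(\<Prod>a\<in>half_res. sin (pi * real a / real p)) > 0" "(\<Prod>a\<in>half_nonres. sin (pi * real a / real p)) > 0"
      using half_sets(4) by (auto intro!: prod_pos sin_pos)
    then show ?thesis unfolding eta_def by (simp add: ln_div)
  qed
  finally show ?thesis using L_1_log by simp
qed

text \<open>At \<open>zeta p\<close> this is \<open>sin (pi * k / p) / sin (pi / p)\<close>, and at 1 it is \<open>k\<close> up to sign; it links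
  \<open>eta\<close> to the residues \<open>half_res\<close> and \<open>half_nonres\<close> modulo \<open>p\<close>.\<close>

definition sin_quot :: "nat \<Rightarrow> complex \<Rightarrow> complex" where
  "sin_quot k x = (- (x ^ n)) ^ (k - 1) * (\<Sum>l<k. x ^ l)"

text \<open>The half-angle root \<open>\<rho> = cis (pi / p)\<close> satisfies
  \<open>\<rho> ^ p = - 1\<close>, hence its inverse is \<open>- (zeta p ^ n)\<close>. So the
  quotient of sines, symmetric in \<open>\<rho>\<close> and its inverse, is an integer polynomial in
  \<open>zeta p\<close>; this explains the first factor of \<open>sin_quot\<close>.\<close>

lemma sin_quot_zeta:
  assumes "k \<ge> 1"
  shows "of_real (sin (pi * real k / real p)) = sin_quot k (zeta p) * of_real (sin (pi / real p))"
proof -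
  define \<rho> where "\<rho> = cis (pi / real p)"
  have \<rho>0: "\<rho> \<noteq> 0" by (simp add: \<rho>_def)
  have z: "zeta p = \<rho>\<^sup>2" by (simp add: zeta_def \<rho>_def Complex.DeMoivre)
  have "\<rho> ^ p = - 1" using p_pos by (simp add: \<rho>_def Complex.DeMoivre)
  then have "\<rho> * zeta p ^ n = - 1" unfolding z using p_eq by (simp add: power_mult)
  then have inv: "- (zeta p ^ n) = inverse \<rho>" using \<rho>0 by (simp add: field_simps)
  have s: "\<rho> ^ j - inverse \<rho> ^ j = 2 * \<i> * of_real (sin (pi * real j / real p))" for j
  proof -
    have "\<rho> ^ j = cis (pi * real j / real p)" unfolding \<rho>_def Complex.DeMoivre by (simp add: mult.commute)
    moreover have "inverse \<rho> ^ j = cnj (\<rho> ^ j)" by (simp add: \<rho>_def cis_cnj power_inverse)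
    ultimately show ?thesis by (simp only:) (simp add: complex_eq_iff)
  qed
  have inv2: "\<rho> - inverse \<rho> = inverse \<rho> * (\<rho>\<^sup>2 - 1)" using \<rho>0 by (simp add: field_simps power2_eq_square)
  have "sin_quot k (zeta p) * (\<rho> - inverse \<rho>) = inverse \<rho> ^ (k - 1) * (inverse \<rho> * ((\<rho>\<^sup>2 - 1) * (\<Sum>l<k. (\<rho>\<^sup>2) ^ l)))"
    unfolding sin_quot_def inv unfolding inv2 z by (simp only: mult_ac)
  also have "\<dots> = inverse \<rho> ^ Suc (k - 1) * ((\<rho>\<^sup>2) ^ k - 1)"
    by (simp only: power_diff_1_eq[symmetric] power_Suc mult_ac)
  also have "Suc (k - 1) = k" using assms by simp
  also have "inverse \<rho> ^ k * ((\<rho>\<^sup>2) ^ k - 1) = \<rho> ^ k - inverse \<rho> ^ k"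
    using \<rho>0 by (simp add: field_simps power2_eq_square power_mult_distrib)
  finally have "sin_quot k (zeta p) * (2 * \<i> * of_real (sin (pi / real p))) = 2 * \<i> * of_real (sin (pi * real k / real p))"
    using s[of 1] s[of k] by simp
  then show ?thesis by simp
qed

lemma sin_quot_1: "sin_quot k 1 = of_int ((- 1) ^ (k - 1) * int k)"
  by (simp add: sin_quot_def)

lemma int_poly_fun_sin_quot: "int_poly_fun (sin_quot k)"
proof -
  have "int_poly_fun (\<lambda>x. (of_int (- 1) * x ^ n) ^ (k - 1) * (\<Sum>l<k. x ^ l))"
    by (intro int_poly_fun_mult int_poly_fun_pow int_poly_fun_sum int_poly_fun_const int_poly_fun_power)
  then show ?thesis by (simp add: sin_quot_def[abs_def])
qed

text \<open>Both products have \<open>m\<close> factors, so the powers of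
  \<open>sin (pi / p)\<close> cancel.\<close>

lemma eta_sin_quot:
  "of_real eta * (\<Prod>a\<in>half_res. sin_quot a (zeta p)) = (\<Prod>b\<in>half_nonres. sin_quot b (zeta p))"
proof -
  let ?s = "complex_of_real (sin (pi / real p))"
  have s0: "?s \<noteq> 0" using sin_pos[of 1] m_pos n_eq by (auto simp: )
  have *: "complex_of_real (\<Prod>a\<in>A. sin (pi * real a / real p)) = (\<Prod>a\<in>A. sin_quot a (zeta p)) * ?s ^ card A"
    if "A \<subseteq> {1..n}" for A
  proof -
    have "complex_of_real (\<Prod>a\<in>A. sin (pi * real a / real p)) = (\<Prod>a\<in>A. sin_quot a (zeta p) * ?s)"
      unfolding of_real_prod by (rule prod.cong[OF refl], rule sin_quot_zeta) (use that in auto)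
    then show ?thesis by (simp add: prod.distrib)
  qed
  have sub: "half_res \<subseteq> {1..n}" "half_nonres \<subseteq> {1..n}" using half_sets(4) by auto
  have "(\<Prod>a\<in>half_res. sin (pi * real a / real p)) > 0"
    using sub by (auto intro!: prod_pos sin_pos)
  then have "eta * (\<Prod>a\<in>half_res. sin (pi * real a / real p)) = (\<Prod>a\<in>half_nonres. sin (pi * real a / real p))"
    by (simp add: eta_def)
  from arg_cong[OF this, of complex_of_real]
  have "of_real eta * (\<Prod>a\<in>half_res. sin_quot a (zeta p)) * ?s ^ m = (\<Prod>b\<in>half_nonres. sin_quot b (zeta p)) * ?s ^ m"
    unfolding of_real_mult *[OF sub(1)] *[OF sub(2)] card_half by simp
  then show ?thesis using s0 by simp
qed

text \<open>The set \<open>Q\<close> of quadratic residues among \<open>1, ..., p - 1\<close> is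
  \<open>half_res\<close> together with its mirror image, as \<open>chi\<close> is even; it also
  consists of the least positive residues of \<open>i ^ 2\<close> for \<open>i \<le> n\<close>. Its
  product is thus \<open>(- 1) ^ m\<close> times the square in question, and equally
  \<open>(n!) ^ 2 = - 1\<close>.\<close>

lemma prod_half_res_square:
  "[(\<Prod>a\<in>half_res. int a)\<^sup>2 = - ((- 1) ^ m)] (mod int p)"
proof -
  define Q where "Q = half_res \<union> (\<lambda>a. p - a) ` half_res"
  have sub: "half_res \<subseteq> {1..n}" using half_sets(4) by auto
  have inj: "inj_on (\<lambda>a. p - a) half_res"
  proof (rule inj_onI)
    fix x y assume "x \<in> half_res" "y \<in> half_res" "p - x = p - y"
    moreover from this have "x \<le> n" "y \<le> n" using sub by auto
    ultimately show "x = y" using n_less_p by linarith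
  qed
  have disj: "half_res \<inter> (\<lambda>a. p - a) ` half_res = {}"
  proof -
    have "p - a \<notin> half_res" if "a \<in> half_res" for a
    proof
      assume "p - a \<in> half_res"
      then have "p - a \<le> n" "a \<le> n" using sub that by auto
      then show False using n_less_p by linarith
    qed
    then show ?thesis by auto
  qed
  have cardQ: "card Q = n"
  proof -
    have "card Q = card half_res + card half_res"
      unfolding Q_def using half_sets(1) by (simp add: card_Un_disjoint disj card_image inj)
    then show ?thesis using card_half n_eq by simp
  qed
  define f where "f = (\<lambda>i. i\<^sup>2 mod p)"
  have fi: "int (f i) = (int i)\<^sup>2 mod int p" for i by (simp add: f_def zmod_int)
  have injf: "inj_on f {1..n}"
  proof (rule inj_onI)
    fix i j assume ij: "i \<in> {1..n}" "j \<in> {1..n}" "f i = f j"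
    then have "[(int i)\<^sup>2 = (int j)\<^sup>2] (mod int p)" by (metis Cong.cong_def fi)
    then have "int p dvd (int i - int j) * (int i + int j)"
      by (simp add: cong_iff_dvd_diff power2_eq_square algebra_simps)
    then have "int p dvd int i - int j \<or> int p dvd int i + int j"
      using prime_int_p by (simp add: prime_dvd_mult_iff)
    moreover have "\<not> int p dvd int i + int j" using ij p_eq by (auto dest: zdvd_imp_le)
    ultimately have "int p dvd int i - int j" by blast
    then show "i = j" using ij p_eq dvd_imp_le_int[of "int i - int j" "int p"] by fastforce
  qed
  have "f ` {1..n} \<subseteq> Q"
  proof safe
    fix i assume i: "i \<in> {1..n}"
    have nd: "\<not> int p dvd int i" by (rule not_p_dvd[OF i])
    have "chi (int (f i)) = chi (int i) * chi (int i)"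
      unfolding fi chi_mult[symmetric] by (rule chi_mod) (simp add: power2_eq_square)
    then have chi: "chi (int (f i)) = 1" using chi_square[OF nd] by simp
    have f0: "f i \<noteq> 0" using chi by (intro notI) simp
    have fp: "f i < p" using p_pos by (simp add: f_def)
    show "f i \<in> Q"
    proof (cases "f i \<le> n")
      case True
      then show ?thesis using f0 chi by (auto simp: Q_def half_res_def)
    next
      case False
      have "chi (int (p - f i)) = chi (- int (f i))"
        using fp by (intro chi_mod) (simp add: of_nat_diff Cong.cong_def)
      then have "chi (int (p - f i)) = 1" using chi by (simp only: chi_minus)
      moreover have "p - f i \<in> {1..n}" using False fp p_eq by auto
      ultimately have "p - f i \<in> half_res" unfolding half_res_def by blast
      moreover have "f i = p - (p - f i)" using fp by simp
      ultimately show ?thesis unfolding Q_def by blast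
    qed
  qed
  moreover have "finite Q" using half_sets(1) by (simp add: Q_def)
  moreover have "card (f ` {1..n}) = n" using card_image[OF injf] by simp
  ultimately have img: "f ` {1..n} = Q" using cardQ by (intro card_subset_eq) auto
  have "(\<Prod>x\<in>Q. int x) = (\<Prod>i=1..n. int (f i))"
    unfolding img[symmetric] using injf by (simp add: prod.reindex)
  also have "[\<dots> = (\<Prod>i=1..n. (int i)\<^sup>2)] (mod int p)"
    by (rule cong_prod) (simp add: fi)
  also have "(\<Prod>i=1..n. (int i)\<^sup>2) = (fact n)\<^sup>2" by (simp add: fact_prod prod_power_distrib)
  also have "[\<dots> = - 1] (mod int p)" by (rule fact_half_square[OF prime_p p_eq n_eq])
  finally have 1: "[(\<Prod>x\<in>Q. int x) = - 1] (mod int p)" .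
  have "(\<Prod>x\<in>Q. int x) = (\<Prod>a\<in>half_res. int a) * (\<Prod>a\<in>half_res. int (p - a))"
    unfolding Q_def using half_sets(1) disj inj by (simp add: prod.union_disjoint prod.reindex)
  also have "[\<dots> = (\<Prod>a\<in>half_res. int a) * (\<Prod>a\<in>half_res. (- 1) * int a)] (mod int p)"
    by (intro cong_mult cong_prod cong_refl) (use sub p_eq in \<open>auto simp: of_nat_diff Cong.cong_def dest!: subsetD\<close>)
  also have "(\<Prod>a\<in>half_res. int a) * (\<Prod>a\<in>half_res. (- 1) * int a) = (- 1) ^ m * (\<Prod>a\<in>half_res. int a)\<^sup>2"
    unfolding prod.distrib by (simp add: card_half power2_eq_square)
  finally have 2: "[(- 1) ^ m * (\<Prod>a\<in>half_res. int a)\<^sup>2 = - 1] (mod int p)"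
    using 1 by (metis cong_sym cong_trans)
  have "[(- 1) ^ m * ((- 1) ^ m * (\<Prod>a\<in>half_res. int a)\<^sup>2) = (- 1) ^ m * (- 1)] (mod int p)"
    by (rule cong_mult[OF cong_refl 2])
  then show ?thesis by (simp flip: mult.assoc power_add add: mult_2[symmetric])
qed

text \<open>\<open>F\<close> encodes \<open>\<epsilon> ^ h = eta\<close>, with all denominators
  cleared, as an integer polynomial vanishing at \<open>zeta p\<close>; hence \<open>p\<close>
  divides its value at 1, which says \<open>u ^ h * A = 2 ^ h * B\<close>. Multiplying by
  \<open>A\<close> produces the known square of \<open>A\<close> and the factorial
  \<open>A * B\<close>, up to sign.\<close>

lemma chowla_cong:
  assumes eps: "\<epsilon> = (of_int u + of_int v * sqrt (real p)) / 2" and h: "\<epsilon> ^ h = eta"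
  shows "[u ^ h = - (2 ^ h * fact n)] (mod int p)"
proof -
  \<comment> \<open>The Gauss sum as a polynomial: it takes the value \<open>sqrt p\<close> at
    \<open>zeta p\<close> and vanishes at 1, so that \<open>\<epsilon>\<close> reduces to
    \<open>u / 2\<close>.\<close>
  define T where "T = (\<lambda>x :: complex. \<Sum>a<p. of_int (chi (int a)) * x ^ a)"
  have Tz: "T (zeta p) = of_real (sqrt (real p))"
  proof -
    have "T (zeta p) = (\<Sum>a=0..<int p. of_int (chi a) * e a)"
      unfolding T_def e_nat[symmetric]
      by (rule sum.reindex_bij_witness[where i = nat and j = int]) auto
    then show ?thesis using gauss_sum_chi gauss_sum_eq by simp
  qed
  have T1: "T 1 = 0"
  proof -
    have "T 1 = of_int (\<Sum>a=0..<0+p. chi (int a))" by (simp add: T_def atLeast0LessThan)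
    then show ?thesis by (simp only: sum_chi_period of_int_0)
  qed
  define A where "A = (\<Prod>a\<in>half_res. (- 1) ^ (a - 1) * int a)"
  define B where "B = (\<Prod>a\<in>half_nonres. (- 1) ^ (a - 1) * int a)"
  define F where "F = (\<lambda>x. (of_int u + of_int v * T x) ^ h * (\<Prod>a\<in>half_res. sin_quot a x) +
      of_int (- (2 ^ h)) * (\<Prod>b\<in>half_nonres. sin_quot b x))"
  have "int_poly_fun F" unfolding F_def T_def
    by (intro int_poly_fun_add int_poly_fun_mult int_poly_fun_pow int_poly_fun_prod int_poly_fun_sum
        int_poly_fun_const int_poly_fun_power int_poly_fun_sin_quot)
  moreover have "F (zeta p) = 0"
  proof -
    have "of_int u + of_int v * T (zeta p) = of_real (2 * \<epsilon>)" by (simp add: Tz eps)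
    then have "(of_int u + of_int v * T (zeta p)) ^ h = of_real ((2 * \<epsilon>) ^ h)" by simp
    also have "(2 * \<epsilon>) ^ h = 2 ^ h * eta" by (simp add: power_mult_distrib h)
    finally show ?thesis using eta_sin_quot by (simp add: F_def mult.assoc)
  qed
  moreover have "F 1 = of_int (u ^ h * A - 2 ^ h * B)"
    by (simp add: F_def T1 A_def B_def sin_quot_1 del: of_int_mult) (simp add: )
  ultimately have "int p dvd u ^ h * A - 2 ^ h * B"
    using int_poly_fun_root_imp_dvd[OF prime_p] by blast
  then have "[u ^ h * A = 2 ^ h * B] (mod int p)" by (simp add: cong_iff_dvd_diff)
  then have "[u ^ h * A * A = 2 ^ h * B * A] (mod int p)" by (rule cong_mult[OF _ cong_refl])
  then have c: "[u ^ h * (A * A) = 2 ^ h * (A * B)] (mod int p)" by (simp add: mult_ac)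
  have AB: "A * B = (- 1) ^ m * fact n"
  proof -
    have "A * B = (\<Prod>a\<in>{1..n}. (- 1) ^ (a - 1) * int a)"
      unfolding A_def B_def half_sets(4)[symmetric] using half_sets by (intro prod.union_disjoint[symmetric]) auto
    also have "\<dots> = (\<Prod>a=1..n. (- 1) ^ (a - 1)) * fact n" by (simp add: prod.distrib fact_prod)
    also have "(\<Prod>a=1..2*k. (- 1) ^ (a - 1)) = (- 1 :: int) ^ k" for k
      by (induction k) auto
    from this[of m] have "(\<Prod>a=1..n. (- 1) ^ (a - 1)) = (- 1 :: int) ^ m" using n_eq by simp
    finally show ?thesis .
  qed
  have "A * A = (\<Prod>a\<in>half_res. int a)\<^sup>2"
    unfolding A_def power2_eq_square prod.distrib[symmetric]
    by (rule prod.cong) (auto simp: mult_ac power_mult_distrib[symmetric])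
  then have AA: "[A * A = - ((- 1) ^ m)] (mod int p)" using prod_half_res_square by simp
  have "[u ^ h * (- ((- 1) ^ m)) = 2 ^ h * ((- 1) ^ m * fact n)] (mod int p)"
    using c AA unfolding AB by (meson cong_mult cong_refl cong_sym cong_trans)
  then have "[- ((- 1) ^ m) * (u ^ h * (- ((- 1) ^ m))) = - ((- 1) ^ m) * (2 ^ h * ((- 1) ^ m * fact n))] (mod int p)"
    by (rule cong_mult[OF cong_refl])
  moreover have "- ((- 1 :: int) ^ m) * (u ^ h * (- ((- 1) ^ m))) = u ^ h"
    by (cases "even m") auto
  moreover have "- ((- 1 :: int) ^ m) * (2 ^ h * ((- 1) ^ m * fact n)) = - (2 ^ h * fact n)"
    by (cases "even m") auto
  ultimately show ?thesis by (simp only:)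
qed

end

subsection \<open>The ring of integers of the quadratic field\<close>

text \<open>In lowest terms \<open>s / t\<close> every power \<open>t ^ k\<close> divides
  \<open>D\<close>, which forces \<open>t = 1\<close>.\<close>

lemma rat_bounded_denominator_imp_int:
  fixes r :: real
  assumes "r \<in> \<rat>" "D \<noteq> 0" "\<And>k. of_int D * r ^ k \<in> \<int>"
  shows "r \<in> \<int>"
proof -
  obtain s t :: int where st: "t > 0" "coprime s t" "r = of_int s / of_int t"
    using assms(1) by (metis Rats_cases' of_int_0_less_iff)
  have dvd: "t ^ k dvd D" for k
  proof -
    obtain j where "of_int D * r ^ k = of_int j" using assms(3)[of k] by (auto elim: Ints_cases)
    then have "real_of_int (D * s ^ k) = of_int (t ^ k * j)"
      using st(1) unfolding st(3) by (simp add: field_simps)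
    then have "D * s ^ k = t ^ k * j" by (simp only: of_int_eq_iff)
    then have "t ^ k dvd D * s ^ k" by simp
    moreover have "coprime (t ^ k) (s ^ k)" using st(2) by (simp add: coprime_commute)
    ultimately show ?thesis by (simp add: coprime_dvd_mult_left_iff)
  qed
  have "t = 1"
  proof (rule ccontr)
    assume "t \<noteq> 1"
    then have "t \<ge> 2" using st(1) by simp
    define k where "k = nat \<bar>D\<bar>"
    have "int k < 2 ^ k" using of_nat_less_iff[of k "2 ^ k", where ?'a = int] less_exp[of k] by simp
    also have "\<dots> \<le> t ^ k" using \<open>t \<ge> 2\<close> by (intro power_mono) auto
    also have "\<dots> \<le> \<bar>D\<bar>" using dvd[of k] assms(2) st(1) dvd_imp_le_int[of D "t ^ k"] by simp
    finally show False by (simp add: k_def)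
  qed
  then show ?thesis using st(3) by simp
qed

context prime_1_mod_4
begin

abbreviation sq :: real where "sq \<equiv> sqrt (real p)"

lemma sq_sq [simp]: "sq * sq = real p" by simp

lemma sq_gt_1: "sq > 1" using p_gt_2 by simp

lemma sq_irrational: "sq \<notin> \<rat>"
proof
  assume "sq \<in> \<rat>"
  moreover have "algebraic_int sq" by (intro algebraic_int_sqrt int_imp_algebraic_int) simp
  ultimately have "sq \<in> \<int>" by (rule rational_algebraic_int_is_int[rotated])
  then obtain k where "sq = of_int k" by (auto elim: Ints_cases)
  then have "real p = of_int (k * k)" using sq_sq by simp
  then have "int p = k * k" by (metis of_int_eq_iff of_int_of_nat_eq)
  then obtain c where c: "c \<ge> 0" "int p = c * c" by (metis abs_ge_zero abs_mult_self_eq)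
  then have "c dvd int p" by simp
  then have "c = 1 \<or> c = int p" using prime_int_p c(1) by (metis prime_int_iff)
  then show False using c(2) p_gt_2 by auto
qed

lemma sq_independent:
  assumes "a \<in> \<rat>" "b \<in> \<rat>" "a + b * sq = 0"
  shows "a = 0 \<and> b = 0"
proof -
  have "b = 0"
  proof (rule ccontr)
    assume "b \<noteq> 0"
    then have "sq = - a / b" using assms(3) by (simp add: field_simps)
    then show False using assms sq_irrational by (metis Rats_divide Rats_minus_iff)
  qed
  then show ?thesis using assms by simp
qed

lemma sq_unique:
  assumes "a \<in> \<rat>" "b \<in> \<rat>" "a' \<in> \<rat>" "b' \<in> \<rat>" "a + b * sq = a' + b' * sq"
  shows "a = a' \<and> b = b'"
  using sq_independent[of "a - a'" "b - b'"] assms by (auto simp: algebra_simps)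

text \<open>Conjugation in \<open>K\<close>. It is well defined because \<open>sqrt p\<close> is
  irrational, and meaningful only on \<open>K\<close>; hence the membership premises below.\<close>

definition cj :: "real \<Rightarrow> real" where
  "cj z = (THE w. \<exists>a\<in>\<rat>. \<exists>b\<in>\<rat>. z = a + b * sq \<and> w = a - b * sq)"

lemma cj_eq: "a \<in> \<rat> \<Longrightarrow> b \<in> \<rat> \<Longrightarrow> cj (a + b * sq) = a - b * sq"
  unfolding cj_def by (rule the_equality) (use sq_unique in blast)+

abbreviation K :: "real set" where "K \<equiv> quad_field p"

lemma K_E: assumes "z \<in> K" obtains a b where "a \<in> \<rat>" "b \<in> \<rat>" "z = a + b * sq"
  using assms unfolding quad_field_def by blast

lemma K_I: "a \<in> \<rat> \<Longrightarrow> b \<in> \<rat> \<Longrightarrow> a + b * sq \<in> K"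
  unfolding quad_field_def by blast

lemma Rats_K: "a \<in> \<rat> \<Longrightarrow> a \<in> K"
  using K_I[of a 0] by simp

lemma cj_Rats: "a \<in> \<rat> \<Longrightarrow> cj a = a"
  using cj_eq[of a 0] by simp

lemma K_add: "x \<in> K \<Longrightarrow> y \<in> K \<Longrightarrow> x + y \<in> K \<and> cj (x + y) = cj x + cj y"
proof -
  assume "x \<in> K" "y \<in> K"
  then obtain a b c d where *: "a \<in> \<rat>" "b \<in> \<rat>" "x = a + b * sq" "c \<in> \<rat>" "d \<in> \<rat>" "y = c + d * sq"
    by (metis K_E)
  have e: "x + y = (a + c) + (b + d) * sq" using * by (simp add: algebra_simps)
  have "a + c \<in> \<rat>" "b + d \<in> \<rat>" using * by auto
  from K_I[OF this] cj_eq[OF this] show ?thesis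
    unfolding e by (simp add: * cj_eq algebra_simps)
qed

lemma K_mult: "x \<in> K \<Longrightarrow> y \<in> K \<Longrightarrow> x * y \<in> K \<and> cj (x * y) = cj x * cj y"
proof -
  assume "x \<in> K" "y \<in> K"
  then obtain a b c d where *: "a \<in> \<rat>" "b \<in> \<rat>" "x = a + b * sq" "c \<in> \<rat>" "d \<in> \<rat>" "y = c + d * sq"
    by (metis K_E)
  have "b * d * (sq * sq) = b * d * real p" by (simp only: sq_sq)
  then have e: "x * y = (a * c + real p * b * d) + (a * d + b * c) * sq"
    and e': "(a - b * sq) * (c - d * sq) = (a * c + real p * b * d) - (a * d + b * c) * sq"
    using * by (simp_all add: algebra_simps)
  have "a * c + real p * b * d \<in> \<rat>" "a * d + b * c \<in> \<rat>" using * by auto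
  from K_I[OF this] cj_eq[OF this] show ?thesis
    unfolding e using e' by (simp add: * cj_eq)
qed

lemma cj_nonzero: "x \<in> K \<Longrightarrow> x \<noteq> 0 \<Longrightarrow> cj x \<noteq> 0"
proof
  assume "x \<in> K" "x \<noteq> 0" "cj x = 0"
  then obtain a b where *: "a \<in> \<rat>" "b \<in> \<rat>" "x = a + b * sq" by (metis K_E)
  then have "a + (- b) * sq = 0" using \<open>cj x = 0\<close> cj_eq[of a b] by simp
  then have "a = 0 \<and> - b = 0" using * by (intro sq_independent) auto
  then show False using * \<open>x \<noteq> 0\<close> by simp
qed

lemma K_inverse: "x \<in> K \<Longrightarrow> inverse x \<in> K \<and> cj (inverse x) = inverse (cj x)"
proof (cases "x = 0")
  case False
  assume x: "x \<in> K"
  then obtain a b where *: "a \<in> \<rat>" "b \<in> \<rat>" "x = a + b * sq" by (metis K_E)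
  have cx: "cj x = a - b * sq" using * cj_eq by simp
  have n: "x * cj x = a * a - real p * b * b"
  proof -
    have "x * cj x = x * (a - b * sq)" by (simp only: cx)
    then show ?thesis by (simp add: *(3) algebra_simps)
  qed
  have n0: "a * a - real p * b * b \<noteq> 0" using n cj_nonzero[OF x False] False by (metis mult_eq_0_iff)
  have "inverse x = cj x / (a * a - real p * b * b)" using False n n0 by (simp add: field_simps)
  also have "\<dots> = a / (a * a - real p * b * b) + (- b / (a * a - real p * b * b)) * sq"
    unfolding cx by (simp add: diff_divide_distrib)
  finally have "inverse x \<in> K" using * K_I[of "a / (a * a - real p * b * b)" "- b / (a * a - real p * b * b)"] by auto
  moreover have "cj x * cj (inverse x) = 1"
    using K_mult[OF x \<open>inverse x \<in> K\<close>] False cj_Rats[of 1] by simp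
  ultimately show ?thesis by (metis inverse_unique)
qed (use cj_Rats[of 0] in auto)

lemma K_div: "x \<in> K \<Longrightarrow> y \<in> K \<Longrightarrow> x / y \<in> K \<and> cj (x / y) = cj x / cj y"
  unfolding divide_inverse using K_mult K_inverse by simp

text \<open>\<open>1, om\<close> is the integral basis for \<open>p = 1\<close> modulo 4. As
  \<open>p = 4 m + 1\<close>, the relation is \<open>om ^ 2 = om + m\<close>, with the
  \<open>m\<close> of the locale.\<close>

definition om :: real where "om = (1 + sq) / 2"
definition om' :: real where "om' = (1 - sq) / 2"

lemma om_sum: "om + om' = 1" by (simp add: om_def om'_def field_simps)
lemma om_diff: "om - om' = sq" by (simp add: om_def om'_def field_simps)
lemma p_eq4: "real p = 4 * real m + 1" using p_eq n_eq by simp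
lemma om_sq: "om * om = om + real m" "om' * om' = om' + real m" "om * om' = - real m"
  using p_eq4 by (simp_all add: om_def om'_def field_simps)

definition el :: "int \<Rightarrow> int \<Rightarrow> real" where "el x y = of_int x + of_int y * om"
definition el' :: "int \<Rightarrow> int \<Rightarrow> real" where "el' x y = of_int x + of_int y * om'"

lemma el_alt: "el x y = (of_int x + of_int y / 2) + (of_int y / 2) * sq"
  "el' x y = (of_int x + of_int y / 2) - (of_int y / 2) * sq"
  by (simp_all add: el_def el'_def om_def om'_def field_simps)

lemma el_K: "el x y \<in> K" and cj_el: "cj (el x y) = el' x y"
  unfolding el_alt by (rule K_I cj_eq; simp)+

lemma el_inj: "el x y = el x' y' \<longleftrightarrow> x = x' \<and> y = y'"
proof
  assume "el x y = el x' y'"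
  then have "real_of_int x + of_int y / 2 = of_int x' + of_int y' / 2 \<and> real_of_int y / 2 = of_int y' / 2"
    unfolding el_alt by (intro sq_unique) auto
  then show "x = x' \<and> y = y'" by auto
qed auto

lemma el_add: "el x y + el x' y' = el (x + x') (y + y')"
  by (simp add: el_def algebra_simps)

lemma el_mult: "el x y * el x' y' = el (x * x' + int m * y * y') (x * y' + y * x' + y * y')"
proof -
  have "el x y * el x' y' = of_int x * of_int x' + (of_int x * of_int y' + of_int y * of_int x') * om + of_int y * of_int y' * (om * om)"
    by (simp add: el_def algebra_simps)
  then show ?thesis unfolding om_sq by (simp add: el_def algebra_simps)
qed

lemma el_uminus: "- el x y = el (- x) (- y)" by (simp add: el_def)

lemma el_0: "el 0 0 = 0" and el_1: "el 1 0 = 1" and el_of_int: "el x 0 = of_int x"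
  by (simp_all add: el_def)

lemma el_norm: "el x y * el' x y = of_int (x * x + x * y - int m * y * y)"
proof -
  have "el x y * el' x y = of_int x * of_int x + of_int x * of_int y * (om + om') + of_int y * of_int y * (om * om')"
    by (simp add: el_def el'_def algebra_simps)
  then show ?thesis unfolding om_sum om_sq by (simp add: algebra_simps)
qed

abbreviation OI :: "real set" where "OI \<equiv> carrier (quad_ring_of_ints p)"

section \<open>Algebraic integers of the quadratic field\<close>

lemma root_monic_quadratic_algebraic_int:
  assumes "z * z = of_int s * z + of_int t"
  shows "algebraic_int (z :: real)"
proof (rule algebraic_int.intros[of "[:- of_int t, - of_int s, 1:]"])
  show "lead_coeff [:- real_of_int t, - of_int s, 1:] = 1" by simp
  show "\<forall>i. poly.coeff [:- of_int t, - of_int s, 1:] i \<in> (\<int> :: real set)"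
    by (auto simp: coeff_pCons split: nat.splits)
  show "poly [:- real_of_int t, - of_int s, 1:] z = 0" using assms by (simp add: algebra_simps)
qed

lemma el_algebraic_int: "algebraic_int (el x y)"
proof (rule root_monic_quadratic_algebraic_int)
  have "el x y * el x y = el x y * ((el x y + el' x y) - el' x y)" by simp
  also have "\<dots> = of_int (2 * x + y) * el x y - el x y * el' x y"
  proof -
    have "el x y + el' x y = of_int (2 * x + y)"
      using om_sum by (simp add: el_def el'_def algebra_simps flip: distrib_left)
    then show ?thesis by (simp add: algebra_simps)
  qed
  finally show "el x y * el x y = of_int (2 * x + y) * el x y + of_int (- (x * x + x * y - int m * y * y))"
    unfolding el_norm by simp
qed

text \<open>Together with the next lemma this replaces Gauss's lemma on minimal polynomials: powers of an
  algebraic integer have bounded denominators, hence so do the powers of its norm.\<close>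

lemma algebraic_int_powers_bounded_denominator:
  assumes "z \<in> K" "algebraic_int z"
  obtains D :: int where "D \<noteq> 0" "\<And>k. \<exists>X Y :: int. of_int D * z ^ k = of_int X + of_int Y * sq"
proof -
  obtain f where f: "lead_coeff f = 1" "\<And>i. poly.coeff f i \<in> \<int>" "poly f z = 0"
    using assms(2) by (auto elim: algebraic_int.cases)
  obtain a b where ab: "a \<in> \<rat>" "b \<in> \<rat>" "z = a + b * sq" using assms(1) by (rule K_E)
  obtain s t s' t' :: int where st: "t > 0" "a = of_int s / of_int t" "t' > 0" "b = of_int s' / of_int t'"
    using ab by (metis Rats_cases' of_int_0_less_iff)
  define d where "d = t * t'"
  have d: "d > 0" using st by (simp add: d_def)
  have dz: "of_int d * z = of_int (s * t') + of_int (s' * t) * sq"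
    using st by (simp add: d_def ab(3) field_simps)
  define N where "N = degree f"
  \<comment> \<open>Clears the denominators of \<open>z ^ i\<close> for all \<open>i < N\<close>;
    higher powers reduce to these by the monic integral equation.\<close>
  define D where "D = d ^ N"
  define P where "P = (\<lambda>w. \<exists>X Y :: int. of_int D * w = of_int X + of_int Y * sq)"
  have P_add: "P (w + w')" if w: "P w" "P w'" for w w'
  proof -
    obtain X Y X' Y' :: int where "of_int D * w = of_int X + of_int Y * sq" "of_int D * w' = of_int X' + of_int Y' * sq"
      using w unfolding P_def by blast
    then have "of_int D * (w + w') = of_int (X + X') + of_int (Y + Y') * sq" by (simp add: algebra_simps)
    then show ?thesis unfolding P_def by blast
  qed
  have P_smult: "P (of_int c * w)" if w: "P w" for c w
  proof -
    obtain X Y :: int where "of_int D * w = of_int X + of_int Y * sq"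
      using w unfolding P_def by blast
    moreover have "of_int D * (of_int c * w) = of_int c * (of_int D * w)" by simp
    ultimately have "of_int D * (of_int c * w) = of_int (c * X) + of_int (c * Y) * sq" by (simp add: algebra_simps)
    then show ?thesis unfolding P_def by blast
  qed
  have P_0: "P 0" unfolding P_def by (intro exI[of _ 0]) simp
  have P_sum: "P (\<Sum>i\<in>A. g i)" if "\<And>i. i \<in> A \<Longrightarrow> P (g i)" for A and g :: "nat \<Rightarrow> real"
    using that by (induction A rule: infinite_finite_induct) (auto intro: P_add P_0)
  have pow: "\<exists>X Y :: int. (of_int d * z) ^ i = of_int X + of_int Y * sq" for i
  proof (induction i)
    case 0
    show ?case by (rule exI[of _ 1], rule exI[of _ 0]) simp
  next
    case (Suc i)
    then obtain X Y :: int where XY: "(of_int d * z) ^ i = of_int X + of_int Y * sq" by blast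
    have "(of_int d * z) ^ Suc i = (of_int (s * t') + of_int (s' * t) * sq) * (of_int X + of_int Y * sq)"
      using XY dz by simp
    also have "\<dots> = of_int (s * t') * of_int X + of_int (s' * t) * of_int Y * (sq * sq) +
        (of_int (s * t') * of_int Y + of_int (s' * t) * of_int X) * sq"
      by (simp only: algebra_simps)
    also have "\<dots> = of_int (s * t' * X + s' * t * Y * int p) + of_int (s * t' * Y + s' * t * X) * sq"
      unfolding sq_sq by simp
    finally show ?case by blast
  qed
  have "P (z ^ k)" for k
  proof (induction k rule: less_induct)
    case (less k)
    show ?case
    proof (cases "k < N")
      case True
      obtain X Y :: int where XY: "(of_int d * z) ^ k = of_int X + of_int Y * sq" using pow by blast
      have "d ^ N = d ^ (N - k) * d ^ k" using True by (simp flip: power_add)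
      then have "of_int D * z ^ k = of_int (d ^ (N - k)) * (of_int d * z) ^ k"
        by (simp add: D_def power_mult_distrib)
      also have "\<dots> = of_int (d ^ (N - k) * X) + of_int (d ^ (N - k) * Y) * sq"
        unfolding XY by (simp add: algebra_simps)
      finally show ?thesis unfolding P_def by blast
    next
      case False
      have "0 = (\<Sum>i\<le>N. poly.coeff f i * z ^ i)" using f(3) by (simp add: poly_altdef N_def)
      also have "\<dots> = z ^ N + (\<Sum>i<N. poly.coeff f i * z ^ i)"
        using f(1) by (simp add: N_def lessThan_Suc_atMost[symmetric])
      finally have "z ^ N = - (\<Sum>i<N. poly.coeff f i * z ^ i)" by simp
      then have "z ^ k = - (\<Sum>i<N. poly.coeff f i * z ^ i) * z ^ (k - N)"
        using False by (metis le_add_diff_inverse not_less power_add)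
      also have "\<dots> = (\<Sum>i<N. - poly.coeff f i * z ^ (i + (k - N)))"
        by (simp add: sum_distrib_right sum_negf power_add mult.assoc)
      also have "P \<dots>"
      proof (rule P_sum)
        fix i assume i: "i \<in> {..<N}"
        obtain c where c: "poly.coeff f i = of_int c" using f(2)[of i] by (auto elim: Ints_cases)
        have "P (z ^ (i + (k - N)))" using i False by (intro less) auto
        from P_smult[OF this, of "- c"] show "P (- poly.coeff f i * z ^ (i + (k - N)))" by (simp add: c)
      qed
      finally show ?thesis .
    qed
  qed
  moreover have "D \<noteq> 0" using d by (simp add: D_def)
  ultimately show ?thesis using that[of D] unfolding P_def by blast
qed

lemma norm_int_of_bounded_powers:
  assumes "z \<in> K" "D \<noteq> 0" "\<And>k. \<exists>X Y :: int. of_int D * z ^ k = of_int X + of_int Y * sq"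
  shows "z * cj z \<in> \<int>"
proof (rule rat_bounded_denominator_imp_int)
  obtain a b where ab: "a \<in> \<rat>" "b \<in> \<rat>" "z = a + b * sq" using assms(1) by (rule K_E)
  have "z * cj z = a * a - b * b * (sq * sq)" by (simp add: ab(3) cj_eq[OF ab(1,2)] algebra_simps)
  then show "z * cj z \<in> \<rat>" using ab by simp
  show "D * D \<noteq> 0" using assms(2) by simp
  have pow: "z ^ k \<in> K \<and> cj (z ^ k) = cj z ^ k" for k
    by (induction k) (use K_mult[OF assms(1)] Rats_K[of 1] cj_Rats[of 1] in auto)
  fix k
  obtain X Y :: int where XY: "of_int D * z ^ k = of_int X + of_int Y * sq" using assms(3) by blast
  have "of_int D * cj z ^ k = cj (of_int D * z ^ k)"
    using K_mult[of "of_int D" "z ^ k"] pow[of k] Rats_K[of "of_int D"] cj_Rats[of "of_int D"] by simp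
  also have "\<dots> = of_int X - of_int Y * sq" unfolding XY by (rule cj_eq) auto
  finally have XY': "of_int D * cj z ^ k = of_int X - of_int Y * sq" .
  have "of_int (D * D) * (z * cj z) ^ k = (of_int D * z ^ k) * (of_int D * cj z ^ k)"
    by (simp add: power_mult_distrib)
  also have "\<dots> = (of_int X + of_int Y * sq) * (of_int X - of_int Y * sq)" unfolding XY XY' ..
  also have "\<dots> = of_int X * of_int X - of_int Y * of_int Y * (sq * sq)" by (simp only: algebra_simps)
  also have "\<dots> = of_int (X * X - Y * Y * int p)" unfolding sq_sq by simp
  finally show "of_int (D * D) * (z * cj z) ^ k \<in> \<int>" by simp
qed

text \<open>As \<open>p\<close> is squarefree, \<open>t ^ 2\<close> dividing
  \<open>p * s ^ 2\<close> with \<open>s\<close>, \<open>t\<close> coprime forces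
  \<open>t = 1\<close>. It is applied to twice the coefficient of \<open>sqrt p\<close>.\<close>

lemma int_halves:
  assumes "b \<in> \<rat>" "real p * b * b \<in> \<int>"
  shows "b \<in> \<int>"
proof -
  obtain s t :: int where st: "t > 0" "coprime s t" "b = of_int s / of_int t"
    using assms(1) by (metis Rats_cases' of_int_0_less_iff)
  obtain j where "real p * b * b = of_int j" using assms(2) by (auto elim: Ints_cases)
  then have "real_of_int (int p * (s * s)) = of_int (j * (t * t))"
    using st(1) unfolding st(3) by (simp add: field_simps)
  then have "int p * (s * s) = j * (t * t)" by (simp only: of_int_eq_iff)
  then have "t * t dvd int p * (s * s)" by simp
  moreover have "coprime (t * t) (s * s)" using st(2) by (simp add: coprime_commute)
  ultimately have tt: "t * t dvd int p" by (simp add: coprime_dvd_mult_left_iff)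
  have "t dvd int p" using tt by (meson dvd_mult_left)
  then have "t = 1 \<or> t = int p" using prime_int_p st(1) by (metis prime_int_iff less_imp_le)
  moreover have "t \<noteq> int p"
  proof
    assume "t = int p"
    then have "int p * int p \<le> int p" using tt p_pos zdvd_imp_le by auto
    then show False using p_gt_2 by simp
  qed
  ultimately show ?thesis using st(3) by simp
qed

text \<open>The integral norms of \<open>z\<close> and of \<open>z + 1\<close> make the trace
  \<open>2 a\<close> an integer; then \<open>p * (2 b) ^ 2\<close>, and so \<open>2 b\<close>, is an
  integer. The integral norm also forces \<open>2 a\<close> and \<open>2 b\<close> to have the same
  parity, which is membership in the span of \<open>1, om\<close>.\<close>

lemma OI_iff: "z \<in> OI \<longleftrightarrow> (\<exists>x y. z = el x y)"
proof
  assume "z \<in> OI"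
  then have z: "z \<in> K" "algebraic_int z" by (simp_all add: quad_ring_of_ints_def)
  obtain D where D: "D \<noteq> 0" "\<And>k. \<exists>X Y :: int. of_int D * z ^ k = of_int X + of_int Y * sq"
    using algebraic_int_powers_bounded_denominator[OF z] by blast
  obtain a b where ab: "a \<in> \<rat>" "b \<in> \<rat>" "z = a + b * sq" using z(1) by (rule K_E)
  \<comment> \<open>By the binomial theorem the powers of \<open>z + 1\<close> have the same bounded
    denominator, so its norm is integral as well.\<close>
  have D': "\<exists>X Y :: int. of_int D * (z + 1) ^ k = of_int X + of_int Y * sq" for k
  proof -
    obtain X Y :: "nat \<Rightarrow> int" where XY: "\<And>k. of_int D * z ^ k = of_int (X k) + of_int (Y k) * sq"
      using D(2) by metis
    have "of_int D * (z + 1) ^ k = (\<Sum>i\<le>k. of_nat (k choose i) * (of_int D * z ^ i))"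
      unfolding binomial_ring by (simp add: sum_distrib_left mult_ac)
    also have "\<dots> = of_int (\<Sum>i\<le>k. of_nat (k choose i) * X i) + of_int (\<Sum>i\<le>k. of_nat (k choose i) * Y i) * sq"
      unfolding XY by (simp add: sum_distrib_left sum_distrib_right algebra_simps sum.distrib)
    finally show ?thesis by blast
  qed
  have z1: "z + 1 \<in> K" using K_add[OF z(1) Rats_K[of 1]] by simp
  have N: "z * cj z \<in> \<int>" by (rule norm_int_of_bounded_powers[OF z(1) D])
  have N1: "(z + 1) * cj (z + 1) \<in> \<int>" by (rule norm_int_of_bounded_powers[OF z1 D(1) D'])
  have cz: "cj z = a - b * sq" using ab cj_eq by simp
  have cz1: "cj (z + 1) = a - b * sq + 1" using K_add[OF z(1) Rats_K[of 1]] cj_Rats[of 1] cz by simp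
  have "(z + 1) * cj (z + 1) - z * cj z - 1 = (z + 1) * (a - b * sq + 1) - z * (a - b * sq) - 1"
    by (simp only: cz cz1)
  also have "\<dots> = 2 * a" by (simp add: ab(3) algebra_simps)
  finally have "(z + 1) * cj (z + 1) - z * cj z - 1 = 2 * a" .
  then have "2 * a \<in> \<int>" using N N1 by (metis Ints_1 Ints_diff)
  then obtain t where t: "2 * a = of_int t" by (auto elim: Ints_cases)
  have Nz: "z * cj z = a * a - real p * b * b"
  proof -
    have "z * cj z = z * (a - b * sq)" by (simp only: cz)
    then show ?thesis by (simp add: ab(3) algebra_simps)
  qed
  have "real p * (2 * b) * (2 * b) = (2 * a) * (2 * a) - 4 * (z * cj z)"
    unfolding Nz by (simp add: algebra_simps)
  also have "\<dots> \<in> \<int>"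
    by (rule Ints_diff[OF Ints_mult[OF \<open>2 * a \<in> \<int>\<close> \<open>2 * a \<in> \<int>\<close>] Ints_mult[OF Ints_numeral N]])
  finally have "real p * (2 * b) * (2 * b) \<in> \<int>" .
  moreover have "2 * b \<in> \<rat>" using ab(2) by simp
  ultimately have "2 * b \<in> \<int>" using int_halves by blast
  then obtain s where s: "2 * b = of_int s" by (auto elim: Ints_cases)
  obtain j where j: "z * cj z = of_int j" using N by (auto elim: Ints_cases)
  have "(2 * a) * (2 * a) - real p * ((2 * b) * (2 * b)) = 4 * of_int j" using Nz j by (simp add: algebra_simps)
  then have "real_of_int (t * t - int p * (s * s)) = of_int (4 * j)" unfolding t s by simp
  then have "t * t - int p * (s * s) = 4 * j" by (simp only: of_int_eq_iff)
  moreover have "even (4 * j)" by simp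
  ultimately have "even (t * t - int p * (s * s))" by simp
  then have "even (t - s)" using odd_p by simp
  then obtain x where x: "t - s = 2 * x" by blast
  then have "real_of_int (t - s) = of_int (2 * x)" by (simp only: of_int_eq_iff)
  then have "2 * a - 2 * b = 2 * of_int x" using t s by simp
  then have "z = el x s" unfolding el_alt ab(3) using s by (simp add: field_simps)
  then show "\<exists>x y. z = el x y" by blast
next
  assume "\<exists>x y. z = el x y"
  then show "z \<in> OI" using el_K el_algebraic_int by (auto simp: quad_ring_of_ints_def)
qed

lemma OI_el [simp]: "el x y \<in> OI" by (auto simp: OI_iff)
lemma OI_of_int [simp]: "of_int x \<in> OI" using OI_el[of x 0] by (simp add: el_of_int del: OI_el)
lemma OI_0 [simp]: "0 \<in> OI" and OI_1 [simp]: "1 \<in> OI"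
  using OI_of_int[of 0] OI_of_int[of 1] by (simp_all del: OI_of_int)
lemma OI_add: "x \<in> OI \<Longrightarrow> y \<in> OI \<Longrightarrow> x + y \<in> OI" unfolding OI_iff using el_add by metis
lemma OI_mult: "x \<in> OI \<Longrightarrow> y \<in> OI \<Longrightarrow> x * y \<in> OI" unfolding OI_iff using el_mult by metis
lemma OI_uminus: "x \<in> OI \<Longrightarrow> - x \<in> OI" unfolding OI_iff using el_uminus by metis
lemma OI_K: "x \<in> OI \<Longrightarrow> x \<in> K" unfolding OI_iff using el_K by metis

lemma quad_ring_simps:
  "x \<otimes>\<^bsub>quad_ring_of_ints p\<^esub> y = x * y" "x \<oplus>\<^bsub>quad_ring_of_ints p\<^esub> y = x + y"
  "\<one>\<^bsub>quad_ring_of_ints p\<^esub> = 1" "\<zero>\<^bsub>quad_ring_of_ints p\<^esub> = 0"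
  by (simp_all add: quad_ring_of_ints_def)

lemma quad_ring_ring: "ring (quad_ring_of_ints p)"
proof (rule ringI)
  show "abelian_group (quad_ring_of_ints p)"
  proof (rule abelian_groupI, unfold quad_ring_simps)
    show "\<exists>y\<in>OI. y + x = 0" if "x \<in> OI" for x
      using OI_uminus[OF that] by (intro bexI[of _ "- x"]) auto
  qed (auto intro: OI_add)
  show "monoid (quad_ring_of_ints p)"
    by (rule monoidI, unfold quad_ring_simps) (auto intro: OI_mult)
qed (auto simp: quad_ring_simps algebra_simps)

lemma ideal_iff:
  "ideal I (quad_ring_of_ints p) \<longleftrightarrow> I \<subseteq> OI \<and> 0 \<in> I \<and> (\<forall>x\<in>I. \<forall>y\<in>I. x + y \<in> I) \<and> (\<forall>x\<in>I. \<forall>r\<in>OI. r * x \<in> I)"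
proof
  assume I: "ideal I (quad_ring_of_ints p)"
  interpret ideal I "quad_ring_of_ints p" by (rule I)
  show "I \<subseteq> OI \<and> 0 \<in> I \<and> (\<forall>x\<in>I. \<forall>y\<in>I. x + y \<in> I) \<and> (\<forall>x\<in>I. \<forall>r\<in>OI. r * x \<in> I)"
  proof (intro conjI ballI)
    show "I \<subseteq> OI" by (rule a_subset)
    show "0 \<in> I" using additive_subgroup.zero_closed[OF is_additive_subgroup] by (simp only: quad_ring_simps)
    show "x + y \<in> I" if "x \<in> I" "y \<in> I" for x y
      using additive_subgroup.a_closed[OF is_additive_subgroup that] by (simp only: quad_ring_simps)
    show "r * x \<in> I" if "x \<in> I" "r \<in> OI" for x r
      using I_l_closed[OF that] by (simp only: quad_ring_simps)
  qed
next
  assume I: "I \<subseteq> OI \<and> 0 \<in> I \<and> (\<forall>x\<in>I. \<forall>y\<in>I. x + y \<in> I) \<and> (\<forall>x\<in>I. \<forall>r\<in>OI. r * x \<in> I)"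
  interpret R: ring "quad_ring_of_ints p" by (rule quad_ring_ring)
  have inv: "\<ominus>\<^bsub>quad_ring_of_ints p\<^esub> x = - x" if "x \<in> OI" for x
    using that OI_uminus[OF that] by (intro R.minus_equality) (auto simp: quad_ring_simps)
  have neg: "- x \<in> I" if "x \<in> I" for x
    using I that OI_of_int[of "- 1"] by (metis mult_minus1 of_int_1 of_int_minus)
  show "ideal I (quad_ring_of_ints p)"
  proof (rule idealI[OF quad_ring_ring])
    show "subgroup I (add_monoid (quad_ring_of_ints p))"
    proof (rule R.add.subgroupI)
      show "\<ominus>\<^bsub>quad_ring_of_ints p\<^esub> x \<in> I" if "x \<in> I" for x
        using I that neg inv by auto
    qed (use I in \<open>auto simp: quad_ring_simps\<close>)
  qed (use I in \<open>auto simp: quad_ring_simps mult.commute\<close>)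
qed

lemma Units_iff: "x \<in> Units (quad_ring_of_ints p) \<longleftrightarrow> x \<in> OI \<and> inverse x \<in> OI \<and> x \<noteq> 0"
proof -
  have "x \<in> Units (quad_ring_of_ints p) \<longleftrightarrow> x \<in> OI \<and> (\<exists>y\<in>OI. x * y = 1)"
    unfolding Units_def quad_ring_simps by (auto simp: mult.commute)
  also have "\<dots> \<longleftrightarrow> x \<in> OI \<and> inverse x \<in> OI \<and> x \<noteq> 0"
    by (metis inverse_unique mult_zero_left right_inverse zero_neq_one)
  finally show ?thesis .
qed

end

subsection \<open>Ideals, norms and units\<close>

lemma int_subgroup_cyclic:
  fixes S :: "int set"
  assumes "\<And>x y. x \<in> S \<Longrightarrow> y \<in> S \<Longrightarrow> x + y \<in> S" "\<And>x c. x \<in> S \<Longrightarrow> c * x \<in> S" "z \<in> S" "z \<noteq> 0"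
  obtains d where "d > 0" "\<And>x. x \<in> S \<longleftrightarrow> d dvd x"
proof -
  define P where "P = (\<lambda>n. n > 0 \<and> int n \<in> S)"
  have "\<bar>z\<bar> \<in> S" using assms(2)[OF assms(3), of "sgn z"] by (simp add: abs_sgn mult.commute)
  then have "P (nat \<bar>z\<bar>)" using assms(4) by (simp add: P_def)
  then have d: "P (LEAST n. P n)" by (rule LeastI)
  define d where "d = int (LEAST n. P n)"
  have d0: "d > 0" "d \<in> S" using d by (auto simp: P_def d_def)
  have "d dvd x" if x: "x \<in> S" for x
  proof (rule ccontr)
    assume nd: "\<not> d dvd x"
    have "x mod d = x + (- (x div d)) * d" by (simp add: minus_div_mult_eq_mod[symmetric])
    then have "x mod d \<in> S" using x d0 assms(1,2) by metis
    moreover have "x mod d > 0" using nd d0 by (simp add: dvd_eq_mod_eq_0 order_less_le)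
    ultimately have "P (nat (x mod d))" by (simp add: P_def)
    then have "(LEAST n. P n) \<le> nat (x mod d)" by (rule Least_le)
    then have "d \<le> x mod d" using \<open>x mod d > 0\<close> unfolding d_def by linarith
    then show False using pos_mod_bound[OF d0(1), of x] by linarith
  qed
  moreover have "x \<in> S" if "d dvd x" for x
    using that assms(2)[OF d0(2)] by (auto simp: mult.commute)
  ultimately show ?thesis using that d0 by blast
qed

context prime_1_mod_4
begin

text \<open>The ideal \<open>k (a \<int> + (t + om) \<int>)\<close>; every nonzero ideal has a unique such form, with
  parameters in \<open>triples\<close>.\<close>

definition idl :: "int \<Rightarrow> int \<Rightarrow> int \<Rightarrow> real set" where
  "idl k a t = {el (k * (a * x + t * y)) (k * y) | x y. True}"

definition triples :: "(int \<times> int \<times> int) set" where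
  "triples = {(k, a, t). k \<ge> 1 \<and> a \<ge> 1 \<and> 0 \<le> t \<and> t < a \<and> a dvd t * t + t - int m}"

lemma el_in_idl:
  assumes "k \<ge> 1"
  shows "el X Y \<in> idl k a t \<longleftrightarrow> k dvd Y \<and> k * a dvd X - t * Y"
proof
  assume "el X Y \<in> idl k a t"
  then obtain x y where "X = k * (a * x + t * y)" "Y = k * y" by (auto simp: idl_def el_inj)
  then have "X - t * Y = k * a * x" "Y = k * y" by (simp_all add: algebra_simps)
  then show "k dvd Y \<and> k * a dvd X - t * Y" by simp
next
  assume *: "k dvd Y \<and> k * a dvd X - t * Y"
  then obtain y x where "Y = k * y" "X - t * Y = k * a * x" by (auto elim!: dvdE)
  then have "Y = k * y" "X = k * (a * x + t * y)" by (auto simp: algebra_simps)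
  then show "el X Y \<in> idl k a t" unfolding idl_def by blast
qed

lemma idl_sub: "idl k a t \<subseteq> OI"
  by (auto simp: idl_def)

lemma nonzero_ideals_iff:
  "I \<in> nonzero_ideals p \<longleftrightarrow> I \<subseteq> OI \<and> 0 \<in> I \<and> (\<forall>x\<in>I. \<forall>y\<in>I. x + y \<in> I) \<and> (\<forall>x\<in>I. \<forall>r\<in>OI. r * x \<in> I) \<and> I \<noteq> {0}"
  unfolding nonzero_ideals_def ideal_iff by auto

text \<open>Stability under multiplication by \<open>om\<close> comes from the divisibility in
  \<open>triples\<close>: \<open>t * t + t - m\<close> is the norm of \<open>t + om\<close>.\<close>

lemma idl_ideal:
  assumes "(k, a, t) \<in> triples"
  shows "idl k a t \<in> nonzero_ideals p"
proof -
  have T: "k \<ge> 1" "a \<ge> 1" "a dvd t * t + t - int m" using assms by (auto simp: triples_def)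
  have z: "0 \<in> idl k a t" using el_in_idl[OF T(1), of 0 0] by (simp add: el_0)
  have "el (k * a) 0 \<in> idl k a t" using el_in_idl[OF T(1)] by simp
  moreover have "el (k * a) 0 \<noteq> 0" using T el_inj[of "k * a" 0 0 0] by (simp add: el_0)
  ultimately have nz: "idl k a t \<noteq> {0}" by auto
  have add: "x + y \<in> idl k a t" if xy: "x \<in> idl k a t" "y \<in> idl k a t" for x y
  proof -
    obtain X Y X' Y' where e: "x = el X Y" "y = el X' Y'" using xy idl_sub unfolding OI_iff subset_iff by metis
    have "k dvd Y + Y'" using xy unfolding e el_in_idl[OF T(1)] by simp
    moreover have "k * a dvd (X - t * Y) + (X' - t * Y')" using xy unfolding e el_in_idl[OF T(1)] by (intro dvd_add) auto
    then have "k * a dvd (X + X') - t * (Y + Y')" by (simp add: algebra_simps)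
    ultimately show ?thesis unfolding e el_add el_in_idl[OF T(1)] by simp
  qed
  have mult: "r * x \<in> idl k a t" if x: "x \<in> idl k a t" and r: "r \<in> OI" for x r
  proof -
    obtain X Y where e: "x = el X Y" using x idl_sub unfolding OI_iff subset_iff by metis
    obtain u v where r: "r = el u v" using r unfolding OI_iff by blast
    have kY: "k dvd Y" and kaX: "k * a dvd X - t * Y" using x unfolding e el_in_idl[OF T(1)] by auto
    have "k dvd (X - t * Y) + t * Y" using kY kaX by (intro dvd_add) (auto intro: dvd_mult_left dvd_mult)
    then have kX: "k dvd X" by simp
    have "k dvd u * Y + v * X + v * Y" using kX kY by simp
    moreover have "k * a dvd (u * X + int m * v * Y) - t * (u * Y + v * X + v * Y)"
    proof -
      have "(u * X + int m * v * Y) - t * (u * Y + v * X + v * Y) =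
          (u - v * t) * (X - t * Y) - v * (Y * (t * t + t - int m))"
        by (simp add: algebra_simps)
      moreover have "k * a dvd Y * (t * t + t - int m)" using kY T(3) by (rule mult_dvd_mono)
      ultimately show ?thesis using kaX by (metis dvd_diff dvd_mult)
    qed
    ultimately show ?thesis unfolding e r el_mult el_in_idl[OF T(1)] by simp
  qed
  show ?thesis unfolding nonzero_ideals_iff using idl_sub z nz add mult by blast
qed

text \<open>Hermite normal form: \<open>k\<close> generates the \<open>om\<close>-coordinates of the
  elements of \<open>I\<close>, and \<open>A = k * a\<close> the integers in \<open>I\<close>.
  Multiplication by \<open>om\<close> shows that \<open>k\<close> divides \<open>A\<close> and the
  first coordinate \<open>x0\<close>; multiplication by the conjugate of \<open>t + om\<close> gives
  the divisibility by \<open>a\<close>.\<close>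

lemma ideal_is_idl:
  assumes "I \<in> nonzero_ideals p"
  shows "\<exists>k a t. (k, a, t) \<in> triples \<and> I = idl k a t"
proof -
  have I: "I \<subseteq> OI" "0 \<in> I" "\<And>x y. x \<in> I \<Longrightarrow> y \<in> I \<Longrightarrow> x + y \<in> I"
    "\<And>x r. x \<in> I \<Longrightarrow> r \<in> OI \<Longrightarrow> r * x \<in> I" "I \<noteq> {0}"
    using assms unfolding nonzero_ideals_iff by blast+
  have smult: "el (c * X) (c * Y) \<in> I" if "el X Y \<in> I" for c X Y
    using I(4)[OF that OI_of_int[of c]] by (simp add: el_def algebra_simps)
  obtain X0 Y0 where XY0: "el X0 Y0 \<in> I" "el X0 Y0 \<noteq> 0"
    using I(1,2,5) unfolding OI_iff subset_iff by (metis (mono_tags, lifting) empty_iff insertI1 subsetI subset_singletonD equals0D singletonD subset_antisym)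
  define S where "S = {x. el x 0 \<in> I}"
  \<comment> \<open>The norm of a nonzero element is a nonzero integer in \<open>I\<close>, so
    \<open>S\<close> is not trivial.\<close>
  define N where "N = X0 * X0 + X0 * Y0 - int m * Y0 * Y0"
  have e': "el' X Y = el (X + Y) (- Y)" for X Y
    unfolding el_def el'_def using om_sum by (simp add: algebra_simps flip: distrib_left)
  have "el N 0 = el' X0 Y0 * el X0 Y0" using el_norm[of X0 Y0] by (simp add: N_def el_of_int mult.commute)
  then have NS: "N \<in> S" unfolding S_def using I(4)[OF XY0(1)] e' by simp
  have "el' X0 Y0 \<noteq> 0" using cj_nonzero[OF el_K XY0(2)] by (simp add: cj_el)
  then have "el X0 Y0 * el' X0 Y0 \<noteq> 0" using XY0(2) by simp
  then have "real_of_int N \<noteq> 0" unfolding N_def el_norm[symmetric] .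
  then have N0: "N \<noteq> 0" by simp
  obtain A where A: "A > 0" "\<And>x. x \<in> S \<longleftrightarrow> A dvd x"
  proof (rule int_subgroup_cyclic[OF _ _ NS N0])
    show "x + y \<in> S" if "x \<in> S" "y \<in> S" for x y using that I(3)[of "el x 0" "el y 0"] by (simp add: S_def el_add)
    show "c * x \<in> S" if "x \<in> S" for x c using that smult[of x 0 c] by (simp add: S_def)
  qed blast
  define R where "R = {y. \<exists>x. el x y \<in> I}"
  have omA: "el 0 A \<in> I"
  proof -
    have "A \<in> S" using A by simp
    then show ?thesis using I(4)[of "el A 0" "el 0 1"] by (simp add: S_def el_mult)
  qed
  then have AR: "A \<in> R" "A \<noteq> 0" using A(1) by (auto simp: R_def)
  obtain k where k: "k > 0" "\<And>y. y \<in> R \<longleftrightarrow> k dvd y"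
  proof (rule int_subgroup_cyclic[OF _ _ AR])
    show "x + y \<in> R" if "x \<in> R" "y \<in> R" for x y
    proof -
      obtain u v where "el u x \<in> I" "el v y \<in> I" using \<open>x \<in> R\<close> \<open>y \<in> R\<close> by (auto simp: R_def)
      from I(3)[OF this] show ?thesis by (auto simp: R_def el_add)
    qed
    show "c * x \<in> R" if "x \<in> R" for x c using that smult by (auto simp: R_def)
  qed blast
  obtain a where a: "A = k * a" using k(2) AR(1) by (auto elim: dvdE)
  have a0: "a > 0" using a A(1) k(1) by (metis zero_less_mult_pos)
  obtain x0 where x0: "el x0 k \<in> I" using k(2)[of k] by (auto simp: R_def)
  have "el (int m * k) (x0 + k) \<in> I" using I(4)[OF x0, of "el 0 1"] by (simp add: el_mult)
  then have "x0 + k \<in> R" unfolding R_def by blast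
  then have "k dvd x0 + k" using k(2) by blast
  then have "k dvd x0" by simp
  then obtain t0 where t0: "x0 = k * t0" by (rule dvdE)
  define t where "t = t0 mod a"
  have kt: "el (k * t) k \<in> I"
  proof -
    have "- (t0 div a) * (k * a) \<in> S" using A a by simp
    then have "el x0 k + el (- (t0 div a) * (k * a)) 0 \<in> I" using x0 by (auto simp: S_def intro: I(3))
    also have "el x0 k + el (- (t0 div a) * (k * a)) 0 = el (k * (t0 - t0 div a * a)) k"
      unfolding el_add t0 by (simp add: algebra_simps)
    finally show ?thesis by (simp add: t_def minus_div_mult_eq_mod)
  qed
  have "a dvd t * t + t - int m"
  proof -
    have "el (t + 1) (- 1) * el (k * t) k \<in> I" using kt by (rule I(4)) simp
    also have "el (t + 1) (- 1) * el (k * t) k = el (k * (t * t + t - int m)) 0"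
      unfolding el_mult by (simp add: algebra_simps)
    finally have "k * a dvd k * (t * t + t - int m)" using A a by (simp add: S_def)
    then show ?thesis using k(1) by simp
  qed
  then have T: "(k, a, t) \<in> triples" using k(1) a0 by (auto simp: triples_def t_def)
  have k1: "k \<ge> 1" using k(1) by simp
  have "el X Y \<in> I \<longleftrightarrow> el X Y \<in> idl k a t" for X Y
  proof
    assume XY: "el X Y \<in> I"
    then have "Y \<in> R" by (auto simp: R_def)
    then obtain y where y: "Y = k * y" using k(2) by auto
    have "el X Y + el (- y * (k * t)) (- y * k) \<in> I" using XY smult[OF kt] by (rule I(3))
    also have "el X Y + el (- y * (k * t)) (- y * k) = el (X - t * Y) 0"
      unfolding el_add y by (simp add: algebra_simps)
    finally have "k * a dvd X - t * Y" using A a by (simp add: S_def)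
    then show "el X Y \<in> idl k a t" using y by (simp add: el_in_idl[OF k1])
  next
    assume "el X Y \<in> idl k a t"
    then obtain y z where y: "Y = k * y" and z: "X - t * Y = k * a * z"
      unfolding el_in_idl[OF k1] by (auto elim!: dvdE)
    have "k * a * z \<in> S" using A a by simp
    then have "el (k * a * z) 0 + el (y * (k * t)) (y * k) \<in> I"
      using smult[OF kt] by (auto simp: S_def intro: I(3))
    also have "el (k * a * z) 0 + el (y * (k * t)) (y * k) = el X Y"
      unfolding el_add z[symmetric] y by (simp add: algebra_simps)
    finally show "el X Y \<in> I" .
  qed
  then have "I = idl k a t" using I(1) idl_sub unfolding OI_iff set_eq_iff subset_iff by metis
  with T show ?thesis by blast
qed

text \<open>\<open>k\<close> and \<open>k * a\<close> are read off as generators of the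
  \<open>om\<close>-coordinates and of the integers in the ideal; \<open>t\<close> is then
  determined modulo \<open>a\<close>, hence by its range.\<close>

lemma idl_inj:
  assumes "(k, a, t) \<in> triples" "(k', a', t') \<in> triples" "idl k a t = idl k' a' t'"
  shows "k = k' \<and> a = a' \<and> t = t'"
proof -
  have T: "k \<ge> 1" "a \<ge> 1" "0 \<le> t" "t < a" "k' \<ge> 1" "a' \<ge> 1" "0 \<le> t'" "t' < a'"
    using assms(1,2) by (auto simp: triples_def)
  have mem: "k dvd Y \<and> k * a dvd X - t * Y \<longleftrightarrow> k' dvd Y \<and> k' * a' dvd X - t' * Y" for X Y
    using assms(3) el_in_idl[OF T(1)] el_in_idl[OF T(5)] by metis
  have "k dvd Y \<longleftrightarrow> k' dvd Y" for Y
    using mem[of Y "t * Y"] mem[of Y "t' * Y"] by auto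
  from this[of k] this[of k'] have "k dvd k'" "k' dvd k" by simp_all
  moreover have "0 \<le> k" "0 \<le> k'" using T by simp_all
  ultimately have k: "k = k'" using zdvd_antisym_nonneg by blast
  have "k * a dvd X \<longleftrightarrow> k' * a' dvd X" for X using mem[of 0 X] by simp
  from this[of "k * a"] this[of "k' * a'"] have "k * a dvd k' * a'" "k' * a' dvd k * a" by simp_all
  moreover have "0 \<le> k * a" "0 \<le> k' * a'" using T by simp_all
  ultimately have "k * a = k' * a'" using zdvd_antisym_nonneg by blast
  then have a: "a = a'" using k T(1) by (simp only: mult_cancel_left) simp
  have "k * a dvd k * t - t' * k" using mem[of k "k * t"] k a by simp
  then have "k * a dvd k * (t - t')" by (simp add: algebra_simps)
  then have "a dvd t - t'" using T by simp
  then have "t = t'" using T a dvd_imp_le_int[of "t - t'" a] by fastforce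
  with k a show ?thesis by simp
qed

text \<open>The index of \<open>I\<close> in the ring of integers, read off from the normal form:
  the basis \<open>k a\<close>, \<open>k (t + om)\<close> has determinant
  \<open>k * k * a\<close>.\<close>

definition nrm :: "real set \<Rightarrow> int" where
  "nrm I = (THE c. \<exists>k a t. (k, a, t) \<in> triples \<and> I = idl k a t \<and> c = k * k * a)"

lemma nrm_idl: "(k, a, t) \<in> triples \<Longrightarrow> nrm (idl k a t) = k * k * a"
  unfolding nrm_def by (rule the_equality) (use idl_inj in blast)+

lemma nrm_pos: "I \<in> nonzero_ideals p \<Longrightarrow> nrm I > 0"
  using ideal_is_idl nrm_idl by (fastforce simp: triples_def)

lemma finite_bounded_ideals: "finite {I \<in> nonzero_ideals p. nrm I \<le> B}"
proof -
  have "{I \<in> nonzero_ideals p. nrm I \<le> B} \<subseteq> (\<lambda>(k, a, t). idl k a t) ` ({1..B} \<times> {1..B} \<times> {0..B})"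
  proof
    fix I assume I: "I \<in> {I \<in> nonzero_ideals p. nrm I \<le> B}"
    then obtain k a t where T: "(k, a, t) \<in> triples" "I = idl k a t" using ideal_is_idl by blast
    then have B: "k * k * a \<le> B" using I nrm_idl by auto
    have T': "k \<ge> 1" "a \<ge> 1" "0 \<le> t" "t < a" using T(1) by (auto simp: triples_def)
    have "1 * 1 \<le> k * a" "1 * 1 \<le> k * k" by (rule mult_mono; use T' in simp)+
    then have "k * 1 \<le> k * (k * a)" "1 * a \<le> (k * k) * a"
      using T' by (auto intro!: mult_left_mono mult_right_mono)
    then have "k \<le> B" "a \<le> B" using B by (simp_all add: mult.assoc)
    then show "I \<in> (\<lambda>(k, a, t). idl k a t) ` ({1..B} \<times> {1..B} \<times> {0..B})"
      using T(2) T' by (intro image_eqI[of _ _ "(k, a, t)"]) auto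
  qed
  then show ?thesis by (rule finite_subset) auto
qed

text \<open>The values of this form on an ideal are the multiples of its norm, which shows how the norm
  behaves under scaling without any index computation.\<close>

definition det2 :: "real \<Rightarrow> real \<Rightarrow> real" where
  "det2 x y = (x * cj y - cj x * y) / sq"

lemma det2_el: "det2 (el a b) (el c d) = of_int (b * c - a * d)"
proof -
  have "el a b * el' c d - el' a b * el c d = of_int (b * c - a * d) * (om - om')"
    by (simp add: el_def el'_def algebra_simps)
  then show ?thesis using sq_gt_1 by (simp add: det2_def cj_el om_diff)
qed

lemma det2_ideal:
  assumes "I \<in> nonzero_ideals p"
  shows "{det2 x y | x y. x \<in> I \<and> y \<in> I} = range (\<lambda>j :: int. of_int (nrm I * j))"
proof -
  obtain k a t where T: "(k, a, t) \<in> triples" "I = idl k a t" using ideal_is_idl[OF assms] by blast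
  show ?thesis
  proof (intro equalityI subsetI)
    fix d assume "d \<in> {det2 x y | x y. x \<in> I \<and> y \<in> I}"
    then obtain x y x' y' where "d = det2 (el (k * (a * x + t * y)) (k * y)) (el (k * (a * x' + t * y')) (k * y'))"
      unfolding T(2) idl_def by blast
    also have "\<dots> = of_int (k * k * a * (y * x' - x * y'))"
      unfolding det2_el by (simp add: algebra_simps)
    finally have "d = of_int (nrm I * (y * x' - x * y'))" using T nrm_idl by simp
    then show "d \<in> range (\<lambda>j :: int. of_int (nrm I * j))" by blast
  next
    fix d assume "d \<in> range (\<lambda>j :: int. real_of_int (nrm I * j))"
    then obtain j where j: "d = of_int (k * k * a * j)" using T nrm_idl by auto
    have "d = det2 (el (k * (a * 0 + t * 1)) (k * 1)) (el (k * (a * j + t * 0)) (k * 0))"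
      unfolding det2_el j by (simp add: algebra_simps)
    then show "d \<in> {det2 x y | x y. x \<in> I \<and> y \<in> I}" unfolding T(2) idl_def by blast
  qed
qed

lemma range_of_int_mult_eq:
  fixes A B :: real
  assumes "range (\<lambda>j :: int. A * of_int j) = range (\<lambda>j :: int. B * of_int j)"
  shows "\<bar>A\<bar> = \<bar>B\<bar>"
proof -
  have AB: "A * of_int 1 \<in> range (\<lambda>j :: int. B * of_int j)" "B * of_int 1 \<in> range (\<lambda>j :: int. A * of_int j)"
    using assms by blast+
  obtain i :: int where i: "A = B * of_int i" using AB(1) by auto
  obtain j :: int where j: "B = A * of_int j" using AB(2) by auto
  note ij = i j
  show ?thesis
  proof (cases "A = 0")
    case False
    have "A = A * of_int (i * j)" using ij by (simp add: mult_ac)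
    then have "real_of_int (i * j) = of_int 1" using False by simp
    then have "i * j = 1" by (simp only: of_int_eq_iff)
    then have "\<bar>i\<bar> = 1" using zmult_eq_1_iff by auto
    then have "\<bar>real_of_int i\<bar> = 1" by linarith
    then show ?thesis using ij(1) by (simp add: abs_mult)
  next
    case True
    then have "B = 0" using ij(2) by simp
    then show ?thesis using True by simp
  qed
qed

text \<open>Multiplying both arguments by \<open>\<alpha>\<close> multiplies \<open>det2\<close> by
  the norm of \<open>\<alpha>\<close>; comparing the values on the common image gives the equality
  up to sign.\<close>

lemma nrm_scale:
  assumes "I \<in> nonzero_ideals p" "J \<in> nonzero_ideals p" "\<alpha> \<in> OI" "\<beta> \<in> OI"
    and eq: "(\<lambda>x. \<alpha> * x) ` I = (\<lambda>x. \<beta> * x) ` J"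
  shows "\<bar>\<alpha> * cj \<alpha>\<bar> * nrm I = \<bar>\<beta> * cj \<beta>\<bar> * nrm J"
proof -
  have *: "{det2 x y | x y. x \<in> (\<lambda>x. \<alpha> * x) ` I \<and> y \<in> (\<lambda>x. \<alpha> * x) ` I} =
      range (\<lambda>j :: int. (\<alpha> * cj \<alpha> * nrm I) * of_int j)"
    if "I \<in> nonzero_ideals p" "\<alpha> \<in> OI" for I \<alpha>
  proof -
    have sub: "I \<subseteq> K" using that(1) OI_K unfolding nonzero_ideals_iff by blast
    have "det2 (\<alpha> * x) (\<alpha> * y) = (\<alpha> * cj \<alpha>) * det2 x y" if "x \<in> I" "y \<in> I" for x y
    proof -
      have "x \<in> K" "y \<in> K" "\<alpha> \<in> K" using that sub \<open>\<alpha> \<in> OI\<close> OI_K by auto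
      then show ?thesis using K_mult by (simp add: det2_def algebra_simps diff_divide_distrib)
    qed
    note d = this
    have "{det2 x y | x y. x \<in> (\<lambda>x. \<alpha> * x) ` I \<and> y \<in> (\<lambda>x. \<alpha> * x) ` I} =
        (\<lambda>d. (\<alpha> * cj \<alpha>) * d) ` {det2 x y | x y. x \<in> I \<and> y \<in> I}" (is "?L = ?R")
    proof (intro equalityI subsetI)
      fix v assume "v \<in> ?L"
      then obtain x y where xy: "x \<in> I" "y \<in> I" "v = det2 (\<alpha> * x) (\<alpha> * y)" by blast
      show "v \<in> ?R" unfolding xy(3) d[OF xy(1,2)] using xy(1,2) by (intro imageI) blast
    next
      fix v assume "v \<in> ?R"
      then obtain x y where xy: "x \<in> I" "y \<in> I" "v = (\<alpha> * cj \<alpha>) * det2 x y" by blast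
      show "v \<in> ?L" unfolding xy(3) d[OF xy(1,2), symmetric] using xy(1,2) by blast
    qed
    also have "\<dots> = range (\<lambda>j :: int. (\<alpha> * cj \<alpha> * nrm I) * of_int j)"
      unfolding det2_ideal[OF that(1)] by (auto simp: image_image mult.assoc)
    finally show ?thesis .
  qed
  have "\<bar>\<alpha> * cj \<alpha> * nrm I\<bar> = \<bar>\<beta> * cj \<beta> * nrm J\<bar>"
    by (rule range_of_int_mult_eq) (use *[OF assms(1,3)] *[OF assms(2,4)] eq in simp)
  then show ?thesis using nrm_pos[OF assms(1)] nrm_pos[OF assms(2)] by (simp add: abs_mult)
qed

section \<open>Existence of a nontrivial unit\<close>

lemma OI_norm_int:
  assumes "x \<in> OI" obtains N :: int where "x * cj x = of_int N" "x \<noteq> 0 \<Longrightarrow> N \<noteq> 0"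
proof -
  obtain a b where x: "x = el a b" using assms OI_iff by blast
  have N: "x * cj x = of_int (a * a + a * b - int m * b * b)" unfolding x cj_el by (rule el_norm)
  moreover have "x * cj x \<noteq> 0" if "x \<noteq> 0" using that cj_nonzero[OF OI_K[OF assms]] by simp
  ultimately show ?thesis using that by (metis of_int_0)
qed

lemma unit_norm:
  assumes "x \<in> Units (quad_ring_of_ints p)"
  shows "\<bar>x * cj x\<bar> = 1"
proof -
  have x: "x \<in> OI" "inverse x \<in> OI" "x \<noteq> 0" using assms unfolding Units_iff by auto
  obtain N where N: "x * cj x = of_int N" using OI_norm_int[OF x(1)] by blast
  obtain M where M: "inverse x * cj (inverse x) = of_int M" using OI_norm_int[OF x(2)] by blast
  have "of_int N * of_int M = (x * inverse x) * (cj x * cj (inverse x))" unfolding N[symmetric] M[symmetric] by (simp only: mult_ac)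
  also have "\<dots> = 1" using x K_inverse[OF OI_K[OF x(1)]] cj_nonzero[OF OI_K[OF x(1)]] by simp
  finally have "real_of_int (N * M) = of_int 1" by simp
  then have "N * M = 1" by (simp only: of_int_eq_iff)
  then have "\<bar>N\<bar> = 1" using zmult_eq_1_iff by auto
  then show ?thesis unfolding N by linarith
qed

lemma idl_unit_triple: "(1, 1, 0) \<in> triples" by (simp add: triples_def)

lemma idl_OI: "idl 1 1 0 = OI"
proof -
  have "el X Y \<in> idl 1 1 0" for X Y by (simp add: el_in_idl)
  then have "OI \<subseteq> idl 1 1 0" by (auto simp: OI_iff)
  then show ?thesis using idl_sub[of 1 1 0] by blast
qed

text \<open>Infinitely many integers of bounded norm generate only finitely many ideals; the quotient of
  two of them generating the same ideal is a unit.\<close>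

lemma ex_unit_gt_1: "\<exists>x \<in> Units (quad_ring_of_ints p). x > 1"
proof -
  \<comment> \<open>Dirichlet's approximation yields \<open>x\<close> of size below
    \<open>1 / N\<close> with a conjugate of size at most \<open>1 + N sqrt p\<close>, so the norms
    stay below \<open>1 / N + sqrt p \<le> B\<close>.\<close>
  define B where "B = 1 + sq"
  define S where "S = {x \<in> OI. x > 0 \<and> \<bar>x * cj x\<bar> \<le> B}"
  have small: "\<exists>x\<in>S. x < 1 / real N" if N0: "N > 0" for N :: nat
  proof -
    obtain h k where hk: "0 < k" "k \<le> int N" "\<bar>of_int k * om - of_int h\<bar> < 1 / real N"
      using Dirichlet_approx[OF N0, of om] by blast
    define x where "x = el (- h) k"
    have x: "\<bar>x\<bar> < 1 / real N" using hk(3) by (simp add: x_def el_def)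
    have x0: "x \<noteq> 0" using el_inj[of "- h" k 0 0] hk(1) by (simp add: x_def el_0)
    have "cj x = x - of_int k * sq" unfolding x_def cj_el by (simp add: el_def el'_def om_diff[symmetric] algebra_simps)
    then have "\<bar>cj x\<bar> \<le> \<bar>x\<bar> + of_int k * sq" using hk(1) sq_gt_1 by (simp add: abs_triangle_ineq4 order_trans[OF abs_triangle_ineq4] abs_mult)
    also have "\<dots> \<le> 1 + real N * sq"
    proof -
      have "1 / real N \<le> 1" using that by simp
      moreover have "real_of_int k \<le> real N" using hk(2) by linarith
      then have "of_int k * sq \<le> real N * sq" using sq_gt_1 by (intro mult_right_mono) auto
      ultimately show ?thesis using x by linarith
    qed
    finally have "\<bar>x\<bar> * \<bar>cj x\<bar> \<le> (1 / real N) * (1 + real N * sq)" using x by (intro mult_mono) auto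
    also have "\<dots> = 1 / real N + sq" using that by (simp add: field_simps)
    also have "\<dots> \<le> B" using that by (simp add: B_def)
    finally have B: "\<bar>x * cj x\<bar> \<le> B" by (simp add: abs_mult)
    have xO: "x \<in> OI" by (simp add: x_def)
    have cm: "cj (- x) = - cj x" unfolding x_def el_uminus cj_el by (simp add: el'_def)
    show ?thesis
    proof (cases "x > 0")
      case True
      then show ?thesis using x xO B by (auto simp: S_def)
    next
      case False
      then show ?thesis using x xO B x0 OI_uminus[OF xO] cm by (intro bexI[of _ "- x"]) (auto simp: S_def)
    qed
  qed
  \<comment> \<open>Elements of \<open>S\<close> are positive but arbitrarily small, so
    \<open>S\<close> cannot have a minimum.\<close>
  have inf: "infinite S"
  proof
    assume fin: "finite S"
    moreover have "S \<noteq> {}" using small[of 1] by auto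
    ultimately have "Min S > 0" by (auto simp: S_def)
    then obtain N :: nat where N: "N > 0" "1 / real N < Min S"
      using ex_inverse_of_nat_less[of "Min S"] by (auto simp: inverse_eq_divide)
    then obtain x where "x \<in> S" "x < Min S" using small[of N] by fastforce
    then show False using fin by (meson Min_le not_less)
  qed
  define P where "P = (\<lambda>x. (\<lambda>y. x * y) ` OI)"
  have P: "P x \<in> {I \<in> nonzero_ideals p. nrm I \<le> \<lfloor>B\<rfloor>}" if "x \<in> S" for x
  proof -
    have x: "x \<in> OI" "x \<noteq> 0" using that by (auto simp: S_def)
    have id: "P x \<in> nonzero_ideals p"
      unfolding nonzero_ideals_iff
    proof (intro conjI ballI)
      show "P x \<subseteq> OI" using x by (auto simp: P_def intro: OI_mult)
      show "0 \<in> P x" unfolding P_def by (rule image_eqI[of _ _ 0]) auto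
      show "a + b \<in> P x" if "a \<in> P x" "b \<in> P x" for a b
        using that unfolding P_def by (auto simp: distrib_left[symmetric] intro!: imageI OI_add)
      show "r * a \<in> P x" if "a \<in> P x" "r \<in> OI" for a r
        using that unfolding P_def by (auto simp: mult.left_commute[of r] intro!: imageI OI_mult)
      have "x * 1 \<in> P x" unfolding P_def by (intro imageI) simp
      then show "P x \<noteq> {0}" using x by auto
    qed
    have "(\<lambda>y. x * y) ` OI = (\<lambda>y. 1 * y) ` P x" by (simp add: P_def)
    moreover have "OI \<in> nonzero_ideals p" using idl_ideal[OF idl_unit_triple] idl_OI by simp
    ultimately have "\<bar>x * cj x\<bar> * nrm OI = \<bar>1 * cj 1\<bar> * nrm (P x)"
      using id x by (intro nrm_scale) auto
    moreover have "nrm OI = 1" using nrm_idl[OF idl_unit_triple] idl_OI by simp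
    ultimately have "real_of_int (nrm (P x)) \<le> B" using that by (simp add: S_def cj_Rats)
    then show ?thesis using id by (simp add: le_floor_iff)
  qed
  have "finite (P ` S)" by (rule finite_subset[OF _ finite_bounded_ideals[of "\<lfloor>B\<rfloor>"]]) (use P in blast)
  then have "\<not> inj_on P S" using inf finite_imageD by blast
  then obtain x y where xy: "x \<in> S" "y \<in> S" "x \<noteq> y" "P x = P y" by (auto simp: inj_on_def)
  have key: "x / y \<in> OI" if h: "x \<in> S" "y \<in> S" "P x = P y" for x y
  proof -
    have "x * 1 \<in> P x" unfolding P_def by (intro imageI) simp
    then have "x \<in> P y" using h(3) by simp
    then obtain z where "z \<in> OI" "x = y * z" unfolding P_def by blast
    then show ?thesis using h by (auto simp: S_def)
  qed
  have unit: "x / y \<in> Units (quad_ring_of_ints p)" if "x \<in> S" "y \<in> S" "P x = P y" for x y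
    using key[of x y] key[of y x] that by (auto simp: Units_iff S_def)
  have "x > 0" "y > 0" using xy by (auto simp: S_def)
  then consider "x / y > 1" | "y / x > 1" using xy(3) by (cases "x < y") auto
  then show ?thesis
  proof cases
    case 1
    then show ?thesis using unit[of x y] xy by auto
  next
    case 2
    then show ?thesis using unit[of y x] xy by auto
  qed
qed

end

subsection \<open>The fundamental unit and ideal classes\<close>

lemma ln_power_int:
  fixes x :: real
  assumes "x > 0"
  shows "ln (x powi k) = of_int k * ln x"
  using assms by (auto simp: power_int_def ln_realpow ln_inverse)

lemma power_int_less_imp_less:
  fixes x :: real
  assumes "x > 1" "x powi j < x powi k"
  shows "j < k"
  using assms power_int_increasing[of k j x] by force

context prime_1_mod_4
begin

abbreviation UU :: "real set" where "UU \<equiv> Units (quad_ring_of_ints p)"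

lemma UU_OI: "x \<in> UU \<Longrightarrow> x \<in> OI" and UU_nonzero: "x \<in> UU \<Longrightarrow> x \<noteq> 0"
  and UU_inverse: "x \<in> UU \<Longrightarrow> inverse x \<in> UU"
  by (auto simp: Units_iff)

lemma UU_mult: "x \<in> UU \<Longrightarrow> y \<in> UU \<Longrightarrow> x * y \<in> UU"
  by (auto simp: Units_iff intro: OI_mult)

lemma UU_uminus: "x \<in> UU \<Longrightarrow> - x \<in> UU"
  by (auto simp: Units_iff intro: OI_uminus)

lemma UU_1: "1 \<in> UU" by (auto simp: Units_iff)

lemma UU_power: "x \<in> UU \<Longrightarrow> x ^ k \<in> UU"
  by (induction k) (auto intro: UU_mult UU_1)

lemma UU_powi: "x \<in> UU \<Longrightarrow> x powi k \<in> UU"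
  unfolding power_int_def by (auto intro: UU_power UU_inverse)

lemma UU_cj: "x \<in> UU \<Longrightarrow> \<bar>cj x\<bar> = inverse \<bar>x\<bar>"
  using unit_norm[of x] UU_nonzero[of x] by (simp add: abs_mult field_simps)

text \<open>The conjugate of a unit above 1 has absolute value below 1, so sum and difference with
  the conjugate, which are \<open>2 a + b\<close> and \<open>b sqrt p\<close>, are bounded.\<close>

lemma finite_bounded_units: "finite {x \<in> UU. 1 < x \<and> x \<le> B}"
proof -
  define C where "C = \<lceil>B\<rceil> + 1"
  have "{x \<in> UU. 1 < x \<and> x \<le> B} \<subseteq> (\<lambda>(a, b). el a b) ` ({-C..C} \<times> {-C..C})"
  proof
    fix x assume x: "x \<in> {x \<in> UU. 1 < x \<and> x \<le> B}"
    then obtain a b where ab: "x = el a b" using UU_OI OI_iff by blast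
    have "\<bar>cj x\<bar> < 1" using x UU_cj[of x] by (simp add: inverse_eq_divide)
    then have c: "\<bar>el' a b\<bar> < 1" unfolding ab cj_el .
    have xB: "1 < el a b" "el a b \<le> of_int \<lceil>B\<rceil>" using x ab by (auto intro: order_trans le_of_int_ceiling)
    have d: "el a b - el' a b = of_int b * sq" by (simp add: el_def el'_def om_diff[symmetric] algebra_simps)
    have s: "el a b + el' a b = of_int (2 * a + b)"
      using om_sum by (simp add: el_def el'_def algebra_simps flip: distrib_left)
    have "\<bar>of_int b * sq\<bar> < of_int C" unfolding d[symmetric] C_def using c xB by simp
    moreover have "\<bar>real_of_int b\<bar> * 1 \<le> \<bar>of_int b\<bar> * sq" using sq_gt_1 by (intro mult_left_mono) auto
    ultimately have "\<bar>real_of_int b\<bar> < of_int C" using sq_gt_1 by (simp add: abs_mult)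
    then have b: "\<bar>b\<bar> < C" by linarith
    have "\<bar>real_of_int (2 * a + b)\<bar> < of_int C" unfolding s[symmetric] C_def using c xB by simp
    then have "\<bar>2 * a + b\<bar> < C" by linarith
    then have "\<bar>a\<bar> \<le> C" using b by linarith
    then show "x \<in> (\<lambda>(a, b). el a b) ` ({-C..C} \<times> {-C..C})"
      using b ab by (intro image_eqI[of _ _ "(a, b)"]) auto
  qed
  then show ?thesis by (rule finite_subset) auto
qed

definition fund_prop :: "real \<Rightarrow> bool" where
  "fund_prop \<epsilon> \<longleftrightarrow> \<epsilon> > 1 \<and> \<epsilon> \<in> UU \<and> (\<forall>x \<in> UU. \<exists>k::int. x = \<epsilon> powi k \<or> x = - (\<epsilon> powi k))"

text \<open>The least unit above 1 works: dividing a positive unit by a suitable power brings it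
  into \<open>[1, \<epsilon>)\<close>, where by minimality only 1 is left.\<close>

lemma ex_fund_prop: "\<exists>\<epsilon>. fund_prop \<epsilon>"
proof -
  obtain B where B: "B \<in> UU" "B > 1" using ex_unit_gt_1 by blast
  define S where "S = {x \<in> UU. 1 < x \<and> x \<le> B}"
  have S: "finite S" "B \<in> S" using finite_bounded_units B by (auto simp: S_def)
  define \<epsilon> where "\<epsilon> = Min S"
  have \<epsilon>: "\<epsilon> \<in> S" unfolding \<epsilon>_def using S by (intro Min_in) auto
  then have e1: "\<epsilon> > 1" "\<epsilon> \<in> UU" "\<epsilon> \<le> B" by (auto simp: S_def)
  have min: "\<epsilon> \<le> x" if "x \<in> UU" "x > 1" for x
  proof (cases "x \<le> B")
    case True
    then have "x \<in> S" using that by (simp add: S_def)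
    then show ?thesis unfolding \<epsilon>_def using S(1) by simp
  qed (use e1 in simp)
  have pos: "\<exists>k::int. x = \<epsilon> powi k" if x: "x \<in> UU" "x > 0" for x
  proof -
    define k where "k = \<lfloor>ln x / ln \<epsilon>\<rfloor>"
    have ek: "\<epsilon> powi k > 0" using e1 by (simp add: zero_less_power_int)
    define y where "y = x * inverse (\<epsilon> powi k)"
    have yU: "y \<in> UU" unfolding y_def using x e1 by (intro UU_mult UU_inverse UU_powi)
    have y0: "y > 0" using x ek by (simp add: y_def)
    have lne: "ln \<epsilon> > 0" using e1 by simp
    have "ln y = ln x - of_int k * ln \<epsilon>"
      using x ek e1 by (simp add: y_def ln_mult ln_inverse ln_power_int)
    moreover have "of_int k * ln \<epsilon> \<le> ln x" "ln x < (of_int k + 1) * ln \<epsilon>"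
      using floor_divide_lower[OF lne, of "ln x"] floor_divide_upper[OF lne, of "ln x"] by (simp_all add: k_def)
    ultimately have "0 \<le> ln y" "ln y < ln \<epsilon>" by (simp_all add: algebra_simps)
    then have "1 \<le> y" "y < \<epsilon>" using y0 e1 by auto
    then have "y = 1" using min[OF yU] by fastforce
    then show ?thesis using ek by (auto simp: y_def field_simps)
  qed
  have "\<exists>k::int. x = \<epsilon> powi k \<or> x = - (\<epsilon> powi k)" if x: "x \<in> UU" for x
  proof (cases "x > 0")
    case False
    then have "- x > 0" using UU_nonzero[OF x] by simp
    then obtain k where "- x = \<epsilon> powi k" using pos[OF UU_uminus[OF x]] by blast
    then have "x = - (\<epsilon> powi k)" by simp
    then show ?thesis by blast
  qed (use pos x in blast)
  then show ?thesis using e1 unfolding fund_prop_def by blast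
qed

lemma fund_prop_unique: "fund_prop \<epsilon> \<Longrightarrow> fund_prop \<epsilon>' \<Longrightarrow> \<epsilon> = \<epsilon>'"
proof -
  have le: "\<epsilon> \<le> \<epsilon>'" if fp: "fund_prop \<epsilon>" "fund_prop \<epsilon>'" for \<epsilon> \<epsilon>'
  proof -
    have \<epsilon>: "\<epsilon> > 1" "\<epsilon>' > 1" using that by (auto simp: fund_prop_def)
    obtain k :: int where "\<epsilon>' = \<epsilon> powi k \<or> \<epsilon>' = - (\<epsilon> powi k)" using fp unfolding fund_prop_def by blast
    moreover have "\<epsilon> powi k > 0" using \<epsilon> by (simp add: zero_less_power_int)
    ultimately have k: "\<epsilon>' = \<epsilon> powi k" using \<epsilon> by linarith
    have "k \<ge> 1"
    proof (rule ccontr)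
      assume "\<not> k \<ge> 1"
      then have "\<epsilon> powi k \<le> \<epsilon> powi 0" using \<epsilon> by (intro power_int_increasing) auto
      then show False using k \<epsilon> by simp
    qed
    then have "\<epsilon> powi 1 \<le> \<epsilon> powi k" using \<epsilon> by (intro power_int_increasing) auto
    then show ?thesis using k by simp
  qed
  assume "fund_prop \<epsilon>" "fund_prop \<epsilon>'"
  then show ?thesis using le by (meson order_antisym)
qed

abbreviation eps :: real where "eps \<equiv> fundamental_unit p"

lemma eps_prop: "fund_prop eps"
proof -
  obtain e where e: "fund_prop e" using ex_fund_prop by blast
  have "fundamental_unit p = (THE e. fund_prop e)" unfolding fundamental_unit_def fund_prop_def ..
  then show ?thesis using theI[of fund_prop, OF e] fund_prop_unique e by metis
qed

lemma eps_gt_1: "eps > 1" and eps_UU: "eps \<in> UU"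
  and UU_cases: "x \<in> UU \<Longrightarrow> \<exists>k::int. x = eps powi k \<or> x = - (eps powi k)"
  using eps_prop unfolding fund_prop_def by blast+

lemma fund_u_eq: "\<exists>v :: int. eps = (of_int (fund_u p) + of_int v * sq) / 2"
proof -
  obtain a b where ab: "eps = el a b" using UU_OI[OF eps_UU] OI_iff by blast
  then have e: "eps = (of_int (2 * a + b) + of_int b * sq) / 2" by (simp add: el_def om_def field_simps)
  have "fund_u p = 2 * a + b"
    unfolding fund_u_def
  proof (rule the_equality)
    show "\<exists>v :: int. eps = (of_int (2 * a + b) + of_int v * sq) / 2" using e by blast
    fix u assume "\<exists>v :: int. eps = (of_int u + of_int v * sq) / 2"
    then obtain v :: int where "eps = (of_int u + of_int v * sq) / 2" by blast
    then have "real_of_int u + of_int v * sq = of_int (2 * a + b) + of_int b * sq" using e by simp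
    then have "real_of_int u = of_int (2 * a + b) \<and> real_of_int v = of_int b"
      by (intro sq_unique) auto
    then show "u = 2 * a + b" by (simp only: of_int_eq_iff)
  qed
  then show ?thesis using e by metis
qed

text \<open>\<open>u ^ 2 - p v ^ 2\<close> is 4 times the norm of \<open>eps\<close>, which is 1 or
  - 1. The sign is settled only in the proof of Chowla's congruence.\<close>

lemma fund_u_norm: "[(fund_u p)\<^sup>2 = 4] (mod int p) \<or> [(fund_u p)\<^sup>2 = - 4] (mod int p)"
proof -
  obtain v :: int where v: "eps = (of_int (fund_u p) + of_int v * sq) / 2" using fund_u_eq by blast
  then have e: "eps = of_int (fund_u p) / 2 + (of_int v / 2) * sq" by (simp add: field_simps)
  have "cj (of_int (fund_u p) / 2 + (of_int v / 2) * sq) = of_int (fund_u p) / 2 - (of_int v / 2) * sq"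
    by (rule cj_eq) auto
  then have c: "cj eps = of_int (fund_u p) / 2 - (of_int v / 2) * sq" unfolding e[symmetric] .
  have "eps * cj eps = (of_int (fund_u p) / 2 + (of_int v / 2) * sq) * (of_int (fund_u p) / 2 - (of_int v / 2) * sq)"
    unfolding c by (subst e) simp
  then have "4 * (eps * cj eps) = of_int (fund_u p) * of_int (fund_u p) - of_int v * of_int v * (sq * sq)"
    by (simp add: field_simps)
  then have "4 * (eps * cj eps) = of_int ((fund_u p)\<^sup>2 - int p * (v * v))"
    unfolding sq_sq by (simp add: power2_eq_square)
  moreover have "eps * cj eps = 1 \<or> eps * cj eps = - 1" using unit_norm[OF eps_UU] by linarith
  ultimately have "real_of_int ((fund_u p)\<^sup>2 - int p * (v * v)) = of_int 4 \<or>
      real_of_int ((fund_u p)\<^sup>2 - int p * (v * v)) = of_int (- 4)" by auto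
  then have "(fund_u p)\<^sup>2 - 4 = int p * (v * v) \<or> (fund_u p)\<^sup>2 - (- 4) = int p * (v * v)"
    unfolding of_int_eq_iff by auto
  then show ?thesis by (auto simp: cong_iff_dvd_diff)
qed

text \<open>An ideal \<open>J\<close> is equivalent to \<open>I = idl 1 a t\<close> iff \<open>a J = \<lambda> I\<close> for some nonzero \<open>\<lambda>\<close> in the conjugate of
  \<open>I\<close>, which is determined up to units. The elements of that conjugate are the \<open>lam a t r s\<close>, with
  conjugates \<open>lam' a t r s\<close>, and \<open>dom\<close> selects one \<open>\<lambda>\<close> from each orbit of the units.\<close>

definition lam :: "int \<Rightarrow> int \<Rightarrow> int \<Rightarrow> int \<Rightarrow> real" where
  "lam a t r s = el (r * a + s * t + s) (- s)"

definition lam' :: "int \<Rightarrow> int \<Rightarrow> int \<Rightarrow> int \<Rightarrow> real" where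
  "lam' a t r s = el (r * a + s * t) s"

lemma el'_eq: "el' x y = el (x + y) (- y)"
proof -
  have "om' = 1 - om" using om_sum by simp
  then have "el' x y = of_int x + of_int y * (1 - om)" by (simp only: el'_def)
  then show ?thesis by (simp add: el_def algebra_simps)
qed

lemma cj_lam: "cj (lam a t r s) = lam' a t r s"
  by (simp add: lam_def lam'_def cj_el el'_eq)

lemma lam_OI: "lam a t r s \<in> OI" by (simp add: lam_def)

lemma lam_inj: "a \<noteq> 0 \<Longrightarrow> lam a t r s = lam a t r' s' \<longleftrightarrow> r = r' \<and> s = s'"
  unfolding lam_def el_inj by auto

abbreviation scale :: "real \<Rightarrow> real set \<Rightarrow> real set" where "scale c I \<equiv> (\<lambda>x. c * x) ` I"

lemma scale_scale: "scale c (scale d I) = scale (c * d) I"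
  by (simp add: image_image mult.assoc)

lemma scale_cancel: "c \<noteq> 0 \<Longrightarrow> scale c I = scale c J \<Longrightarrow> I = J"
  by (rule inj_image_eq_iff[THEN iffD1, of "\<lambda>x. c * x"]) (auto simp: inj_def)

lemma el_in_idl_1: "el X Y \<in> idl 1 a t \<longleftrightarrow> a dvd X - t * Y"
  by (simp add: el_in_idl)

text \<open>The product of the ideal with its conjugate lies in the ideal generated by
  \<open>a\<close>: for \<open>t + om\<close> times its conjugate this is the divisibility in
  \<open>triples\<close>.\<close>

lemma lam_scale_sub:
  assumes T: "(1, a, t) \<in> triples"
  shows "scale (lam a t r s) (idl 1 a t) \<subseteq> scale (of_int a) OI"
proof
  fix z assume "z \<in> scale (lam a t r s) (idl 1 a t)"
  then obtain x where x: "x \<in> idl 1 a t" "z = lam a t r s * x" by blast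
  obtain X Y where XY: "x = el X Y" using x(1) idl_sub OI_iff by blast
  then have "a dvd X - t * Y" using x(1) by (simp add: el_in_idl_1)
  then obtain w where "X - t * Y = a * w" by (rule dvdE)
  then have w: "X = a * w + t * Y" by simp
  obtain c where c: "t * t + t - int m = a * c" using T by (auto simp: triples_def elim: dvdE)
  have "z = el ((r * a + s * t + s) * X + int m * (- s) * Y) ((r * a + s * t + s) * Y + (- s) * X + (- s) * Y)"
    unfolding x(2) XY lam_def el_mult ..
  also have "(r * a + s * t + s) * X + int m * (- s) * Y = a * (r * X + s * t * w + s * w) + s * Y * (t * t + t - int m)"
    by (simp add: w algebra_simps)
  also have "\<dots> = a * (r * X + s * t * w + s * w + s * Y * c)" unfolding c by (simp add: algebra_simps)
  also have "(r * a + s * t + s) * Y + (- s) * X + (- s) * Y = a * (r * Y - s * w)"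
    by (simp add: w algebra_simps)
  finally have "z = of_int a * el (r * X + s * t * w + s * w + s * Y * c) (r * Y - s * w)"
    by (simp add: el_def algebra_simps)
  then show "z \<in> scale (of_int a) OI" by (rule image_eqI) simp
qed

text \<open>Testing the inclusion on the single element \<open>t + om\<close> already forces the
  shape of \<open>l\<close>: the \<open>om\<close>-coordinate of the product must be divisible by
  \<open>a\<close>.\<close>

lemma ex_lam:
  assumes T: "(1, a, t) \<in> triples" and l: "l \<in> OI" and sub: "scale l (idl 1 a t) \<subseteq> scale (of_int a) OI"
  shows "\<exists>r s. l = lam a t r s"
proof -
  obtain X Y where XY: "l = el X Y" using l OI_iff by blast
  define s where "s = - Y"
  define w where "w = X - s * t - s"
  have "el t 1 \<in> idl 1 a t" by (simp add: el_in_idl_1)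
  then have "l * el t 1 \<in> scale (of_int a) OI" using sub by blast
  then obtain v where v: "v \<in> OI" "l * el t 1 = of_int a * v" by blast
  obtain U V where "v = el U V" using v(1) unfolding OI_iff by blast
  with v(2) have "l * el t 1 = of_int a * el U V" by simp
  also have "of_int a * el U V = el (a * U) (a * V)" by (simp add: el_def algebra_simps)
  finally have "X * 1 + Y * t + Y * 1 = a * V" unfolding XY el_mult el_inj by blast
  then have "w = a * V" by (simp add: w_def s_def)
  then have "X = V * a + s * t + s" by (simp add: w_def mult.commute)
  then have "l = lam a t V s" unfolding XY lam_def s_def by simp
  then show ?thesis by blast
qed

text \<open>Multiplication by \<open>d\<close> acts on the lattice basis \<open>a\<close>,
  \<open>t + om\<close> by an integer matrix, so \<open>d\<close> is a root of its monic
  characteristic polynomial.\<close>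

lemma fractional_stabilizer:
  assumes T: "(1, a, t) \<in> triples" and d: "d \<in> K" "scale d (idl 1 a t) = idl 1 a t"
  shows "d \<in> OI"
proof -
  have a: "a \<ge> 1" using T by (simp add: triples_def)
  have mem: "\<exists>x y :: int. d * z = of_int x * of_int a + of_int y * el t 1" if "z \<in> idl 1 a t" for z
  proof -
    have "d * z \<in> idl 1 a t" using that d(2) by blast
    then obtain x y where "d * z = el (1 * (a * x + t * y)) (1 * y)" unfolding idl_def by blast
    then have "d * z = of_int x * of_int a + of_int y * el t 1" by (simp add: el_def algebra_simps)
    then show ?thesis by blast
  qed
  have "el a 0 \<in> idl 1 a t" "el t 1 \<in> idl 1 a t" by (simp_all add: el_in_idl_1)
  then obtain x y z w :: int where
    1: "d * of_int a = of_int x * of_int a + of_int y * el t 1" and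
    2: "d * el t 1 = of_int z * of_int a + of_int w * el t 1"
    using mem[of "el a 0"] mem[of "el t 1"] by (auto simp: el_of_int)
  have nz: "of_int a * el t 1 \<noteq> 0" using a el_inj[of t 1 0 0] by (simp add: el_0)
  have "((d - of_int x) * (d - of_int w)) * (of_int a * el t 1) =
      (d * of_int a - of_int x * of_int a) * (d * el t 1 - of_int w * el t 1)" by (simp add: algebra_simps)
  also have "\<dots> = of_int (y * z) * (of_int a * el t 1)" unfolding 1 2 by (simp add: algebra_simps)
  finally have "(d - of_int x) * (d - of_int w) = of_int (y * z)" using nz by simp
  then have "d * d = of_int (x + w) * d + of_int (y * z - x * w)" by (simp add: algebra_simps)
  then have "algebraic_int d" by (rule root_monic_quadratic_algebraic_int)
  then show ?thesis using d(1) by (simp add: quad_ring_of_ints_def)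
qed

lemma same_scale_imp_unit:
  assumes T: "(1, a, t) \<in> triples" and l: "l \<in> OI" "l \<noteq> 0" "l' \<in> OI" "l' \<noteq> 0"
    and eq: "scale l (idl 1 a t) = scale l' (idl 1 a t)"
  shows "l / l' \<in> UU"
proof -
  have *: "l / l' \<in> OI" if "l \<in> OI" "l' \<in> OI" "l' \<noteq> 0" "scale l (idl 1 a t) = scale l' (idl 1 a t)" for l l'
  proof (rule fractional_stabilizer[OF T])
    show "l / l' \<in> K" using K_div[OF OI_K[OF that(1)] OI_K[OF that(2)]] by blast
    have "scale (l / l') (idl 1 a t) = scale (inverse l') (scale l (idl 1 a t))"
      unfolding scale_scale by (simp add: field_simps)
    also have "\<dots> = scale (inverse l') (scale l' (idl 1 a t))" using that by simp
    also have "\<dots> = idl 1 a t" unfolding scale_scale using that by simp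
    finally show "scale (l / l') (idl 1 a t) = idl 1 a t" .
  qed
  from *[of l l'] *[of l' l] show ?thesis using assms by (auto simp: Units_iff)
qed

lemma scale_unit_ideal:
  assumes "I \<in> nonzero_ideals p" "x \<in> UU"
  shows "scale x I = I"
proof -
  have sub: "scale y I \<subseteq> I" if "y \<in> UU" for y
    using assms(1) UU_OI[OF that] unfolding nonzero_ideals_iff by auto
  have "I = scale x (scale (inverse x) I)" unfolding scale_scale using UU_nonzero[OF assms(2)] by simp
  also have "\<dots> \<subseteq> scale x I" using sub[OF UU_inverse[OF assms(2)]] by (rule image_mono)
  finally show ?thesis using sub[OF assms(2)] by blast
qed

text \<open>Since \<open>a\<close> lies in the ideal, \<open>\<alpha> * a = \<beta> * j\<close> for
  some \<open>j\<close> in \<open>J\<close>. This \<open>j\<close> is the required element: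
  \<open>j\<close> times the ideal is \<open>a\<close> times \<open>J\<close>, which lies in
  \<open>a\<close> times the ring, so \<open>ex_lam\<close> applies.\<close>

lemma class_rel_lam:
  assumes T: "(1, a, t) \<in> triples" and rel: "(idl 1 a t, J) \<in> ideal_class_rel p"
  obtains r s where "lam a t r s \<noteq> 0" "scale (of_int a) J = scale (lam a t r s) (idl 1 a t)"
proof -
  obtain \<alpha> \<beta> where ab: "\<alpha> \<in> OI" "\<alpha> \<noteq> 0" "\<beta> \<in> OI" "\<beta> \<noteq> 0" "scale \<alpha> (idl 1 a t) = scale \<beta> J"
    using rel unfolding ideal_class_rel_def by auto
  have J: "J \<in> nonzero_ideals p" using rel unfolding ideal_class_rel_def by auto
  have a: "a \<ge> 1" using T by (simp add: triples_def)
  have "el a 0 \<in> idl 1 a t" by (simp add: el_in_idl_1)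
  then have "\<alpha> * of_int a \<in> scale \<alpha> (idl 1 a t)" unfolding el_of_int by (rule imageI)
  then have "\<alpha> * of_int a \<in> scale \<beta> J" using ab(5) by simp
  then obtain j where j: "j \<in> J" "\<alpha> * of_int a = \<beta> * j" by blast
  have "scale \<beta> (scale j (idl 1 a t)) = scale (of_int a) (scale \<alpha> (idl 1 a t))"
    unfolding scale_scale j(2)[symmetric] by (simp add: mult.commute)
  also have "\<dots> = scale \<beta> (scale (of_int a) J)" unfolding ab(5) scale_scale by (simp add: mult.commute)
  finally have eq: "scale j (idl 1 a t) = scale (of_int a) J" using scale_cancel[OF ab(4)] by blast
  have jO: "j \<in> OI" "J \<subseteq> OI" using j J unfolding nonzero_ideals_iff by auto
  then have "scale j (idl 1 a t) \<subseteq> scale (of_int a) OI" unfolding eq by (intro image_mono)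
  then obtain r s where rs: "j = lam a t r s" using ex_lam[OF T jO(1)] by blast
  have "j \<noteq> 0" using j(2) ab a by auto
  then show ?thesis using that[of r s] rs eq by simp
qed

text \<open>The inverse construction: \<open>J\<close> is \<open>lam / a\<close> times the ideal,
  which is integral by \<open>lam_scale_sub\<close>.\<close>

lemma lam_class_rel:
  assumes T: "(1, a, t) \<in> triples" and l0: "lam a t r s \<noteq> 0"
  obtains J where "(idl 1 a t, J) \<in> ideal_class_rel p" "scale (of_int a) J = scale (lam a t r s) (idl 1 a t)"
proof -
  let ?l = "lam a t r s"
  have a: "a \<ge> 1" using T by (simp add: triples_def)
  define J where "J = {x \<in> OI. of_int a * x \<in> scale ?l (idl 1 a t)}"
  have I: "idl 1 a t \<in> nonzero_ideals p" by (rule idl_ideal[OF T])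
  have eq: "scale (of_int a) J = scale ?l (idl 1 a t)"
  proof (intro equalityI subsetI)
    fix z assume z: "z \<in> scale ?l (idl 1 a t)"
    then have "z \<in> scale (of_int a) OI" using lam_scale_sub[OF T, of r s] by (rule rev_subsetD)
    then obtain x where x: "x \<in> OI" "z = of_int a * x" by blast
    then have "x \<in> J" using z unfolding J_def by simp
    then show "z \<in> scale (of_int a) J" using x(2) by (rule rev_image_eqI)
  qed (auto simp: J_def)
  have Iprops: "0 \<in> idl 1 a t" "\<And>x y. x \<in> idl 1 a t \<Longrightarrow> y \<in> idl 1 a t \<Longrightarrow> x + y \<in> idl 1 a t"
     "\<And>x r. x \<in> idl 1 a t \<Longrightarrow> r \<in> OI \<Longrightarrow> r * x \<in> idl 1 a t" "idl 1 a t \<noteq> {0}"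
    using I unfolding nonzero_ideals_iff by blast+
  have "J \<in> nonzero_ideals p"
    unfolding nonzero_ideals_iff
  proof (intro conjI ballI)
    show "J \<subseteq> OI" by (auto simp: J_def)
    have "?l * 0 \<in> scale ?l (idl 1 a t)" using Iprops(1) by blast
    then show "0 \<in> J" by (simp add: J_def)
    show "x + y \<in> J" if "x \<in> J" "y \<in> J" for x y
    proof -
      obtain u v where "u \<in> idl 1 a t" "of_int a * x = ?l * u" "v \<in> idl 1 a t" "of_int a * y = ?l * v"
        using \<open>x \<in> J\<close> \<open>y \<in> J\<close> unfolding J_def by blast
      then have "of_int a * (x + y) = ?l * (u + v)" "u + v \<in> idl 1 a t" using Iprops(2) by (simp_all add: distrib_left)
      then show ?thesis using that OI_add unfolding J_def by auto
    qed
    show "z * x \<in> J" if "x \<in> J" "z \<in> OI" for x z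
    proof -
      obtain u where "u \<in> idl 1 a t" "of_int a * x = ?l * u"
        using \<open>x \<in> J\<close> unfolding J_def by blast
      then have e: "of_int a * (z * x) = ?l * (z * u)" and "z * u \<in> idl 1 a t"
        using Iprops(3) that(2) by (simp_all add: mult.left_commute)
      then have "of_int a * (z * x) \<in> scale ?l (idl 1 a t)" unfolding e by (intro imageI)
      then show ?thesis using that OI_mult unfolding J_def by auto
    qed
    show "J \<noteq> {0}"
    proof
      assume "J = {0}"
      then have "scale ?l (idl 1 a t) = scale (of_int a) {0}" using eq by (simp only:)
      also have "\<dots> = scale ?l {0}" by simp
      finally have "scale ?l (idl 1 a t) = scale ?l {0}" .
      then show False using scale_cancel[OF l0] Iprops(4) by blast
    qed
  qed
  moreover have "?l \<in> OI - {0}" "of_int a \<in> OI - {0}" using a l0 lam_OI by auto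
  ultimately have "(idl 1 a t, J) \<in> ideal_class_rel p"
    unfolding ideal_class_rel_def using I eq[symmetric] by blast
  then show ?thesis using that eq by blast
qed

definition dom :: "int \<Rightarrow> int \<Rightarrow> real \<Rightarrow> (int \<times> int) set" where
  "dom a t X = {(r, s). 0 < lam a t r s \<and> \<bar>lam' a t r s\<bar> \<le> lam a t r s \<and>
      lam a t r s < eps\<^sup>2 * \<bar>lam' a t r s\<bar> \<and> lam a t r s * \<bar>lam' a t r s\<bar> \<le> of_int a * X}"

text \<open>\<open>F\<close> sends \<open>\<lambda>\<close> to the ideal
  \<open>\<lambda> I / a\<close>. Multiplying \<open>\<lambda>\<close> by \<open>eps ^ k\<close>
  changes the absolute ratio of \<open>\<lambda>\<close> to its conjugate by
  \<open>eps ^ (2 k)\<close>, so the window \<open>[1, eps ^ 2)\<close> for this ratio together with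
  \<open>\<lambda> > 0\<close> leaves exactly one generator per ideal. The norm of the ideal is the
  absolute norm of \<open>\<lambda>\<close> divided by \<open>a\<close>, which accounts for the last
  condition of \<open>dom\<close>.\<close>

lemma card_class_dom:
  assumes T: "(1, a, t) \<in> triples"
  shows "card {J. (idl 1 a t, J) \<in> ideal_class_rel p \<and> nrm J \<le> X} = card (dom a t (of_int X))"
proof -
  let ?I = "idl 1 a t" and ?l = "\<lambda>(r, s). lam a t r s"
  have a: "a \<ge> 1" using T by (simp add: triples_def)
  have I: "?I \<in> nonzero_ideals p" by (rule idl_ideal[OF T])
  define F where "F = (\<lambda>z. {x. of_int a * x \<in> scale (?l z) ?I})"
  have F: "F z = J \<longleftrightarrow> scale (of_int a) J = scale (?l z) ?I" for z J
  proof -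
    have "scale (of_int a) (F z) = scale (?l z) ?I"
    proof (intro equalityI subsetI)
      fix y assume y: "y \<in> scale (?l z) ?I"
      have ya: "y = of_int a * (y / of_int a)" using a by simp
      then have "of_int a * (y / of_int a) \<in> scale (?l z) ?I" using y by (simp only:)
      then have "y / of_int a \<in> F z" unfolding F_def by (rule CollectI)
      then show "y \<in> scale (of_int a) (F z)" using ya by (rule rev_image_eqI)
    next
      fix y assume "y \<in> scale (of_int a) (F z)"
      then obtain x where "x \<in> F z" "y = of_int a * x" by blast
      then show "y \<in> scale (?l z) ?I" unfolding F_def by (simp only: mem_Collect_eq)
    qed
    note FE = this
    show ?thesis
    proof
      assume "scale (of_int a) J = scale (?l z) ?I"
      then have "scale (of_int a) (F z) = scale (of_int a) J" using FE by (simp only:)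
      moreover have "real_of_int a \<noteq> 0" using a by simp
      ultimately show "F z = J" by (rule scale_cancel[rotated])
    qed (use FE in blast)
  qed
  have nrmJ: "of_int a * real_of_int (nrm J) = \<bar>?l z * cj (?l z)\<bar>"
    if "J \<in> nonzero_ideals p" "scale (of_int a) J = scale (?l z) ?I" for z J
  proof -
    have "\<bar>of_int a * cj (of_int a)\<bar> * nrm J = \<bar>?l z * cj (?l z)\<bar> * nrm ?I"
      using that I by (intro nrm_scale) (auto simp: lam_OI split: prod.splits)
    then have "of_int a * of_int a * real_of_int (nrm J) = \<bar>?l z * cj (?l z)\<bar> * of_int a"
      using nrm_idl[OF T] a by (simp add: cj_Rats abs_mult)
    then show ?thesis using a by simp
  qed
  have rat: "\<bar>(x * y) * cj (x * y)\<bar> = \<bar>x * cj x\<bar>" "\<bar>cj (x * y)\<bar> = \<bar>cj x\<bar> * inverse \<bar>y\<bar>"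
    if "x \<in> OI" "y \<in> UU" for x y
    using K_mult[OF OI_K[OF that(1)] OI_K[OF UU_OI[OF that(2)]]] unit_norm[OF that(2)] UU_cj[OF that(2)]
    by (simp_all add: abs_mult mult_ac)
  have "bij_betw F (dom a t (of_int X)) {J. (?I, J) \<in> ideal_class_rel p \<and> nrm J \<le> X}"
    unfolding bij_betw_def
  proof
    show "inj_on F (dom a t (of_int X))"
    proof (rule inj_onI)
      fix z z' assume z: "z \<in> dom a t (of_int X)" "z' \<in> dom a t (of_int X)" "F z = F z'"
      obtain r s r' s' where rs: "z = (r, s)" "z' = (r', s')" by (cases z, cases z') blast
      let ?x = "lam a t r s" and ?y = "lam a t r' s'"
      have x: "?x > 0" "\<bar>cj ?x\<bar> \<le> ?x" "?x < eps\<^sup>2 * \<bar>cj ?x\<bar>" and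
        y: "?y > 0" "\<bar>cj ?y\<bar> \<le> ?y" "?y < eps\<^sup>2 * \<bar>cj ?y\<bar>" using z rs by (auto simp: dom_def cj_lam)
      have "scale ?x ?I = scale ?y ?I" using z(3) F rs by (metis case_prod_conv)
      then have "?x / ?y \<in> UU" using x y lam_OI by (intro same_scale_imp_unit[OF T]) auto
      then obtain k :: int where "?x / ?y = eps powi k \<or> ?x / ?y = - (eps powi k)" using UU_cases by blast
      moreover have "eps powi k > 0" using eps_gt_1 by (simp add: zero_less_power_int)
      moreover have "?x / ?y > 0" using x y by simp
      ultimately have k: "?x / ?y = eps powi k" by linarith
      then have xy: "?x = ?y * eps powi k" using y by (simp add: field_simps)
      have cxy: "\<bar>cj ?x\<bar> = \<bar>cj ?y\<bar> * inverse (eps powi k)"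
        unfolding xy using rat(2)[OF lam_OI UU_powi[OF eps_UU]] \<open>eps powi k > 0\<close> by simp
      have cy: "\<bar>cj ?y\<bar> > 0" using cj_nonzero[OF OI_K[OF lam_OI]] y(1) by simp
      \<comment> \<open>The factor \<open>eps ^ (2 k)\<close> between the two ratios. Both ratios
        lie in \<open>[1, eps ^ 2)\<close>, which pins \<open>q\<close> strictly between
        \<open>eps ^ (- 2)\<close> and \<open>eps ^ 2\<close>, so that \<open>k = 0\<close>.\<close>
      define q where "q = eps powi k * eps powi k"
      have q: "q = eps powi (2 * k)" unfolding q_def using eps_gt_1 by (simp add: power_int_add[symmetric])
      have "?y * q < eps\<^sup>2 * \<bar>cj ?y\<bar>" "\<bar>cj ?y\<bar> \<le> ?y * q"
        using x(2,3) \<open>eps powi k > 0\<close> unfolding cxy unfolding xy by (simp_all add: q_def field_simps)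
      moreover have "?y * q \<ge> \<bar>cj ?y\<bar> * q" using y(2) eps_gt_1 unfolding q by (intro mult_right_mono) (auto simp: zero_le_power_int)
      moreover have "?y * q < eps\<^sup>2 * \<bar>cj ?y\<bar> * q" using y(3) eps_gt_1 unfolding q by (intro mult_strict_right_mono) (auto simp: zero_less_power_int)
      ultimately have "\<bar>cj ?y\<bar> * q < \<bar>cj ?y\<bar> * eps\<^sup>2" "\<bar>cj ?y\<bar> * 1 < \<bar>cj ?y\<bar> * (eps\<^sup>2 * q)" by (simp_all add: mult_ac)
      then have q1: "q < eps\<^sup>2" and q2: "1 < eps\<^sup>2 * q" using cy by (simp_all only: mult_less_cancel_left_pos)
      have e1: "eps\<^sup>2 = eps powi 2" by simp
      have "eps powi (2 + 2 * k) = eps powi 2 * eps powi (2 * k)" using eps_gt_1 by (intro power_int_add) simp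
      then have e2: "eps\<^sup>2 * q = eps powi (2 + 2 * k)" unfolding q by simp
      have "eps powi (2 * k) < eps powi 2" using q1 by (simp only: q e1)
      moreover have "eps powi 0 < eps powi (2 + 2 * k)" using q2 by (simp only: e2 power_int_0_right)
      ultimately have "2 * k < 2" "0 < 2 + 2 * k" using power_int_less_imp_less[OF eps_gt_1] by blast+
      then have "k = 0" by simp
      then have "?x = ?y" using xy by simp
      then show "z = z'" using lam_inj a rs by simp
    qed
    show "F ` dom a t (of_int X) = {J. (?I, J) \<in> ideal_class_rel p \<and> nrm J \<le> X}"
    proof (intro equalityI subsetI)
      fix J assume "J \<in> F ` dom a t (of_int X)"
      then obtain z where z: "z \<in> dom a t (of_int X)" "F z = J" by blast
      obtain r s where zrs: "z = (r, s)" by (cases z)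
      have rs: "(r, s) \<in> dom a t (of_int X)" "scale (of_int a) J = scale (lam a t r s) ?I"
        using z F[of "(r, s)" J] unfolding zrs by simp_all
      then have "lam a t r s \<noteq> 0" by (auto simp: dom_def)
      then obtain J' where J': "(?I, J') \<in> ideal_class_rel p" "scale (of_int a) J' = scale (lam a t r s) ?I"
        using lam_class_rel[OF T] by blast
      then have "J' = J" using rs(2) scale_cancel[of "of_int a" J' J] a by simp
      then have J: "(?I, J) \<in> ideal_class_rel p" using J' by simp
      then have "J \<in> nonzero_ideals p" by (simp add: ideal_class_rel_def)
      then have "of_int a * real_of_int (nrm J) = \<bar>lam a t r s * cj (lam a t r s)\<bar>" using nrmJ[of J "(r, s)"] rs(2) by simp
      also have "\<dots> \<le> of_int a * of_int X" using rs(1) by (auto simp: dom_def cj_lam abs_mult)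
      finally have "nrm J \<le> X" using a by simp
      then show "J \<in> {J. (?I, J) \<in> ideal_class_rel p \<and> nrm J \<le> X}" using J by simp
    next
      fix J assume "J \<in> {J. (?I, J) \<in> ideal_class_rel p \<and> nrm J \<le> X}"
      then have J: "(?I, J) \<in> ideal_class_rel p" "nrm J \<le> X" by auto
      obtain r s where rs: "lam a t r s \<noteq> 0" "scale (of_int a) J = scale (lam a t r s) ?I"
        using class_rel_lam[OF T J(1)] by blast
      let ?l0 = "lam a t r s"
      have c0: "cj ?l0 \<noteq> 0" using cj_nonzero[OF OI_K[OF lam_OI] rs(1)] .
      define \<rho> where "\<rho> = \<bar>?l0\<bar> / \<bar>cj ?l0\<bar>"
      have \<rho>0: "\<rho> > 0" using rs(1) c0 by (simp add: \<rho>_def)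
      \<comment> \<open>The exponent that moves the ratio \<open>\<rho>\<close> into
        \<open>[1, eps ^ 2)\<close>; \<open>eps ^ k\<close> acts on the ratio by its square, hence
        the factor 2.\<close>
      define k where "k = - \<lfloor>ln \<rho> / (2 * ln eps)\<rfloor>"
      define x where "x = sgn ?l0 * ?l0 * eps powi k"
      have ek: "eps powi k > 0" using eps_gt_1 by (simp add: zero_less_power_int)
      have lne: "2 * ln eps > 0" using eps_gt_1 by simp
      have "of_int (- k) * (2 * ln eps) \<le> ln \<rho>" "ln \<rho> < (of_int (- k) + 1) * (2 * ln eps)"
        using floor_divide_lower[OF lne, of "ln \<rho>"] floor_divide_upper[OF lne, of "ln \<rho>"] by (simp_all add: k_def)
      moreover have "ln (\<rho> * (eps powi k * eps powi k)) = ln \<rho> + 2 * of_int k * ln eps"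
        using \<rho>0 ek eps_gt_1 by (simp add: ln_mult ln_power_int)
      moreover have "ln (eps\<^sup>2) = 2 * ln eps" using eps_gt_1 by (simp add: ln_realpow)
      ultimately have "0 \<le> ln (\<rho> * (eps powi k * eps powi k))" "ln (\<rho> * (eps powi k * eps powi k)) < ln (eps\<^sup>2)"
        by (simp_all add: algebra_simps)
      then have \<rho>k: "1 \<le> \<rho> * (eps powi k * eps powi k)" "\<rho> * (eps powi k * eps powi k) < eps\<^sup>2"
        using \<rho>0 ek eps_gt_1 by (simp_all add: )
      define \<mu> where "\<mu> = sgn ?l0 * eps powi k"
      have \<mu>U: "\<mu> \<in> UU" using rs(1) UU_powi[OF eps_UU, of k] UU_uminus[OF UU_powi[OF eps_UU, of k]]
        by (auto simp: \<mu>_def sgn_if)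
      have x\<mu>: "x = ?l0 * \<mu>" by (simp add: x_def \<mu>_def)
      have xI: "scale x ?I = scale ?l0 ?I"
        unfolding x\<mu> scale_scale[symmetric] scale_unit_ideal[OF I \<mu>U] ..
      have xO: "x \<in> OI" unfolding x\<mu> using lam_OI UU_OI[OF \<mu>U] by (rule OI_mult)
      have "scale x ?I \<subseteq> scale (of_int a) OI" unfolding xI by (rule lam_scale_sub[OF T])
      then obtain r' s' where x': "x = lam a t r' s'" using ex_lam[OF T xO] by blast
      have absx: "x = \<bar>?l0\<bar> * eps powi k" by (simp add: x_def abs_sgn mult.commute)
      have x0: "x > 0" unfolding absx using rs(1) ek by simp
      have "\<bar>\<mu>\<bar> = eps powi k" using rs(1) ek by (simp add: \<mu>_def abs_mult abs_sgn_eq)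
      then have cx: "\<bar>cj x\<bar> = \<bar>cj ?l0\<bar> * inverse (eps powi k)" unfolding x\<mu> rat(2)[OF lam_OI \<mu>U] by simp
      have 1: "\<bar>cj x\<bar> \<le> x" "x < eps\<^sup>2 * \<bar>cj x\<bar>"
        using \<rho>k c0 ek unfolding cx unfolding absx \<rho>_def by (simp_all add: field_simps)
      have "J \<in> nonzero_ideals p" using J by (simp add: ideal_class_rel_def)
      then have "of_int a * real_of_int (nrm J) = \<bar>?l0 * cj ?l0\<bar>" using nrmJ[of J "(r, s)"] rs(2) by simp
      also have "\<dots> = \<bar>x * cj x\<bar>" unfolding x\<mu> rat(1)[OF lam_OI \<mu>U] ..
      finally have "x * \<bar>cj x\<bar> = of_int a * real_of_int (nrm J)" using x0 by (simp add: abs_mult)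
      also have "\<dots> \<le> of_int a * of_int X" using J(2) a by simp
      finally have "(r', s') \<in> dom a t (of_int X)" using x0 1 unfolding x' by (simp add: dom_def cj_lam)
      moreover have "F (r', s') = J" using F[of "(r', s')" J] rs(2) xI x' by simp
      ultimately show "J \<in> F ` dom a t (of_int X)" by blast
    qed
  qed
  then show ?thesis by (rule bij_betw_same_card[symmetric])
qed

end

subsection \<open>Ideals of given norm\<close>

definition nat_multiplicative :: "(nat \<Rightarrow> 'a::comm_semiring_1) \<Rightarrow> bool" where
  "nat_multiplicative f \<longleftrightarrow> f 1 = 1 \<and> (\<forall>a b. a > 0 \<longrightarrow> b > 0 \<longrightarrow> coprime a b \<longrightarrow> f (a * b) = f a * f b)"

definition dconv :: "(nat \<Rightarrow> 'a::comm_semiring_1) \<Rightarrow> (nat \<Rightarrow> 'a) \<Rightarrow> nat \<Rightarrow> 'a" where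
  "dconv f g k = (\<Sum>d | d dvd k. f d * g (k div d))"

text \<open>Every divisor of \<open>a * b\<close> is uniquely a product of a divisor of
  \<open>a\<close> and a divisor of \<open>b\<close>; the factors are recovered as gcds.\<close>

lemma nat_multiplicative_dconv:
  fixes f g :: "nat \<Rightarrow> 'a::comm_semiring_1"
  assumes f: "nat_multiplicative f" and g: "nat_multiplicative g"
  shows "nat_multiplicative (dconv f g)"
  unfolding nat_multiplicative_def
proof (intro conjI allI impI)
  have "{d :: nat. d dvd 1} = {1}" by auto
  then show "dconv f g 1 = 1" using f g by (simp add: dconv_def nat_multiplicative_def)
  fix a b :: nat assume ab: "a > 0" "b > 0" "coprime a b"
  have cop: "coprime x y" if "x dvd a" "y dvd b" for x y
    using coprime_divisors[OF that ab(3)] .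
  have gcd1: "gcd (d * d') a = d" if "d dvd a" "d' dvd b" for d d'
  proof -
    have "coprime a d'" using cop[of a d'] that by simp
    then have "gcd (d * d') a = gcd d a"
      by (metis coprime_commute gcd_mult_right_right_cancel gcd.commute)
    then show ?thesis using that by (simp add: gcd_proj1_iff)
  qed
  have gcd2: "gcd (d * d') b = d'" if "d dvd a" "d' dvd b" for d d'
  proof -
    have "coprime d b" using cop[of d b] that by simp
    then have "gcd (d * d') b = gcd d' b"
      by (metis gcd_mult_left_left_cancel gcd.commute coprime_commute)
    then show ?thesis using that by (simp add: gcd_proj1_iff)
  qed
  have "dconv f g a * dconv f g b = (\<Sum>(d, d')\<in>{d. d dvd a} \<times> {d. d dvd b}. (f d * g (a div d)) * (f d' * g (b div d')))"
    unfolding dconv_def sum_product by (rule sum.cartesian_product)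
  also have "\<dots> = (\<Sum>k\<in>{k. k dvd a * b}. f k * g (a * b div k))"
  proof (rule sum.reindex_bij_witness[where j = "\<lambda>(d, d'). d * d'" and i = "\<lambda>k. (gcd k a, gcd k b)"])
    fix z assume z: "z \<in> {d. d dvd a} \<times> {d. d dvd b}"
    then obtain d d' where d: "z = (d, d')" "d dvd a" "d' dvd b" by auto
    show "(gcd (case z of (d, d') \<Rightarrow> d * d') a, gcd (case z of (d, d') \<Rightarrow> d * d') b) = z"
      using gcd1 gcd2 d by simp
    show "(case z of (d, d') \<Rightarrow> d * d') \<in> {k. k dvd a * b}" using d by (simp add: mult_dvd_mono)
    obtain u v where uv: "a = d * u" "b = d' * v" using d by (auto elim!: dvdE)
    have pos: "d > 0" "d' > 0" "u > 0" "v > 0" using ab uv by auto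
    have "coprime d d'" "coprime u v" using cop uv by auto
    moreover have "a * b div (d * d') = u * v" unfolding uv using pos by (simp add: mult.assoc mult.left_commute[of u])
    moreover have "a div d = u" "b div d' = v" unfolding uv using pos by simp_all
    ultimately show "f (case z of (d, d') \<Rightarrow> d * d') * g (a * b div (case z of (d, d') \<Rightarrow> d * d')) =
        (case z of (d, d') \<Rightarrow> f d * g (a div d) * (f d' * g (b div d')))"
    proof -
      assume *: "coprime d d'" "coprime u v" "a * b div (d * d') = u * v" "a div d = u" "b div d' = v"
      have "f (d * d') = f d * f d'" using f pos *(1) unfolding nat_multiplicative_def by blast
      moreover have "g (u * v) = g u * g v" using g pos *(2) unfolding nat_multiplicative_def by blast
      ultimately show ?thesis unfolding d(1) prod.case *(3-5) by (simp only: mult_ac)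
    qed
  next
    fix k assume k: "k \<in> {k. k dvd a * b}"
    show "(gcd k a, gcd k b) \<in> {d. d dvd a} \<times> {d. d dvd b}" by simp
    obtain d d' where "k = d * d'" "d dvd a" "d' dvd b" using k division_decomp[of k a b] by auto
    then show "(case (gcd k a, gcd k b) of (d, d') \<Rightarrow> d * d') = k" using gcd1 gcd2 by simp
  qed
  finally show "dconv f g (a * b) = dconv f g a * dconv f g b" by (simp add: dconv_def)
qed

lemma nat_multiplicative_eqI:
  fixes f g :: "nat \<Rightarrow> 'a::comm_semiring_1"
  assumes "nat_multiplicative f" "nat_multiplicative g"
    and "\<And>q j. prime q \<Longrightarrow> f (q ^ j) = g (q ^ j)" and "k > 0"
  shows "f k = g k"
  using assms(4)
proof (induction k rule: less_induct)
  case (less k)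
  show ?case
  proof (cases "k = 1")
    case True
    then show ?thesis using assms(1,2) by (simp add: nat_multiplicative_def)
  next
    case False
    then obtain q where q: "prime q" "q dvd k" using prime_factor_nat by blast
    obtain c where c: "k = q ^ multiplicity q k * c" "\<not> q dvd c"
      using multiplicity_decompose'[of k q] less.prems q(1) not_prime_unit by blast
    have j0: "multiplicity q k > 0" using q less.prems by (simp add: prime_multiplicity_gt_zero_iff prime_imp_prime_elem)
    have "q ^ multiplicity q k \<ge> q ^ 1" using j0 prime_gt_0_nat[OF q(1)] by (intro power_increasing) auto
    then have q1: "q ^ multiplicity q k > 1" using prime_gt_1_nat[OF q(1)] by simp
    have c0: "c > 0" using c(2) by (intro gr0I) auto
    have "c * 1 < c * q ^ multiplicity q k" using q1 c0 by (intro mult_strict_left_mono) auto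
    then have "c < k" by (subst c(1)) (simp add: mult.commute)
    then have fc: "f c = g c" using less.IH c0 by simp
    have cop: "coprime (q ^ multiplicity q k) c" using q(1) c(2) prime_imp_coprime[of q c] by simp
    have mult: "h (q ^ multiplicity q k * c) = h (q ^ multiplicity q k) * h c" if "nat_multiplicative h" for h :: "nat \<Rightarrow> 'a"
      using that cop c0 q1 unfolding nat_multiplicative_def by (meson less_trans zero_less_one)
    have "f (q ^ multiplicity q k * c) = g (q ^ multiplicity q k * c)"
      unfolding mult[OF assms(1)] mult[OF assms(2)] fc assms(3)[OF q(1)] ..
    then show ?thesis using c(1) by simp
  qed
qed

lemma dconv_prime_power:
  assumes "prime (q :: nat)"
  shows "dconv f g (q ^ j) = (\<Sum>i\<le>j. f (q ^ i) * g (q ^ (j - i)))"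
proof -
  have "{d. d dvd q ^ j} = (\<lambda>i. q ^ i) ` {..j}"
    using divides_primepow_nat[OF assms] by auto
  moreover have "inj_on (\<lambda>i. q ^ i) {..j}"
    using prime_gt_1_nat[OF assms] by (auto simp: inj_on_def)
  ultimately have "dconv f g (q ^ j) = (\<Sum>i\<le>j. f (q ^ i) * g (q ^ j div q ^ i))"
    unfolding dconv_def by (simp add: sum.reindex)
  also have "\<dots> = (\<Sum>i\<le>j. f (q ^ i) * g (q ^ (j - i)))"
    using prime_gt_0_nat[OF assms] by (intro sum.cong) (auto simp: power_diff)
  finally show ?thesis .
qed

context prime_1_mod_4
begin

text \<open>The norm of \<open>t + om\<close>, a quadratic polynomial of discriminant
  \<open>p\<close>.\<close>

definition fq :: "int \<Rightarrow> int" where "fq t = t * t + t - int m"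

text \<open>Counts the ideals \<open>idl 1 a t\<close>, that is, the primitive ideals of norm
  \<open>a\<close>.\<close>

definition rho :: "nat \<Rightarrow> int" where
  "rho a = int (card {t \<in> {0..<int a}. int a dvd fq t})"

lemma int_p_eq4: "int p = 4 * int m + 1" using p_eq n_eq by simp

lemma fq_disc: "4 * fq t = (2 * t + 1) * (2 * t + 1) - int p"
  unfolding fq_def int_p_eq4 by (simp add: algebra_simps)

lemma fq_cong: "[t = t'] (mod k) \<Longrightarrow> k dvd fq t \<longleftrightarrow> k dvd fq t'"
proof -
  assume "[t = t'] (mod k)"
  then have "[fq t = fq t'] (mod k)" unfolding fq_def by (intro cong_diff cong_add cong_mult cong_refl)
  then show ?thesis by (rule cong_dvd_iff)
qed

lemma rho_multiplicative: "nat_multiplicative rho"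
  unfolding nat_multiplicative_def
proof (intro conjI allI impI)
  have "{t \<in> {0..<int 1}. int 1 dvd fq t} = {0}" by auto
  then show "rho 1 = 1" by (simp add: rho_def)
  fix a b :: nat assume ab: "a > 0" "b > 0" "coprime a b"
  let ?S = "\<lambda>k. {t \<in> {0..<int k}. int k dvd fq t}"
  have cop: "coprime (int a) (int b)" using ab(3) by simp
  have dvd: "int (a * b) dvd x \<longleftrightarrow> int a dvd x \<and> int b dvd x" for x
    using cop divides_mult[of "int a" x "int b"] by (auto intro: dvd_mult_left dvd_mult_right)
  have "bij_betw (\<lambda>t. (t mod int a, t mod int b)) (?S (a * b)) (?S a \<times> ?S b)"
    unfolding bij_betw_def
  proof
    show "inj_on (\<lambda>t. (t mod int a, t mod int b)) (?S (a * b))"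
    proof (rule inj_onI)
      fix x y assume xy: "x \<in> ?S (a * b)" "y \<in> ?S (a * b)" "(x mod int a, x mod int b) = (y mod int a, y mod int b)"
      then have "int a dvd x - y" "int b dvd x - y" by (auto simp: mod_eq_dvd_iff)
      then have "int (a * b) dvd x - y" using dvd by blast
      then show "x = y" using xy(1,2) dvd_imp_le_int[of "x - y" "int (a * b)"] by fastforce
    qed
    show "(\<lambda>t. (t mod int a, t mod int b)) ` ?S (a * b) = ?S a \<times> ?S b"
    proof (intro equalityI subsetI)
      fix z assume "z \<in> (\<lambda>t. (t mod int a, t mod int b)) ` ?S (a * b)"
      then obtain t where t: "z = (t mod int a, t mod int b)" "int a dvd fq t" "int b dvd fq t" using dvd by auto
      then show "z \<in> ?S a \<times> ?S b"
        using ab fq_cong[of t "t mod int a" "int a"] fq_cong[of t "t mod int b" "int b"] by simp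
    next
      fix z assume "z \<in> ?S a \<times> ?S b"
      then obtain x y where xy: "z = (x, y)" "x \<in> ?S a" "y \<in> ?S b" by auto
      obtain w where w: "[w = x] (mod int a)" "[w = y] (mod int b)"
        using binary_chinese_remainder_int[OF cop] by blast
      define t where "t = w mod int (a * b)"
      have "[t = w] (mod int (a * b))" by (simp add: t_def)
      then have "[t = w] (mod int a)" "[t = w] (mod int b)"
        by (auto intro: cong_dvd_modulus)
      then have t: "[t = x] (mod int a)" "[t = y] (mod int b)" using w cong_trans by blast+
      have "int a dvd fq t" "int b dvd fq t" using fq_cong[OF t(1)] fq_cong[OF t(2)] xy by auto
      then have "t \<in> ?S (a * b)" using dvd ab by (simp add: t_def)
      moreover have "(t mod int a, t mod int b) = z" using t xy by (simp add: Cong.cong_def)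
      ultimately show "z \<in> (\<lambda>t. (t mod int a, t mod int b)) ` ?S (a * b)" by blast
    qed
  qed
  then have "card (?S (a * b)) = card (?S a) * card (?S b)"
    by (simp only: bij_betw_same_card card_cartesian_product)
  then show "rho (a * b) = rho a * rho b" by (simp add: rho_def)
qed

text \<open>With \<open>i = n!\<close>, a square root of - 1 modulo \<open>p\<close>, one has
  \<open>(1 + i) ^ 2 = 2 * i\<close>. Euler's criterion applied to this square gives
  \<open>1 = 2 ^ n * (i ^ 2) ^ m\<close>.\<close>

lemma chi_2: "chi 2 = (- 1) ^ m"
proof (rule chi_eqI)
  define i :: int where "i = fact n"
  have ii: "[i\<^sup>2 = - 1] (mod int p)" unfolding i_def by (rule fact_half_square[OF prime_p p_eq n_eq])
  have "\<not> int p dvd 1 + i"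
  proof
    assume "int p dvd 1 + i"
    then have "[i = - 1] (mod int p)" by (simp add: cong_iff_dvd_diff add.commute)
    then have "[i\<^sup>2 = (- 1)\<^sup>2] (mod int p)" by (rule cong_pow)
    then have "[1 = - 1] (mod int p)" using ii by (metis cong_sym cong_trans power2_minus power_one)
    then have "int p dvd 2" by (simp add: cong_iff_dvd_diff)
    then show False using p_gt_2 by (auto dest: zdvd_imp_le)
  qed
  then have "chi ((1 + i) * (1 + i)) = 1" unfolding chi_mult by (rule chi_square)
  then have 1: "[((1 + i) * (1 + i)) ^ n = 1] (mod int p)" using chi_cong[of "(1 + i) * (1 + i)"] by (simp add: cong_sym)
  have "[(1 + i) * (1 + i) = 2 * i] (mod int p)"
    using cong_add[OF cong_refl[of "1 + 2 * i"] ii] by (simp add: power2_eq_square algebra_simps)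
  then have "[((1 + i) * (1 + i)) ^ n = (2 * i) ^ n] (mod int p)" by (rule cong_pow)
  also have "(2 * i) ^ n = 2 ^ n * (i\<^sup>2) ^ m" using n_eq by (simp add: power_mult_distrib power_mult)
  also have "[\<dots> = 2 ^ n * (- 1) ^ m] (mod int p)" by (intro cong_mult cong_refl cong_pow ii)
  also have "[2 ^ n * (- 1) ^ m = chi 2 * (- 1) ^ m] (mod int p)" by (intro cong_mult cong_refl cong_sym[OF chi_cong])
  finally have "[chi 2 * (- 1) ^ m = 1] (mod int p)" using 1 by (metis cong_sym cong_trans)
  then have "[chi 2 * (- 1) ^ m * (- 1) ^ m = 1 * (- 1) ^ m] (mod int p)" by (rule cong_mult[OF _ cong_refl])
  then show "[chi 2 = (- 1) ^ m] (mod int p)" by (simp add: mult.assoc power_mult_distrib[symmetric])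
  show "(- 1) ^ m \<in> {- 1, 0, 1 :: int}" by (cases "even m") auto
qed

text \<open>For odd \<open>q\<close> completing the square reduces the question to whether
  \<open>p\<close> is a square modulo \<open>q\<close>, and quadratic reciprocity turns it around.
  For \<open>q = 2\<close> the values of \<open>fq\<close> have the parity of \<open>m\<close>,
  which matches the supplementary law \<open>chi_2\<close>.\<close>

lemma chi_prime_root:
  assumes q: "prime q" "q \<noteq> p"
  shows "chi (int q) = 1 \<longleftrightarrow> (\<exists>t. int q dvd fq t)" and "chi (int q) \<noteq> 0"
proof -
  have "\<not> p dvd q" using q prime_p by (metis primes_dvd_imp_eq)
  then show "chi (int q) \<noteq> 0" unfolding chi_eq_0_iff by simp
  show "chi (int q) = 1 \<longleftrightarrow> (\<exists>t. int q dvd fq t)"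
  proof (cases "q = 2")
    case True
    have "(\<exists>t. int q dvd fq t) \<longleftrightarrow> even m"
    proof
      assume "\<exists>t. int q dvd fq t"
      then show "even m" using True by (auto simp: fq_def)
    next
      assume "even m"
      then have "int q dvd fq 0" using True by (simp add: fq_def)
      then show "\<exists>t. int q dvd fq t" ..
    qed
    moreover have "chi (int q) = (- 1) ^ m" using chi_2 True by simp
    ultimately show ?thesis by (cases "even m") auto
  next
    case False
    then have q2: "q > 2" using prime_ge_2_nat[OF q(1)] by simp
    have oq: "odd q" using q(1) q2 prime_odd_nat by blast
    have even: "even ((p - 1) div 2 * ((q - 1) div 2))" using p_eq n_eq by simp
    have "Legendre (int p) (int q) * Legendre (int q) (int p) = (- 1) ^ ((p - 1) div 2 * ((q - 1) div 2))"
      by (rule Quadratic_Reciprocity) (use prime_p p_gt_2 q q2 in auto)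
    then have rec: "Legendre (int p) (int q) * chi (int q) = 1" using even by (simp add: chi_def)
    have ndq: "\<not> [int p = 0] (mod int q)"
      unfolding cong_0_iff using q prime_p by (metis int_dvd_int_iff primes_dvd_imp_eq)
    have "chi (int q) = 1 \<longleftrightarrow> Legendre (int p) (int q) = 1"
      using rec chi_values[of "int q"] by auto
    also have "\<dots> \<longleftrightarrow> (\<exists>y. [y\<^sup>2 = int p] (mod int q))" using ndq by (simp add: Legendre_def QuadRes_def)
    also have "\<dots> \<longleftrightarrow> (\<exists>t. int q dvd fq t)"
    proof
      assume "\<exists>y. [y\<^sup>2 = int p] (mod int q)"
      then obtain y where y: "[y\<^sup>2 = int p] (mod int q)" by blast
      \<comment> \<open>Of \<open>y\<close> and \<open>y + q\<close> the odd one is taken, to be of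
        the form \<open>2 * t + 1\<close>.\<close>
      define y' where "y' = (if odd y then y else y + int q)"
      have "[y' = y] (mod int q)" by (simp add: y'_def Cong.cong_def)
      then have "[y'\<^sup>2 = int p] (mod int q)" using y cong_pow cong_trans by blast
      moreover have "odd y'" using oq by (simp add: y'_def)
      then obtain t where t: "y' = 2 * t + 1" by (elim oddE)
      ultimately have "int q dvd 4 * fq t" unfolding fq_disc by (simp add: cong_iff_dvd_diff power2_eq_square)
      moreover have "coprime (int q) 4"
      proof -
        have "coprime (int q) (2 ^ 2)" using oq by (simp only: coprime_power_right_iff) simp
        then show ?thesis by simp
      qed
      ultimately have "int q dvd fq t" by (simp add: coprime_dvd_mult_right_iff)
      then show "\<exists>t. int q dvd fq t" ..
    next
      assume "\<exists>t. int q dvd fq t"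
      then obtain t where "int q dvd fq t" by blast
      then have "int q dvd 4 * fq t" by simp
      then have "[(2 * t + 1)\<^sup>2 = int p] (mod int q)" unfolding fq_disc by (simp add: cong_iff_dvd_diff power2_eq_square)
      then show "\<exists>y. [y\<^sup>2 = int p] (mod int q)" by blast
    qed
    finally show ?thesis .
  qed
qed

text \<open>The derivative \<open>2 * t + 1\<close> cannot vanish at a root modulo \<open>q\<close>,
  as its square differs from \<open>4 * fq t\<close> by the discriminant \<open>p\<close>.\<close>

lemma simple_root:
  assumes "prime q" "q \<noteq> p" "int q dvd fq t"
  shows "\<not> int q dvd 2 * t + 1"
proof
  assume "int q dvd 2 * t + 1"
  then have "int q dvd (2 * t + 1) * (2 * t + 1) - 4 * fq t" using assms(3) by (intro dvd_diff) auto
  then have "int q dvd int p" unfolding fq_disc by simp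
  then show False using assms prime_p by (metis int_dvd_int_iff primes_dvd_imp_eq)
qed

lemma hensel_root:
  assumes "prime q" "q \<noteq> p" "\<exists>t. int q dvd fq t" "j > 0"
  shows "\<exists>t. int q ^ j dvd fq t"
  using assms(4)
proof (induction j rule: nat_induct_non_zero)
  case 1
  then show ?case using assms(3) by simp
next
  case (Suc j)
  then obtain t where t: "int q ^ j dvd fq t" by blast
  then obtain c where c: "fq t = int q ^ j * c" by (auto elim: dvdE)
  have "int q dvd int q ^ j" using Suc.hyps by simp
  then have qt: "int q dvd fq t" using t dvd_trans by blast
  have "\<not> int q dvd 2 * t + 1" by (rule simple_root[OF assms(1,2) qt])
  then have "coprime (2 * t + 1) (int q)"
    using prime_imp_coprime[of "int q" "2 * t + 1"] assms(1) by (simp add: coprime_commute)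
  then obtain w where w: "[(2 * t + 1) * w = 1] (mod int q)" using cong_solve_coprime_int by blast
  \<comment> \<open>Newton correction: \<open>w\<close> inverts the derivative, and \<open>s\<close>
    cancels the quotient \<open>c\<close> modulo \<open>q\<close>.\<close>
  define s where "s = - c * w"
  have "[c + (2 * t + 1) * s = c + - c * 1] (mod int q)"
  proof -
    have "(2 * t + 1) * s = - c * ((2 * t + 1) * w)" by (simp add: s_def)
    moreover have "[c + - c * ((2 * t + 1) * w) = c + - c * 1] (mod int q)"
      by (intro cong_add cong_mult cong_refl w)
    ultimately show ?thesis by simp
  qed
  then have d1: "int q dvd c + (2 * t + 1) * s" by (simp add: cong_0_iff)
  have "fq (t + int q ^ j * s) = fq t + int q ^ j * s * (2 * t + 1) + (int q ^ j * s) * (int q ^ j * s)"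
    by (simp add: fq_def algebra_simps)
  also have "\<dots> = int q ^ j * (c + (2 * t + 1) * s) + int q ^ j * (int q ^ j * (s * s))"
    unfolding c by (simp add: algebra_simps)
  finally have e: "fq (t + int q ^ j * s) = int q ^ j * (c + (2 * t + 1) * s) + int q ^ j * (int q ^ j * (s * s))" .
  have "int q ^ Suc j dvd fq (t + int q ^ j * s)"
    unfolding e power_Suc2
    by (rule dvd_add[OF mult_dvd_mono[OF dvd_refl d1]
          mult_dvd_mono[OF dvd_refl dvd_mult2[OF \<open>int q dvd int q ^ j\<close>]]])
  then show ?case by blast
qed

text \<open>If \<open>t0\<close> is a root, the other one is \<open>- 1 - t0\<close>. For any root
  \<open>t\<close> the product \<open>(t - t0) * (t + t0 + 1)\<close> is divisible by
  \<open>Q\<close>; since the root is simple, \<open>q\<close> divides at most one factor, which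
  then absorbs all of \<open>Q\<close>.\<close>

lemma rho_prime_power:
  assumes q: "prime q" "q \<noteq> p" and j: "j > 0"
  shows "rho (q ^ j) = 1 + chi (int q)"
proof (cases "\<exists>t. int q dvd fq t")
  case False
  have "\<not> int (q ^ j) dvd fq t" for t
  proof
    assume "int (q ^ j) dvd fq t"
    moreover have "int q dvd int (q ^ j)" using j by simp
    ultimately show False using False dvd_trans by blast
  qed
  then have "rho (q ^ j) = 0" by (simp add: rho_def)
  moreover have "chi (int q) = - 1" using chi_prime_root[OF q] False chi_values[of "int q"] by auto
  ultimately show ?thesis by simp
next
  case True
  define Q where "Q = int q ^ j"
  have Q0: "Q > 0" using prime_gt_0_nat[OF q(1)] by (simp add: Q_def)
  obtain t1 where t1: "Q dvd fq t1" using hensel_root[OF q True j] unfolding Q_def by blast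
  define t0 where "t0 = t1 mod Q"
  have t0: "Q dvd fq t0" "0 \<le> t0" "t0 < Q"
    using t1 fq_cong[of t0 t1 Q] Q0 by (simp_all add: t0_def)
  define t0' where "t0' = (- 1 - t0) mod Q"
  have c': "[t0' = - 1 - t0] (mod Q)" by (simp add: t0'_def)
  have "fq (- 1 - t0) = fq t0" by (simp add: fq_def algebra_simps)
  then have t0': "Q dvd fq t0'" "0 \<le> t0'" "t0' < Q"
    using t0 fq_cong[OF c'] Q0 by (simp_all add: t0'_def)
  have qQ: "int q dvd Q" unfolding Q_def using j by simp
  then have "int q dvd fq t0" using t0(1) dvd_trans by blast
  then have nr: "\<not> int q dvd 2 * t0 + 1" by (rule simple_root[OF q])
  have "{t \<in> {0..<Q}. Q dvd fq t} = {t0, t0'}"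
  proof (intro equalityI subsetI)
    fix t assume t: "t \<in> {t \<in> {0..<Q}. Q dvd fq t}"
    then have "Q dvd fq t - fq t0" using t0(1) by (intro dvd_diff) auto
    also have "fq t - fq t0 = (t - t0) * (t + t0 + 1)" by (simp add: fq_def algebra_simps)
    finally have d: "Q dvd (t - t0) * (t + t0 + 1)" .
    show "t \<in> {t0, t0'}"
    proof (cases "int q dvd t - t0")
      case True
      have "\<not> int q dvd t + t0 + 1"
      proof
        assume "int q dvd t + t0 + 1"
        then have "int q dvd (t + t0 + 1) - (t - t0)" using True by (rule dvd_diff)
        then show False using nr by (simp add: algebra_simps)
      qed
      then have "coprime Q (t + t0 + 1)"
        unfolding Q_def using q(1) prime_imp_coprime[of "int q" "t + t0 + 1"] by simp
      then have "Q dvd t - t0" using d by (simp add: coprime_dvd_mult_left_iff)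
      then have "t = t0" using t t0 dvd_imp_le_int[of "t - t0" Q] by fastforce
      then show ?thesis by simp
    next
      case False
      then have "coprime Q (t - t0)"
        unfolding Q_def using q(1) prime_imp_coprime[of "int q" "t - t0"] by simp
      then have "Q dvd t + t0 + 1" using d by (simp add: coprime_dvd_mult_right_iff)
      then have "[t = - 1 - t0] (mod Q)" by (simp add: cong_iff_dvd_diff algebra_simps)
      then have "[t = t0'] (mod Q)" using c' by (metis cong_sym cong_trans)
      then have "t = t0'" using t t0' by (simp add: Cong.cong_def)
      then show ?thesis by simp
    qed
  qed (use t0 t0' in auto)
  moreover have "t0 \<noteq> t0'"
  proof
    assume "t0 = t0'"
    then have "Q dvd t0 - (- 1 - t0)" using c' by (simp add: cong_iff_dvd_diff)
    then have "Q dvd 2 * t0 + 1" by (simp add: algebra_simps)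
    then show False using nr qQ dvd_trans by blast
  qed
  ultimately have "rho (q ^ j) = 2" unfolding rho_def by (simp add: Q_def)
  then show ?thesis using chi_prime_root(1)[OF q] True by simp
qed

text \<open>At the ramified prime \<open>4 * fq t\<close> is a perfect square modulo
  \<open>p\<close>; the double root is \<open>n\<close>, since \<open>2 * n + 1 = p\<close>.\<close>

lemma rho_p: "rho p = 1"
proof -
  have d: "int p dvd fq t \<longleftrightarrow> int p dvd 2 * t + 1" for t
  proof
    assume "int p dvd fq t"
    then have "int p dvd 4 * fq t + int p" by simp
    then have "int p dvd (2 * t + 1) * (2 * t + 1)" unfolding fq_disc by simp
    then show "int p dvd 2 * t + 1" using prime_int_p by (simp add: prime_dvd_mult_iff)
  next
    assume "int p dvd 2 * t + 1"
    then have "int p dvd (2 * t + 1) * (2 * t + 1) - int p" by simp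
    then have "int p dvd 4 * fq t" unfolding fq_disc .
    moreover have "coprime (int p) (2 ^ 2)" using odd_p by (simp only: coprime_power_right_iff) simp
    ultimately show "int p dvd fq t" by (simp add: coprime_dvd_mult_right_iff)
  qed
  have "{t \<in> {0..<int p}. int p dvd fq t} = {int n}"
  proof (intro equalityI subsetI)
    fix t assume t: "t \<in> {t \<in> {0..<int p}. int p dvd fq t}"
    then have "int p dvd 2 * t + 1" using d by simp
    then have "int p dvd (2 * t + 1) - int p" by simp
    then have "2 * t + 1 = int p"
      using t dvd_imp_le_int[of "(2 * t + 1) - int p" "int p"] by fastforce
    then show "t \<in> {int n}" using p_eq by simp
  next
    fix t assume "t \<in> {int n}"
    moreover have "2 * int n + 1 = int p" using p_eq by simp
    ultimately show "t \<in> {t \<in> {0..<int p}. int p dvd fq t}" using d[of "int n"] n_less_p by simp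
  qed
  then show ?thesis by (simp add: rho_def)
qed

text \<open>A root modulo \<open>p ^ 2\<close> would make \<open>2 * t + 1\<close> divisible by
  \<open>p\<close>, and then \<open>p ^ 2\<close> would divide \<open>p\<close>.\<close>

lemma rho_p_power: "j \<ge> 2 \<Longrightarrow> rho (p ^ j) = 0"
proof -
  assume j: "j \<ge> 2"
  have "\<not> int (p ^ j) dvd fq t" for t
  proof
    assume "int (p ^ j) dvd fq t"
    moreover have "int p ^ 2 dvd int p ^ j" using j by (rule le_imp_power_dvd)
    ultimately have "int p ^ 2 dvd fq t" using dvd_trans by simp
    then have "int p * int p dvd 4 * fq t" by (simp add: power2_eq_square)
    then have pp: "int p * int p dvd (2 * t + 1) * (2 * t + 1) - int p" unfolding fq_disc .
    then have "int p dvd ((2 * t + 1) * (2 * t + 1) - int p) + int p" by (intro dvd_add) (auto intro: dvd_mult_left)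
    then have "int p dvd 2 * t + 1" using prime_int_p by (simp add: prime_dvd_mult_iff)
    then have "int p * int p dvd (2 * t + 1) * (2 * t + 1)" by (intro mult_dvd_mono)
    then have "int p * int p dvd (2 * t + 1) * (2 * t + 1) - ((2 * t + 1) * (2 * t + 1) - int p)" using pp by (rule dvd_diff)
    then have "int p * int p dvd int p * 1" by simp
    then have "int p dvd 1" using p_pos by (simp only: dvd_times_left_cancel_iff)
    then show False using p_gt_2 by simp
  qed
  then show ?thesis by (simp add: rho_def)
qed

text \<open>The integer factor \<open>k\<close> of an ideal contributes \<open>k * k\<close> to its
  norm: convolution with this indicator passes from primitive ideals to all ideals.\<close>

definition sq_ind :: "nat \<Rightarrow> int" where "sq_ind d = (if is_square d then 1 else 0)"

lemma sq_ind_multiplicative: "nat_multiplicative sq_ind"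
  unfolding nat_multiplicative_def sq_ind_def
  by (auto simp: is_nth_power_mult_coprime_nat_iff)

lemma chi_nat_multiplicative: "nat_multiplicative (\<lambda>d. chi (int d))"
  unfolding nat_multiplicative_def by (simp add: chi_mult)

text \<open>The left-hand side counts the ideals \<open>idl i a t\<close> of norm \<open>k = i * i * a\<close>; this is the identity
  between the Dedekind zeta function and \<open>\<zeta>(s) L(s, chi)\<close>, coefficient by coefficient.\<close>

lemma ideal_count_arith:
  assumes "k > 0"
  shows "dconv sq_ind rho k = dconv (\<lambda>d. chi (int d)) (\<lambda>_. 1) k"
proof (rule nat_multiplicative_eqI[OF _ _ _ assms])
  show "nat_multiplicative (dconv sq_ind rho)"
    by (rule nat_multiplicative_dconv[OF sq_ind_multiplicative rho_multiplicative])
  show "nat_multiplicative (dconv (\<lambda>d. chi (int d)) (\<lambda>_. 1))"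
    by (rule nat_multiplicative_dconv[OF chi_nat_multiplicative]) (simp add: nat_multiplicative_def)
  fix q j :: nat assume q: "prime q"
  define c where "c = chi (int q)"
  have sqi: "sq_ind (q ^ i) = (if even i then 1 else 0)" for i
  proof -
    have "is_square (q ^ i) \<longleftrightarrow> even i" using is_nth_power_prime_power_nat_iff[OF q, of 2 i] by simp
    then show ?thesis by (simp add: sq_ind_def)
  qed
  have B: "dconv (\<lambda>d. chi (int d)) (\<lambda>_. 1) (q ^ i) = (\<Sum>l\<le>i. c ^ l)" for i
  proof -
    have "chi (int q ^ l) = c ^ l" for l by (induction l) (auto simp: chi_mult c_def)
    then show ?thesis unfolding dconv_prime_power[OF q] by simp
  qed
  \<comment> \<open>Only even exponents carry a square: the first two terms split off, and the rest
    is the same sum two steps lower.\<close>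
  have A: "dconv sq_ind rho (q ^ (i + 2)) = rho (q ^ (i + 2)) + dconv sq_ind rho (q ^ i)" for i
  proof -
    define H where "H = (\<lambda>l. sq_ind (q ^ l) * rho (q ^ (i + 2 - l)))"
    have "dconv sq_ind rho (q ^ (i + 2)) = (\<Sum>l\<le>Suc (Suc i). H l)"
      unfolding dconv_prime_power[OF q] H_def by simp
    also have "\<dots> = H 0 + (H 1 + (\<Sum>l\<le>i. H (Suc (Suc l))))"
      by (simp add: sum.atMost_Suc_shift del: sum.atMost_Suc)
    also have "H 0 = rho (q ^ (i + 2))" unfolding H_def sqi by simp
    also have "H 1 = 0" unfolding H_def sqi by simp
    also have "(\<Sum>l\<le>i. H (Suc (Suc l))) = dconv sq_ind rho (q ^ i)"
      unfolding dconv_prime_power[OF q] H_def sqi by simp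
    finally show ?thesis by simp
  qed
  have rho1: "rho 1 = 1" using rho_multiplicative by (simp add: nat_multiplicative_def)
  have rho_q: "rho q = 1 + c"
    using rho_prime_power[of q 1] q rho_p by (cases "q = p") (auto simp: c_def chi_eq_0_iff)
  have step: "rho (q ^ (i + 2)) = c ^ Suc i + c ^ Suc (Suc i)" for i
  proof (cases "q = p")
    case True
    then have "c = 0" by (simp add: c_def chi_eq_0_iff)
    then show ?thesis using rho_p_power[of "i + 2"] True by simp
  next
    case False
    then have "c = 1 \<or> c = - 1" using chi_prime_root(2)[OF q] chi_values[of "int q"] by (auto simp: c_def)
    then show ?thesis using rho_prime_power[OF q False, of "i + 2"] by (auto simp: c_def[symmetric])
  qed
  show "dconv sq_ind rho (q ^ j) = dconv (\<lambda>d. chi (int d)) (\<lambda>_. 1) (q ^ j)"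
    unfolding B
  proof (induction j rule: induct_nat_012)
    case 0
    show ?case using dconv_prime_power[OF q, of sq_ind rho 0] rho1 sqi[of 0] by simp
  next
    case 1
    show ?case using dconv_prime_power[OF q, of sq_ind rho 1] rho1 rho_q sqi[of 0] sqi[of 1] by simp
  next
    case (ge2 j)
    then show ?case using A[of j] step[of j] by simp
  qed
qed

end

section \<open>The density of ideals with respect to the norm\<close>

lemma nat_div_bounds:
  assumes "d > 0"
  shows "real (X div d) \<le> real X / real d" "real X / real d \<le> real (X div d) + 1"
proof -
  have "real X = real (d * (X div d) + X mod d)" by simp
  then have e: "real X = real d * real (X div d) + real (X mod d)" by (simp only: of_nat_add of_nat_mult)
  have "real (X mod d) \<le> real d" using assms by (simp add: less_imp_le)
  then have "real X \<le> (real (X div d) + 1) * real d" unfolding e by (simp add: algebra_simps)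
  then show "real X / real d \<le> real (X div d) + 1" using assms by (simp add: divide_le_eq)
  have "real (X div d) * real d \<le> real X" unfolding e by (simp add: mult.commute)
  then show "real (X div d) \<le> real X / real d" using assms by (simp add: le_divide_eq)
qed

context prime_1_mod_4
begin

text \<open>The normal forms of norm \<open>N\<close> are sorted by \<open>k\<close>, which leaves
  \<open>a = N / k ^ 2\<close>; the sum over \<open>k\<close> becomes a convolution supported on the
  square divisors of \<open>N\<close>.\<close>

lemma card_ideals_norm_eq:
  assumes "N > 0"
  shows "int (card {I \<in> nonzero_ideals p. nrm I = int N}) = dconv (\<lambda>d. chi (int d)) (\<lambda>_. 1) N"
proof -
  let ?T = "\<lambda>a. {t \<in> {0..<int a}. int a dvd fq t}"
  define S where "S = {k :: nat. k\<^sup>2 dvd N}"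
  define Z where "Z = (SIGMA k:S. ?T (N div k\<^sup>2))"
  have S0: "k > 0" if "k \<in> S" for k using that assms by (intro gr0I) (auto simp: S_def)
  have finS: "finite S"
  proof (rule finite_subset)
    show "S \<subseteq> {0..N}"
    proof
      fix k assume k: "k \<in> S"
      then have "k\<^sup>2 \<le> N" using assms by (auto simp: S_def dest: dvd_imp_le)
      then have "k \<le> N" using order_trans[OF le_square[of k]] by (simp add: power2_eq_square)
      then show "k \<in> {0..N}" by simp
    qed
  qed simp
  have "bij_betw (\<lambda>(k, t). idl (int k) (int (N div k\<^sup>2)) t) Z {I \<in> nonzero_ideals p. nrm I = int N}"
    unfolding bij_betw_def
  proof
    have tri: "(int k, int (N div k\<^sup>2), t) \<in> triples \<and> int k * int k * int (N div k\<^sup>2) = int N"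
      if "(k, t) \<in> Z" for k t
    proof -
      have k: "k \<in> S" "t \<in> ?T (N div k\<^sup>2)" using that by (auto simp: Z_def)
      then have e: "k\<^sup>2 * (N div k\<^sup>2) = N" by (simp add: S_def)
      then have "N div k\<^sup>2 > 0" using assms by (intro gr0I) simp
      moreover have "int (k\<^sup>2 * (N div k\<^sup>2)) = int N" using e by (simp only:)
      ultimately show ?thesis using k S0[OF k(1)] by (simp add: triples_def fq_def power2_eq_square)
    qed
    show "inj_on (\<lambda>(k, t). idl (int k) (int (N div k\<^sup>2)) t) Z"
    proof (rule inj_onI)
      fix z z' assume z: "z \<in> Z" "z' \<in> Z"
        "(case z of (k, t) \<Rightarrow> idl (int k) (int (N div k\<^sup>2)) t) = (case z' of (k, t) \<Rightarrow> idl (int k) (int (N div k\<^sup>2)) t)"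
      obtain k t k' t' where e: "z = (k, t)" "z' = (k', t')" by (cases z, cases z')
      show "z = z'" using idl_inj[of "int k" "int (N div k\<^sup>2)" t "int k'" "int (N div k'\<^sup>2)" t'] tri[of k t] tri[of k' t'] z e by simp
    qed
    show "(\<lambda>(k, t). idl (int k) (int (N div k\<^sup>2)) t) ` Z = {I \<in> nonzero_ideals p. nrm I = int N}"
    proof (intro equalityI subsetI)
      fix I assume "I \<in> (\<lambda>(k, t). idl (int k) (int (N div k\<^sup>2)) t) ` Z"
      then obtain k t where kt: "(k, t) \<in> Z" "I = idl (int k) (int (N div k\<^sup>2)) t" by auto
      then show "I \<in> {I \<in> nonzero_ideals p. nrm I = int N}"
        using tri[OF kt(1)] idl_ideal nrm_idl by auto
    next
      fix I assume I: "I \<in> {I \<in> nonzero_ideals p. nrm I = int N}"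
      then obtain k a t where T: "(k, a, t) \<in> triples" "I = idl k a t" using ideal_is_idl by blast
      then have N: "int N = k * k * a" using I nrm_idl by auto
      have T': "k \<ge> 1" "a \<ge> 1" "0 \<le> t" "t < a" "a dvd fq t" using T by (auto simp: triples_def fq_def)
      define k' where "k' = nat k"
      define a' where "a' = nat a"
      have ka: "k = int k'" "a = int a'" using T' by (simp_all add: k'_def a'_def)
      then have "int N = int (k'\<^sup>2 * a')" using N by (simp add: power2_eq_square)
      then have N': "N = k'\<^sup>2 * a'" by (simp only: of_nat_eq_iff)
      then have "N div k'\<^sup>2 = a'" using T' ka by simp
      then have "(k', t) \<in> Z" "I = idl (int k') (int (N div k'\<^sup>2)) t"
        using T T' N' ka by (auto simp: Z_def S_def)
      then show "I \<in> (\<lambda>(k, t). idl (int k) (int (N div k\<^sup>2)) t) ` Z" by (intro image_eqI[of _ _ "(k', t)"]) auto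
    qed
  qed
  then have "card {I \<in> nonzero_ideals p. nrm I = int N} = card Z" by (rule bij_betw_same_card[symmetric])
  also have "\<dots> = (\<Sum>k\<in>S. card (?T (N div k\<^sup>2)))"
  proof -
    have "finite (?T a)" for a by (rule finite_subset[of _ "{0..<int a}"]) auto
    then show ?thesis unfolding Z_def using finS by (intro card_SigmaI) blast+
  qed
  finally have "int (card {I \<in> nonzero_ideals p. nrm I = int N}) = (\<Sum>k\<in>S. rho (N div k\<^sup>2))"
    by (simp add: rho_def)
  also have "\<dots> = (\<Sum>d\<in>(\<lambda>k. k\<^sup>2) ` S. rho (N div d))"
    by (subst sum.reindex) (auto simp: inj_on_def)
  also have "\<dots> = (\<Sum>d\<in>(\<lambda>k. k\<^sup>2) ` S. sq_ind d * rho (N div d))"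
    by (rule sum.cong) (auto simp: sq_ind_def)
  also have "\<dots> = (\<Sum>d | d dvd N. sq_ind d * rho (N div d))"
    by (rule sum.mono_neutral_left) (use assms in \<open>auto simp: S_def sq_ind_def elim!: is_nth_powerE\<close>)
  also have "\<dots> = dconv sq_ind rho N" by (simp add: dconv_def)
  finally show ?thesis using ideal_count_arith[OF assms] by simp
qed

lemma card_ideals_norm_le:
  "int (card {I \<in> nonzero_ideals p. nrm I \<le> int X}) = (\<Sum>d=1..X. chi (int d) * int (X div d))"
proof -
  let ?A = "\<lambda>N. {I \<in> nonzero_ideals p. nrm I = int N}"
  have "{I \<in> nonzero_ideals p. nrm I \<le> int X} = (\<Union>N\<in>{1..X}. ?A N)"
  proof (intro equalityI subsetI)
    fix I assume I: "I \<in> {I \<in> nonzero_ideals p. nrm I \<le> int X}"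
    then have "nrm I > 0" using nrm_pos by blast
    then show "I \<in> (\<Union>N\<in>{1..X}. ?A N)" using I by (intro UN_I[of "nat (nrm I)"]) auto
  qed auto
  moreover have "card (\<Union>N\<in>{1..X}. ?A N) = (\<Sum>N=1..X. card (?A N))"
  proof (rule card_UN_disjoint)
    show "\<forall>N\<in>{1..X}. finite (?A N)"
      using finite_subset[OF _ finite_bounded_ideals] by (metis (mono_tags, lifting) Collect_mono order_refl)
  qed auto
  ultimately have "card {I \<in> nonzero_ideals p. nrm I \<le> int X} = (\<Sum>N=1..X. card (?A N))" by simp
  then have "int (card {I \<in> nonzero_ideals p. nrm I \<le> int X}) = (\<Sum>N=1..X. \<Sum>d | d dvd N. chi (int d))"
    using card_ideals_norm_eq by (simp add: dconv_def)
  also have "\<dots> = (\<Sum>N=1..X. \<Sum>d\<in>{d \<in> {1..X}. d dvd N}. chi (int d))"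
    by (intro sum.cong) (auto dest: dvd_imp_le intro: Suc_leI gr0I)
  also have "\<dots> = (\<Sum>d=1..X. \<Sum>N\<in>{N \<in> {1..X}. d dvd N}. chi (int d))"
    by (rule sum.swap_restrict) auto
  also have "\<dots> = (\<Sum>d=1..X. chi (int d) * int (X div d))"
  proof (rule sum.cong[OF refl])
    fix d assume d: "d \<in> {1..X}"
    have "{N \<in> {1..X}. d dvd N} = (\<lambda>i. d * i) ` {1..X div d}"
    proof (intro equalityI subsetI)
      fix N assume N: "N \<in> {N \<in> {1..X}. d dvd N}"
      then obtain i where i: "N = d * i" by (auto elim: dvdE)
      then have "i \<le> X div d" using N d by (simp add: less_eq_div_iff_mult_less_eq mult.commute)
      moreover have "i \<ge> 1" using N i by (cases i) auto
      ultimately show "N \<in> (\<lambda>i. d * i) ` {1..X div d}" using i by auto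
    next
      fix N assume "N \<in> (\<lambda>i. d * i) ` {1..X div d}"
      then show "N \<in> {N \<in> {1..X}. d dvd N}" using d
        by (auto simp: less_eq_div_iff_mult_less_eq mult.commute Suc_le_eq)
    qed
    moreover have "inj_on (\<lambda>i. d * i) {1..X div d}" using d by (auto simp: inj_on_def)
    ultimately have "card {N \<in> {1..X}. d dvd N} = X div d" by (simp add: card_image)
    then show "(\<Sum>N\<in>{N \<in> {1..X}. d dvd N}. chi (int d)) = chi (int d) * int (X div d)" by simp
  qed
  finally show ?thesis .
qed

text \<open>The sum is split at \<open>M\<close>: for \<open>d < M\<close> dropping the floor costs
  at most 1 per term, while for \<open>d \<ge> M\<close> summation by parts bounds both the counting
  sum, as \<open>X div d\<close> decreases in \<open>d\<close>, and the tail of the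
  L-series.\<close>

lemma ideal_density_bound:
  assumes "M \<ge> 1" "X \<ge> M"
  shows "\<bar>real (card {I \<in> nonzero_ideals p. nrm I \<le> int X}) / real X - L_fun 1\<bar> \<le> real M / real X + 2 * (real p / real M)"
proof -
  let ?c = "\<lambda>d. real_of_int (chi (int d))"
  have X0: "real X > 0" using assms by simp
  have "real (card {I \<in> nonzero_ideals p. nrm I \<le> int X}) = of_int (int (card {I \<in> nonzero_ideals p. nrm I \<le> int X}))" by simp
  also have "\<dots> = (\<Sum>d=1..X. ?c d * real (X div d))" unfolding card_ideals_norm_le by simp
  also have "{1..X} = {1..<M} \<union> {M..<Suc X}" using assms by auto
  also have "(\<Sum>d\<in>\<dots>. ?c d * real (X div d)) = (\<Sum>d=1..<M. ?c d * real (X div d)) + (\<Sum>d=M..<Suc X. ?c d * real (X div d))"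
    by (rule sum.union_disjoint) auto
  finally have S: "real (card {I \<in> nonzero_ideals p. nrm I \<le> int X}) =
      (\<Sum>d=1..<M. ?c d * real (X div d)) + (\<Sum>d=M..<Suc X. ?c d * real (X div d))" .
  have head: "\<bar>(\<Sum>d=1..<M. ?c d * real (X div d)) - real X * (\<Sum>d<M. L_term 1 d)\<bar> \<le> real M"
  proof -
    have "(\<Sum>d<M. L_term 1 d) = (\<Sum>d=1..<M. L_term 1 d)"
      by (rule sum.mono_neutral_right) (auto simp: L_term_def Suc_le_eq)
    then have "(\<Sum>d=1..<M. ?c d * real (X div d)) - real X * (\<Sum>d<M. L_term 1 d) =
        (\<Sum>d=1..<M. ?c d * (real (X div d) - real X / real d))"
      by (simp add: L_term_def sum_distrib_left sum_subtractf[symmetric] algebra_simps)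
    also have "\<bar>\<dots>\<bar> \<le> (\<Sum>d=1..<M. 1)"
    proof (rule order_trans[OF sum_abs sum_mono])
      fix d assume d: "d \<in> {1..<M}"
      have "\<bar>real (X div d) - real X / real d\<bar> \<le> 1"
        using nat_div_bounds[of d X] d by (simp add: abs_le_iff)
      moreover have "\<bar>?c d\<bar> \<le> 1" using chi_values[of "int d"] by auto
      ultimately have "\<bar>?c d\<bar> * \<bar>real (X div d) - real X / real d\<bar> \<le> 1 * 1" by (intro mult_mono) auto
      then show "\<bar>?c d * (real (X div d) - real X / real d)\<bar> \<le> 1" by (simp add: abs_mult)
    qed
    also have "\<dots> \<le> real M" by simp
    finally show ?thesis .
  qed
  have tail: "\<bar>\<Sum>d=M..<Suc X. ?c d * real (X div d)\<bar> \<le> real p * real (X div M)"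
  proof (rule abel_summation_bound[OF sum_chi_bound])
    fix i assume "i \<ge> M"
    then show "real (X div Suc i) \<le> real (X div i)" using assms by (simp add: div_le_mono2)
  qed simp
  have "real (X div M) \<le> real X / real M" using nat_div_bounds(1)[of M X] assms by simp
  then have "real p * real (X div M) \<le> real p * (real X / real M)" by (rule mult_left_mono) simp
  then have tail': "\<bar>\<Sum>d=M..<Suc X. ?c d * real (X div d)\<bar> \<le> real X * (real p / real M)"
    using tail by (simp add: mult_ac)
  have Lt: "\<bar>real X * (\<Sum>d<M. L_term 1 d) - real X * L_fun 1\<bar> \<le> real X * (real p / real M)"
  proof -
    have "\<bar>L_fun 1 - (\<Sum>d<M. L_term 1 d)\<bar> \<le> real p / real M" using L_tail[of 1 M] assms by simp
    then have "real X * \<bar>L_fun 1 - (\<Sum>d<M. L_term 1 d)\<bar> \<le> real X * (real p / real M)" by (rule mult_left_mono) simp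
    moreover have "\<bar>real X * (\<Sum>d<M. L_term 1 d) - real X * L_fun 1\<bar> = real X * \<bar>L_fun 1 - (\<Sum>d<M. L_term 1 d)\<bar>"
      unfolding right_diff_distrib[symmetric] abs_mult by (simp add: abs_minus_commute)
    ultimately show ?thesis by simp
  qed
  have "\<bar>real (card {I \<in> nonzero_ideals p. nrm I \<le> int X}) - real X * L_fun 1\<bar> \<le> real M + 2 * (real X * (real p / real M))"
    using head tail' Lt unfolding S by linarith
  then have "\<bar>real (card {I \<in> nonzero_ideals p. nrm I \<le> int X}) - real X * L_fun 1\<bar> / real X \<le>
      (real M + 2 * (real X * (real p / real M))) / real X" using X0 by (intro divide_right_mono) auto
  moreover have "\<bar>real (card {I \<in> nonzero_ideals p. nrm I \<le> int X}) - real X * L_fun 1\<bar> / real X =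
      \<bar>real (card {I \<in> nonzero_ideals p. nrm I \<le> int X}) / real X - L_fun 1\<bar>"
  proof -
    have "real (card {I \<in> nonzero_ideals p. nrm I \<le> int X}) / real X - L_fun 1 =
        (real (card {I \<in> nonzero_ideals p. nrm I \<le> int X}) - real X * L_fun 1) / real X"
      using X0 by (simp add: diff_divide_distrib)
    then show ?thesis using X0 by (simp add: abs_divide)
  qed
  moreover have "(real M + 2 * (real X * (real p / real M))) / real X = real M / real X + 2 * (real p / real M)"
    using X0 by (simp add: add_divide_distrib)
  ultimately show ?thesis by simp
qed

theorem ideal_density:
  "(\<lambda>X. real (card {I \<in> nonzero_ideals p. nrm I \<le> int X}) / real X) \<longlonglongrightarrow> L_fun 1"
proof (rule LIMSEQ_I)
  fix \<epsilon> :: real assume \<epsilon>: "\<epsilon> > 0"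
  \<comment> \<open>\<open>M\<close> is fixed first to control the tails; then \<open>X\<close> is
    taken large against \<open>M\<close>.\<close>
  obtain M :: nat where M: "4 * real p / \<epsilon> < real M" using reals_Archimedean2 by blast
  then have M0: "M \<ge> 1" using \<epsilon> by (cases M) (auto simp: field_simps)
  have b1: "2 * (real p / real M) < \<epsilon> / 2" using M M0 \<epsilon> by (simp add: field_simps)
  obtain X0 :: nat where X0: "2 * real M / \<epsilon> < real X0" using reals_Archimedean2 by blast
  show "\<exists>N. \<forall>X\<ge>N. norm (real (card {I \<in> nonzero_ideals p. nrm I \<le> int X}) / real X - L_fun 1) < \<epsilon>"
  proof (intro exI allI impI)
    fix X assume X: "X \<ge> max M X0"
    have "2 * real M / \<epsilon> < real X" using X X0 by simp
    moreover have "real X > 0" using X M0 by simp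
    ultimately have "real M / real X < \<epsilon> / 2" using \<epsilon> by (simp add: field_simps)
    moreover have "\<bar>real (card {I \<in> nonzero_ideals p. nrm I \<le> int X}) / real X - L_fun 1\<bar> \<le> real M / real X + 2 * (real p / real M)"
      using ideal_density_bound[OF M0, of X] X by simp
    ultimately show "norm (real (card {I \<in> nonzero_ideals p. nrm I \<le> int X}) / real X - L_fun 1) < \<epsilon>"
      using b1 unfolding real_norm_def by linarith
  qed
qed

end

subsection \<open>Lattice points in a hyperbolic region\<close>

text \<open>Replacing each lattice point by the half-open square at its upper right turns the counting
  function into the integral of the indicator of \<open>D\<close> precomposed with rounding to the lattice.\<close>

lemma lattice_point_count:
  fixes D :: "(real \<times> real) set"
  assumes D: "D \<in> sets borel" and bdd: "D \<subseteq> {-B..B} \<times> {-B..B}"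
    and bdry: "AE w in lborel. \<forall>\<^sub>F z in nhds w. (z \<in> D) = (w \<in> D)"
  shows "(\<lambda>X. real (card {(r :: int, s :: int). (of_int r / sqrt (real X), of_int s / sqrt (real X)) \<in> D}) / real X)
    \<longlonglongrightarrow> measure lborel D"
proof -
  define q where "q = (\<lambda>X. sqrt (real X))"
  define S where "S = (\<lambda>X. {(r :: int, s :: int). (of_int r / q X, of_int s / q X) \<in> D})"
  define rd where "rd = (\<lambda>X (x, y). (of_int \<lfloor>q X * x\<rfloor> / q X, of_int \<lfloor>q X * y\<rfloor> / q X) :: real \<times> real)"
  define G where "G = (\<lambda>X w. indicat_real D (rd X w))"
  have q0: "q X > 0" if "X > 0" for X using that by (simp add: q_def)
  have qq: "q X * q X = real X" for X by (simp add: q_def)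
  have finS: "finite (S X)" if "X > 0" for X
  proof (rule finite_subset)
    show "S X \<subseteq> {-\<lceil>B * q X\<rceil>..\<lceil>B * q X\<rceil>} \<times> {-\<lceil>B * q X\<rceil>..\<lceil>B * q X\<rceil>}"
    proof
      fix z assume "z \<in> S X"
      then obtain r s where z: "z = (r, s)" "(of_int r / q X, of_int s / q X) \<in> D" by (auto simp: S_def)
      have *: "i \<in> {-\<lceil>B * q X\<rceil>..\<lceil>B * q X\<rceil>}" if "- B \<le> of_int i / q X" "of_int i / q X \<le> B" for i :: int
      proof -
        have "of_int i \<le> B * q X" "- (B * q X) \<le> of_int i" using that q0[OF \<open>X > 0\<close>] by (simp_all add: field_simps)
        then show ?thesis by (simp add: le_ceiling_iff) linarith
      qed
      show "z \<in> {-\<lceil>B * q X\<rceil>..\<lceil>B * q X\<rceil>} \<times> {-\<lceil>B * q X\<rceil>..\<lceil>B * q X\<rceil>}"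
      proof -
        have "(of_int r / q X, of_int s / q X) \<in> {-B..B} \<times> {-B..B}" using z(2) bdd by blast
        then show ?thesis unfolding z(1) using *[of r] *[of s] by simp
      qed
    qed
  qed auto
  define box where "box = (\<lambda>X (r :: int, s :: int). {of_int r / q X..<(of_int r + 1) / q X} \<times> {of_int s / q X..<(of_int s + 1) / q X} :: (real \<times> real) set)"
  have mem_box: "w \<in> box X (r, s) \<longleftrightarrow> \<lfloor>q X * fst w\<rfloor> = r \<and> \<lfloor>q X * snd w\<rfloor> = s" if "X > 0" for X w r s
    using q0[OF that] by (cases w) (auto simp: box_def floor_eq_iff field_simps)
  have boxm: "box X z \<in> sets lborel" for X z by (cases z) (auto simp: box_def intro!: borel_Times)
  have emb: "emeasure lborel (box X z) = ennreal (1 / real X)" if "X > 0" for X z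
  proof -
    obtain r s where z: "z = (r, s)" by (cases z)
    have "(of_int i + 1) / q X - of_int i / q X = 1 / q X" for i :: int by (simp add: diff_divide_distrib[symmetric])
    then have e: "emeasure lborel {of_int i / q X..<(of_int i + 1) / q X} = ennreal (1 / q X)" for i :: int
      using q0[OF that] by (subst emeasure_lborel_Ico) (auto intro!: divide_right_mono)
    have "emeasure lborel (box X z) = emeasure (lborel \<Otimes>\<^sub>M lborel) (box X z)" by (simp add: lborel_prod)
    also have "\<dots> = ennreal (1 / q X) * ennreal (1 / q X)"
      unfolding z box_def prod.case by (subst lborel.emeasure_pair_measure_Times) (simp_all add: e)
    also have "\<dots> = ennreal (1 / real X)" using q0[OF that] by (simp add: ennreal_mult[symmetric] qq)
    finally show ?thesis .
  qed
  have Gsum: "G X w = (\<Sum>z\<in>S X. indicat_real (box X z) w)" if X: "X > 0" for X w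
  proof -
    define z0 where "z0 = (\<lfloor>q X * fst w\<rfloor>, \<lfloor>q X * snd w\<rfloor>)"
    have "(\<Sum>z\<in>S X. indicat_real (box X z) w) = (\<Sum>z\<in>S X. if z = z0 then 1 else 0)"
      by (rule sum.cong) (auto simp: z0_def mem_box[OF X] indicator_def)
    also have "\<dots> = (if z0 \<in> S X then 1 else 0)" using finS[OF X] by simp
    also have "z0 \<in> S X \<longleftrightarrow> rd X w \<in> D" by (cases w) (simp add: z0_def S_def rd_def)
    finally show ?thesis by (simp add: G_def indicator_def)
  qed
  have int: "integrable lborel (indicat_real (box X z))" if "X > 0" for X z
    using emb[OF that, of z] boxm by (simp add: integrable_indicator_iff)
  have Gint: "integral\<^sup>L lborel (G X) = real (card (S X)) / real X" if X: "X > 0" for X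
  proof -
    have "integral\<^sup>L lborel (G X) = (\<integral>w. (\<Sum>z\<in>S X. indicat_real (box X z) w) \<partial>lborel)"
      by (rule Bochner_Integration.integral_cong) (simp_all add: Gsum[OF X])
    also have "\<dots> = (\<Sum>z\<in>S X. measure lborel (box X z))"
      using int[OF X] by (subst Bochner_Integration.integral_sum) auto
    also have "\<dots> = (\<Sum>z\<in>S X. 1 / real X)"
      by (rule sum.cong) (simp_all add: measure_def emb[OF X])
    finally show ?thesis by simp
  qed
  \<comment> \<open>The shift to \<open>Suc X\<close> keeps the scale \<open>q\<close> at least 1
    and is undone at the end. Rounding then moves a point by at most 1 in each coordinate, hence the
    box enlarged by 1 as dominating function.\<close>
  have "(\<lambda>X. integral\<^sup>L lborel (G (Suc X))) \<longlonglongrightarrow> integral\<^sup>L lborel (indicat_real D)"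
  proof (rule integral_dominated_convergence[where w = "indicat_real ({-B-1..B+1} \<times> {-B-1..B+1})"])
    show "indicat_real D \<in> borel_measurable lborel" using D by simp
    show "G (Suc X) \<in> borel_measurable lborel" for X
    proof -
      have "G (Suc X) = (\<lambda>w. \<Sum>z\<in>S (Suc X). indicat_real (box (Suc X) z) w)" using Gsum[of "Suc X"] by auto
      then show ?thesis using boxm by simp
    qed
    have "emeasure lborel ({-B-1..B+1} \<times> {-B-1..B+1} :: (real \<times> real) set) < \<infinity>"
    proof -
      have "compact ({-B-1..B+1} \<times> {-B-1..B+1} :: (real \<times> real) set)" by (intro compact_Times compact_Icc)
      then show ?thesis using emeasure_compact_finite by blast
    qed
    then show "integrable lborel (indicat_real ({-B-1..B+1} \<times> {-B-1..B+1} :: (real \<times> real) set))"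
      by (intro integrable_real_indicator) (auto intro!: borel_Times)
    show "AE w in lborel. (\<lambda>X. G (Suc X) w) \<longlonglongrightarrow> indicat_real D w"
      using bdry
    proof eventually_elim
      case (elim w)
      have lim1: "(\<lambda>X. of_int \<lfloor>q (Suc X) * x\<rfloor> / q (Suc X)) \<longlonglongrightarrow> x" for x
      proof (rule real_tendsto_sandwich)
        show "\<forall>\<^sub>F X in sequentially. x - 1 / q (Suc X) \<le> of_int \<lfloor>q (Suc X) * x\<rfloor> / q (Suc X)"
        proof (intro always_eventually allI)
          fix X
          have "q (Suc X) * x - 1 \<le> of_int \<lfloor>q (Suc X) * x\<rfloor>" by linarith
          then have "(q (Suc X) * x - 1) / q (Suc X) \<le> of_int \<lfloor>q (Suc X) * x\<rfloor> / q (Suc X)"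
            using q0[of "Suc X"] by (intro divide_right_mono) auto
          then show "x - 1 / q (Suc X) \<le> of_int \<lfloor>q (Suc X) * x\<rfloor> / q (Suc X)"
            using q0[of "Suc X"] by (simp add: diff_divide_distrib)
        qed
        show "\<forall>\<^sub>F X in sequentially. of_int \<lfloor>q (Suc X) * x\<rfloor> / q (Suc X) \<le> x"
        proof (intro always_eventually allI)
          fix X
          have "of_int \<lfloor>q (Suc X) * x\<rfloor> \<le> q (Suc X) * x" by linarith
          then show "of_int \<lfloor>q (Suc X) * x\<rfloor> / q (Suc X) \<le> x"
            using q0[of "Suc X"] by (simp add: field_simps)
        qed
        have "filterlim (\<lambda>X. q (Suc X)) at_top sequentially"
          unfolding q_def
          by (intro filterlim_compose[OF sqrt_at_top] filterlim_compose[OF filterlim_real_sequentially filterlim_Suc])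
        then have "(\<lambda>X. 1 / q (Suc X)) \<longlonglongrightarrow> 0" by (intro tendsto_divide_0[OF tendsto_const] filterlim_at_top_imp_at_infinity)
        then show "(\<lambda>X. x - 1 / q (Suc X)) \<longlonglongrightarrow> x" by (auto intro: tendsto_eq_intros)
      qed simp
      have "(\<lambda>X. rd (Suc X) w) \<longlonglongrightarrow> w"
      proof -
        have "(\<lambda>X. (of_int \<lfloor>q (Suc X) * fst w\<rfloor> / q (Suc X), of_int \<lfloor>q (Suc X) * snd w\<rfloor> / q (Suc X))) \<longlonglongrightarrow> (fst w, snd w)"
          by (intro tendsto_Pair lim1)
        then show ?thesis by (simp add: rd_def case_prod_unfold)
      qed
      then have "\<forall>\<^sub>F X in sequentially. (rd (Suc X) w \<in> D) = (w \<in> D)"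
        using elim by (auto simp: filterlim_iff)
      then have "\<forall>\<^sub>F X in sequentially. G (Suc X) w = indicat_real D w"
        by eventually_elim (simp add: G_def indicator_def)
      then show ?case by (rule tendsto_eventually)
    qed
    show "AE w in lborel. norm (G (Suc X) w) \<le> indicat_real ({-B-1..B+1} \<times> {-B-1..B+1}) w" for X
    proof (intro always_eventually allI)
      fix w :: "real \<times> real"
      show "norm (G (Suc X) w) \<le> indicat_real ({-B-1..B+1} \<times> {-B-1..B+1}) w"
      proof (cases "rd (Suc X) w \<in> D")
        case True
        have q1: "q (Suc X) \<ge> 1" by (simp add: q_def)
        have *: "x \<in> {-B-1..B+1}" if "of_int \<lfloor>q (Suc X) * x\<rfloor> / q (Suc X) \<in> {-B..B}" for x
        proof -
          have "of_int \<lfloor>q (Suc X) * x\<rfloor> \<le> q (Suc X) * x" "q (Suc X) * x \<le> of_int \<lfloor>q (Suc X) * x\<rfloor> + 1" by linarith+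
          moreover have "- B * q (Suc X) \<le> of_int \<lfloor>q (Suc X) * x\<rfloor>" "of_int \<lfloor>q (Suc X) * x\<rfloor> \<le> B * q (Suc X)"
            using that q1 by (auto simp: field_simps)
          ultimately have "- B * q (Suc X) \<le> q (Suc X) * x" "q (Suc X) * x \<le> B * q (Suc X) + q (Suc X)"
            using q1 by linarith+
          then have "- B * q (Suc X) \<le> x * q (Suc X)" "x * q (Suc X) \<le> (B + 1) * q (Suc X)"
            by (simp_all only: distrib_right mult.commute[of "q (Suc X)"] mult_1)
          moreover have "q (Suc X) > 0" using q1 by linarith
          ultimately have "- B \<le> x" "x \<le> B + 1" by (simp_all only: mult_le_cancel_right_pos)
          then show ?thesis by simp
        qed
        have "rd (Suc X) w \<in> {-B..B} \<times> {-B..B}" using True bdd by blast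
        then have "w \<in> {-B-1..B+1} \<times> {-B-1..B+1}"
          using * by (cases w) (auto simp: rd_def simp del: atLeastAtMost_iff)
        then show ?thesis using True by (simp add: G_def)
      qed (simp add: G_def)
    qed
  qed
  moreover have "integral\<^sup>L lborel (indicat_real D) = measure lborel D" using D by simp
  ultimately have "(\<lambda>X. real (card (S (Suc X))) / real (Suc X)) \<longlonglongrightarrow> measure lborel D"
    using Gint by simp
  then have "(\<lambda>X. real (card (S X)) / real X) \<longlonglongrightarrow> measure lborel D"
    by (rule LIMSEQ_imp_Suc)
  then show ?thesis by (simp add: S_def q_def)
qed

section \<open>The hyperbolic region: area, boundedness and boundary\<close>

definition hyp_region :: "real \<Rightarrow> real \<Rightarrow> (real \<times> real) set" where
  "hyp_region A E = {(u, v). 0 < u \<and> \<bar>v\<bar> \<le> u \<and> u < E\<^sup>2 * \<bar>v\<bar> \<and> u * \<bar>v\<bar> \<le> A}"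

text \<open>\<open>hyp_region\<close> is the condition of \<open>dom\<close> in the coordinates
  \<open>u = \<lambda>\<close> and \<open>v\<close>, its conjugate. Here it is pulled back along the
  linear map from lattice coordinates to \<open>(u, v)\<close>, of determinant
  \<open>a * s\<close>.\<close>

definition hyp_region_lin :: "real \<Rightarrow> real \<Rightarrow> real \<Rightarrow> real \<Rightarrow> real \<Rightarrow> (real \<times> real) set" where
  "hyp_region_lin A E a c s = {(x, y). (a * x + c * y, a * x + c * y + s * y) \<in> hyp_region A E}"

lemma divide_le_divide_iff_square:
  fixes u K A :: real
  assumes "u > 0" "K > 0"
  shows "u / K \<le> A / u \<longleftrightarrow> u\<^sup>2 \<le> A * K"
  using assms by (simp add: field_simps power2_eq_square)

lemma hyp_region_borel: "hyp_region A E \<in> sets borel"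
proof -
  have [measurable]: "(fst :: real \<times> real \<Rightarrow> real) \<in> borel_measurable borel" "(snd :: real \<times> real \<Rightarrow> real) \<in> borel_measurable borel"
    by (auto intro!: borel_measurable_continuous_onI continuous_intros)
  show ?thesis unfolding hyp_region_def case_prod_unfold by measurable
qed

text \<open>For fixed \<open>u\<close> the absolute value of \<open>v\<close> ranges from
  \<open>u / E ^ 2\<close>, excluded, to \<open>min u (A / u)\<close>. The minimum switches at
  \<open>u ^ 2 = A\<close>, and the slice is empty beyond \<open>u ^ 2 = A * E ^ 2\<close>.\<close>

lemma hyp_region_slice:
  assumes A: "A > 0" and E: "E > 1" and u: "u > 0"
  shows "emeasure lborel {v. (u, v) \<in> hyp_region A E} =
    (if u\<^sup>2 \<le> A then ennreal (2 * u * (1 - 1 / E\<^sup>2))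
     else if u\<^sup>2 \<le> A * E\<^sup>2 then ennreal (2 * (A / u - u / E\<^sup>2)) else 0)"
proof -
  have E2: "E\<^sup>2 > 1" using E by simp
  then have E0: "E\<^sup>2 > 0" by linarith
  have sym: "emeasure lborel {v. lo < \<bar>v\<bar> \<and> \<bar>v\<bar> \<le> hi} = ennreal (2 * (hi - lo))" if "0 \<le> lo" "lo \<le> hi" for lo hi :: real
  proof -
    have "{v. lo < \<bar>v\<bar> \<and> \<bar>v\<bar> \<le> hi} = {lo<..hi} \<union> {-hi..<-lo}" using that by auto
    moreover have "emeasure lborel ({lo<..hi} \<union> {-hi..<-lo}) = emeasure lborel {lo<..hi} + emeasure lborel {-hi..<-lo}"
      using that by (intro plus_emeasure[symmetric]) auto
    ultimately show ?thesis using that by (simp add: ennreal_plus[symmetric] del: ennreal_plus)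
  qed
  have "{v. (u, v) \<in> hyp_region A E} = {v. u / E\<^sup>2 < \<bar>v\<bar> \<and> \<bar>v\<bar> \<le> min u (A / u)}"
    using u by (auto simp: hyp_region_def pos_divide_less_eq[OF E0] pos_le_divide_eq[OF u] mult.commute)
  moreover have "emeasure lborel {v. u / E\<^sup>2 < \<bar>v\<bar> \<and> \<bar>v\<bar> \<le> min u (A / u)} =
    (if u\<^sup>2 \<le> A then ennreal (2 * u * (1 - 1 / E\<^sup>2))
     else if u\<^sup>2 \<le> A * E\<^sup>2 then ennreal (2 * (A / u - u / E\<^sup>2)) else 0)"
  proof (cases "u\<^sup>2 \<le> A")
    case True
    then have "min u (A / u) = u" using u by (simp add: min_def field_simps power2_eq_square)
    moreover have "u / E\<^sup>2 \<le> u" using u E2 by (simp add: pos_divide_le_eq[OF E0])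
    ultimately show ?thesis using True sym[of "u / E\<^sup>2" u] u by (simp add: algebra_simps)
  next
    case False
    then have m: "min u (A / u) = A / u" using u by (simp add: min_def field_simps power2_eq_square)
    show ?thesis
    proof (cases "u\<^sup>2 \<le> A * E\<^sup>2")
      case True
      then have "u / E\<^sup>2 \<le> A / u" using divide_le_divide_iff_square[OF u E0] by simp
      then show ?thesis using True False sym[of "u / E\<^sup>2" "A / u"] u m by simp
    next
      case F: False
      then have "A / u < u / E\<^sup>2" using F divide_le_divide_iff_square[OF u E0, of A] by simp
      then have "{v. u / E\<^sup>2 < \<bar>v\<bar> \<and> \<bar>v\<bar> \<le> min u (A / u)} = {}" unfolding m by auto
      then have "emeasure lborel {v. u / E\<^sup>2 < \<bar>v\<bar> \<and> \<bar>v\<bar> \<le> min u (A / u)} = 0" by (simp only: emeasure_empty)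
      then show ?thesis using False F by (simp only: if_False)
    qed
  qed
  ultimately show ?thesis by simp
qed

text \<open>The two pieces of the slice function have elementary primitives. Their contributions
  \<open>A * (1 - 1 / E ^ 2)\<close> cancel, which leaves the logarithm.\<close>

lemma hyp_region_area:
  assumes A: "A > 0" and E: "E > 1"
  shows "(\<integral>\<^sup>+u. emeasure lborel {v. (u, v) \<in> hyp_region A E} \<partial>lborel) = ennreal (2 * A * ln E)"
proof -
  have E2: "E\<^sup>2 > 1" using E by simp
  have En: "E \<noteq> 0" using E by simp
  have E0: "E\<^sup>2 > 0" using E2 by linarith
  have k1: "1 / E\<^sup>2 \<le> 1" unfolding pos_divide_le_eq[OF E0] using E2 by linarith
  define r where "r = sqrt A"
  have r: "r > 0" "r\<^sup>2 = A" using A by (simp_all add: r_def)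
  define g1 where "g1 = (\<lambda>u. 2 * u * (1 - 1 / E\<^sup>2))"
  define g2 where "g2 = (\<lambda>u. 2 * (A / u - u / E\<^sup>2))"
  have le: "u\<^sup>2 \<le> A \<longleftrightarrow> u \<le> r" "u\<^sup>2 \<le> A * E\<^sup>2 \<longleftrightarrow> u \<le> E * r" if "u > 0" for u
  proof -
    show "u\<^sup>2 \<le> A \<longleftrightarrow> u \<le> r" unfolding r(2)[symmetric] using that r(1) by (intro power_mono_iff) auto
    have "A * E\<^sup>2 = (E * r)\<^sup>2" using r(2) by (simp add: power_mult_distrib)
    then show "u\<^sup>2 \<le> A * E\<^sup>2 \<longleftrightarrow> u \<le> E * r" using that r(1) E by (simp only:) (intro power_mono_iff, auto)
  qed
  \<comment> \<open>The breakpoint belongs to both intervals and is discarded as a null set.\<close>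
  have "AE u in lborel. u \<noteq> r" by (rule AE_lborel_singleton)
  then have "AE u in lborel. emeasure lborel {v. (u, v) \<in> hyp_region A E} =
      ennreal (g1 u) * indicator {0..r} u + ennreal (g2 u) * indicator {r..E * r} u"
  proof eventually_elim
    case (elim u)
    show ?case
    proof (cases "u > 0")
      case True
      have "r < E * r" using E r by simp
      then show ?thesis unfolding hyp_region_slice[OF A E True] le[OF True]
        using elim True by (auto simp: g1_def g2_def indicator_def)
    next
      case False
      then have "{v. (u, v) \<in> hyp_region A E} = {}" by (auto simp: hyp_region_def)
      then show ?thesis using False r by (auto simp: g1_def indicator_def)
    qed
  qed
  then have "(\<integral>\<^sup>+u. emeasure lborel {v. (u, v) \<in> hyp_region A E} \<partial>lborel) =
      (\<integral>\<^sup>+u. ennreal (g1 u) * indicator {0..r} u + ennreal (g2 u) * indicator {r..E * r} u \<partial>lborel)"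
    by (rule nn_integral_cong_AE)
  also have "\<dots> = (\<integral>\<^sup>+u. ennreal (g1 u) * indicator {0..r} u \<partial>lborel) + (\<integral>\<^sup>+u. ennreal (g2 u) * indicator {r..E * r} u \<partial>lborel)"
    unfolding g1_def g2_def by (rule nn_integral_add) measurable
  also have "(\<integral>\<^sup>+u. ennreal (g1 u) * indicator {0..r} u \<partial>lborel) = ennreal (r\<^sup>2 * (1 - 1 / E\<^sup>2) - 0\<^sup>2 * (1 - 1 / E\<^sup>2))"
  proof (rule nn_integral_FTC_Icc)
    show "g1 \<in> borel_measurable borel" unfolding g1_def by measurable
    show "((\<lambda>u. u\<^sup>2 * (1 - 1 / E\<^sup>2)) has_real_derivative g1 u) (at u)" for u
      unfolding g1_def by (auto intro!: derivative_eq_intros)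
    show "0 \<le> g1 u" if "u \<in> {0..r}" for u using that k1 by (simp add: g1_def)
  qed (use r in auto)
  also have "(\<integral>\<^sup>+u. ennreal (g2 u) * indicator {r..E * r} u \<partial>lborel) =
      ennreal ((2 * A * ln (E * r) - (E * r)\<^sup>2 / E\<^sup>2) - (2 * A * ln r - r\<^sup>2 / E\<^sup>2))"
  proof (rule nn_integral_FTC_Icc)
    show "g2 \<in> borel_measurable borel" unfolding g2_def by measurable
    show "((\<lambda>u. 2 * A * ln u - u\<^sup>2 / E\<^sup>2) has_real_derivative g2 u) (at u)" if "u \<in> {r..E * r}" for u
    proof -
      have "u > 0" using that r by simp
      then have "((\<lambda>u. 2 * A * ln u - u\<^sup>2 * k) has_real_derivative 2 * (A / u - u * k)) (at u)" for k
        by (auto intro!: derivative_eq_intros)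
      from this[of "1 / E\<^sup>2"] show ?thesis by (simp add: g2_def)
    qed
    show "0 \<le> g2 u" if "u \<in> {r..E * r}" for u
    proof -
      have u: "u > 0" using that r by simp
      then have "u\<^sup>2 \<le> A * E\<^sup>2" using le(2) that by simp
      then have "u / E\<^sup>2 \<le> A / u" using divide_le_divide_iff_square[OF u E0] by simp
      then show ?thesis by (simp add: g2_def)
    qed
    show "r \<le> E * r" using E r by simp
  qed
  also have "ennreal (r\<^sup>2 * (1 - 1 / E\<^sup>2) - 0\<^sup>2 * (1 - 1 / E\<^sup>2)) +
      ennreal ((2 * A * ln (E * r) - (E * r)\<^sup>2 / E\<^sup>2) - (2 * A * ln r - r\<^sup>2 / E\<^sup>2)) = ennreal (2 * A * ln E)"
  proof -
    have 1: "(2 * A * ln (E * r) - (E * r)\<^sup>2 / E\<^sup>2) - (2 * A * ln r - r\<^sup>2 / E\<^sup>2) = 2 * A * ln E - A * (1 - 1 / E\<^sup>2)"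
    proof -
      have "(E * r)\<^sup>2 / E\<^sup>2 = r\<^sup>2" using En by (simp add: power_mult_distrib)
      moreover have "ln (E * r) = ln E + ln r" using r(1) E by (intro ln_mult_pos) auto
      ultimately show ?thesis unfolding r(2) by (simp only: r(2)) (simp add: algebra_simps)
    qed
    \<comment> \<open>The second piece must be nonnegative for the addition in
      \<open>ennreal\<close>; this is \<open>ln x \<le> x - 1\<close> at
      \<open>x = 1 / E ^ 2\<close>.\<close>
    have 2: "A * (1 - 1 / E\<^sup>2) \<le> 2 * A * ln E"
    proof -
      have "ln (1 / E\<^sup>2) \<le> 1 / E\<^sup>2 - 1" using E0 by (intro ln_le_minus_one) (simp only: zero_less_divide_1_iff)
      moreover have "ln (1 / E\<^sup>2) = - (2 * ln E)" using En by (simp add: ln_div ln_realpow)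
      ultimately have "1 - 1 / E\<^sup>2 \<le> 2 * ln E" by simp
      then have "A * (1 - 1 / E\<^sup>2) \<le> A * (2 * ln E)" using A by (intro mult_left_mono) auto
      then show ?thesis by simp
    qed
    have 3: "0 \<le> A * (1 - 1 / E\<^sup>2)" using A k1 by (intro mult_nonneg_nonneg) auto
    have "ennreal (A * (1 - 1 / E\<^sup>2)) + ennreal (2 * A * ln E - A * (1 - 1 / E\<^sup>2)) = ennreal (2 * A * ln E)"
      using 2 3 by (subst ennreal_plus[symmetric]) auto
    then show ?thesis unfolding 1 using r(2) by simp
  qed
  finally show ?thesis .
qed

lemma hyp_region_lin_borel: "hyp_region_lin A E a c s \<in> sets borel"
proof -
  have [measurable]: "(\<lambda>w :: real \<times> real. a * fst w + c * snd w) \<in> borel_measurable borel"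
    "(\<lambda>w :: real \<times> real. a * fst w + c * snd w + s * snd w) \<in> borel_measurable borel"
    by (auto intro!: borel_measurable_continuous_onI continuous_intros)
  show ?thesis
    unfolding hyp_region_lin_def hyp_region_def case_prod_unfold mem_Collect_eq fst_conv snd_conv by measurable
qed

text \<open>The linear map is undone one variable at a time: first the \<open>x\<close>-integral is
  rescaled by \<open>a\<close>, then, after exchanging the integrals, the \<open>y\<close>-integral
  by \<open>s\<close>. The shear \<open>c\<close> disappears by translation invariance.\<close>

lemma hyp_region_lin_area:
  assumes A: "A > 0" and E: "E > 1" and a: "a > 0" and s: "s > 0"
  shows "measure lborel (hyp_region_lin A E a c s) = 2 * A * ln E / (a * s)"
proof -
  let ?R = "hyp_region A E" and ?D = "hyp_region_lin A E a c s"
  have mR: "(\<lambda>w. indicator ?R w :: ennreal) \<in> borel_measurable (borel \<Otimes>\<^sub>M borel)"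
    using hyp_region_borel by (simp add: borel_prod)
  have mf: "(\<lambda>(u, y). indicator ?R (u, u + s * y) :: ennreal) \<in> borel_measurable (borel \<Otimes>\<^sub>M borel)"
    unfolding case_prod_unfold by (rule measurable_compose[OF _ mR]) measurable
  have m1: "(\<lambda>u. indicator ?R (u, u + k) :: ennreal) \<in> borel_measurable borel" for k
    by (rule measurable_compose[OF _ mR]) measurable
  have m2: "(\<lambda>v. indicator ?R (u, v) :: ennreal) \<in> borel_measurable borel" for u
    by (rule measurable_compose[OF _ mR]) measurable
  have "ennreal a * emeasure lborel ?D = ennreal a * (\<integral>\<^sup>+w. indicator ?D w \<partial>(lborel \<Otimes>\<^sub>M lborel))"
    using hyp_region_lin_borel by (simp add: lborel_prod)
  also have "(\<integral>\<^sup>+w. indicator ?D w \<partial>(lborel \<Otimes>\<^sub>M lborel)) = (\<integral>\<^sup>+y. \<integral>\<^sup>+x. indicator ?D (x, y) \<partial>lborel \<partial>lborel)"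
    using hyp_region_lin_borel by (intro lborel_pair.nn_integral_snd[symmetric]) (simp add: lborel_prod)
  also have "ennreal a * \<dots> = (\<integral>\<^sup>+y. ennreal a * (\<integral>\<^sup>+x. indicator ?D (x, y) \<partial>lborel) \<partial>lborel)"
    using hyp_region_lin_borel
    by (intro nn_integral_cmult[symmetric] lborel.borel_measurable_nn_integral) (simp add: borel_prod)
  also have "\<dots> = (\<integral>\<^sup>+y. \<integral>\<^sup>+u. indicator ?R (u, u + s * y) \<partial>lborel \<partial>lborel)"
  proof (rule nn_integral_cong)
    fix y :: real
    have "(\<integral>\<^sup>+u. indicator ?R (u, u + s * y) \<partial>lborel) =
        ennreal \<bar>a\<bar> * (\<integral>\<^sup>+x. indicator ?R (c * y + a * x, c * y + a * x + s * y) \<partial>lborel)"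
      by (rule nn_integral_real_affine[OF m1]) (use a in simp)
    also have "(\<integral>\<^sup>+x. indicator ?R (c * y + a * x, c * y + a * x + s * y) \<partial>lborel) = (\<integral>\<^sup>+x. indicator ?D (x, y) \<partial>lborel :: ennreal)"
      by (rule nn_integral_cong) (simp add: hyp_region_lin_def indicator_def add.commute)
    finally show "ennreal a * (\<integral>\<^sup>+x. indicator ?D (x, y) \<partial>lborel) = (\<integral>\<^sup>+u. indicator ?R (u, u + s * y) \<partial>lborel)"
      using a by simp
  qed
  also have "\<dots> = (\<integral>\<^sup>+u. \<integral>\<^sup>+y. indicator ?R (u, u + s * y) \<partial>lborel \<partial>lborel)"
    by (rule lborel_pair.Fubini') (use mf in simp)
  finally have 1: "ennreal a * emeasure lborel ?D = (\<integral>\<^sup>+u. \<integral>\<^sup>+y. indicator ?R (u, u + s * y) \<partial>lborel \<partial>lborel)" .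
  have "ennreal s * (\<integral>\<^sup>+u. \<integral>\<^sup>+y. indicator ?R (u, u + s * y) \<partial>lborel \<partial>lborel) =
      (\<integral>\<^sup>+u. ennreal s * (\<integral>\<^sup>+y. indicator ?R (u, u + s * y) \<partial>lborel) \<partial>lborel)"
    using mf by (intro nn_integral_cmult[symmetric] lborel.borel_measurable_nn_integral) simp
  also have "\<dots> = (\<integral>\<^sup>+u. emeasure lborel {v. (u, v) \<in> ?R} \<partial>lborel)"
  proof (rule nn_integral_cong)
    fix u :: real
    have "(\<integral>\<^sup>+v. indicator ?R (u, v) \<partial>lborel) = ennreal \<bar>s\<bar> * (\<integral>\<^sup>+y. indicator ?R (u, u + s * y) \<partial>lborel)"
      by (rule nn_integral_real_affine[OF m2]) (use s in simp)
    moreover have "(\<integral>\<^sup>+v. indicator ?R (u, v) \<partial>lborel) = emeasure lborel {v. (u, v) \<in> ?R}"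
    proof -
      have "(\<lambda>v. (u, v)) -` ?R \<in> sets borel"
        using measurable_sets[of "\<lambda>v. (u, v)" borel "borel :: (real \<times> real) measure" ?R] hyp_region_borel
        by (simp add: borel_prod[symmetric])
      then have "{v. (u, v) \<in> ?R} \<in> sets lborel" by (simp add: vimage_def)
      moreover have "(\<lambda>v. indicator ?R (u, v) :: ennreal) = indicator {v. (u, v) \<in> ?R}" by (auto simp: indicator_def)
      ultimately show ?thesis by simp
    qed
    ultimately show "ennreal s * (\<integral>\<^sup>+y. indicator ?R (u, u + s * y) \<partial>lborel) = emeasure lborel {v. (u, v) \<in> ?R}"
      using s by simp
  qed
  also have "\<dots> = ennreal (2 * A * ln E)" by (rule hyp_region_area[OF A E])
  finally have 2: "ennreal s * (ennreal a * emeasure lborel ?D) = ennreal (2 * A * ln E)" using 1 by simp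
  have "emeasure lborel ?D \<noteq> \<infinity>"
  proof
    assume "emeasure lborel ?D = \<infinity>"
    then show False using 2 a s by (simp add: ennreal_mult_top)
  qed
  then have "emeasure lborel ?D = ennreal (measure lborel ?D)" by (simp add: emeasure_eq_ennreal_measure)
  then have "ennreal (s * (a * measure lborel ?D)) = ennreal (2 * A * ln E)"
    using 2 a s by (simp add: ennreal_mult)
  then have "s * (a * measure lborel ?D) = 2 * A * ln E"
    using a s A E by (subst (asm) ennreal_inj) auto
  then show ?thesis using a s by (simp add: field_simps)
qed

text \<open>On the region \<open>u ^ 2\<close> is at most \<open>A * E ^ 2\<close>, so
  \<open>u\<close>, and with it \<open>v\<close>, is bounded; \<open>C\<close> uses
  \<open>u \<le> max 1 (u ^ 2)\<close>.\<close>

lemma hyp_region_lin_bounded: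
  assumes A: "A > 0" and E: "E > 1" and a: "a > 0" and s: "s > 0"
  shows "\<exists>B. hyp_region_lin A E a c s \<subseteq> {-B..B} \<times> {-B..B}"
proof -
  define C where "C = 1 + A * E\<^sup>2"
  define Y where "Y = 2 * C / s"
  define B where "B = Y + (C + \<bar>c\<bar> * Y) / a"
  have C: "C > 0" using A by (simp add: C_def add_pos_nonneg)
  have Y: "Y \<ge> 0" using C s by (simp add: Y_def)
  have "hyp_region_lin A E a c s \<subseteq> {-B..B} \<times> {-B..B}"
  proof
    fix w assume "w \<in> hyp_region_lin A E a c s"
    then obtain x y where w: "w = (x, y)" and R: "(a * x + c * y, a * x + c * y + s * y) \<in> hyp_region A E"
      by (auto simp: hyp_region_lin_def)
    define u where "u = a * x + c * y"
    define v where "v = u + s * y"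
    have uv: "0 < u" "\<bar>v\<bar> \<le> u" "u < E\<^sup>2 * \<bar>v\<bar>" "u * \<bar>v\<bar> \<le> A"
      using R by (auto simp: hyp_region_def u_def v_def)
    have "u * u \<le> u * (E\<^sup>2 * \<bar>v\<bar>)" using uv by (intro mult_left_mono) auto
    also have "\<dots> = E\<^sup>2 * (u * \<bar>v\<bar>)" by simp
    also have "\<dots> \<le> E\<^sup>2 * A" using uv by (intro mult_left_mono) auto
    finally have uu: "u * u \<le> A * E\<^sup>2" by (simp add: mult.commute)
    have uC: "u \<le> C"
    proof (cases "u \<le> 1")
      case True
      then show ?thesis using A by (simp add: C_def add_increasing2)
    next
      case False
      then have "u * 1 \<le> u * u" by (intro mult_left_mono) auto
      then show ?thesis using uu by (simp add: C_def)
    qed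
    have "\<bar>s * y\<bar> \<le> 2 * C" using uv uC unfolding v_def by linarith
    then have yY: "\<bar>y\<bar> \<le> Y" using s by (simp add: Y_def abs_mult field_simps)
    have "\<bar>a * x\<bar> \<le> \<bar>u\<bar> + \<bar>c * y\<bar>" unfolding u_def by linarith
    also have "\<dots> \<le> C + \<bar>c\<bar> * Y" using uC uv(1) yY by (intro add_mono) (auto simp: abs_mult intro: mult_left_mono)
    finally have "\<bar>x\<bar> \<le> (C + \<bar>c\<bar> * Y) / a" using a by (simp add: abs_mult field_simps)
    then have "\<bar>x\<bar> \<le> B" using Y by (simp add: B_def)
    moreover have "\<bar>y\<bar> \<le> B" using yY C Y a by (simp add: B_def add_increasing2)
    ultimately show "w \<in> {-B..B} \<times> {-B..B}" using w by auto
  qed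
  then show ?thesis by blast
qed

lemma eventually_sign_constant:
  fixes f :: "'a::t2_space \<Rightarrow> real"
  assumes "continuous_on UNIV f" "f w \<noteq> 0"
  shows "\<forall>\<^sub>F z in nhds w. (0 < f z) = (0 < f w) \<and> (0 \<le> f z) = (0 \<le> f w)"
proof -
  have lim: "(f \<longlongrightarrow> f w) (nhds w)"
  proof -
    have "isCont f w" using assms(1) by (simp add: continuous_on_eq_continuous_at)
    then show ?thesis by (simp add: isCont_def tendsto_at_iff_tendsto_nhds)
  qed
  show ?thesis
  proof (cases "f w > 0")
    case True
    then have "\<forall>\<^sub>F z in nhds w. f z > 0" using order_tendstoD(1)[OF lim] by blast
    then show ?thesis by eventually_elim (use True in auto)
  next
    case False
    then have neg: "f w < 0" using assms(2) by simp
    then have "\<forall>\<^sub>F z in nhds w. f z < 0" using order_tendstoD(2)[OF lim] by blast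
    then show ?thesis by eventually_elim (use neg in auto)
  qed
qed

text \<open>Membership is locally constant where none of the four defining functions vanishes. On
  each line of constant \<open>y \<noteq> 0\<close> their zeros lie among those of finitely many
  nonzero polynomials in \<open>u\<close>, so the exceptional set is null by Fubini.\<close>

lemma hyp_region_lin_boundary:
  assumes A: "A > 0" and E: "E > 1" and a: "a > 0" and s: "s > 0"
  shows "AE w in lborel. \<forall>\<^sub>F z in nhds w. (z \<in> hyp_region_lin A E a c s) = (w \<in> hyp_region_lin A E a c s)"
proof -
  have E2: "E\<^sup>2 > 1" using E by simp
  define u where "u = (\<lambda>w :: real \<times> real. a * fst w + c * snd w)"
  define v where "v = (\<lambda>w :: real \<times> real. u w + s * snd w)"
  define f1 where "f1 = (\<lambda>w. u w - \<bar>v w\<bar>)"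
  define f2 where "f2 = (\<lambda>w. E\<^sup>2 * \<bar>v w\<bar> - u w)"
  define f3 where "f3 = (\<lambda>w. A - u w * \<bar>v w\<bar>)"
  define P where "P = (\<lambda>w. u w \<noteq> 0 \<and> f1 w \<noteq> 0 \<and> f2 w \<noteq> 0 \<and> f3 w \<noteq> 0)"
  have cu: "continuous_on UNIV u" unfolding u_def by (intro continuous_intros)
  then have cv: "continuous_on UNIV v" unfolding v_def by (intro continuous_intros)
  have c1: "continuous_on UNIV f1" and c2: "continuous_on UNIV f2" and c3: "continuous_on UNIV f3"
    unfolding f1_def f2_def f3_def using cu cv by (auto intro!: continuous_intros)
  have mem: "w \<in> hyp_region_lin A E a c s \<longleftrightarrow> 0 < u w \<and> 0 \<le> f1 w \<and> 0 < f2 w \<and> 0 \<le> f3 w" for w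
    by (cases w) (auto simp: hyp_region_lin_def hyp_region_def u_def v_def f1_def f2_def f3_def)
  have ev: "\<forall>\<^sub>F z in nhds w. (z \<in> hyp_region_lin A E a c s) = (w \<in> hyp_region_lin A E a c s)" if "P w" for w
  proof -
    have nz: "u w \<noteq> 0" "f1 w \<noteq> 0" "f2 w \<noteq> 0" "f3 w \<noteq> 0" using that by (auto simp: P_def)
    show ?thesis
      using eventually_sign_constant[OF cu nz(1)] eventually_sign_constant[OF c1 nz(2)]
        eventually_sign_constant[OF c2 nz(3)] eventually_sign_constant[OF c3 nz(4)]
      by eventually_elim (simp add: mem)
  qed
  have inner: "AE x in lborel. P (x, y)" if y: "y \<noteq> 0" for y
  proof -
    define d where "d = s * y"
    have d: "d \<noteq> 0" using y s by (simp add: d_def)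
    \<comment> \<open>With \<open>t = u\<close> and \<open>v = t + d\<close> these encode
      \<open>u = 0\<close>, \<open>v = - u\<close>, \<open>u = E ^ 2 * v\<close>,
      \<open>u = - E ^ 2 * v\<close>, \<open>u * v = A\<close> and \<open>u * v = - A\<close>; the
      case \<open>v = u\<close> is excluded by \<open>d \<noteq> 0\<close>.\<close>
    define Z where "Z = {[:0, 1:], [:d, 2:], [:- (E\<^sup>2 * d), 1 - E\<^sup>2:], [:E\<^sup>2 * d, 1 + E\<^sup>2:], [:- A, d, 1:], [:A, d, 1:]}"
    have "finite (\<Union>q\<in>Z. {t. poly q t = 0})"
    proof (rule finite_UN_I)
      show "finite Z" by (simp add: Z_def)
      fix q assume "q \<in> Z"
      then have "q \<noteq> 0" using d E2 by (auto simp: Z_def)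
      then show "finite {t. poly q t = 0}" by (rule poly_roots_finite)
    qed
    then have "finite ((\<lambda>x. u (x, y)) -` (\<Union>q\<in>Z. {t. poly q t = 0}))"
      by (rule finite_vimageI) (use a in \<open>auto simp: inj_def u_def\<close>)
    then have "AE x in lborel. x \<notin> (\<lambda>x. u (x, y)) -` (\<Union>q\<in>Z. {t. poly q t = 0})"
      by (intro AE_not_in finite_imp_null_set_lborel)
    then show ?thesis
    proof eventually_elim
      case (elim x)
      define t where "t = u (x, y)"
      have vt: "v (x, y) = t + d" by (simp add: v_def t_def d_def)
      have nz: "poly q t \<noteq> 0" if "q \<in> Z" for q using elim that by (auto simp: t_def)
      have n: "t \<noteq> 0" "d + 2 * t \<noteq> 0" "t - E\<^sup>2 * (t + d) \<noteq> 0" "t + E\<^sup>2 * (t + d) \<noteq> 0"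
          "t * (t + d) \<noteq> A" "t * (t + d) \<noteq> - A"
        using nz[of "[:0, 1:]"] nz[of "[:d, 2:]"] nz[of "[:- (E\<^sup>2 * d), 1 - E\<^sup>2:]"] nz[of "[:E\<^sup>2 * d, 1 + E\<^sup>2:]"]
          nz[of "[:- A, d, 1:]"] nz[of "[:A, d, 1:]"]
        by (auto simp: Z_def algebra_simps)
      show ?case
        unfolding P_def f1_def f2_def f3_def vt t_def[symmetric]
        using n d by (auto simp: abs_if algebra_simps split: if_splits)
    qed
  qed
  have mu: "u \<in> borel_measurable borel" "f1 \<in> borel_measurable borel" "f2 \<in> borel_measurable borel" "f3 \<in> borel_measurable borel"
    using cu c1 c2 c3 by (auto intro: borel_measurable_continuous_onI)
  have mP: "{w. P w} \<in> sets borel" unfolding P_def using mu by measurable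
  have mP': "{w. P w} \<in> sets (borel \<Otimes>\<^sub>M borel)" using mP by (simp only: borel_prod)
  have "AE y in lborel. AE x in lborel. P (x, y)"
    using AE_lborel_singleton[of 0] by eventually_elim (rule inner)
  then have "AE x in lborel. AE y in lborel. P (x, y)"
    by (subst lborel_pair.AE_commute) (use mP' in \<open>simp_all add: space_pair_measure\<close>)
  then have "AE w in lborel \<Otimes>\<^sub>M lborel. P w"
    by (rule lborel_pair.AE_pair_measure[rotated]) (use mP' in \<open>simp add: space_pair_measure\<close>)
  then show ?thesis unfolding lborel_prod by eventually_elim (rule ev)
qed

context prime_1_mod_4
begin

text \<open>All conditions of \<open>dom\<close> are homogeneous, so the bound \<open>X\<close> on
  the norm becomes a dilation of the region by \<open>sqrt X\<close>. The region has parameter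
  \<open>A = a\<close> and determinant \<open>a * sqrt p\<close>, so \<open>a\<close> drops out of
  the area and all classes get the same density.\<close>

theorem class_density:
  assumes T: "(1, a, t) \<in> triples"
  shows "(\<lambda>X. real (card {J. (idl 1 a t, J) \<in> ideal_class_rel p \<and> nrm J \<le> int X}) / real X) \<longlonglongrightarrow> 2 * ln eps / sq"
proof -
  have a: "real_of_int a > 0" using T by (simp add: triples_def)
  have s: "sq > 0" using sq_gt_1 by simp
  let ?c = "of_int t + om'"
  let ?D = "hyp_region_lin (of_int a) eps (of_int a) ?c sq"
  have lam: "lam a t r s' = of_int a * of_int r + ?c * of_int s'" "lam' a t r s' = lam a t r s' + sq * of_int s'" for r s'
  proof -
    have "om' = 1 - om" using om_sum by simp
    then have "?c * of_int s' = of_int (t * s') + (1 - om) * of_int s'" by (simp only: distrib_right of_int_mult)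
    then show "lam a t r s' = of_int a * of_int r + ?c * of_int s'" by (simp add: lam_def el_def algebra_simps)
    have "sq = 2 * om - 1" unfolding om_def by (simp only: nonzero_mult_div_cancel_left mult_divide_mult_cancel_left times_divide_eq_right)
    then have "sq * of_int s' = (2 * om - 1) * of_int s'" by (simp only:)
    then show "lam' a t r s' = lam a t r s' + sq * of_int s'" by (simp add: lam'_def lam_def el_def algebra_simps)
  qed
  have eq: "dom a t (of_int (int X)) = {(r :: int, s' :: int). (of_int r / sqrt (real X), of_int s' / sqrt (real X)) \<in> ?D}" if X: "X > 0" for X
  proof -
    define q where "q = sqrt (real X)"
    have q: "q > 0" "q * q = real X" using X by (simp_all add: q_def)
    have "(r, s') \<in> dom a t (of_int (int X)) \<longleftrightarrow> (of_int r / q, of_int s' / q) \<in> ?D" for r s'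
    proof -
      let ?u = "lam a t r s'" and ?v = "lam' a t r s'"
      have u: "of_int a * (of_int r / q) + ?c * (of_int s' / q) = ?u / q"
        unfolding lam(1) by (simp add: add_divide_distrib)
      have v: "?u / q + sq * (of_int s' / q) = ?v / q" unfolding lam(2) by (simp add: add_divide_distrib)
      have uvq: "?u / q * \<bar>?v / q\<bar> = ?u * \<bar>?v\<bar> / (q * q)" using q(1) by (simp add: abs_divide)
      have "?u / q * \<bar>?v / q\<bar> \<le> of_int a \<longleftrightarrow> ?u * \<bar>?v\<bar> \<le> of_int a * real X"
        unfolding uvq q(2) using X by (simp add: pos_divide_le_eq)
      moreover have "\<bar>?v / q\<bar> \<le> ?u / q \<longleftrightarrow> \<bar>?v\<bar> \<le> ?u" using q(1) by (simp add: abs_divide divide_le_cancel)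
      moreover have "?u / q < eps\<^sup>2 * \<bar>?v / q\<bar> \<longleftrightarrow> ?u < eps\<^sup>2 * \<bar>?v\<bar>"
      proof -
        have "eps\<^sup>2 * \<bar>?v / q\<bar> = (eps\<^sup>2 * \<bar>?v\<bar>) / q" using q(1) by (simp add: abs_divide)
        then show ?thesis using q(1) by (simp only: divide_less_cancel) simp
      qed
      moreover have "0 < ?u / q \<longleftrightarrow> 0 < ?u" using q(1) by (simp add: zero_less_divide_iff)
      ultimately show ?thesis
        unfolding hyp_region_lin_def mem_Collect_eq prod.case u v hyp_region_def dom_def by simp
    qed
    then show ?thesis unfolding q_def by auto
  qed
  obtain B where B: "?D \<subseteq> {-B..B} \<times> {-B..B}" using hyp_region_lin_bounded[OF a eps_gt_1 a s] by blast
  have "(\<lambda>X. real (card {(r :: int, s' :: int). (of_int r / sqrt (real X), of_int s' / sqrt (real X)) \<in> ?D}) / real X)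
      \<longlonglongrightarrow> measure lborel ?D"
    by (rule lattice_point_count[OF hyp_region_lin_borel B hyp_region_lin_boundary[OF a eps_gt_1 a s]])
  also have "measure lborel ?D = 2 * ln eps / sq"
    using hyp_region_lin_area[OF a eps_gt_1 a s] a by simp
  finally have lim: "(\<lambda>X. real (card {(r :: int, s' :: int). (of_int r / sqrt (real X), of_int s' / sqrt (real X)) \<in> ?D}) / real X)
      \<longlonglongrightarrow> 2 * ln eps / sq" .
  show ?thesis
  proof (rule Lim_transform_eventually[OF lim])
    show "\<forall>\<^sub>F X in sequentially. real (card {(r :: int, s' :: int). (of_int r / sqrt (real X), of_int s' / sqrt (real X)) \<in> ?D}) / real X =
        real (card {J. (idl 1 a t, J) \<in> ideal_class_rel p \<and> nrm J \<le> int X}) / real X"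
      using eventually_gt_at_top[of 0]
      by eventually_elim (simp only: eq[symmetric] card_class_dom[OF T])
  qed
qed

subsection \<open>The class number formula and the factorial\<close>

lemma ideal_class_equiv: "equiv (nonzero_ideals p) (ideal_class_rel p)"
proof (rule equivI)
  show "ideal_class_rel p \<subseteq> nonzero_ideals p \<times> nonzero_ideals p" by (auto simp: ideal_class_rel_def)
  show "refl_on (nonzero_ideals p) (ideal_class_rel p)"
    unfolding refl_on_def ideal_class_rel_def by (auto intro!: bexI[of _ 1])
  show "sym (ideal_class_rel p)"
  proof (rule symI)
    fix I J assume "(I, J) \<in> ideal_class_rel p"
    then obtain \<alpha> \<beta> where "I \<in> nonzero_ideals p" "J \<in> nonzero_ideals p"
      "\<alpha> \<in> OI - {0}" "\<beta> \<in> OI - {0}" "scale \<beta> J = scale \<alpha> I" unfolding ideal_class_rel_def by force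
    then show "(J, I) \<in> ideal_class_rel p" unfolding ideal_class_rel_def by blast
  qed
  show "trans (ideal_class_rel p)"
  proof (rule transI)
    fix I J M assume IJ: "(I, J) \<in> ideal_class_rel p" and JM: "(J, M) \<in> ideal_class_rel p"
    obtain \<alpha> \<beta> where 1: "\<alpha> \<in> OI - {0}" "\<beta> \<in> OI - {0}" "scale \<alpha> I = scale \<beta> J" using IJ by (auto simp: ideal_class_rel_def)
    obtain \<gamma> \<delta> where 2: "\<gamma> \<in> OI - {0}" "\<delta> \<in> OI - {0}" "scale \<gamma> J = scale \<delta> M" using JM by (auto simp: ideal_class_rel_def)
    have "scale (\<gamma> * \<alpha>) I = scale \<gamma> (scale \<beta> J)" unfolding scale_scale[symmetric] 1(3) ..
    also have "\<dots> = scale \<beta> (scale \<gamma> J)" unfolding scale_scale by (simp only: mult.commute)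
    also have "\<dots> = scale (\<beta> * \<delta>) M" unfolding 2(3) scale_scale ..
    finally have "scale (\<gamma> * \<alpha>) I = scale (\<beta> * \<delta>) M" .
    moreover have "\<gamma> * \<alpha> \<in> OI - {0}" "\<beta> * \<delta> \<in> OI - {0}" using 1 2 OI_mult by auto
    moreover have "I \<in> nonzero_ideals p" "M \<in> nonzero_ideals p" using IJ JM by (auto simp: ideal_class_rel_def)
    ultimately show "(I, M) \<in> ideal_class_rel p" unfolding ideal_class_rel_def by blast
  qed
qed

abbreviation Cl :: "real set set set" where "Cl \<equiv> nonzero_ideals p // ideal_class_rel p"

text \<open>\<open>idl k a t\<close> is \<open>k\<close> times the primitive ideal
  \<open>idl 1 a t\<close>, so every class contains a primitive one.\<close>

lemma class_primitive_rep:
  assumes "C \<in> Cl"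
  obtains a t where "(1, a, t) \<in> triples" "C = {J. (idl 1 a t, J) \<in> ideal_class_rel p}"
proof -
  obtain I where I: "I \<in> nonzero_ideals p" "C = ideal_class_rel p `` {I}" using assms by (rule quotientE)
  obtain k a t where T: "(k, a, t) \<in> triples" "I = idl k a t" using ideal_is_idl[OF I(1)] by blast
  then have T1: "(1, a, t) \<in> triples" and k: "k \<ge> 1" by (auto simp: triples_def)
  have "scale (of_int k) (idl 1 a t) = idl k a t"
  proof -
    have "of_int k * el X Y = el (k * X) (k * Y)" for X Y by (simp add: el_def algebra_simps)
    then show ?thesis unfolding idl_def by (simp add: image_Collect) (metis (no_types, opaque_lifting) mult_1)
  qed
  then have "scale (of_int k) (idl 1 a t) = scale 1 I" using T(2) by simp
  moreover have "of_int k \<in> OI - {0}" "1 \<in> OI - {0}" using k by auto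
  ultimately have "(idl 1 a t, I) \<in> ideal_class_rel p"
    unfolding ideal_class_rel_def using idl_ideal[OF T1] I(1) by blast
  then have "ideal_class_rel p `` {idl 1 a t} = ideal_class_rel p `` {I}"
    by (rule equiv_class_eq[OF ideal_class_equiv])
  then show ?thesis using that[OF T1] I(2) by blast
qed

definition cls_count :: "real set set \<Rightarrow> nat \<Rightarrow> nat" where
  "cls_count C X = card {J \<in> C. nrm J \<le> int X}"

lemma cls_count_density:
  assumes "C \<in> Cl"
  shows "(\<lambda>X. real (cls_count C X) / real X) \<longlonglongrightarrow> 2 * ln eps / sq"
proof -
  obtain a t where T: "(1, a, t) \<in> triples" "C = {J. (idl 1 a t, J) \<in> ideal_class_rel p}"
    using class_primitive_rep[OF assms] .
  show ?thesis using class_density[OF T(1)] unfolding cls_count_def T(2) by simp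
qed

lemma sum_cls_count:
  assumes "finite F" "F \<subseteq> Cl"
  shows "(\<Sum>C\<in>F. cls_count C X) = card {I \<in> \<Union>F. nrm I \<le> int X}"
proof -
  have sub: "C \<subseteq> nonzero_ideals p" if "C \<in> F" for C
    using that assms(2) ideal_class_equiv in_quotient_imp_subset by blast
  have "{I \<in> \<Union>F. nrm I \<le> int X} = (\<Union>C\<in>F. {J \<in> C. nrm J \<le> int X})" by auto
  moreover have "card (\<Union>C\<in>F. {J \<in> C. nrm J \<le> int X}) = (\<Sum>C\<in>F. card {J \<in> C. nrm J \<le> int X})"
  proof (rule card_UN_disjoint[OF assms(1)])
    show "\<forall>C\<in>F. finite {J \<in> C. nrm J \<le> int X}"
    proof
      fix C assume "C \<in> F"
      then have "{J \<in> C. nrm J \<le> int X} \<subseteq> {I \<in> nonzero_ideals p. nrm I \<le> int X}" using sub by blast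
      then show "finite {J \<in> C. nrm J \<le> int X}" using finite_bounded_ideals by (rule finite_subset)
    qed
    show "\<forall>C\<in>F. \<forall>C'\<in>F. C \<noteq> C' \<longrightarrow> {J \<in> C. nrm J \<le> int X} \<inter> {J \<in> C'. nrm J \<le> int X} = {}"
    proof (intro ballI impI)
      fix C C' assume "C \<in> F" "C' \<in> F" "C \<noteq> C'"
      then have "C \<inter> C' = {}" using quotient_disj[OF ideal_class_equiv] assms(2) by blast
      then show "{J \<in> C. nrm J \<le> int X} \<inter> {J \<in> C'. nrm J \<le> int X} = {}" by blast
    qed
  qed
  ultimately show ?thesis by (simp add: cls_count_def)
qed

lemma sum_density:
  assumes "finite F" "F \<subseteq> Cl"
  shows "(\<lambda>X. real (card {I \<in> \<Union>F. nrm I \<le> int X}) / real X) \<longlonglongrightarrow> real (card F) * (2 * ln eps / sq)"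
proof -
  have "(\<lambda>X. \<Sum>C\<in>F. real (cls_count C X) / real X) \<longlonglongrightarrow> (\<Sum>C\<in>F. 2 * ln eps / sq)"
    using assms(2) by (intro tendsto_sum cls_count_density) auto
  moreover have "(\<Sum>C\<in>F. real (cls_count C X) / real X) = real (card {I \<in> \<Union>F. nrm I \<le> int X}) / real X" for X
    unfolding sum_cls_count[OF assms, symmetric] by (simp add: sum_divide_distrib)
  ultimately show ?thesis by simp
qed

text \<open>\<open>class_number\<close> is a cardinality, so finiteness has to come first:
  \<open>N\<close> distinct classes occupy the density \<open>N * \<kappa>\<close>, which is at most
  \<open>L_fun 1\<close>. With finitely many classes the densities add up to \<open>L_fun 1\<close>,
  which \<open>L_1_eta\<close> identifies.\<close>

theorem class_number_formula: "eps ^ class_number p = eta"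
proof -
  define \<kappa> where "\<kappa> = 2 * ln eps / sq"
  have \<kappa>: "\<kappa> > 0" using eps_gt_1 sq_gt_1 by (simp add: \<kappa>_def)
  have bound: "real (card F) * \<kappa> \<le> L_fun 1" if F: "finite F" "F \<subseteq> Cl" for F
  proof (rule LIMSEQ_le[OF sum_density[OF F, folded \<kappa>_def] ideal_density])
    show "\<exists>N. \<forall>X\<ge>N. real (card {I \<in> \<Union>F. nrm I \<le> int X}) / real X \<le> real (card {I \<in> nonzero_ideals p. nrm I \<le> int X}) / real X"
    proof (intro exI allI impI divide_right_mono)
      fix X
      have "\<Union>F \<subseteq> nonzero_ideals p" using F(2) Union_quotient[OF ideal_class_equiv] by blast
      then show "real (card {I \<in> \<Union>F. nrm I \<le> int X}) \<le> real (card {I \<in> nonzero_ideals p. nrm I \<le> int X})"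
        using finite_bounded_ideals[of "int X"] by (intro of_nat_mono card_mono) auto
    qed simp
  qed
  have fin: "finite Cl"
  proof (rule ccontr)
    assume "infinite Cl"
    obtain N :: nat where N: "L_fun 1 / \<kappa> < real N" using reals_Archimedean2 by blast
    obtain F where "F \<subseteq> Cl" "finite F" "card F = N" using infinite_arbitrarily_large[OF \<open>infinite Cl\<close>] by blast
    then have "real N * \<kappa> \<le> L_fun 1" using bound by blast
    then show False using N \<kappa> by (simp add: field_simps)
  qed
  have "(\<lambda>X. real (card {I \<in> \<Union>Cl. nrm I \<le> int X}) / real X) \<longlonglongrightarrow> real (card Cl) * \<kappa>"
    using sum_density[OF fin order_refl] by (simp add: \<kappa>_def)
  then have "real (card Cl) * \<kappa> = L_fun 1"
    unfolding Union_quotient[OF ideal_class_equiv] using ideal_density LIMSEQ_unique by blast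
  then have "sq * (real (class_number p) * \<kappa>) = sq * L_fun 1" by (simp add: class_number_def)
  then have "real (class_number p) * (2 * ln eps) = 2 * ln eta"
    unfolding L_1_eta \<kappa>_def using sq_gt_1 by simp
  then have "ln (eps ^ class_number p) = ln eta" by (simp add: ln_realpow)
  then show ?thesis using eps_gt_1 eta_pos by (simp add: ln_inj_iff)
qed

lemma two_cop: "coprime (2 ^ k) (int p)"
  using odd_p by simp

theorem chowla_factorial:
  "odd (class_number p)"
  "[2 * fact n = (- 1) ^ ((class_number p + 1) div 2) * fund_u p] (mod int p)"
proof -
  define h where "h = class_number p"
  define u where "u = fund_u p"
  obtain v :: int where v: "eps = (of_int u + of_int v * sq) / 2" using fund_u_eq unfolding u_def by blast
  have ch: "[u ^ h = - (2 ^ h * fact n)] (mod int p)"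
    by (rule chowla_cong[OF v class_number_formula[folded h_def]])
  have "[(u ^ h)\<^sup>2 = (- (2 ^ h * fact n))\<^sup>2] (mod int p)" by (rule cong_pow[OF ch])
  also have "(- (2 ^ h * fact n))\<^sup>2 = 4 ^ h * (fact n :: int)\<^sup>2"
  proof -
    have "(2 ^ h)\<^sup>2 = (4 :: int) ^ h" by (simp add: power2_eq_square power_mult_distrib[symmetric])
    then show ?thesis by (simp add: power_mult_distrib)
  qed
  also have "[\<dots> = 4 ^ h * (- 1)] (mod int p)"
    by (intro cong_mult cong_refl fact_half_square[OF prime_p p_eq n_eq])
  also have "(u ^ h)\<^sup>2 = (u\<^sup>2) ^ h" by (simp flip: power_mult add: mult.commute)
  finally have sq: "[(u\<^sup>2) ^ h = - (4 ^ h)] (mod int p)" by simp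
  have no: "\<not> [4 ^ h = - (4 ^ h)] (mod int p)"
  proof
    assume "[4 ^ h = - (4 ^ h)] (mod int p)"
    then have "int p dvd 4 ^ h - - (4 ^ h)" by (simp only: cong_iff_dvd_diff)
    moreover have "4 ^ h - - (4 ^ h) = (2 :: int) ^ (2 * h + 1)" by (simp add: power_mult)
    ultimately have "int p dvd 2 ^ (2 * h + 1)" by (simp only:)
    then have "int p dvd 1" by (rule coprime_common_divisor[OF two_cop _ dvd_refl])
    then show False using p_gt_2 by simp
  qed
  \<comment> \<open>If \<open>eps\<close> had norm 1, so that \<open>u ^ 2 = 4\<close>, the
    \<open>h\<close>-th power would contradict the squared congruence above.\<close>
  have u4: "[u\<^sup>2 = - 4] (mod int p)"
  proof (rule ccontr)
    assume "\<not> [u\<^sup>2 = - 4] (mod int p)"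
    then have "[u\<^sup>2 = 4] (mod int p)" using fund_u_norm unfolding u_def by blast
    then have "[(u\<^sup>2) ^ h = 4 ^ h] (mod int p)" by (rule cong_pow)
    then show False using sq no by (metis cong_sym cong_trans)
  qed
  then have p4: "[(u\<^sup>2) ^ j = (- 4) ^ j] (mod int p)" for j by (rule cong_pow)
  \<comment> \<open>For even \<open>h\<close> the sign of - 4 disappears and the same contradiction
    results.\<close>
  have oh: "odd h"
  proof
    assume "even h"
    then show False using sq p4[of h] no by (metis cong_sym cong_trans power_minus_even)
  qed
  then show "odd (class_number p)" by (simp add: h_def)
  obtain j where j: "h = 2 * j + 1" using oh by (elim oddE)
  have "[- (2 ^ h * fact n) = u ^ h] (mod int p)" by (rule cong_sym[OF ch])
  also have "u ^ h = (u\<^sup>2) ^ j * u" by (simp add: j power_mult)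
  also have "[\<dots> = (- 4) ^ j * u] (mod int p)" by (intro cong_mult p4 cong_refl)
  also have "(- 4) ^ j * u = 2 ^ (2 * j) * ((- 1) ^ j * u)"
  proof -
    have "(- 4 :: int) ^ j = 4 ^ j * (- 1) ^ j" by (simp flip: power_mult_distrib)
    then show ?thesis by (simp add: power_mult)
  qed
  also have "- (2 ^ h * fact n) = 2 ^ (2 * j) * - (2 * fact n :: int)" by (simp add: j)
  finally have "[2 ^ (2 * j) * - (2 * fact n) = 2 ^ (2 * j) * ((- 1) ^ j * u)] (mod int p)" .
  then have "[- (2 * fact n) = (- 1) ^ j * u] (mod int p)"
    using two_cop cong_mult_lcancel by blast
  then have "[- (- (2 * fact n)) = - ((- 1) ^ j * u)] (mod int p)" by (simp only: cong_minus_minus_iff)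
  moreover have "(class_number p + 1) div 2 = Suc j" using j by (simp add: h_def)
  ultimately show "[2 * fact n = (- 1) ^ ((class_number p + 1) div 2) * fund_u p] (mod int p)"
    by (simp add: u_def)
qed

section \<open>The two formulas for the sign\<close>

lemma sign_sigma02_formula:
  fixes g :: int
  assumes g: "residue_primroot p (nat (g mod int p))"
  defines "H \<equiv> (class_number p + 1) div 2"
  shows "[2 * (sign (sigma02 p g) * (- 1) ^ H) = int n ^ m * fund_u p * g ^ (6 * m ^ 3 - m\<^sup>2 - m)] (mod int p)"
proof -
  let ?G = "6 * m ^ 3 - m\<^sup>2 - m"
  have "[sign (sigma02 p g) * (2 * (- 1) ^ H) = int n ^ m * g ^ ?G * fact n * (2 * (- 1) ^ H)] (mod int p)"
    by (rule cong_mult[OF sign_sigma02_cong[OF prime_p p_eq n_eq g] cong_refl])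
  also have "int n ^ m * g ^ ?G * fact n * (2 * (- 1) ^ H) = int n ^ m * g ^ ?G * (- 1) ^ H * (2 * fact n)"
    by (simp add: mult_ac)
  also have "[\<dots> = int n ^ m * g ^ ?G * (- 1) ^ H * ((- 1) ^ H * fund_u p)] (mod int p)"
    unfolding H_def by (intro cong_mult cong_refl chowla_factorial(2))
  also have "int n ^ m * g ^ ?G * (- 1) ^ H * ((- 1) ^ H * fund_u p) = int n ^ m * fund_u p * g ^ ?G"
    by (cases "even H") auto
  finally show ?thesis by (simp add: mult_ac)
qed

lemma sign_abs_bound: "2 * \<bar>sign \<pi> * (- 1) ^ k\<bar> < int p"
  using p_gt_2 by (simp add: abs_mult power_abs sign_def)

text \<open>A sign is its own least absolute residue, so the congruence becomes an equality.
  \<open>(- 1) ^ k\<close> absorbs a sign produced by the power of \<open>g\<close>: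
  \<open>k = 0\<close> in the general formula, while for \<open>p = 5\<close> modulo 8 it replaces
  the whole power.\<close>

lemma abs_least_residue_sign:
  fixes g :: int
  assumes g: "residue_primroot p (nat (g mod int p))"
    and c: "[int n ^ m * fund_u p * g ^ (6 * m ^ 3 - m\<^sup>2 - m) = y * (- 1) ^ k] (mod int p)"
  shows "sign (sigma02 p g) = abs_least_residue p (1 / 2 * of_int y) * (- 1) ^ ((class_number p + 1) div 2 + k)"
proof -
  define H where "H = (class_number p + 1) div 2"
  let ?s = "sign (sigma02 p g)"
  have "[2 * (?s * (- 1) ^ H) * (- 1) ^ k = y * (- 1) ^ k * (- 1) ^ k] (mod int p)"
    using cong_trans[OF sign_sigma02_formula[OF g, folded H_def] c] by (rule cong_mult[OF _ cong_refl])
  then have "[2 * (?s * (- 1) ^ (H + k)) = y] (mod int p)"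
    by (simp add: mult.assoc power_add power_mult_distrib[symmetric])
  then have "abs_least_residue p (1 / 2 * of_int y) = ?s * (- 1) ^ (H + k)"
    by (rule abs_least_residue_half[OF odd_p sign_abs_bound])
  then show ?thesis unfolding H_def[symmetric] by (simp add: mult.assoc power_mult_distrib[symmetric])
qed

text \<open>Here \<open>3 n ^ 2 - n - 2 = 2 * (6 m ^ 2 - m - 1)\<close> and
  \<open>p - 1 = 4 m\<close>, so the division by 8 is exact.\<close>

lemma exponent_eq: "(p - 1) * (3 * n\<^sup>2 - n - 2) div 8 = 6 * m ^ 3 - m\<^sup>2 - m"
proof -
  have "3 * n\<^sup>2 - n - 2 = 2 * (6 * m\<^sup>2 - m - 1)"
    using n_eq by (simp add: power_mult_distrib diff_mult_distrib2)
  moreover have "p - 1 = 4 * m" using p_eq n_eq by simp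
  ultimately have "(p - 1) * (3 * n\<^sup>2 - n - 2) = 8 * (m * (6 * m\<^sup>2 - m - 1))" by simp
  moreover have "m * (6 * m\<^sup>2 - m - 1) = 6 * m ^ 3 - m\<^sup>2 - m"
    by (simp add: diff_mult_distrib2 power2_eq_square power3_eq_cube mult.left_commute)
  ultimately show ?thesis by simp
qed

text \<open>For \<open>m = 2 k + 1\<close> the exponent factors as
  \<open>n * (4 k + 1) * (3 k + 2)\<close>. Since \<open>g ^ n = - 1\<close>, only the parity of
  \<open>3 k + 2\<close>, which is that of \<open>k\<close>, matters.\<close>

lemma primroot_power_mod_8:
  fixes g :: int
  assumes g: "residue_primroot p (nat (g mod int p))" and k: "m = 2 * k + 1"
  shows "[g ^ (6 * m ^ 3 - m\<^sup>2 - m) = (- 1) ^ k] (mod int p)"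
proof -
  have "int (6 * m ^ 3 - m\<^sup>2 - m) = 6 * int m ^ 3 - (int m)\<^sup>2 - int m"
  proof -
    have "m\<^sup>2 + m \<le> 6 * m ^ 3"
    proof -
      have "m * m \<le> m * m * m" "m \<le> m * m * m" using m_pos by auto
      then have "m * m + m \<le> 6 * (m * m * m)" by linarith
      then show ?thesis by (simp add: power2_eq_square power3_eq_cube)
    qed
    then show ?thesis by (simp add: of_nat_diff)
  qed
  also have "\<dots> = int (n * ((4 * k + 1) * (3 * k + 2)))"
    by (simp add: n_eq k power2_eq_square power3_eq_cube algebra_simps)
  finally have "6 * m ^ 3 - m\<^sup>2 - m = n * ((4 * k + 1) * (3 * k + 2))" by (simp only: of_nat_eq_iff)
  then have "g ^ (6 * m ^ 3 - m\<^sup>2 - m) = (g ^ n) ^ ((4 * k + 1) * (3 * k + 2))" by (simp only: power_mult)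
  also have "[\<dots> = (- 1) ^ ((4 * k + 1) * (3 * k + 2))] (mod int p)"
    by (rule cong_pow[OF primroot_half[OF prime_p p_eq g]])
  also have "(- 1 :: int) ^ ((4 * k + 1) * (3 * k + 2)) = (- 1) ^ k" by (cases "even k") auto
  finally show ?thesis .
qed

end

theorem theorem2:
  fixes p n :: nat and g :: int
  assumes "prime p"
    and "[p = 1] (mod 4)"
    and "p = 2 * n + 1"
    and "residue_primroot p (nat (g mod int p))"
  shows
    "sign (sigma02 p g) =
       abs_least_residue p
         (1 / 2 * of_nat n ^ (n div 2) * of_int (fund_u p) *
          of_int g ^ ((p - 1) * (3 * n ^ 2 - n - 2) div 8)) *
       (- 1) ^ ((class_number p + 1) div 2)
     \<and> ([p = 5] (mod 8) \<longrightarrow>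
          (\<forall>g'. residue_primroot p (nat (g' mod int p)) \<longrightarrow>
             sign (sigma02 p g') = sign (sigma02 p g)) \<and>
          sign (sigma02 p g) =
            abs_least_residue p (1 / 2 * of_nat n ^ (n div 2) * of_int (fund_u p)) *
            (- 1) ^ ((2 * class_number p + n) div 4))"
proof -
  define m where "m = n div 2"
  have "4 dvd 2 * n"
    using assms(2) cong_altdef_nat[of 1 p 4] unfolding assms(3) by (simp add: cong_iff_dvd_diff)
  then have n: "n = 2 * m" unfolding m_def by (elim dvdE) simp
  interpret prime_1_mod_4 p n m by unfold_locales (use assms n in auto)
  have arg1: "1 / 2 * of_nat n ^ (n div 2) * of_int (fund_u p) * of_int g ^ ((p - 1) * (3 * n ^ 2 - n - 2) div 8) =
      (1 / 2 * of_int (int n ^ m * fund_u p * g ^ (6 * m ^ 3 - m\<^sup>2 - m)) :: rat)"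
    unfolding exponent_eq m_def[symmetric] by simp
  have arg2: "1 / 2 * of_nat n ^ (n div 2) * of_int (fund_u p) = (1 / 2 * of_int (int n ^ m * fund_u p) :: rat)"
    unfolding m_def[symmetric] by simp
  \<comment> \<open>The right-hand side does not mention \<open>g'\<close>, which also yields the
    independence of the primitive root.\<close>
  have part2: "sign (sigma02 p g') =
      abs_least_residue p (1 / 2 * of_nat n ^ (n div 2) * of_int (fund_u p)) * (- 1) ^ ((2 * class_number p + n) div 4)"
    if p8: "[p = 5] (mod 8)" and g': "residue_primroot p (nat (g' mod int p))" for g'
  proof -
    have "odd m" using p8 p_eq n_eq by (auto simp: Cong.cong_def elim!: evenE)
    then obtain k where k: "m = 2 * k + 1" by (elim oddE)
    obtain j where j: "class_number p = 2 * j + 1" using chowla_factorial(1) by (elim oddE)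
    \<comment> \<open>With \<open>n = 4 k + 2\<close> and \<open>class_number p = 2 j + 1\<close>
      both sides are \<open>j + k + 1\<close>; the oddness of the class number enters here.\<close>
    have e: "(2 * class_number p + n) div 4 = (class_number p + 1) div 2 + k"
      using j k n by simp
    show ?thesis unfolding arg2 e
      by (rule abs_least_residue_sign[OF g']) (rule cong_mult[OF cong_refl primroot_power_mod_8[OF g' k]])
  qed
  have "sign (sigma02 p g) =
      abs_least_residue p (1 / 2 * of_int (int n ^ m * fund_u p * g ^ (6 * m ^ 3 - m\<^sup>2 - m))) *
      (- 1) ^ ((class_number p + 1) div 2 + 0)"
    by (rule abs_least_residue_sign[OF assms(4)]) (simp only: power_0 mult_1_right cong_refl)
  then show ?thesis unfolding arg1 using part2 assms(4) by (intro conjI impI allI) (simp_all only: add_0_right)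
qed

end
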